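(* Fix $N=2k+1\ge 3$ and let $V=\mathbb{C}^N$. If $q=1$, the representation of $C_{n,-}$ into $\mathrm{End}(V^{\otimes n})$ surjects onto $\mathrm{End}_{Sp(N-1)}(V^{\otimes n})$, where the embedding $Sp(N-1)\subset SL(N)$ is defined via the symplectic form $(v,w)=v^TAw$ given by the matrix $A$ at $q=1$. That is, the algebra generated by the values at $q=1$ of $E\otimes1_{n-1}$, of $U_i$ ($1\le i<n$), and of $\frac{1}{q^{1/2}-q^{-1/2}}U_iE_{(r)}$ and $\frac{1}{q^{1/2}-q^{-1/2}}E_{(r)}U_i$ ($1\le i<r\le n$) is equal to $\mathrm{End}_{Sp(N-1)}(V^{\otimes n})$. In particular, $\dim_{\mathbb{C}(q)}C_{n,-}(q^N,q)\ge\dim\mathrm{End}_{Sp(N-1)}(V^{\otimes n})$.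
   Context: Hecke relations for $u_1,\dots,u_{n-1}$: with $g_i=q-u_i$, $g_ig_{i+1}g_i=g_{i+1}g_ig_{i+1}$, $g_ig_j=g_jg_i$ for $|i-j|\ne1$, $g_i^2=(q-q^{-1})g_i+1$. The algebra $C_{n,-}(q^N,q)$ over $\mathbb{C}(q)$ has generators $u_i$ ($1\le i<n$), $e_{(r)}$ ($1\le r\le n$), $e_{(0)}=1$, $e=e_{(1)}$, and relations: (a) Hecke relations for the $u_i$, and $eu_i=u_ie$ for $i\ge2$; (b) the $e_{(r)}$ are idempotents and $e_{(r+1)}=\frac{q^{(N-2)/2}+q^{-(N-2)/2}}{q^{N/2}+q^{-N/2}}e_{(r)}-e_{(r)}u_re_{(r)}$ for $1\le r<n$; (c) for $2\le j<r\le n$: $(u_{j-1}u_j+u_{j-1})e_{(r)}=(u_ju_{j-1}+u_j)e_{(r)}$ and $e_{(r)}(u_ju_{j-1}+u_{j-1})=e_{(r)}(u_{j-1}u_j+u_j)$. In the extended version used for the limit $q\to1$ one also takes as generators $\frac{1}{q^{1/2}-q^{-1/2}}u_ie_{(r)}$ and $\frac{1}{q^{1/2}-q^{-1/2}}e_{(r)}u_i$ for $1\le i<r\le n$. Representation of $C_{n,-}$: with $v_1,\dots,v_N$ the standard basis of $V$ and a fixed choice of $(-q)^{1/2}$, let $E\in\mathrm{End}(V)$ be the matrix with entries $E_{ij}=(-q)^{(2k+2-i-j)/2}/\sum_{m=1}^N(-q)^{k+1-m}$; it is the projection onto the span of $v_o=\sum_j(-q)^{(k+1-j)/2}v_j$.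 Let $U(v_i\otimes v_i)=0$ and, for $i<j$, $U(v_i\otimes v_j)=q^{-1}v_i\otimes v_j-v_j\otimes v_i$, $U(v_j\otimes v_i)=-v_i\otimes v_j+q\,v_j\otimes v_i$; $U_i$ is $U$ acting on factors $i,i+1$, and $E_{(r)}=E^{\otimes r}\otimes1_{n-r}$. The representation is $e\mapsto E\otimes1_{n-1}$, $e_{(r)}\mapsto E_{(r)}$, $u_i\mapsto U_i$. The matrix entries of $\frac{1}{q^{1/2}-q^{-1/2}}U_iE_{(r)}$ and $\frac{1}{q^{1/2}-q^{-1/2}}E_{(r)}U_i$ for $i<r$ extend to $q=1$. Matrix $A$: $N\times N$ matrix with $a_{ij}=(-q^{-1})^{k+1-(i+j)/2}$ for $i<j$, $a_{ij}=-(-q^{-1})^{k+1-(i+j)/2}$ for $i>j$, $a_{ii}=0$, where the square roots of $-q$ and $-q^{-1}$ are chosen with product $-1$. It has kernel $\mathbb{C}v_o$. $Sp(N-1)$ is the group of linear maps of $V$ which, at $q=1$, fix $v_o$, preserve the complement $V'=\ker E$, and preserve the form $v^TAw$. *)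

theory Defs
  imports
    Complex_Main
    "HOL-Library.Extended_Nat"
    "HOL-Library.Poly_Mapping"
    "HOL-Computational_Algebra.Fraction_Field"
    "HOL-Computational_Algebra.Polynomial"
    "HOL-Algebra.QuotRing"
    "HOL-Algebra.Generated_Rings"
    "HOL-Algebra.Embedded_Algebras"
    "Jordan_Normal_Form.Matrix"
    "Jordan_Normal_Form.Matrix_Kernel"
begin

text \<open>
  \<open>GenU i\<close> stands for $u_i$ and \<open>GenE r\<close> for $e_{(r)}$.  Vectors and matrices are indexed from 0, as
  usual for \<^typ>\<open>'a mat\<close>: the basis vector $v_i$ of $V$ has index $i - 1$, so an exponent
  $2k+2-i-j$ of the literature reads $2k-i-j$ below.  Tensor factors and generators keep
  their indices from 1.
\<close>

section \<open>Dimension of a subspace of an algebra\<close>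

text \<open>\<open>K\<close> is a subfield of the ring \<open>R\<close>, and \<open>E\<close> a \<open>K\<close>-subspace.\<close>

definition vdim :: "('a, 'b) ring_scheme \<Rightarrow> 'a set \<Rightarrow> 'a set \<Rightarrow> enat" where
  "vdim R K E = (if \<exists>d. ring.dimension R d K E then enat (THE d. ring.dimension R d K E) else \<infinity>)"

section \<open>The algebra with generators and relations\<close>

type_synonym ratfun = "complex poly fract"

definition q_ind :: ratfun where
  "q_ind = Fraction_Field.Fract [:0, 1:] 1"

datatype gen = GenU nat | GenE nat

text \<open>The free monoid on the generators, written additively as required by \<^typ>\<open>'a \<Rightarrow>\<^sub>0 'b\<close>, whose
  multiplication is then that of the monoid algebra.\<close>

datatype monomial = Monomial (letters: "gen list")

instantiation monomial :: monoid_add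
begin

definition zero_monomial :: monomial where
  "zero_monomial = Monomial []"

definition plus_monomial :: "monomial \<Rightarrow> monomial \<Rightarrow> monomial" where
  "plus_monomial v w = Monomial (letters v @ letters w)"

instance
  by standard (simp_all add: zero_monomial_def plus_monomial_def)

end

type_synonym ncpoly = "monomial \<Rightarrow>\<^sub>0 ratfun"

definition gens :: "nat \<Rightarrow> gen set" where
  "gens n = {GenU i | i. 1 \<le> i \<and> i < n} \<union> {GenE r | r. 1 \<le> r \<and> r \<le> n}"

definition free_alg :: "nat \<Rightarrow> ncpoly ring" where
  "free_alg n = \<lparr>carrier = {f. \<forall>w \<in> Poly_Mapping.keys f. set (letters w) \<subseteq> gens n},
     mult = (*), one = 1, zero = 0, add = (+)\<rparr>"

definition const :: "ratfun \<Rightarrow> ncpoly" where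
  "const c = Poly_Mapping.single 0 c"

definition u_gen :: "nat \<Rightarrow> ncpoly" where
  "u_gen i = Poly_Mapping.single (Monomial [GenU i]) 1"

definition e_gen :: "nat \<Rightarrow> ncpoly" where
  "e_gen r = Poly_Mapping.single (Monomial [GenE r]) 1"

definition g_gen :: "nat \<Rightarrow> ncpoly" where
  "g_gen i = const q_ind - u_gen i"

text \<open>The coefficient
  $(q^{(N-2)/2} + q^{-(N-2)/2}) / (q^{N/2} + q^{-N/2})$ is expanded by $q^{N/2}$, which removes the
  half-integral powers.\<close>

definition e_coeff :: "nat \<Rightarrow> ratfun" where
  "e_coeff N = (q_ind ^ (N - 1) + q_ind) / (q_ind ^ N + 1)"

definition hecke_relators :: "nat \<Rightarrow> ncpoly set" where
  "hecke_relators n =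
     {g_gen i * g_gen (i + 1) * g_gen i - g_gen (i + 1) * g_gen i * g_gen (i + 1) | i. 1 \<le> i \<and> i + 1 < n}
   \<union> {g_gen i * g_gen j - g_gen j * g_gen i | i j.
        1 \<le> i \<and> i < n \<and> 1 \<le> j \<and> j < n \<and> \<bar>int i - int j\<bar> \<noteq> 1}
   \<union> {g_gen i * g_gen i - (const (q_ind - inverse q_ind) * g_gen i + 1) | i. 1 \<le> i \<and> i < n}"

definition relators :: "nat \<Rightarrow> nat \<Rightarrow> ncpoly set" where
  "relators N n =
     hecke_relators n
   \<union> {e_gen 1 * u_gen i - u_gen i * e_gen 1 | i. 2 \<le> i \<and> i < n}
   \<union> {e_gen r * e_gen r - e_gen r | r. 1 \<le> r \<and> r \<le> n}
   \<union> {e_gen (r + 1) - (const (e_coeff N) * e_gen r - e_gen r * u_gen r * e_gen r) | r. 1 \<le> r \<and> r < n}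
   \<union> {(u_gen (j - 1) * u_gen j + u_gen (j - 1)) * e_gen r
       - (u_gen j * u_gen (j - 1) + u_gen j) * e_gen r | j r. 2 \<le> j \<and> j < r \<and> r \<le> n}
   \<union> {e_gen r * (u_gen j * u_gen (j - 1) + u_gen (j - 1))
       - e_gen r * (u_gen (j - 1) * u_gen j + u_gen j) | j r. 2 \<le> j \<and> j < r \<and> r \<le> n}"

definition rel_ideal :: "nat \<Rightarrow> nat \<Rightarrow> ncpoly set" where
  "rel_ideal N n = Idl\<^bsub>free_alg n\<^esub> (relators N n)"

text \<open>$C_{n,-}(q^N, q)$; note that HOL-Algebra ideals are two-sided.  The multiples of
  $u_i e_{(r)}$ and $e_{(r)} u_i$ by $1/(q^{1/2} - q^{-1/2})$ only matter for the limit $q \to 1$, see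
  \<open>gens_at_1\<close> below; over a field they generate nothing new.\<close>

definition C_alg :: "nat \<Rightarrow> nat \<Rightarrow> ncpoly set ring" where
  "C_alg N n = free_alg n Quot rel_ideal N n"

definition C_scalars :: "nat \<Rightarrow> nat \<Rightarrow> ncpoly set set" where
  "C_scalars N n = {rel_ideal N n +>\<^bsub>free_alg n\<^esub> const c | c. True}"

section \<open>Tensor products of matrices\<close>

definition kron :: "'a :: semiring_1 mat \<Rightarrow> 'a mat \<Rightarrow> 'a mat" (infixr \<open>\<otimes>\<^sub>k\<close> 72) where
  "A \<otimes>\<^sub>k B = mat (dim_row A * dim_row B) (dim_col A * dim_col B)
     (\<lambda>(x, y). A $$ (x div dim_row B, y div dim_col B) * B $$ (x mod dim_row B, y mod dim_col B))"

primrec tensor_pow :: "'a :: semiring_1 mat \<Rightarrow> nat \<Rightarrow> 'a mat" where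
  "tensor_pow A 0 = 1\<^sub>m 1"
| "tensor_pow A (Suc r) = A \<otimes>\<^sub>k tensor_pow A r"

text \<open>$\mathrm{End}(V^{\otimes n})$ for $V = \mathbf{C}^N$\<close>

abbreviation End_tensor :: "nat \<Rightarrow> nat \<Rightarrow> complex mat ring" where
  "End_tensor N n \<equiv> ring_mat TYPE(complex) (N ^ n) ()"

definition End_scalars :: "nat \<Rightarrow> nat \<Rightarrow> complex mat set" where
  "End_scalars N n = {c \<cdot>\<^sub>m 1\<^sub>m (N ^ n) | c. True}"

section \<open>The representation\<close>

text \<open>Here $N = 2k+1$, \<open>q\<close> is a complex parameter and \<open>s\<close> the chosen value of $(-q)^{1/2}$.\<close>

definition E_mat :: "nat \<Rightarrow> complex \<Rightarrow> complex \<Rightarrow> complex mat" where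
  "E_mat k q s = mat (2 * k + 1) (2 * k + 1)
     (\<lambda>(i, j). s powi (2 * int k - int i - int j)
               / (\<Sum>m = 1..2 * k + 1. (- q) powi (int k + 1 - int m)))"

definition v_o :: "nat \<Rightarrow> complex \<Rightarrow> complex vec" where
  "v_o k s = vec (2 * k + 1) (\<lambda>j. s powi (int k - int j))"

text \<open>Row \<open>(a, b)\<close>, column \<open>(c, d)\<close>: the coefficient of $v_a \otimes v_b$ in $U(v_c \otimes v_d)$.\<close>

definition U_coeff :: "complex \<Rightarrow> nat \<times> nat \<Rightarrow> nat \<times> nat \<Rightarrow> complex" where
  "U_coeff q = (\<lambda>(a, b) (c, d).
     if c = d then 0
     else if (a, b) = (c, d) then (if c < d then inverse q else q)
     else if (a, b) = (d, c) then - 1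
     else 0)"

definition U_mat :: "nat \<Rightarrow> complex \<Rightarrow> complex mat" where
  "U_mat N q = mat (N * N) (N * N) (\<lambda>(x, y). U_coeff q (x div N, x mod N) (y div N, y mod N))"

primrec rep :: "nat \<Rightarrow> nat \<Rightarrow> complex \<Rightarrow> complex \<Rightarrow> gen \<Rightarrow> complex mat" where
  "rep k n q s (GenU i) =
     (let N = 2 * k + 1 in 1\<^sub>m (N ^ (i - 1)) \<otimes>\<^sub>k U_mat N q \<otimes>\<^sub>k 1\<^sub>m (N ^ (n - i - 1)))"
| "rep k n q s (GenE r) = tensor_pow (E_mat k q s) r \<otimes>\<^sub>k 1\<^sub>m ((2 * k + 1) ^ (n - r))"

text \<open>The value at $q = 1$ of a matrix whose entries extend continuously to $q = 1$\<close>

definition value_at_1 :: "(complex \<Rightarrow> complex mat) \<Rightarrow> complex mat" where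
  "value_at_1 F = mat (dim_row (F 1)) (dim_col (F 1)) (\<lambda>(x, y). Lim (at 1) (\<lambda>q. F q $$ (x, y)))"

text \<open>The generators at $q = 1$, where \<open>rq\<close> and \<open>rmq\<close> are branches of $q^{1/2}$ and $(-q)^{1/2}$ near 1\<close>

definition gens_at_1 ::
  "nat \<Rightarrow> nat \<Rightarrow> (complex \<Rightarrow> complex) \<Rightarrow> (complex \<Rightarrow> complex) \<Rightarrow> complex mat set" where
  "gens_at_1 k n rq rmq =
     {rep k n 1 (rmq 1) (GenE 1)}
   \<union> {rep k n 1 (rmq 1) (GenU i) | i. 1 \<le> i \<and> i < n}
   \<union> {value_at_1 (\<lambda>q. (1 / (rq q - inverse (rq q))) \<cdot>\<^sub>m
         (rep k n q (rmq q) (GenU i) * rep k n q (rmq q) (GenE r))) | i r. 1 \<le> i \<and> i < r \<and> r \<le> n}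
   \<union> {value_at_1 (\<lambda>q. (1 / (rq q - inverse (rq q))) \<cdot>\<^sub>m
         (rep k n q (rmq q) (GenE r) * rep k n q (rmq q) (GenU i))) | i r. 1 \<le> i \<and> i < r \<and> r \<le> n}"

text \<open>The unital complex algebra generated by \<open>G\<close> inside $\mathrm{End}(V^{\otimes n})$\<close>

definition alg_generated :: "nat \<Rightarrow> nat \<Rightarrow> complex mat set \<Rightarrow> complex mat set" where
  "alg_generated N n G = generate_ring (End_tensor N n) (End_scalars N n \<union> G)"

section \<open>The symplectic group\<close>

text \<open>\<open>t\<close> is the chosen value of $(-q^{-1})^{1/2}$.\<close>

definition A_mat :: "nat \<Rightarrow> complex \<Rightarrow> complex mat" where
  "A_mat k t = mat (2 * k + 1) (2 * k + 1)
     (\<lambda>(i, j). if i < j then t powi (2 * int k - int i - int j)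
               else if i > j then - (t powi (2 * int k - int i - int j))
               else 0)"

text \<open>$Sp(N-1)$ at $q = 1$, for $N = 2k+1$; the kernel of $E$ is the complement $V'$ of $v_o$.\<close>

definition Sp :: "nat \<Rightarrow> complex \<Rightarrow> complex \<Rightarrow> complex mat set" where
  "Sp k s t = {g \<in> carrier_mat (2 * k + 1) (2 * k + 1).
     invertible_mat g
   \<and> g *\<^sub>v v_o k s = v_o k s
   \<and> (\<forall>w \<in> mat_kernel (E_mat k 1 s). g *\<^sub>v w \<in> mat_kernel (E_mat k 1 s))
   \<and> (\<forall>v \<in> carrier_vec (2 * k + 1). \<forall>w \<in> carrier_vec (2 * k + 1).
        (g *\<^sub>v v) \<bullet> (A_mat k t *\<^sub>v (g *\<^sub>v w)) = v \<bullet> (A_mat k t *\<^sub>v w))}"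

definition End_Sp :: "nat \<Rightarrow> nat \<Rightarrow> complex \<Rightarrow> complex \<Rightarrow> complex mat set" where
  "End_Sp k n s t = {X \<in> carrier (End_tensor (2 * k + 1) n).
     \<forall>g \<in> Sp k s t. X * tensor_pow g n = tensor_pow g n * X}"

end

theory Submission
  imports Defs "HOL-Combinatorics.Permutations"
begin

text \<open>
  At $q = 1$ the algebra is compared with the commutant in a basis adapted to the symplectic form.
  There it contains all partial permutations of the tensor factors and all maps inserting or contracting
  the symplectic form, hence all Brauer diagrams with additional free ends at $v_o$.  Project a matrix of
  the commutant orthogonally to the algebra and view the difference as a tensor $T$ in
  $V^{\otimes 2n}$.  Differentiating along symplectic transvections shows that $T$ is invariant
  under the Lie algebra, and $T$ is orthogonal to all diagrams.  Contractions of $T$ are of the same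
  kind, so by induction they vanish.  For an invariant tensor without nonzero contractions the sum of the
  squared norms of all $E_{ac} T$ equals minus a sum of squared norms of components of $T$, which
  forces $T$ to be a multiple of a power of $v_o$, and then $T = 0$.

  For the dimension, the representation satisfies the defining relations for $q$ near 1, and every
  element of the algebra at $q = 1$ is a limit of values of noncommutative polynomials over
  $\mathbf{C}(q)$.  Lifting a basis in this way gives independent elements of $C_{n,-}$: a linear
  relation, divided by the highest power of $1/(q-1)$ among its coefficients, would have a nontrivial limit.
\<close>

text \<open>The symplectic form enters only through the scaled generators. The columns of $E_{(r)}$
  are symmetric in the first r factors, and on such tensors U is a scalar that depends on the order
  of two indices and vanishes at q = 1. Division by $q^{1/2} - q^{-1/2}$ leaves the sign of that
  order, and this sign times E \<otimes> E is a rank one map whose image is spanned by A, read as a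
  tensor. The positivity argument needs each $E_{ac}$ to be tied by invariance to a single other
  matrix unit while its adjoint is $E_{ca}$. Both hold in a basis of hyperbolic pairs, which is the
  reason for leaving the standard basis. Of the group only the transvections are used: their
  derivatives already give the whole Lie algebra after polarisation. For the dimension there are two
  obstacles. Evaluating rational coefficients is additive and multiplicative only outside finite
  sets that depend on the elements, so every identity is stated eventually near 1. And $q^{1/2}$ is
  not rational in q, so only its value at 1 is kept where nothing but the limit counts.\<close>

section \<open>Tensors invariant under the symplectic Lie algebra\<close>

text \<open>
  Basis tensors are functions from positions to indices, extended by 0.
\<close>

definition idx :: "nat \<Rightarrow> nat \<Rightarrow> (nat \<Rightarrow> nat) set" where
  "idx N m = {F. (\<forall>i<m. F i < N) \<and> (\<forall>i\<ge>m. F i = 0)}"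

lemma idx_upd: "F \<in> idx N m \<Longrightarrow> l < m \<Longrightarrow> a < N \<Longrightarrow> F(l := a) \<in> idx N m"
  by (auto simp: idx_def)

lemma idx_less: "F \<in> idx N m \<Longrightarrow> 0 < N \<Longrightarrow> F l < N"
  by (cases "l < m") (auto simp: idx_def)

lemma idx_zero: "0 < N \<Longrightarrow> (\<lambda>_. 0) \<in> idx N m"
  by (auto simp: idx_def)

lemma idx_Suc: "idx N (Suc m) = (\<lambda>(F, a). F(m := a)) ` (idx N m \<times> {..<N})"
proof (intro Set.set_eqI iffI)
  fix F assume F: "F \<in> idx N (Suc m)"
  have "F = (\<lambda>(F, a). F(m := a)) (F(m := 0), F m)" by auto
  moreover have "(F(m := 0), F m) \<in> idx N m \<times> {..<N}"
    using F by (auto simp: idx_def not_le less_Suc_eq_le Suc_le_eq)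
  ultimately show "F \<in> (\<lambda>(F, a). F(m := a)) ` (idx N m \<times> {..<N})" by (rule image_eqI)
qed (auto simp: idx_def)

lemma finite_idx: "finite (idx N m)"
proof (induction m)
  case 0
  have "idx N 0 = {\<lambda>_. 0}" by (auto simp: idx_def)
  thus ?case by simp
next
  case (Suc m) thus ?case by (auto simp: idx_Suc)
qed

text \<open>
  The index 0 belongs to the invariant vector $v_o$, and $e_1, e_2, \ldots, e_{2k-1}, e_{2k}$ are hyperbolic
  pairs: \<open>e\<^sub>a\<close> pairs with \<open>e\<^bsub>partner a\<^esub>\<close> to \<open>eta a\<close>.  The value \<open>eta 0 = 1\<close> keeps
  products of signs invertible.
\<close>

definition partner :: "nat \<Rightarrow> nat" where
  "partner a = (if a = 0 then 0 else if odd a then a + 1 else a - 1)"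

definition eta :: "nat \<Rightarrow> complex" where
  "eta a = (if a = 0 \<or> odd a then 1 else - 1)"

lemma partner_0 [simp]: "partner 0 = 0" by (simp add: partner_def)
lemma eta_0 [simp]: "eta 0 = 1" by (simp add: eta_def)
lemma partner_partner [simp]: "partner (partner a) = a"
  by (auto simp: partner_def elim!: evenE oddE)
lemma partner_eq_iff [simp]: "partner a = partner b \<longleftrightarrow> a = b" by (metis partner_partner)
lemma partner_eq_0 [simp]: "partner a = 0 \<longleftrightarrow> a = 0" by (metis partner_partner partner_0)
lemma zero_eq_partner [simp]: "0 = partner a \<longleftrightarrow> a = 0" by (metis partner_partner partner_0)
lemma partner_swap: "partner a = b \<longleftrightarrow> a = partner b" by auto
lemma partner_mem: "a \<in> {1..2 * k} \<Longrightarrow> partner a \<in> {1..2 * k}"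
  by (auto simp: partner_def elim!: evenE oddE; presburger)
lemma partner_less: "a < 2 * k + 1 \<Longrightarrow> partner a < 2 * k + 1"
  using partner_mem[of a k] by (cases "a = 0") auto
lemma eta_partner: "a \<noteq> 0 \<Longrightarrow> eta (partner a) = - eta a"
  by (auto simp: partner_def eta_def)
lemma eta_eta [simp]: "eta a * eta a = 1" by (simp add: eta_def)
lemma eta_eta' [simp]: "eta a * (eta a * z) = z" by (simp add: eta_def)
lemma cnj_eta [simp]: "cnj (eta a) = eta a" by (simp add: eta_def)
lemma eta_nz [simp]: "eta a \<noteq> 0" by (simp add: eta_def)

text \<open>
  \<open>site a c l\<close> is the matrix unit $E_{ac}$ at position \<open>l\<close>; \<open>lie_inv\<close> says that
  $E_{ac} - \eta_a \eta_c E_{c'a'}$ annihilates \<open>T\<close>, and these elements span the symplectic Lie algebra.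
\<close>

definition site :: "nat \<Rightarrow> nat \<Rightarrow> nat \<Rightarrow> ((nat \<Rightarrow> nat) \<Rightarrow> complex) \<Rightarrow> (nat \<Rightarrow> nat) \<Rightarrow> complex" where
  "site a c l T F = (if F l = a then T (F(l := c)) else 0)"

definition lie_inv :: "nat \<Rightarrow> nat \<Rightarrow> ((nat \<Rightarrow> nat) \<Rightarrow> complex) \<Rightarrow> bool" where
  "lie_inv k m T \<longleftrightarrow> (\<forall>a\<in>{1..2*k}. \<forall>c\<in>{1..2*k}. \<forall>F\<in>idx (2*k+1) m.
     (\<Sum>l<m. site a c l T F) = eta a * eta c * (\<Sum>l<m. site (partner c) (partner a) l T F))"

text \<open>
  The contracted positions are kept and filled with 0, so that all tensors live in one space and
  \<open>arc\<close> is adjoint to \<open>contr\<close>.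
\<close>

definition contr :: "nat \<Rightarrow> nat \<Rightarrow> nat \<Rightarrow> ((nat \<Rightarrow> nat) \<Rightarrow> complex) \<Rightarrow> (nat \<Rightarrow> nat) \<Rightarrow> complex" where
  "contr k i j T F = (if F i = 0 \<and> F j = 0 then \<Sum>a\<in>{1..2*k}. eta a * T (F(i := a, j := partner a)) else 0)"

definition arc :: "nat \<Rightarrow> nat \<Rightarrow> ((nat \<Rightarrow> nat) \<Rightarrow> complex) \<Rightarrow> (nat \<Rightarrow> nat) \<Rightarrow> complex" where
  "arc i j d F = (if F i \<noteq> 0 \<and> F j = partner (F i) then eta (F i) * d (F(i := 0, j := 0)) else 0)"

definition ip :: "nat \<Rightarrow> nat \<Rightarrow> ((nat \<Rightarrow> nat) \<Rightarrow> complex) \<Rightarrow> ((nat \<Rightarrow> nat) \<Rightarrow> complex) \<Rightarrow> complex" where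
  "ip N m T S = (\<Sum>F\<in>idx N m. T F * cnj (S F))"

lemma ip_cong:
  "(\<And>F. F \<in> idx N m \<Longrightarrow> T F = T' F) \<Longrightarrow> (\<And>F. F \<in> idx N m \<Longrightarrow> S F = S' F) \<Longrightarrow> ip N m T S = ip N m T' S'"
  by (simp add: ip_def)

lemma ip_sum_left: "ip N m (\<lambda>F. \<Sum>x\<in>A. f x F) S = (\<Sum>x\<in>A. ip N m (f x) S)"
  by (simp add: ip_def sum_distrib_right sum.swap[of _ "idx N m"])
lemma ip_sum_right: "ip N m S (\<lambda>F. \<Sum>x\<in>A. f x F) = (\<Sum>x\<in>A. ip N m S (f x))"
  by (simp add: ip_def sum_distrib_left sum.swap[of _ "idx N m"])
lemma ip_mult_right: "ip N m S (\<lambda>F. c * T F) = cnj c * ip N m S T"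
  by (simp add: ip_def sum_distrib_left mult_ac)

text \<open>The matrix units $E_{ac}$ and $E_{ca}$ are adjoint: resetting position \<open>l\<close>
  exchanges the index functions with value \<open>a\<close> there and those with value
  \<open>c\<close>.\<close>

lemma ip_site:
  assumes "l < m" "a < N" "c < N"
  shows "ip N m (site a c l T) S = ip N m T (site c a l S)"
proof -
  have "ip N m (site a c l T) S = (\<Sum>F\<in>{F\<in>idx N m. F l = a}. T (F(l := c)) * cnj (S F))"
    unfolding ip_def by (rule sum.mono_neutral_cong_right) (auto simp: finite_idx site_def)
  also have "\<dots> = (\<Sum>F\<in>{F\<in>idx N m. F l = c}. T F * cnj (S (F(l := a))))"
    by (rule sum.reindex_bij_witness[of _ "\<lambda>F. F(l := a)" "\<lambda>F. F(l := c)"])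
      (use assms in \<open>auto simp: idx_upd fun_upd_idem\<close>)
  also have "\<dots> = ip N m T (site c a l S)"
    unfolding ip_def by (rule sum.mono_neutral_cong_left) (auto simp: finite_idx site_def)
  finally show ?thesis .
qed

text \<open>Reindexing the sum by \<open>partner\<close> changes the sign of every
  \<open>eta\<close>, since the form is skew.\<close>

lemma contr_swap: "i \<noteq> j \<Longrightarrow> contr k j i T F = - contr k i j T F"
proof -
  assume ij: "i \<noteq> j"
  have "(\<Sum>a\<in>{1..2*k}. eta a * T (F(j := a, i := partner a))) =
     (\<Sum>a\<in>{1..2*k}. eta (partner a) * T (F(j := partner a, i := a)))"
    by (rule sum.reindex_bij_witness[of _ partner partner]) (use partner_mem in auto)
  also have "\<dots> = - (\<Sum>a\<in>{1..2*k}. eta a * T (F(i := a, j := partner a)))"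
    unfolding sum_negf[symmetric]
    by (rule sum.cong) (auto simp: eta_partner fun_upd_twist[OF ij])
  finally show ?thesis by (auto simp: contr_def)
qed

text \<open>Filling two positions that carry 0 with \<open>a\<close> and \<open>partner a\<close> is
  a bijection onto the index functions at which \<open>arc\<close> can be nonzero. The pairing is
  bilinear, without conjugation.\<close>

lemma contr_adjoint:
  assumes "i < m" "j < m" "i \<noteq> j"
  shows "(\<Sum>F\<in>idx (2*k+1) m. contr k i j T F * d F) = (\<Sum>F\<in>idx (2*k+1) m. T F * arc i j d F)"
proof -
  let ?I = "idx (2*k+1) m"
  have "(\<Sum>F\<in>?I. contr k i j T F * d F)
      = (\<Sum>F\<in>{F\<in>?I. F i = 0 \<and> F j = 0}. \<Sum>a\<in>{1..2*k}. eta a * T (F(i := a, j := partner a)) * d F)"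
    by (rule sum.mono_neutral_cong_right) (auto simp: finite_idx contr_def sum_distrib_right)
  also have "\<dots> = (\<Sum>(F,a)\<in>{F\<in>?I. F i = 0 \<and> F j = 0} \<times> {1..2*k}. eta a * T (F(i := a, j := partner a)) * d F)"
    by (simp add: sum.cartesian_product)
  also have "\<dots> = (\<Sum>F\<in>{F\<in>?I. F i \<noteq> 0 \<and> F j = partner (F i)}. T F * (eta (F i) * d (F(i := 0, j := 0))))"
  proof (rule sum.reindex_bij_witness[of _ "\<lambda>F. (F(i := 0, j := 0), F i)" "\<lambda>(F,a). F(i := a, j := partner a)"], goal_cases)
    case (1 p) thus ?case using assms by (auto simp: fun_upd_idem fun_eq_iff)
  next
    case (2 p)
    obtain F a where p: "p = (F, a)" by (cases p)
    have "F(i := a, j := partner a) \<in> ?I"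
      using 2 p assms partner_less[of a k] by (intro idx_upd) auto
    thus ?case using 2 p assms by simp
  next
    case (3 p) thus ?case using assms by (auto simp: fun_upd_idem fun_eq_iff)
  next
    case (4 F) thus ?case using assms idx_less[of F "2*k+1" m i] by (auto intro!: idx_upd)
  next
    case (5 p)
    obtain F a where p: "p = (F, a)" by (cases p)
    have "F(i := 0, j := 0) = F" using 5 p by (auto simp: fun_eq_iff)
    moreover have "F(i := a, j := partner a, i := 0, j := 0) = F(i := 0, j := 0)" by (auto simp: fun_eq_iff)
    ultimately show ?case using assms p by simp
  qed
  also have "\<dots> = (\<Sum>F\<in>?I. T F * arc i j d F)"
    unfolding sum.inter_filter[OF finite_idx] by (rule sum.cong) (simp_all add: arc_def)
  finally show ?thesis .
qed

text \<open>The Lie algebra annihilates the form, so contraction commutes with it: the contributions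
  of the two contracted positions are equal on both sides of the invariance relation and
  cancel.\<close>

lemma lie_inv_contr:
  assumes inv: "lie_inv k m T" and ij: "i < m" "j < m" "i \<noteq> j"
  shows "lie_inv k m (contr k i j T)"
  unfolding lie_inv_def
proof (intro ballI)
  fix a c F assume a: "a \<in> {1..2*k}" and c: "c \<in> {1..2*k}" and F: "F \<in> idx (2*k+1) m"
  let ?L = "{..<m} - {i, j}"
  \<comment> \<open>Positions \<open>i\<close> and \<open>j\<close> drop out, because the
    contraction vanishes as soon as one of them carries the nonzero index \<open>c\<close>.\<close>
  have red: "(\<Sum>l<m. site a c l (contr k i j T) F) = (\<Sum>l\<in>?L. site a c l (contr k i j T) F)"
    if "c \<noteq> 0" for a c
    by (rule sum.mono_neutral_right) (use that ij in \<open>auto simp: site_def contr_def\<close>)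
  show "(\<Sum>l<m. site a c l (contr k i j T) F) =
          eta a * eta c * (\<Sum>l<m. site (partner c) (partner a) l (contr k i j T) F)"
  proof (cases "F i = 0 \<and> F j = 0")
    case False
    have "(\<Sum>l\<in>?L. site a c l (contr k i j T) F) = 0" for a c
      by (rule sum.neutral) (use False in \<open>auto simp: site_def contr_def\<close>)
    moreover have "c \<noteq> 0" "partner a \<noteq> 0" using a c by auto
    ultimately show ?thesis using red[of c a] red[of "partner a" "partner c"] by simp
  next
    case True
    \<comment> \<open>In the sum over the filled pairs (b, partner b), the matrix unit at position
      \<open>i\<close> keeps only b = a, and the one at position \<open>j\<close> keeps only b =
      partner a.\<close>
    have split: "(\<Sum>b\<in>{1..2*k}. eta b * (\<Sum>l<m. site a c l T (F(i := b, j := partner b))))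
       = (\<Sum>l\<in>?L. site a c l (contr k i j T) F)
         + (eta a * T (F(i := c, j := partner a)) + eta (partner a) * T (F(i := partner a, j := c)))"
      if a: "a \<in> {1..2*k}" for a c
    proof -
      have 1: "(\<Sum>l<m. site a c l T G) = (\<Sum>l\<in>?L. site a c l T G) + (site a c i T G + site a c j T G)" for G
      proof -
        have "{..<m} = ?L \<union> {i, j}" using ij by auto
        hence "(\<Sum>l<m. site a c l T G) = (\<Sum>l\<in>?L \<union> {i, j}. site a c l T G)" by simp
        also have "\<dots> = (\<Sum>l\<in>?L. site a c l T G) + (\<Sum>l\<in>{i, j}. site a c l T G)"
          by (rule sum.union_disjoint) auto
        finally show ?thesis using ij by simp
      qed
      have 2: "(\<Sum>b\<in>{1..2*k}. eta b * (\<Sum>l\<in>?L. site a c l T (F(i := b, j := partner b))))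
          = (\<Sum>l\<in>?L. site a c l (contr k i j T) F)"
      proof -
        have "(\<Sum>b\<in>{1..2*k}. eta b * (\<Sum>l\<in>?L. site a c l T (F(i := b, j := partner b))))
          = (\<Sum>l\<in>?L. \<Sum>b\<in>{1..2*k}. eta b * site a c l T (F(i := b, j := partner b)))"
          unfolding sum_distrib_left by (rule sum.swap)
        also have "\<dots> = (\<Sum>l\<in>?L. site a c l (contr k i j T) F)"
        proof (rule sum.cong[OF refl])
          fix l assume l: "l \<in> ?L"
          have "F(i := b, j := partner b, l := c) = F(l := c, i := b, j := partner b)" for b
            using l by (auto simp: fun_eq_iff)
          thus "(\<Sum>b\<in>{1..2*k}. eta b * site a c l T (F(i := b, j := partner b))) = site a c l (contr k i j T) F"
            using l True by (auto simp: site_def contr_def)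
        qed
        finally show ?thesis .
      qed
      have 3: "(\<Sum>b\<in>{1..2*k}. eta b * site a c i T (F(i := b, j := partner b))) = eta a * T (F(i := c, j := partner a))"
      proof -
        have "(\<Sum>b\<in>{1..2*k}. eta b * site a c i T (F(i := b, j := partner b)))
          = (\<Sum>b\<in>{1..2*k}. if b = a then eta a * T (F(i := c, j := partner a)) else 0)"
          using ij by (intro sum.cong) (auto simp: site_def fun_upd_twist)
        thus ?thesis using a by simp
      qed
      have 4: "(\<Sum>b\<in>{1..2*k}. eta b * site a c j T (F(i := b, j := partner b))) = eta (partner a) * T (F(i := partner a, j := c))"
      proof -
        have "(\<Sum>b\<in>{1..2*k}. eta b * site a c j T (F(i := b, j := partner b)))
          = (\<Sum>b\<in>{1..2*k}. if b = partner a then eta (partner a) * T (F(i := partner a, j := c)) else 0)"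
          using ij by (intro sum.cong) (auto simp: site_def fun_upd_twist)
        thus ?thesis using partner_mem[OF a] by simp
      qed
      show ?thesis unfolding 1 distrib_left sum.distrib 2 3 4 ..
    qed
    have "(\<Sum>b\<in>{1..2*k}. eta b * (\<Sum>l<m. site a c l T (F(i := b, j := partner b))))
      = (\<Sum>b\<in>{1..2*k}. eta b * (eta a * eta c * (\<Sum>l<m. site (partner c) (partner a) l T (F(i := b, j := partner b)))))"
    proof (rule sum.cong[OF refl])
      fix b assume b: "b \<in> {1..2*k}"
      have "F(i := b, j := partner b) \<in> idx (2*k+1) m"
        using b ij F partner_less[of b k] by (intro idx_upd) auto
      thus "eta b * (\<Sum>l<m. site a c l T (F(i := b, j := partner b))) = eta b * (eta a * eta c * (\<Sum>l<m. site (partner c) (partner a) l T (F(i := b, j := partner b))))"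
        using inv a c unfolding lie_inv_def by auto
    qed
    also have "\<dots> = eta a * eta c * (\<Sum>b\<in>{1..2*k}. eta b * (\<Sum>l<m. site (partner c) (partner a) l T (F(i := b, j := partner b))))"
      by (simp add: sum_distrib_left mult_ac)
    finally have e: "(\<Sum>l\<in>?L. site a c l (contr k i j T) F)
         + (eta a * T (F(i := c, j := partner a)) + eta (partner a) * T (F(i := partner a, j := c)))
       = eta a * eta c * ((\<Sum>l\<in>?L. site (partner c) (partner a) l (contr k i j T) F)
         + (eta (partner c) * T (F(i := partner a, j := c)) + eta c * T (F(i := c, j := partner a))))"
      unfolding split[OF a] split[OF partner_mem[OF c]] partner_partner .
    \<comment> \<open>With these signs the terms from positions \<open>i\<close> and
      \<open>j\<close> are the same on both sides of \<open>e\<close>.\<close>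
    have "eta (partner a) = - eta a" "eta (partner c) = - eta c" using a c by (auto intro!: eta_partner)
    with e have "(\<Sum>l\<in>?L. site a c l (contr k i j T) F) = eta a * eta c * (\<Sum>l\<in>?L. site (partner c) (partner a) l (contr k i j T) F)"
      by (simp add: algebra_simps)
    thus ?thesis using red[of c a] red[of "partner a" "partner c"] a c by simp
  qed
qed

text \<open>
  In $\sum_{a,c} \|E_{ac} T\|^2$ invariance moves one of the two operators across.  Two different positions
  then contribute a contraction, and a single position \<open>l\<close> contributes minus the squared norm of
  the components of \<open>T\<close> with \<open>F l \<noteq> 0\<close>.
\<close>

lemma lie_inv_no_contr:
  assumes inv: "lie_inv k m T"
    and z: "\<And>i j F. i < m \<Longrightarrow> j < m \<Longrightarrow> i \<noteq> j \<Longrightarrow> F \<in> idx (2*k+1) m \<Longrightarrow> contr k i j T F = 0"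
    and F: "F \<in> idx (2*k+1) m" "T F \<noteq> 0"
  shows "F l = 0"
proof (rule ccontr)
  assume Fl: "F l \<noteq> 0"
  let ?I = "idx (2*k+1) m" and ?W = "{1..2*k}"
  let ?ip = "ip (2*k+1) m"
  define E where "E a c = (\<lambda>F. \<Sum>l<m. site a c l T F)" for a c
  \<comment> \<open>Invariance rewrites only the right argument; taking the adjoint then moves
    $E_{ac}$ across, so that two operators act on the same \<open>T\<close>.\<close>
  have ipE: "?ip (E a c) (E a c) = (\<Sum>l<m. \<Sum>l'<m. eta a * eta c * ?ip T (site c a l (site (partner c) (partner a) l' T)))"
    if ac: "a \<in> ?W" "c \<in> ?W" for a c
  proof -
    have "?ip (E a c) (E a c) = ?ip (E a c) (\<lambda>F. eta a * eta c * E (partner c) (partner a) F)"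
      using inv ac by (intro ip_cong) (auto simp: E_def lie_inv_def)
    also have "\<dots> = eta a * eta c * ?ip (E a c) (E (partner c) (partner a))"
      by (simp add: ip_mult_right)
    also have "?ip (E a c) (E (partner c) (partner a)) = (\<Sum>l<m. \<Sum>l'<m. ?ip (site a c l T) (site (partner c) (partner a) l' T))"
      unfolding E_def by (simp add: ip_sum_left ip_sum_right)
    also have "\<dots> = (\<Sum>l<m. \<Sum>l'<m. ?ip T (site c a l (site (partner c) (partner a) l' T)))"
      using ac by (intro sum.cong refl ip_site) auto
    finally show ?thesis by (simp add: sum_distrib_left)
  qed
  \<comment> \<open>At two different positions the operators insert the pair (a, partner a), so the
    sum over \<open>a\<close> is a contraction of \<open>T\<close>.\<close>
  have off: "(\<Sum>a\<in>?W. eta a * eta c * ?ip T (site c a l (site (partner c) (partner a) l' T))) = 0"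
    if c: "c \<in> ?W" and l: "l < m" "l' < m" "l \<noteq> l'" for c l l'
  proof -
    have "(\<Sum>a\<in>?W. eta a * eta c * ?ip T (site c a l (site (partner c) (partner a) l' T)))
      = eta c * (\<Sum>a\<in>?W. ?ip T (\<lambda>F. eta a * site c a l (site (partner c) (partner a) l' T) F))"
      by (simp add: ip_mult_right sum_distrib_left mult_ac)
    also have "(\<Sum>a\<in>?W. ?ip T (\<lambda>F. eta a * site c a l (site (partner c) (partner a) l' T) F))
      = ?ip T (\<lambda>F. \<Sum>a\<in>?W. eta a * site c a l (site (partner c) (partner a) l' T) F)"
      by (simp add: ip_sum_right)
    also have "\<dots> = ?ip T (\<lambda>F. 0)"
    proof (rule ip_cong[OF refl])
      fix F assume F: "F \<in> ?I"
      have "F(l := 0, l' := 0) \<in> ?I" using F l by (intro idx_upd) auto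
      hence "contr k l l' T (F(l := 0, l' := 0)) = 0" using z l by auto
      hence "(\<Sum>a\<in>?W. eta a * T (F(l := a, l' := partner a))) = 0"
        using l by (simp add: contr_def fun_upd_twist)
      moreover have "eta a * site c a l (site (partner c) (partner a) l' T) F =
          (if F l = c \<and> F l' = partner c then eta a * T (F(l := a, l' := partner a)) else 0)" for a
        using l by (simp add: site_def)
      ultimately show "(\<Sum>a\<in>?W. eta a * site c a l (site (partner c) (partner a) l' T) F) = 0"
        by (cases "F l = c \<and> F l' = partner c") simp_all
    qed
    finally show ?thesis by (simp add: ip_def)
  qed
  \<comment> \<open>At one position the product of the two matrix units is nonzero only for a =
    partner c, where it is $E_{cc}$; the sign is that of \<open>eta (partner c) * eta c\<close>,
    which is -1.\<close>
  have diag: "(\<Sum>a\<in>?W. eta a * eta c * ?ip T (site c a l (site (partner c) (partner a) l T))) =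
     - (\<Sum>F\<in>?I. if F l = c then T F * cnj (T F) else 0)"
    if c: "c \<in> ?W" for c l
  proof -
    have "(\<Sum>a\<in>?W. eta a * eta c * ?ip T (site c a l (site (partner c) (partner a) l T))) =
       (\<Sum>a\<in>?W. if a = partner c then - (\<Sum>F\<in>?I. if F l = c then T F * cnj (T F) else 0) else 0)"
    proof (rule sum.cong[OF refl])
      fix a assume "a \<in> ?W"
      show "eta a * eta c * ?ip T (site c a l (site (partner c) (partner a) l T)) =
        (if a = partner c then - (\<Sum>F\<in>?I. if F l = c then T F * cnj (T F) else 0) else 0)"
      proof (cases "a = partner c")
        case True
        have "?ip T (site c a l (site (partner c) (partner a) l T)) = (\<Sum>F\<in>?I. if F l = c then T F * cnj (T F) else 0)"
          unfolding ip_def by (rule sum.cong) (auto simp: True site_def fun_upd_idem)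
        moreover have "eta (partner c) = - eta c" using c by (intro eta_partner) auto
        ultimately show ?thesis using True by simp
      next
        case False
        hence "?ip T (site c a l (site (partner c) (partner a) l T)) = 0"
          unfolding ip_def by (intro sum.neutral) (auto simp: site_def)
        thus ?thesis using False by simp
      qed
    qed
    thus ?thesis using partner_mem[OF c] by simp
  qed
  have "(\<Sum>a\<in>?W. \<Sum>c\<in>?W. ?ip (E a c) (E a c)) =
     (\<Sum>c\<in>?W. \<Sum>l<m. \<Sum>l'<m. \<Sum>a\<in>?W. eta a * eta c * ?ip T (site c a l (site (partner c) (partner a) l' T)))"
  proof -
    have "(\<Sum>a\<in>?W. \<Sum>c\<in>?W. ?ip (E a c) (E a c)) = (\<Sum>c\<in>?W. \<Sum>a\<in>?W. ?ip (E a c) (E a c))"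
      by (rule sum.swap)
    also have "\<dots> = (\<Sum>c\<in>?W. \<Sum>a\<in>?W. \<Sum>l<m. \<Sum>l'<m. eta a * eta c * ?ip T (site c a l (site (partner c) (partner a) l' T)))"
      using ipE by (intro sum.cong refl) auto
    also have "\<dots> = (\<Sum>c\<in>?W. \<Sum>l<m. \<Sum>a\<in>?W. \<Sum>l'<m. eta a * eta c * ?ip T (site c a l (site (partner c) (partner a) l' T)))"
      by (intro sum.cong refl sum.swap)
    also have "\<dots> = (\<Sum>c\<in>?W. \<Sum>l<m. \<Sum>l'<m. \<Sum>a\<in>?W. eta a * eta c * ?ip T (site c a l (site (partner c) (partner a) l' T)))"
      by (intro sum.cong refl sum.swap)
    finally show ?thesis .
  qed
  also have "\<dots> = (\<Sum>c\<in>?W. \<Sum>l<m. \<Sum>l'<m. if l' = l then - (\<Sum>F\<in>?I. if F l = c then T F * cnj (T F) else 0) else 0)"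
    by (intro sum.cong refl) (auto simp: diag[simplified] off[simplified])
  also have "\<dots> = - (\<Sum>c\<in>?W. \<Sum>l<m. (\<Sum>F\<in>?I. if F l = c then T F * cnj (T F) else 0))"
    by (simp add: sum_negf)
  finally have eq: "(\<Sum>a\<in>?W. \<Sum>c\<in>?W. ?ip (E a c) (E a c)) = - (\<Sum>c\<in>?W. \<Sum>l<m. (\<Sum>F\<in>?I. if F l = c then T F * cnj (T F) else 0))" .
  have pos: "0 \<le> Re (z * cnj z)" for z :: complex
    by (simp add: complex_mult_cnj)
  have "0 \<le> Re (\<Sum>a\<in>?W. \<Sum>c\<in>?W. ?ip (E a c) (E a c))"
    unfolding ip_def Re_sum by (intro sum_nonneg pos)
  hence le: "(\<Sum>c\<in>?W. \<Sum>l<m. (\<Sum>F\<in>?I. if F l = c then Re (T F * cnj (T F)) else 0)) \<le> 0"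
    unfolding eq uminus_complex.simps Re_sum if_distrib[of Re] zero_complex.simps by simp
  have lm: "l < m" using F(1) Fl by (auto simp: idx_def not_less[symmetric])
  have Fc: "F l \<in> ?W" using Fl idx_less[OF F(1), of l] by auto
  have "0 < Re (T F * cnj (T F))"
    using F(2) by (simp add: complex_mult_cnj complex_neq_0)
  also have "\<dots> = (if F l = F l then Re (T F * cnj (T F)) else 0)" by simp
  also have "\<dots> \<le> (\<Sum>F'\<in>?I. if F' l = F l then Re (T F' * cnj (T F')) else 0)"
    by (rule member_le_sum[OF F(1)]) (use pos finite_idx in auto)
  also have "\<dots> \<le> (\<Sum>l'<m. (\<Sum>F'\<in>?I. if F' l' = F l then Re (T F' * cnj (T F')) else 0))"
    by (rule member_le_sum) (use lm pos in \<open>auto intro!: sum_nonneg\<close>)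
  also have "\<dots> \<le> (\<Sum>c\<in>?W. \<Sum>l<m. (\<Sum>F\<in>?I. if F l = c then Re (T F * cnj (T F)) else 0))"
  proof -
    define G where "G = (\<lambda>c. \<Sum>l<m. (\<Sum>F\<in>?I. if F l = c then Re (T F * cnj (T F)) else 0))"
    have "G (F l) \<le> sum G ?W"
      by (rule member_le_sum[OF Fc]) (use pos in \<open>auto simp: G_def intro!: sum_nonneg\<close>)
    thus ?thesis by (simp only: G_def)
  qed
  finally show False using le by linarith
qed

text \<open>
  Closure of \<open>D\<close> under \<open>arc\<close> makes contractions of \<open>T\<close> orthogonal to \<open>D\<close> as well; the induction is on
  the set of positions at which \<open>T\<close> is not supported at 0.
\<close>

lemma lie_inv_eq_zero:
  assumes D0: "\<And>d. d = (\<lambda>F. if F = (\<lambda>_. 0) then 1 else 0) \<Longrightarrow> d \<in> D"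
    and D: "\<And>d i j. d \<in> D \<Longrightarrow> i < j \<Longrightarrow> j < m \<Longrightarrow> arc i j d \<in> D"
    and inv: "lie_inv k m T"
    and orth: "\<And>d. d \<in> D \<Longrightarrow> (\<Sum>F\<in>idx (2*k+1) m. T F * d F) = 0"
    and F: "F \<in> idx (2*k+1) m"
  shows "T F = 0"
proof -
  have "\<forall>F\<in>idx (2*k+1) m. T F = 0"
    if "lie_inv k m T" "\<And>d. d \<in> D \<Longrightarrow> (\<Sum>F\<in>idx (2*k+1) m. T F * d F) = 0"
       "S \<subseteq> {..<m}" "\<And>F l. F \<in> idx (2*k+1) m \<Longrightarrow> T F \<noteq> 0 \<Longrightarrow> l \<notin> S \<Longrightarrow> F l = 0" for T S
    using that
  proof (induction "card S" arbitrary: S T rule: less_induct)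
    case less
    have fS: "finite S" using less.prems(3) finite_subset by blast
    \<comment> \<open>If \<open>i\<close> or \<open>j\<close> lies outside \<open>S\<close>, no
      filling of the pair meets the support of \<open>T\<close>. Otherwise the contraction is
      supported at 0 on both positions, and the induction hypothesis applies to \<open>S\<close>
      without them.\<close>
    have lt: "contr k i j T F = 0" if ij: "i < j" "j < m" and F: "F \<in> idx (2*k+1) m" for i j F
    proof (cases "i \<in> S \<and> j \<in> S")
      case False
      have "T (F(i := a, j := partner a)) = 0" if a: "a \<in> {1..2*k}" for a
      proof (rule ccontr)
        assume nz: "T (F(i := a, j := partner a)) \<noteq> 0"
        have "F(i := a, j := partner a) \<in> idx (2*k+1) m"
          using a ij F partner_less[of a k] by (intro idx_upd) auto
        from less.prems(4)[OF this nz, of i] less.prems(4)[OF this nz, of j] show False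
          using False a ij by (auto split: if_splits)
      qed
      thus ?thesis by (simp add: contr_def)
    next
      case True
      let ?S = "S - {i, j}"
      have "card ?S < card S" using True fS by (intro psubset_card_mono) auto
      moreover have "lie_inv k m (contr k i j T)" using less.prems(1) ij by (intro lie_inv_contr) auto
      moreover have "(\<Sum>F\<in>idx (2*k+1) m. contr k i j T F * d F) = 0" if "d \<in> D" for d
        using contr_adjoint[of i m j k T d] less.prems(2)[OF D[OF that ij]] ij by simp
      moreover have "?S \<subseteq> {..<m}" using less.prems(3) by auto
      moreover have "F l = 0" if F: "F \<in> idx (2*k+1) m" and nz: "contr k i j T F \<noteq> 0" and l: "l \<notin> ?S" for F l
      proof (rule ccontr)
        assume Fl: "F l \<noteq> 0"
        from nz have ij0: "F i = 0" "F j = 0" by (auto simp: contr_def split: if_splits)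
        with nz have "(\<Sum>a\<in>{1..2*k}. eta a * T (F(i := a, j := partner a))) \<noteq> 0" by (auto simp: contr_def)
        then obtain a where a: "a \<in> {1..2*k}" and nz': "T (F(i := a, j := partner a)) \<noteq> 0"
          using sum.not_neutral_contains_not_neutral by (metis (no_types, lifting) mult_zero_right)
        have "F(i := a, j := partner a) \<in> idx (2*k+1) m"
          using a ij F partner_less[of a k] by (intro idx_upd) auto
        from less.prems(4)[OF this nz', of l] show False using l ij0 Fl by (auto split: if_splits)
      qed
      ultimately show ?thesis using less.hyps[of ?S "contr k i j T"] F by blast
    qed
    \<comment> \<open>\<open>D\<close> is closed only under arcs with i < j; the other order follows
      from skewness.\<close>
    have z: "contr k i j T F = 0" if ij: "i < m" "j < m" "i \<noteq> j" and F: "F \<in> idx (2*k+1) m" for i j F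
    proof (cases "i < j")
      case True thus ?thesis using lt ij F by blast
    next
      case False
      hence "contr k j i T F = 0" using lt ij F by (metis linorder_neqE_nat)
      thus ?thesis using contr_swap[of j i k T F] ij by simp
    qed
    have supp: "F = (\<lambda>_. 0)" if "F \<in> idx (2*k+1) m" "T F \<noteq> 0" for F
      by (rule ext, rule lie_inv_no_contr[OF less.prems(1) z that])
    \<comment> \<open>The tensor concentrated at 0 belongs to \<open>D\<close>, and it pairs with
      \<open>T\<close> to the only coefficient that is left.\<close>
    have "(\<Sum>F\<in>idx (2*k+1) m. T F * (if F = (\<lambda>_. 0) then 1 else 0)) = 0"
      using less.prems(2)[OF D0[OF refl]] .
    hence "T (\<lambda>_. 0) = 0"
      using idx_zero[of "2*k+1" m] finite_idx by (simp add: if_distrib cong: if_cong)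
    thus ?case using supp by metis
  qed
  from this[OF inv orth, of "{..<m}"] F show ?thesis by (auto simp: idx_def)
qed

section \<open>Kronecker products and digits\<close>

lemma sum_div_mod:
  fixes h :: "nat \<Rightarrow> nat \<Rightarrow> 'b :: comm_monoid_add"
  shows "(\<Sum>z<a * b. h (z div b) (z mod b)) = (\<Sum>x<a. \<Sum>y<b. h x y)"
proof (cases "b = 0")
  case False
  have "(\<Sum>z<a * b. h (z div b) (z mod b)) = (\<Sum>(x, y)\<in>{..<a} \<times> {..<b}. h x y)"
  proof (rule sum.reindex_bij_witness[of _ "\<lambda>(x, y). x * b + y" "\<lambda>z. (z div b, z mod b)"], goal_cases)
    case (2 z) thus ?case using False by (auto simp: less_mult_imp_div_less)
  next
    case (4 p)
    then obtain x y where p: "p = (x, y)" "x < a" "y < b" by auto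
    have "x * b + y < (x + 1) * b" using p by simp
    also have "\<dots> \<le> a * b" using p by (intro mult_right_mono) auto
    finally show ?case using p by simp
  qed (use False in auto)
  thus ?thesis by (simp add: sum.cartesian_product)
qed auto

lemma dim_kron [simp]:
  "dim_row (A \<otimes>\<^sub>k B) = dim_row A * dim_row B" "dim_col (A \<otimes>\<^sub>k B) = dim_col A * dim_col B"
  by (auto simp: kron_def)

lemma kron_carrier [intro]:
  "A \<in> carrier_mat a b \<Longrightarrow> B \<in> carrier_mat c d \<Longrightarrow> A \<otimes>\<^sub>k B \<in> carrier_mat (a * c) (b * d)"
  by auto

lemma kron_index:
  "x < dim_row A * dim_row B \<Longrightarrow> y < dim_col A * dim_col B \<Longrightarrow>
   (A \<otimes>\<^sub>k B) $$ (x, y) = A $$ (x div dim_row B, y div dim_col B) * B $$ (x mod dim_row B, y mod dim_col B)"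
  by (simp add: kron_def)

lemma div_mod_less: "(x :: nat) < a * b \<Longrightarrow> x div b < a \<and> x mod b < b"
  by (metis less_mult_imp_div_less less_nat_zero_code mod_less_divisor mult_0_right neq0_conv)

lemma mat_mult_index:
  "x < dim_row A \<Longrightarrow> y < dim_col B \<Longrightarrow> dim_col A = dim_row B \<Longrightarrow>
   (A * B) $$ (x, y) = (\<Sum>z<dim_row B. A $$ (x, z) * B $$ (z, y))"
  by (simp add: scalar_prod_def atLeast0LessThan)

lemma kron_mult:
  fixes A B C D :: "'a :: comm_semiring_1 mat"
  assumes "dim_col A = dim_row C" "dim_col B = dim_row D"
  shows "(A \<otimes>\<^sub>k B) * (C \<otimes>\<^sub>k D) = (A * C) \<otimes>\<^sub>k (B * D)"
proof (rule eq_matI)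
  fix x y assume "x < dim_row ((A * C) \<otimes>\<^sub>k (B * D))" "y < dim_col ((A * C) \<otimes>\<^sub>k (B * D))"
  hence x: "x < dim_row A * dim_row B" and y: "y < dim_col C * dim_col D" by auto
  note x' = div_mod_less[OF x] and y' = div_mod_less[OF y]
  have "((A \<otimes>\<^sub>k B) * (C \<otimes>\<^sub>k D)) $$ (x, y) =
    (\<Sum>z<dim_row C * dim_row D. (A $$ (x div dim_row B, z div dim_row D) * B $$ (x mod dim_row B, z mod dim_row D)) *
       (C $$ (z div dim_row D, y div dim_col D) * D $$ (z mod dim_row D, y mod dim_col D)))"
    using x y assms by (simp add: mat_mult_index kron_index del: index_mult_mat(1))
  also have "\<dots> = (\<Sum>z<dim_row C. \<Sum>w<dim_row D. (A $$ (x div dim_row B, z) * B $$ (x mod dim_row B, w)) *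
       (C $$ (z, y div dim_col D) * D $$ (w, y mod dim_col D)))"
    by (rule sum_div_mod)
  also have "\<dots> = (\<Sum>z<dim_row C. A $$ (x div dim_row B, z) * C $$ (z, y div dim_col D)) *
      (\<Sum>w<dim_row D. B $$ (x mod dim_row B, w) * D $$ (w, y mod dim_col D))"
    by (simp add: sum_product mult_ac)
  also have "\<dots> = ((A * C) \<otimes>\<^sub>k (B * D)) $$ (x, y)"
    using x y x' y' assms by (simp add: mat_mult_index kron_index del: index_mult_mat(1))
  finally show "((A \<otimes>\<^sub>k B) * (C \<otimes>\<^sub>k D)) $$ (x, y) = ((A * C) \<otimes>\<^sub>k (B * D)) $$ (x, y)" .
qed auto

lemma kron_assoc:
  fixes A B C :: "'a :: comm_semiring_1 mat"
  shows "(A \<otimes>\<^sub>k B) \<otimes>\<^sub>k C = A \<otimes>\<^sub>k B \<otimes>\<^sub>k C"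
proof (rule eq_matI)
  fix x y assume "x < dim_row (A \<otimes>\<^sub>k B \<otimes>\<^sub>k C)" "y < dim_col (A \<otimes>\<^sub>k B \<otimes>\<^sub>k C)"
  hence x: "x < dim_row A * (dim_row B * dim_row C)" and y: "y < dim_col A * (dim_col B * dim_col C)" by auto
  hence x2: "x < (dim_row A * dim_row B) * dim_row C" and y2: "y < (dim_col A * dim_col B) * dim_col C"
    by (simp_all add: mult.assoc)
  have m: "z mod (b * c) div c = z div c mod b" "z mod (b * c) mod c = z mod c" "z div (b * c) = z div c div b" for z b c :: nat
    by (cases "c = 0"; simp add: mult.commute[of b c] mod_mult2_eq div_mult2_eq mod_mod_cancel)+
  have c: "0 < dim_row B" "0 < dim_col B" "0 < dim_row C" "0 < dim_col C"
    using x y by (auto intro!: Nat.gr0I)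
  show "((A \<otimes>\<^sub>k B) \<otimes>\<^sub>k C) $$ (x, y) = (A \<otimes>\<^sub>k B \<otimes>\<^sub>k C) $$ (x, y)"
    using x y x2 y2 c div_mod_less[OF x] div_mod_less[OF y] div_mod_less[OF x2] div_mod_less[OF y2]
    by (simp add: kron_index m mult.assoc)
qed (auto simp: mult.assoc)

lemma one_kron_one: "1\<^sub>m a \<otimes>\<^sub>k 1\<^sub>m b = (1\<^sub>m (a * b) :: 'a :: comm_semiring_1 mat)"
proof (rule eq_matI)
  fix x y assume "x < dim_row (1\<^sub>m (a * b) :: 'a mat)" "y < dim_col (1\<^sub>m (a * b) :: 'a mat)"
  hence x: "x < a * b" and y: "y < a * b" by auto
  have "x = y \<longleftrightarrow> x div b = y div b \<and> x mod b = y mod b" by (metis div_mult_mod_eq)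
  thus "(1\<^sub>m a \<otimes>\<^sub>k 1\<^sub>m b) $$ (x, y) = (1\<^sub>m (a * b) :: 'a mat) $$ (x, y)"
    using x y div_mod_less[OF x] div_mod_less[OF y] by (auto simp: kron_index)
qed auto

lemma one_kron_left: "1\<^sub>m 1 \<otimes>\<^sub>k A = (A :: 'a :: comm_semiring_1 mat)"
  by (rule eq_matI) (auto simp: kron_index)

lemma one_kron_right: "A \<otimes>\<^sub>k 1\<^sub>m 1 = (A :: 'a :: comm_semiring_1 mat)"
  by (rule eq_matI) (auto simp: kron_index)

lemma kron_minus_left:
  fixes A B C :: "'a :: comm_ring_1 mat"
  assumes "A \<in> carrier_mat a b" "B \<in> carrier_mat a b"
  shows "(A - B) \<otimes>\<^sub>k C = A \<otimes>\<^sub>k C - B \<otimes>\<^sub>k C"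
  by (rule eq_matI) (use assms in \<open>auto simp: kron_index left_diff_distrib dest!: div_mod_less\<close>)

lemma kron_minus_right:
  fixes A B C :: "'a :: comm_ring_1 mat"
  assumes "A \<in> carrier_mat a b" "B \<in> carrier_mat a b"
  shows "C \<otimes>\<^sub>k (A - B) = C \<otimes>\<^sub>k A - C \<otimes>\<^sub>k B"
  by (rule eq_matI) (use assms in \<open>auto simp: kron_index right_diff_distrib dest!: div_mod_less\<close>)

lemma kron_smult_left:
  fixes A C :: "'a :: comm_ring_1 mat"
  shows "(c \<cdot>\<^sub>m A) \<otimes>\<^sub>k C = c \<cdot>\<^sub>m (A \<otimes>\<^sub>k C)"
  by (rule eq_matI) (auto simp: kron_index dest!: div_mod_less)

lemma kron_smult_right:
  fixes A C :: "'a :: comm_ring_1 mat"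
  shows "C \<otimes>\<^sub>k (c \<cdot>\<^sub>m A) = c \<cdot>\<^sub>m (C \<otimes>\<^sub>k A)"
  by (rule eq_matI) (auto simp: kron_index dest!: div_mod_less)

lemma transpose_kron: "transpose_mat (A \<otimes>\<^sub>k B) = transpose_mat A \<otimes>\<^sub>k transpose_mat B"
  by (rule eq_matI) (auto simp: kron_index dest!: div_mod_less)

lemma tensor_pow_carrier [intro]: "A \<in> carrier_mat a b \<Longrightarrow> tensor_pow A r \<in> carrier_mat (a ^ r) (b ^ r)"
  by (induction r) auto

lemma dim_tensor_pow [simp]:
  "dim_row (tensor_pow A r) = dim_row A ^ r" "dim_col (tensor_pow A r) = dim_col A ^ r"
  by (induction r) auto

lemma tensor_pow_add:
  fixes A :: "'a :: comm_semiring_1 mat"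
  shows "tensor_pow A (r + s) = tensor_pow A r \<otimes>\<^sub>k tensor_pow A s"
  by (induction r) (simp_all add: one_kron_left[simplified] kron_assoc)

lemma tensor_pow_1: "tensor_pow A 1 = (A :: 'a :: comm_semiring_1 mat)"
  by (simp add: one_kron_right[simplified])

lemma tensor_pow_mult:
  fixes A :: "'a :: comm_semiring_1 mat"
  assumes "dim_col A = dim_row B"
  shows "tensor_pow A r * tensor_pow B r = tensor_pow (A * B) r"
  by (induction r) (use assms in \<open>simp_all add: kron_mult\<close>)

lemma tensor_pow_one: "tensor_pow (1\<^sub>m a) r = (1\<^sub>m (a ^ r) :: 'a :: comm_semiring_1 mat)"
  by (induction r) (simp_all add: one_kron_one)

lemma transpose_tensor_pow: "transpose_mat (tensor_pow A r) = tensor_pow (transpose_mat A) r"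
  by (induction r) (simp_all add: transpose_kron)

text \<open>
  The last tensor factor belongs to the lowest digit: the tensor factor \<open>i\<close>, counted from 1, is the
  position \<open>n - i\<close>.
\<close>

definition dgt :: "nat \<Rightarrow> nat \<Rightarrow> nat \<Rightarrow> nat" where
  "dgt N x j = x div N ^ j mod N"

lemma dgt_0: "dgt N x 0 = x mod N" by (simp add: dgt_def)
lemma dgt_Suc: "dgt N x (Suc j) = dgt N (x div N) j" by (simp add: dgt_def div_mult2_eq)

lemma dgt_less [simp]: "0 < N \<Longrightarrow> dgt N x j < N" by (simp add: dgt_def)

lemma dgt_beyond:
  assumes "x < N ^ m" "m \<le> j"
  shows "dgt N x j = 0"
proof (cases "N = 0")
  case True
  hence "x = 0" using assms(1) by (cases m) auto
  thus ?thesis by (simp add: dgt_def)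
next
  case False
  hence "N ^ m \<le> N ^ j" using assms(2) by (intro power_increasing) auto
  hence "x div N ^ j = 0" using assms(1) by (intro div_less) linarith
  thus ?thesis by (simp add: dgt_def)
qed

lemma dgt_idx: "0 < N \<Longrightarrow> x < N ^ m \<Longrightarrow> dgt N x \<in> idx N m"
  by (simp add: idx_def dgt_beyond)

lemma dgt_inject: "x < N ^ m \<Longrightarrow> y < N ^ m \<Longrightarrow> (\<And>j. j < m \<Longrightarrow> dgt N x j = dgt N y j) \<Longrightarrow> x = y"
proof (induction m arbitrary: x y)
  case (Suc m)
  have "x div N < N ^ m" "y div N < N ^ m"
    using Suc.prems(1,2) by (auto intro!: less_mult_imp_div_less simp: mult.commute)
  moreover have "dgt N (x div N) j = dgt N (y div N) j" if "j < m" for j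
    using Suc.prems(3)[of "Suc j"] that by (simp add: dgt_Suc)
  ultimately have "x div N = y div N" by (rule Suc.IH)
  moreover have "x mod N = y mod N" using Suc.prems(3)[of 0] by (simp add: dgt_0)
  ultimately show ?case by (metis div_mult_mod_eq)
qed simp

lemma dgt_bij: "0 < N \<Longrightarrow> bij_betw (dgt N) {..<N ^ m} (idx N m)"
proof (induction m)
  case 0
  have "idx N 0 = {\<lambda>_. 0}" by (auto simp: idx_def)
  moreover have "dgt N 0 = (\<lambda>_. 0)" by (simp add: dgt_def fun_eq_iff)
  ultimately show ?case by (simp add: bij_betw_def lessThan_Suc)
next
  case (Suc m)
  have inj: "inj_on (dgt N) {..<N ^ Suc m}"
    by (rule inj_onI) (rule dgt_inject[of _ N "Suc m"], auto)
  have "F \<in> dgt N ` {..<N ^ Suc m}" if F: "F \<in> idx N (Suc m)" for F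
  proof -
    have "(\<lambda>j. F (Suc j)) \<in> idx N m" using F by (auto simp: idx_def)
    then obtain x where x: "x < N ^ m" "dgt N x = (\<lambda>j. F (Suc j))"
      using Suc unfolding bij_betw_def by (metis imageE lessThan_iff)
    have F0: "F 0 < N" using F by (auto simp: idx_def)
    have "dgt N (x * N + F 0) = F"
    proof
      fix j show "dgt N (x * N + F 0) j = F j"
        using F0 x(2) by (cases j) (simp_all add: dgt_0 dgt_Suc)
    qed
    moreover have "x * N + F 0 < N ^ Suc m"
    proof -
      have "x * N + F 0 < (x + 1) * N" using F0 by simp
      also have "\<dots> \<le> N ^ m * N" using x by (intro mult_right_mono) auto
      finally show ?thesis by (simp add: mult.commute)
    qed
    ultimately show ?thesis by (metis imageI lessThan_iff)
  qed
  moreover have "dgt N x \<in> idx N (Suc m)" if "x < N ^ Suc m" for x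
    using dgt_idx[OF Suc.prems that] .
  ultimately have "dgt N ` {..<N ^ Suc m} = idx N (Suc m)" by auto
  thus ?case using inj by (simp add: bij_betw_def)
qed

lemma sum_dgt: "0 < N \<Longrightarrow> (\<Sum>x<N ^ m. h (dgt N x)) = (\<Sum>F\<in>idx N m. h F)"
  by (rule sum.reindex_bij_betw[OF dgt_bij])

lemma dgt_div_power: "dgt N (x div N ^ b) j = dgt N x (j + b)"
  by (simp add: dgt_def power_add div_mult2_eq mult.commute[of "N ^ j"])

lemma dgt_mod_power:
  assumes N: "0 < N"
  shows "dgt N (x mod N ^ b) j = (if j < b then dgt N x j else 0)"
proof (cases "j < b")
  case True
  define c where "c = b - Suc j"
  have "b = j + Suc c" using True by (simp add: c_def)
  hence "N ^ b = N ^ j * (N * N ^ c)" by (simp add: power_add)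
  hence "x mod N ^ b div N ^ j mod N = x div N ^ j mod N"
    using N by (simp add: mod_mult2_eq)
  thus ?thesis using True by (simp add: dgt_def)
next
  case False
  have "x mod N ^ b < N ^ b" using N by simp
  thus ?thesis using False dgt_beyond by auto
qed

section \<open>The representing matrices as operators on functions of the digits\<close>

lemma if_one_mult:
  "(if P then 1 else 0) * (a * (if Q then 1 else 0)) = (if P \<and> Q then a else (0 :: 'a :: comm_ring_1))"
  "a * (if Q then 1 else 0) = (if Q then a else 0)"
  by simp_all

lemma mod_mult_div: "(z :: nat) mod (b * c) div c = z div c mod b"
  by (cases "c = 0") (simp_all add: mult.commute[of b c] mod_mult2_eq)

lemma div_power_eq_iff:
  assumes N: "0 < N" and xy: "x < N ^ n" "y < N ^ n"
  shows "x div N ^ b = y div N ^ b \<longleftrightarrow> (\<forall>j\<ge>b. dgt N x j = dgt N y j)"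
proof
  assume "x div N ^ b = y div N ^ b"
  thus "\<forall>j\<ge>b. dgt N x j = dgt N y j" by (metis dgt_div_power le_add_diff_inverse2)
next
  assume a: "\<forall>j\<ge>b. dgt N x j = dgt N y j"
  have "x div N ^ b \<le> x" "y div N ^ b \<le> y" by (rule div_le_dividend)+
  hence "x div N ^ b < N ^ n" "y div N ^ b < N ^ n" using xy by linarith+
  thus "x div N ^ b = y div N ^ b"
    by (rule dgt_inject) (use a in \<open>simp add: dgt_div_power\<close>)
qed

lemma mod_power_eq_iff:
  assumes N: "0 < N"
  shows "x mod N ^ b = y mod N ^ b \<longleftrightarrow> (\<forall>j<b. dgt N x j = dgt N y j)"
proof
  assume "x mod N ^ b = y mod N ^ b"
  thus "\<forall>j<b. dgt N x j = dgt N y j" by (metis dgt_mod_power[OF N])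
next
  assume a: "\<forall>j<b. dgt N x j = dgt N y j"
  have "x mod N ^ b < N ^ b" "y mod N ^ b < N ^ b" using N by auto
  thus "x mod N ^ b = y mod N ^ b"
    by (rule dgt_inject) (use a in \<open>simp add: dgt_mod_power[OF N]\<close>)
qed

definition loc2 :: "nat \<Rightarrow> nat \<Rightarrow> nat \<Rightarrow> 'a :: comm_ring_1 mat \<Rightarrow> 'a mat" where
  "loc2 N n i M = 1\<^sub>m (N ^ (i - 1)) \<otimes>\<^sub>k M \<otimes>\<^sub>k 1\<^sub>m (N ^ (n - i - 1))"

lemma loc2_dims:
  fixes N :: nat
  assumes "1 \<le> i" "i < n"
  shows "N ^ (i - 1) * (N * N * N ^ (n - i - 1)) = N ^ n"
proof -
  have "N ^ (i - 1) * (N * N * N ^ (n - i - 1)) = N ^ ((i - 1) + (2 + (n - i - 1)))"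
    by (simp add: power_add power2_eq_square mult_ac)
  also have "(i - 1) + (2 + (n - i - 1)) = n" using assms by simp
  finally show ?thesis .
qed

lemma loc2_carrier: "1 \<le> i \<Longrightarrow> i < n \<Longrightarrow> M \<in> carrier_mat (N * N) (N * N) \<Longrightarrow> loc2 N n i M \<in> carrier_mat (N ^ n) (N ^ n)"
  using loc2_dims[of i n N] by (intro carrier_matI) (simp_all add: loc2_def)

text \<open>The last factor is the lowest digit, so \<open>p\<close> is the position of the factor
  \<open>i + 1\<close>, while the factor \<open>i\<close> sits at \<open>Suc p\<close> and supplies
  the leading index of \<open>M\<close>.\<close>

lemma loc2_index:
  assumes N: "0 < N" and i: "1 \<le> i" "i < n" and p: "p = n - i - 1"
    and M: "M \<in> carrier_mat (N * N) (N * N)" and xy: "x < N ^ n" "y < N ^ n"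
  shows "loc2 N n i M $$ (x, y) =
    (if \<forall>l. l \<noteq> p \<longrightarrow> l \<noteq> Suc p \<longrightarrow> dgt N x l = dgt N y l
     then M $$ (dgt N x (Suc p) * N + dgt N x p, dgt N y (Suc p) * N + dgt N y p) else 0)"
proof -
  let ?Q = "N * N * N ^ p"
  have Q: "?Q = N ^ (p + 2)" by (simp add: mult_ac)
  have d: "N ^ (i - 1) * ?Q = N ^ n" using loc2_dims[OF i, of N] p by simp
  have x2: "x < N ^ (i - 1) * ?Q" and y2: "y < N ^ (i - 1) * ?Q" using xy d by auto
  note xd = div_mod_less[OF x2] and yd = div_mod_less[OF y2]
  have xm: "x mod ?Q < N * N * N ^ p" and ym: "y mod ?Q < N * N * N ^ p" using xd yd by auto
  have dd: "z div N ^ p mod (N * N) = dgt N z (Suc p) * N + dgt N z p" for z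
    by (simp add: mod_mult2_eq dgt_def div_mult2_eq[symmetric] mult.commute)
  have mm: "z mod ?Q mod N ^ p = z mod N ^ p" for z by (simp add: mod_mod_cancel)
  have "loc2 N n i M $$ (x, y) = (if x div ?Q = y div ?Q then 1 else 0) *
     (M $$ (x mod ?Q div N ^ p, y mod ?Q div N ^ p) * (if x mod N ^ p = y mod N ^ p then 1 else 0))"
    using M x2 y2 xd yd div_mod_less[OF xm] div_mod_less[OF ym]
    unfolding loc2_def p[symmetric] by (simp add: kron_index mm del: mod_mod_cancel)
  also have "\<dots> = (if (\<forall>j\<ge>p+2. dgt N x j = dgt N y j) \<and> (\<forall>j<p. dgt N x j = dgt N y j)
      then M $$ (dgt N x (Suc p) * N + dgt N x p, dgt N y (Suc p) * N + dgt N y p) else 0)"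
    unfolding mod_mult_div dd unfolding Q div_power_eq_iff[OF N xy] mod_power_eq_iff[OF N]
    by (rule if_one_mult)
  also have "(\<forall>j\<ge>p+2. dgt N x j = dgt N y j) \<and> (\<forall>j<p. dgt N x j = dgt N y j) \<longleftrightarrow>
     (\<forall>l. l \<noteq> p \<longrightarrow> l \<noteq> Suc p \<longrightarrow> dgt N x l = dgt N y l)"
  proof -
    have "l \<noteq> p \<and> l \<noteq> Suc p \<longleftrightarrow> p + 2 \<le> l \<or> l < p" for l by arith
    thus ?thesis by blast
  qed
  finally show ?thesis .
qed

lemma tensor_pow_index:
  fixes M :: "'a :: comm_ring_1 mat"
  assumes N: "0 < N" and M: "M \<in> carrier_mat N N"
  shows "x < N ^ n \<Longrightarrow> y < N ^ n \<Longrightarrow> tensor_pow M n $$ (x, y) = (\<Prod>j<n. M $$ (dgt N x j, dgt N y j))"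
proof (induction n arbitrary: x y)
  case (Suc n)
  have "x div N ^ n < N" "y div N ^ n < N"
    using Suc.prems by (auto intro!: less_mult_imp_div_less)
  hence "dgt N x n = x div N ^ n" "dgt N y n = y div N ^ n" by (simp_all add: dgt_def)
  moreover have "x mod N ^ n < N ^ n" "y mod N ^ n < N ^ n" using N by auto
  ultimately show ?case using Suc M
    by (simp add: kron_index Suc.IH dgt_mod_power[OF N] mult.commute)
qed simp

text \<open>The first \<open>r\<close> tensor factors are the highest digits, those from
  \<open>n - r\<close> on; the identity acts on the digits below.\<close>

lemma tensor_pow_one_index:
  fixes M :: "'a :: comm_ring_1 mat"
  assumes N: "0 < N" and M: "M \<in> carrier_mat N N" and r: "r \<le> n" and xy: "x < N ^ n" "y < N ^ n"
  shows "(tensor_pow M r \<otimes>\<^sub>k 1\<^sub>m (N ^ (n - r))) $$ (x, y) =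
    (if \<forall>j<n-r. dgt N x j = dgt N y j then \<Prod>j\<in>{n-r..<n}. M $$ (dgt N x j, dgt N y j) else 0)"
proof -
  let ?b = "n - r"
  have d: "N ^ n = N ^ r * N ^ ?b" using r by (simp flip: power_add)
  have x2: "x < N ^ r * N ^ ?b" and y2: "y < N ^ r * N ^ ?b" using xy d by auto
  note xd = div_mod_less[OF x2] and yd = div_mod_less[OF y2]
  have "(tensor_pow M r \<otimes>\<^sub>k 1\<^sub>m (N ^ ?b)) $$ (x, y) =
     (\<Prod>j<r. M $$ (dgt N x (j + ?b), dgt N y (j + ?b))) * (if x mod N ^ ?b = y mod N ^ ?b then 1 else 0)"
    using M x2 y2 xd yd by (simp add: kron_index tensor_pow_index[OF N] dgt_div_power)
  also have "(\<Prod>j<r. M $$ (dgt N x (j + ?b), dgt N y (j + ?b))) = (\<Prod>j\<in>{?b..<n}. M $$ (dgt N x j, dgt N y j))"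
    by (rule prod.reindex_bij_witness[of _ "\<lambda>j. j - ?b" "\<lambda>j. j + ?b"]) (use r in auto)
  finally show ?thesis unfolding mod_power_eq_iff[OF N]
    by (simp only: if_one_mult)
qed

lemma tensor_pow_one_carrier:
  "M \<in> carrier_mat N N \<Longrightarrow> r \<le> n \<Longrightarrow> tensor_pow M r \<otimes>\<^sub>k 1\<^sub>m (N ^ (n - r)) \<in> carrier_mat (N ^ n) (N ^ n)"
  by (rule carrier_matI) (simp_all flip: power_add)

text \<open>
  \<open>opr N n X F\<close>: the matrix \<open>X\<close> acts on functions of the digits as \<open>F\<close>.
\<close>

definition opr :: "nat \<Rightarrow> nat \<Rightarrow> complex mat \<Rightarrow> (((nat \<Rightarrow> nat) \<Rightarrow> complex) \<Rightarrow> (nat \<Rightarrow> nat) \<Rightarrow> complex) \<Rightarrow> bool" where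
  "opr N n X F \<longleftrightarrow> X \<in> carrier_mat (N ^ n) (N ^ n) \<and>
     (\<forall>v. \<forall>x<N ^ n. (\<Sum>y<N ^ n. X $$ (x, y) * v (dgt N y)) = F v (dgt N x))"

lemma oprD: "opr N n X F \<Longrightarrow> x < N ^ n \<Longrightarrow> (\<Sum>y<N ^ n. X $$ (x, y) * v (dgt N y)) = F v (dgt N x)"
  by (simp add: opr_def)

lemma opr_carrier: "opr N n X F \<Longrightarrow> X \<in> carrier_mat (N ^ n) (N ^ n)"
  by (simp add: opr_def)

lemma opr_mult:
  assumes X: "opr N n X F" and Y: "opr N n Y G"
  shows "opr N n (X * Y) (\<lambda>v. F (G v))"
  unfolding opr_def
proof (intro conjI allI impI)
  show "X * Y \<in> carrier_mat (N ^ n) (N ^ n)" using X Y by (auto simp: opr_def)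
  fix v x assume x: "x < N ^ n"
  have c: "X \<in> carrier_mat (N ^ n) (N ^ n)" "Y \<in> carrier_mat (N ^ n) (N ^ n)" using X Y by (auto simp: opr_def)
  have "(\<Sum>y<N ^ n. (X * Y) $$ (x, y) * v (dgt N y)) =
    (\<Sum>y<N ^ n. \<Sum>z<N ^ n. X $$ (x, z) * (Y $$ (z, y) * v (dgt N y)))"
    using c x by (intro sum.cong refl) (simp add: mat_mult_index sum_distrib_right mult.assoc del: index_mult_mat(1))
  also have "\<dots> = (\<Sum>z<N ^ n. X $$ (x, z) * (\<Sum>y<N ^ n. Y $$ (z, y) * v (dgt N y)))"
    by (subst sum.swap) (simp add: sum_distrib_left)
  also have "\<dots> = (\<Sum>z<N ^ n. X $$ (x, z) * G v (dgt N z))"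
    by (intro sum.cong refl) (simp add: oprD[OF Y])
  also have "\<dots> = F (G v) (dgt N x)" using oprD[OF X x] .
  finally show "(\<Sum>y<N ^ n. (X * Y) $$ (x, y) * v (dgt N y)) = F (G v) (dgt N x)" .
qed

lemma opr_add: "opr N n X F \<Longrightarrow> opr N n Y G \<Longrightarrow> opr N n (X + Y) (\<lambda>v f. F v f + G v f)"
  by (auto simp: opr_def distrib_right sum.distrib)
lemma opr_minus: "opr N n X F \<Longrightarrow> opr N n Y G \<Longrightarrow> opr N n (X - Y) (\<lambda>v f. F v f - G v f)"
  by (auto simp: opr_def left_diff_distrib sum_subtractf)
lemma opr_smult: "opr N n X F \<Longrightarrow> opr N n (c \<cdot>\<^sub>m X) (\<lambda>v f. c * F v f)"
  by (auto simp: opr_def mult.assoc sum_distrib_left[symmetric])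
lemma opr_one: "opr N n (1\<^sub>m (N ^ n)) (\<lambda>v. v)"
  by (auto simp: opr_def if_distrib[of "\<lambda>z. z * _"] cong: if_cong)

text \<open>The column \<open>y\<close> is the image of the indicator function of the digits of
  \<open>y\<close>.\<close>

lemma opr_index:
  assumes X: "opr N n X F" and xy: "x < N ^ n" "y < N ^ n"
  shows "X $$ (x, y) = F (\<lambda>f. if f = dgt N y then 1 else 0) (dgt N x)"
proof -
  have "(\<Sum>z<N ^ n. X $$ (x, z) * (if dgt N z = dgt N y then 1 else 0)) = (\<Sum>z<N ^ n. if z = y then X $$ (x, y) else 0)"
    using dgt_inject[OF _ xy(2)] by (intro sum.cong refl) auto
  thus ?thesis using oprD[OF X xy(1), of "\<lambda>f. if f = dgt N y then 1 else 0"] xy by simp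
qed

lemma opr_unique:
  assumes X: "opr N n X F" and Y: "opr N n Y G" and N: "0 < N"
    and eq: "\<And>v f. f \<in> idx N n \<Longrightarrow> F v f = G v f"
  shows "X = Y"
  by (rule eq_matI)
    (use opr_carrier[OF X] opr_carrier[OF Y] opr_index[OF X] opr_index[OF Y] eq dgt_idx[OF N] in auto)

lemma opr_cong:
  "opr N n X F \<Longrightarrow> 0 < N \<Longrightarrow> (\<And>v f. f \<in> idx N n \<Longrightarrow> F v f = G v f) \<Longrightarrow> opr N n X G"
  by (auto simp: opr_def dgt_idx)

lemma opr_kernel:
  assumes N: "0 < N" and X: "X \<in> carrier_mat (N ^ n) (N ^ n)"
    and e: "\<And>x y. x < N ^ n \<Longrightarrow> y < N ^ n \<Longrightarrow> X $$ (x, y) = K (dgt N x) (dgt N y)"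
    and F: "\<And>v f. f \<in> idx N n \<Longrightarrow> (\<Sum>g\<in>idx N n. K f g * v g) = F v f"
  shows "opr N n X F"
  unfolding opr_def
proof (intro conjI allI impI X)
  fix v x assume x: "x < N ^ n"
  have "(\<Sum>y<N ^ n. X $$ (x, y) * v (dgt N y)) = (\<Sum>y<N ^ n. K (dgt N x) (dgt N y) * v (dgt N y))"
    using e x by simp
  also have "\<dots> = (\<Sum>g\<in>idx N n. K (dgt N x) g * v g)" by (rule sum_dgt[OF N])
  finally show "(\<Sum>y<N ^ n. X $$ (x, y) * v (dgt N y)) = F v (dgt N x)"
    using F dgt_idx[OF N x] by simp
qed

text \<open>A column of \<open>Y\<close> is itself a function of the digits, so a product can be
  computed without the entries of \<open>X\<close>.\<close>

lemma mult_index_opr: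
  assumes X: "opr N n X F" and Y: "Y \<in> carrier_mat (N ^ n) (N ^ n)"
    and e: "\<And>x y. x < N ^ n \<Longrightarrow> y < N ^ n \<Longrightarrow> Y $$ (x, y) = K (dgt N x) (dgt N y)"
    and xy: "x < N ^ n" "y < N ^ n"
  shows "(X * Y) $$ (x, y) = F (\<lambda>f. K f (dgt N y)) (dgt N x)"
proof -
  have "(X * Y) $$ (x, y) = (\<Sum>z<N ^ n. X $$ (x, z) * K (dgt N z) (dgt N y))"
    using opr_carrier[OF X] Y e xy by (simp add: mat_mult_index del: index_mult_mat(1))
  thus ?thesis using oprD[OF X xy(1), of "\<lambda>f. K f (dgt N y)"] by simp
qed

definition swp :: "nat \<Rightarrow> (nat \<Rightarrow> nat) \<Rightarrow> nat \<Rightarrow> nat" where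
  "swp p f = f(Suc p := f p, p := f (Suc p))"

lemma swp_idx: "f \<in> idx N n \<Longrightarrow> Suc p < n \<Longrightarrow> swp p f \<in> idx N n"
  by (auto simp: idx_def swp_def)

lemma swp_app [simp]: "swp p f p = f (Suc p)" "swp p f (Suc p) = f p"
  "l \<noteq> p \<Longrightarrow> l \<noteq> Suc p \<Longrightarrow> swp p f l = f l"
  by (auto simp: swp_def)

lemma swp_swp [simp]: "swp p (swp p f) = f"
  by (auto simp: swp_def)

text \<open>U read along the rows of its matrix: \<open>f (Suc p)\<close> is the first and
  \<open>f p\<close> the second index of the row.\<close>

definition Uop :: "complex \<Rightarrow> nat \<Rightarrow> ((nat \<Rightarrow> nat) \<Rightarrow> complex) \<Rightarrow> (nat \<Rightarrow> nat) \<Rightarrow> complex" where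
  "Uop q p v f = (if f (Suc p) = f p then 0
     else (if f (Suc p) < f p then inverse q else q) * v f - v (swp p f))"

lemma U_mat_carrier: "U_mat N q \<in> carrier_mat (N * N) (N * N)"
  by (simp add: U_mat_def)

lemma pair_less: "a < N \<Longrightarrow> b < N \<Longrightarrow> a * N + b < N * (N :: nat)"
proof -
  assume ab: "a < N" "b < N"
  have "a * N + b < (a + 1) * N" using ab by simp
  also have "\<dots> \<le> N * N" using ab by (intro mult_right_mono) auto
  finally show ?thesis .
qed

lemma U_mat_index:
  "a < N \<Longrightarrow> b < N \<Longrightarrow> c < N \<Longrightarrow> d < N \<Longrightarrow> U_mat N q $$ (a * N + b, c * N + d) = U_coeff q (a, b) (c, d)"
  by (simp add: U_mat_def pair_less)

lemma rep_U: "rep k n q s (GenU i) = loc2 (2 * k + 1) n i (U_mat (2 * k + 1) q)"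
  by (simp add: loc2_def Let_def)

text \<open>A row \<open>f\<close> of U has at most two nonzero entries, in the columns
  \<open>f\<close> and \<open>swp p f\<close>.\<close>

lemma opr_U:
  assumes i: "1 \<le> i" "i < n"
  shows "opr (2 * k + 1) n (rep k n q s (GenU i)) (Uop q (n - i - 1))"
proof -
  define N where "N = 2 * k + 1"
  define p where "p = n - i - 1"
  have N: "0 < N" by (simp add: N_def)
  have pn: "Suc p < n" using i by (auto simp: p_def)
  define K where "K f g = (if \<forall>l. l \<noteq> p \<longrightarrow> l \<noteq> Suc p \<longrightarrow> f l = g l
     then U_coeff q (f (Suc p), f p) (g (Suc p), g p) else 0)" for f g :: "nat \<Rightarrow> nat"
  have "opr N n (loc2 N n i (U_mat N q)) (Uop q p)"
  proof (rule opr_kernel[OF N loc2_carrier[OF i U_mat_carrier], where K = K])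
    fix x y assume xy: "x < N ^ n" "y < N ^ n"
    show "loc2 N n i (U_mat N q) $$ (x, y) = K (dgt N x) (dgt N y)"
      using N by (simp only: loc2_index[OF N i p_def U_mat_carrier xy] U_mat_index dgt_less K_def)
  next
    fix v f assume f: "f \<in> idx N n"
    have eqf: "g = f" if "\<forall>l. l \<noteq> p \<longrightarrow> l \<noteq> Suc p \<longrightarrow> f l = g l" "f (Suc p) = g (Suc p)" "f p = g p" for g
    proof
      fix l show "g l = f l" using that by (cases "l = p \<or> l = Suc p") auto
    qed
    have eqs: "g = swp p f" if "\<forall>l. l \<noteq> p \<longrightarrow> l \<noteq> Suc p \<longrightarrow> f l = g l" "f (Suc p) = g p" "f p = g (Suc p)" for g
    proof
      fix l show "g l = swp p f l" using that by (cases "l = p \<or> l = Suc p") auto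
    qed
    show "(\<Sum>g\<in>idx N n. K f g * v g) = Uop q p v f"
    proof (cases "f (Suc p) = f p")
      case True
      have "K f g = 0" for g unfolding K_def U_coeff_def using True by auto
      thus ?thesis using True by (simp add: Uop_def)
    next
      case False
      have ne: "swp p f \<noteq> f" using False by (metis swp_app(1))
      have "(\<Sum>g\<in>idx N n. K f g * v g) = (\<Sum>g\<in>{f, swp p f}. K f g * v g)"
      proof (rule sum.mono_neutral_right[OF finite_idx])
        show "{f, swp p f} \<subseteq> idx N n" using f swp_idx[OF f pn] by auto
        show "\<forall>g\<in>idx N n - {f, swp p f}. K f g * v g = 0"
        proof
          fix g assume "g \<in> idx N n - {f, swp p f}"
          hence "g \<noteq> f" "g \<noteq> swp p f" by auto
          hence "K f g = 0" using eqf[of g] eqs[of g] unfolding K_def U_coeff_def split by (metis prod.inject)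
          thus "K f g * v g = 0" by simp
        qed
      qed
      also have "\<dots> = K f f * v f + K f (swp p f) * v (swp p f)" using ne by simp
      also have "K f f = (if f (Suc p) < f p then inverse q else q)"
        using False by (simp add: K_def U_coeff_def)
      also have "K f (swp p f) = - 1"
        using False by (simp add: K_def U_coeff_def)
      also have "(if f (Suc p) < f p then inverse q else q) * v f + (- 1) * v (swp p f) = Uop q p v f"
        using False by (simp add: Uop_def)
      finally show ?thesis .
    qed
  qed
  thus ?thesis by (simp only: rep_U N_def[symmetric] p_def[symmetric])
qed

section \<open>The idempotents $E_{(r)}$ and their products with $U_i$\<close>

lemma E_mat_carrier: "E_mat k q s \<in> carrier_mat (2 * k + 1) (2 * k + 1)"
  by (simp add: E_mat_def)

definition Snum :: "nat \<Rightarrow> complex \<Rightarrow> complex" where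
  "Snum k q = (\<Sum>m = 1..2 * k + 1. (- q) powi (int k + 1 - int m))"

lemma E_mat_index:
  assumes "s \<noteq> 0" "i < 2 * k + 1" "j < 2 * k + 1"
  shows "E_mat k q s $$ (i, j) = s powi (int k - int i) * s powi (int k - int j) / Snum k q"
proof -
  have "2 * int k - int i - int j = (int k - int i) + (int k - int j)" by simp
  hence "s powi (2 * int k - int i - int j) = s powi (int k - int i) * s powi (int k - int j)"
    using assms(1) by (metis power_int_add)
  thus ?thesis using assms(2,3) by (simp only: E_mat_def Snum_def index_mat split)
qed

definition Eker :: "nat \<Rightarrow> nat \<Rightarrow> complex \<Rightarrow> complex \<Rightarrow> nat \<Rightarrow> (nat \<Rightarrow> nat) \<Rightarrow> (nat \<Rightarrow> nat) \<Rightarrow> complex" where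
  "Eker k n q s r f g = (if \<forall>j<n-r. f j = g j
     then \<Prod>j\<in>{n-r..<n}. E_mat k q s $$ (f j, g j) else 0)"

lemma rep_E_carrier: "r \<le> n \<Longrightarrow> rep k n q s (GenE r) \<in> carrier_mat ((2 * k + 1) ^ n) ((2 * k + 1) ^ n)"
  unfolding rep.simps by (rule tensor_pow_one_carrier[OF E_mat_carrier])

lemma rep_U_carrier: "1 \<le> i \<Longrightarrow> i < n \<Longrightarrow> rep k n q s (GenU i) \<in> carrier_mat ((2 * k + 1) ^ n) ((2 * k + 1) ^ n)"
  by (rule opr_carrier[OF opr_U])

lemma rep_E_index:
  assumes r: "r \<le> n" and xy: "x < (2 * k + 1) ^ n" "y < (2 * k + 1) ^ n"
  shows "rep k n q s (GenE r) $$ (x, y) = Eker k n q s r (dgt (2 * k + 1) x) (dgt (2 * k + 1) y)"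
  unfolding rep.simps Eker_def by (rule tensor_pow_one_index[OF _ E_mat_carrier r xy]) simp

text \<open>The matrix E has rank one, so an entry of its tensor power depends on the row digits
  only through a product of one factor per digit, which is symmetric.\<close>

lemma Eker_swp:
  assumes f: "f \<in> idx (2 * k + 1) n" and g: "g \<in> idx (2 * k + 1) n" and s: "s \<noteq> 0"
    and p: "n - r \<le> p" "Suc p < n"
  shows "Eker k n q s r (swp p f) g = Eker k n q s r f g"
proof -
  let ?A = "{n-r..<n}"
  have pA: "p \<in> ?A" "Suc p \<in> ?A" using p by auto
  have x: "f j < 2 * k + 1" "g j < 2 * k + 1" "swp p f j < 2 * k + 1" for j
    using idx_less[OF f] idx_less[OF g] idx_less[OF swp_idx[OF f p(2)]] by auto
  have split: "(\<Prod>j\<in>?A. E_mat k q s $$ (h j, g j)) =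
     E_mat k q s $$ (h p, g p) * (E_mat k q s $$ (h (Suc p), g (Suc p)) * (\<Prod>j\<in>?A - {p} - {Suc p}. E_mat k q s $$ (h j, g j)))" for h
    using pA by (subst prod.remove[of _ p]; simp; subst prod.remove[of _ "Suc p"]; simp)
  have "(\<Prod>j\<in>?A. E_mat k q s $$ (swp p f j, g j)) = (\<Prod>j\<in>?A. E_mat k q s $$ (f j, g j))"
    unfolding split using x by (simp add: E_mat_index[OF s] mult_ac)
  moreover have "(\<forall>j<n-r. swp p f j = g j) \<longleftrightarrow> (\<forall>j<n-r. f j = g j)"
    using p by auto
  ultimately show ?thesis by (simp only: Eker_def)
qed

lemma E_mat_sym: "s \<noteq> 0 \<Longrightarrow> transpose_mat (E_mat k q s) = E_mat k q s"
  by (rule eq_matI) (auto simp: E_mat_def algebra_simps)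

lemma U_mat_sym: "transpose_mat (U_mat N q) = U_mat N q"
  by (rule eq_matI) (auto simp: U_mat_def U_coeff_def)

lemma transpose_loc2: "transpose_mat (loc2 N n i M) = loc2 N n i (transpose_mat M)"
  by (simp add: loc2_def transpose_kron)

lemma rep_U_sym: "transpose_mat (rep k n q s (GenU i)) = rep k n q s (GenU i)"
  unfolding rep_U transpose_loc2 U_mat_sym ..

lemma rep_E_sym: "s \<noteq> 0 \<Longrightarrow> transpose_mat (rep k n q s (GenE r)) = rep k n q s (GenE r)"
  by (simp add: transpose_kron transpose_tensor_pow E_mat_sym)

text \<open>
  The scalar by which \<open>U\<close> multiplies a tensor symmetric in the two positions; it vanishes at $q = 1$.
\<close>

definition Ucoef :: "complex \<Rightarrow> nat \<Rightarrow> nat \<Rightarrow> complex" where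
  "Ucoef q a b = (if a < b then inverse q - 1 else if b < a then q - 1 else 0)"

lemma Uop_sym:
  assumes "v (swp p f) = v f"
  shows "Uop q p v f = Ucoef q (f (Suc p)) (f p) * v f"
  using assms by (auto simp: Uop_def Ucoef_def algebra_simps)

text \<open>Since i < r, the columns of $E_{(r)}$ are symmetric in the factors \<open>i\<close> and
  \<open>i + 1\<close>, and U acts on them by the scalar \<open>Ucoef\<close>.\<close>

lemma U_E_index:
  assumes i: "1 \<le> i" "i < r" "r \<le> n" and s: "s \<noteq> 0" and xy: "x < (2 * k + 1) ^ n" "y < (2 * k + 1) ^ n"
  shows "(rep k n q s (GenU i) * rep k n q s (GenE r)) $$ (x, y) =
    Ucoef q (dgt (2 * k + 1) x (n - i)) (dgt (2 * k + 1) x (n - i - 1)) *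
      Eker k n q s r (dgt (2 * k + 1) x) (dgt (2 * k + 1) y)"
proof -
  have i': "i < n" using i by simp
  have S: "Suc (n - i - 1) = n - i" using i' by simp
  have "(rep k n q s (GenU i) * rep k n q s (GenE r)) $$ (x, y) =
     Uop q (n - i - 1) (\<lambda>f. Eker k n q s r f (dgt (2 * k + 1) y)) (dgt (2 * k + 1) x)"
    by (rule mult_index_opr[OF opr_U[OF i(1) i'] rep_E_carrier[OF i(3)] rep_E_index[OF i(3)] xy])
  also have "\<dots> = Ucoef q (dgt (2 * k + 1) x (Suc (n - i - 1))) (dgt (2 * k + 1) x (n - i - 1)) *
      Eker k n q s r (dgt (2 * k + 1) x) (dgt (2 * k + 1) y)"
    by (intro Uop_sym Eker_swp[OF _ _ s]) (use i xy in \<open>auto intro!: dgt_idx\<close>)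
  finally show ?thesis unfolding S .
qed

text \<open>All these matrices are symmetric, so the second family of scaled generators consists of
  the transposes of the first.\<close>

lemma E_U_transpose:
  assumes i: "1 \<le> i" "i < r" "r \<le> n" and s: "s \<noteq> 0"
  shows "rep k n q s (GenE r) * rep k n q s (GenU i) =
     transpose_mat (rep k n q s (GenU i) * rep k n q s (GenE r))"
  using transpose_mult[OF rep_U_carrier rep_E_carrier, of i n r k q s q s] i
  by (simp only: rep_U_sym rep_E_sym[OF s])

section \<open>The generators at q = 1 commute with the symplectic group\<close>

text \<open>The derivative of \<open>Ucoef\<close> in q at q = 1, which is what remains of U on
  symmetric tensors after the scaling.\<close>

definition order_sign :: "nat \<Rightarrow> nat \<Rightarrow> complex" where
  "order_sign a b = (if a < b then - 1 else if b < a then 1 else 0)"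

definition sgnmat :: "nat \<Rightarrow> complex mat" where
  "sgnmat N = mat (N * N) (N * N) (\<lambda>(x, y). if x = y then order_sign (x div N) (x mod N) else 0)"

lemma sgnmat_carrier: "sgnmat N \<in> carrier_mat (N * N) (N * N)"
  by (simp add: sgnmat_def)

lemma dim_sgnmat [simp]: "dim_row (sgnmat N) = N * N" "dim_col (sgnmat N) = N * N"
  by (simp_all add: sgnmat_def)

lemma sgnmat_mult_index:
  assumes M: "M \<in> carrier_mat (N * N) (N * N)" and xy: "x < N * N" "y < N * N"
  shows "(sgnmat N * M) $$ (x, y) = order_sign (x div N) (x mod N) * M $$ (x, y)"
proof -
  have "(sgnmat N * M) $$ (x, y) = (\<Sum>z<N * N. if z = x then order_sign (x div N) (x mod N) * M $$ (x, y) else 0)"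
  proof -
    have "(sgnmat N * M) $$ (x, y) = (\<Sum>z<N * N. (if x = z then order_sign (x div N) (x mod N) else 0) * M $$ (z, y))"
      using M xy by (simp add: mat_mult_index sgnmat_def del: index_mult_mat(1))
    also have "\<dots> = (\<Sum>z<N * N. if z = x then order_sign (x div N) (x mod N) * M $$ (x, y) else 0)"
      by (rule sum.cong) auto
    finally show ?thesis .
  qed
  thus ?thesis using xy by simp
qed

lemma loc2_mult:
  fixes A B :: "complex mat"
  assumes "A \<in> carrier_mat (N * N) (N * N)" "B \<in> carrier_mat (N * N) (N * N)"
  shows "loc2 N n i A * loc2 N n i B = loc2 N n i (A * B)"
  using assms by (simp add: loc2_def kron_mult)

lemma tensor_pow_split2:
  fixes g :: "complex mat"
  assumes "1 \<le> i" "i < n"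
  shows "tensor_pow g n = tensor_pow g (i - 1) \<otimes>\<^sub>k (g \<otimes>\<^sub>k g) \<otimes>\<^sub>k tensor_pow g (n - i - 1)"
proof -
  have "tensor_pow g (a + Suc (Suc b)) = tensor_pow g a \<otimes>\<^sub>k (g \<otimes>\<^sub>k g) \<otimes>\<^sub>k tensor_pow g b" for a b
    unfolding tensor_pow_add by (simp add: kron_assoc)
  moreover have "(i - 1) + Suc (Suc (n - i - 1)) = n" using assms by simp
  ultimately show ?thesis by metis
qed

lemma loc2_commute_tensor_pow:
  fixes g :: "complex mat"
  assumes g: "g \<in> carrier_mat N N" and M: "M \<in> carrier_mat (N * N) (N * N)"
    and i: "1 \<le> i" "i < n" and c: "M * (g \<otimes>\<^sub>k g) = (g \<otimes>\<^sub>k g) * M"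
  shows "loc2 N n i M * tensor_pow g n = tensor_pow g n * loc2 N n i M"
proof -
  have d: "dim_row g = N" "dim_col g = N" "dim_row M = N * N" "dim_col M = N * N" using g M by auto
  note [simp] = d
  have 1: "1\<^sub>m (N ^ r) * tensor_pow g r = tensor_pow g r * 1\<^sub>m (N ^ r)" for r
    using tensor_pow_carrier[OF g, of r] by simp
  show ?thesis
    unfolding tensor_pow_split2[OF i] loc2_def by (simp add: kron_mult 1 c)
qed

lemma tensor_pow_one_commute:
  fixes g E :: "complex mat"
  assumes g: "g \<in> carrier_mat N N" and E: "E \<in> carrier_mat N N" and r: "r \<le> n"
    and c: "E * g = g * E"
  shows "(tensor_pow E r \<otimes>\<^sub>k 1\<^sub>m (N ^ (n - r))) * tensor_pow g n = tensor_pow g n * (tensor_pow E r \<otimes>\<^sub>k 1\<^sub>m (N ^ (n - r)))"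
proof -
  have "tensor_pow g n = tensor_pow g r \<otimes>\<^sub>k tensor_pow g (n - r)"
    using r by (simp flip: tensor_pow_add)
  moreover have "1\<^sub>m (N ^ m) * tensor_pow g m = tensor_pow g m * 1\<^sub>m (N ^ m)" for m
    unfolding left_mult_one_mat[OF tensor_pow_carrier[OF g]] right_mult_one_mat[OF tensor_pow_carrier[OF g]] ..
  ultimately show ?thesis
    using g E by (simp add: kron_mult tensor_pow_mult c)
qed

text \<open>Idempotency allows a further pair E \<otimes> E to be split off from $E_{(r)}$. This
  confines the interesting part of a scaled generator to two factors.\<close>

lemma loc2_idem_absorb:
  fixes E :: "complex mat"
  assumes E: "E \<in> carrier_mat N N" and EE: "E * E = E" and i: "1 \<le> i" "i < r" "r \<le> n"
  shows "loc2 N n i (E \<otimes>\<^sub>k E) * (tensor_pow E r \<otimes>\<^sub>k 1\<^sub>m (N ^ (n - r))) = tensor_pow E r \<otimes>\<^sub>k 1\<^sub>m (N ^ (n - r))"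
proof -
  have s: "tensor_pow E r = tensor_pow E (i - 1) \<otimes>\<^sub>k (E \<otimes>\<^sub>k E) \<otimes>\<^sub>k tensor_pow E (r - i - 1)"
    by (rule tensor_pow_split2[OF i(1,2)])
  have "n - i - 1 = (r - i - 1) + (n - r)" using i by simp
  hence 1: "N ^ (n - i - 1) = N ^ (r - i - 1) * N ^ (n - r)" by (simp flip: power_add)
  have 2: "(1\<^sub>m (N ^ m) :: complex mat) * tensor_pow E m = tensor_pow E m" for m
    by (rule left_mult_one_mat[OF tensor_pow_carrier[OF E]])
  have d: "dim_row E = N" "dim_col E = N" using E by auto
  show ?thesis
    unfolding loc2_def s 1 kron_assoc by (simp add: kron_mult d 2 EE 1[symmetric] one_kron_one[symmetric])
qed

lemma transpose_eq_carrier: "A \<in> carrier_mat n n \<Longrightarrow> transpose_mat A \<in> carrier_mat n n" by auto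

lemma mult_unit_vec: "(A :: complex mat) \<in> carrier_mat nr nc \<Longrightarrow> j < nc \<Longrightarrow> A *\<^sub>v unit_vec nc j = col A j"
  by (rule eq_vecI) auto

text \<open>\<open>s\<close> is the chosen value of $(-q)^{1/2}$ at q = 1. The condition s t = -1 on
  the other square root then forces t = s, so the group appears below as
  \<open>Sp k s s\<close>.\<close>

locale at_one =
  fixes k :: nat and s :: complex
  assumes s2: "s ^ 2 = - 1"
begin

definition N :: nat where N_eq: "N = 2 * k + 1"

lemma N_pos [simp]: "0 < N" by (simp add: N_eq)

definition xo :: "nat \<Rightarrow> complex" where "xo j = s powi (int k - int j)"

lemma s_nz: "s \<noteq> 0" using s2 by auto

lemma xo_sq: "xo j * xo j = (- 1) ^ k * (- 1) ^ j"
proof -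
  have "xo j * xo j = (s * s) powi (int k - int j)"
    by (simp add: xo_def power_int_mult_distrib)
  also have "s * s = - 1" using s2 by (simp add: power2_eq_square)
  also have "(- 1 :: complex) powi (int k - int j) = (- 1) ^ k * (- 1) ^ j"
    by (simp add: power_int_diff power_one_over[symmetric] divide_inverse flip: power_inverse)
  finally show ?thesis .
qed

text \<open>An odd number of alternating signs: the terms after the first cancel in pairs.\<close>

lemma Snum_1: "Snum k 1 = (- 1) ^ k"
proof -
  have "(\<Sum>m = 1..2 * j + 1. (- 1 :: complex) powi (int k + 1 - int m)) = (- 1) ^ k" for j
  proof (induction j)
    case (Suc j)
    have e: "2 * Suc j + 1 = Suc (Suc (2 * j + 1))" by simp
    have h: "(- 1 :: complex) powi (m + 1) = - ((- 1) powi m)" for m :: int by (simp add: power_int_add)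
    have m: "int k - 2 * int j - 1 = (int k - 2 * int j - 2) + 1" by simp
    have "(- 1 :: complex) powi (int k - 2 * int j - 2) + (- 1) powi (int k - 2 * int j - 1) = 0"
      unfolding m h by (simp only: add.right_inverse)
    thus ?case unfolding e by (subst sum.nat_ivl_Suc', simp, subst sum.nat_ivl_Suc', simp, subst Suc.IH) simp
  qed simp
  thus ?thesis unfolding Snum_def .
qed

section \<open>The matrices E and A at q = 1\<close>

definition Em :: "complex mat" where "Em = E_mat k 1 s"
definition Am :: "complex mat" where "Am = A_mat k s"

lemma Em_carrier: "Em \<in> carrier_mat N N" and Am_carrier: "Am \<in> carrier_mat N N"
  by (simp_all add: Em_def E_mat_def Am_def A_mat_def N_eq)

lemma Em_index: "i < N \<Longrightarrow> j < N \<Longrightarrow> Em $$ (i, j) = (- 1) ^ k * xo i * xo j"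
  by (simp add: N_eq Em_def E_mat_index[OF s_nz] Snum_1 xo_def divide_inverse flip: power_inverse)

text \<open>Apart from the factors \<open>xo\<close> on both sides, A is the matrix of order signs;
  as the squares of the \<open>xo\<close> alternate in sign, the identities for A reduce to
  alternating sums.\<close>

lemma Am_index: "i < N \<Longrightarrow> j < N \<Longrightarrow> Am $$ (i, j) = - order_sign i j * xo i * xo j"
proof -
  assume ij: "i < N" "j < N"
  have "2 * int k - int i - int j = (int k - int i) + (int k - int j)" by simp
  hence "s powi (2 * int k - int i - int j) = xo i * xo j"
    using s_nz unfolding xo_def by (metis power_int_add)
  thus ?thesis using ij by (simp add: N_eq Am_def A_mat_def order_sign_def)
qed

lemma Em_sym: "transpose_mat Em = Em"
  unfolding Em_def by (rule E_mat_sym[OF s_nz])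

lemma Am_skew: "transpose_mat Am = - Am"
  by (rule eq_matI) (use Am_carrier in \<open>auto simp: Am_index order_sign_def\<close>)

definition alt :: "nat \<Rightarrow> complex" where "alt m = (\<Sum>l<m. (- 1) ^ l)"

lemma alt_eq: "alt m = (if odd m then 1 else 0)"
  by (induction m) (auto simp: alt_def)

lemma xo_sum: "(\<Sum>l<N. xo l * xo l) = (- 1) ^ k"
  using alt_eq[of N] unfolding alt_def by (simp only: xo_sq sum_distrib_left[symmetric]) (simp add: N_eq)

lemma sum_lessThan_split3:
  fixes h :: "nat \<Rightarrow> complex"
  assumes "i < n"
  shows "(\<Sum>l<n. h l) = (\<Sum>l<i. h l) + h i + (\<Sum>l\<in>{i<..<n}. h l)"
proof -
  have "{..<n} = {..<i} \<union> ({i} \<union> {i<..<n})" using assms by auto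
  hence "(\<Sum>l<n. h l) = (\<Sum>l\<in>{..<i} \<union> ({i} \<union> {i<..<n}). h l)" by simp
  also have "\<dots> = (\<Sum>l<i. h l) + (\<Sum>l\<in>{i} \<union> {i<..<n}. h l)"
    by (rule sum.union_disjoint) auto
  also have "(\<Sum>l\<in>{i} \<union> {i<..<n}. h l) = h i + (\<Sum>l\<in>{i<..<n}. h l)"
    by (subst sum.union_disjoint) auto
  finally show ?thesis by (simp add: add.assoc)
qed

lemma alt_range: "i < n \<Longrightarrow> (\<Sum>l\<in>{i<..<n}. (- 1) ^ l) = alt n - alt (Suc i)"
  using sum_lessThan_split3[of i n "\<lambda>l. (- 1) ^ l"] by (simp add: alt_def)

lemma sum_order_sign: "i < n \<Longrightarrow> (\<Sum>l<n. order_sign i l * (- 1) ^ l) = alt i - (alt n - alt (Suc i))"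
proof -
  assume i: "i < n"
  have 1: "(\<Sum>l<i. order_sign i l * (- 1) ^ l) = alt i" unfolding alt_def by (rule sum.cong) (auto simp: order_sign_def)
  have 2: "(\<Sum>l\<in>{i<..<n}. order_sign i l * (- 1) ^ l) = - (\<Sum>l\<in>{i<..<n}. (- 1) ^ l)"
    unfolding sum_negf[symmetric] by (rule sum.cong) (auto simp: order_sign_def)
  show ?thesis
    unfolding sum_lessThan_split3[OF i] 1 2 alt_range[OF i] by (simp add: order_sign_def)
qed

lemma Em_idem: "Em * Em = Em"
proof (rule eq_matI)
  fix i j assume "i < dim_row Em" "j < dim_col Em"
  hence ij: "i < N" "j < N" using Em_carrier by auto
  have "(Em * Em) $$ (i, j) = (\<Sum>l<N. ((- 1) ^ k * xo i * xo l) * ((- 1) ^ k * xo l * xo j))"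
    using ij Em_carrier by (simp add: mat_mult_index Em_index del: index_mult_mat(1) sum.lessThan_Suc)
  also have "\<dots> = (- 1) ^ k * (- 1) ^ k * xo i * xo j * (\<Sum>l<N. xo l * xo l)"
    by (simp add: sum_distrib_left mult_ac del: sum.lessThan_Suc)
  also have "\<dots> = Em $$ (i, j)" unfolding xo_sum using ij
    by (simp add: Em_index power_mult_distrib[symmetric])
  finally show "(Em * Em) $$ (i, j) = Em $$ (i, j)" .
qed (use Em_carrier in auto)

text \<open>$v_o$ lies in the kernel of A because N is odd: the alternating sums over the indices
  below and above any \<open>i\<close> are equal.\<close>

lemma Am_Em: "Am * Em = 0\<^sub>m N N"
proof (rule eq_matI)
  fix i j assume "i < dim_row (0\<^sub>m N N :: complex mat)" "j < dim_col (0\<^sub>m N N :: complex mat)"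
  hence ij: "i < N" "j < N" by auto
  have "(Am * Em) $$ (i, j) = (\<Sum>l<N. (- order_sign i l * xo i * xo l) * ((- 1) ^ k * xo l * xo j))"
    using ij Em_carrier Am_carrier by (simp add: mat_mult_index Em_index Am_index del: index_mult_mat(1) sum.lessThan_Suc)
  also have "\<dots> = (\<Sum>l<N. (- ((- 1) ^ k) * xo i * xo j) * (order_sign i l * (xo l * xo l)))"
    by (rule sum.cong) (auto simp: mult_ac)
  also have "\<dots> = - xo i * xo j * (\<Sum>l<N. order_sign i l * (- 1) ^ l)"
    unfolding sum_distrib_left xo_sq by (rule sum.cong) (auto simp: mult_ac simp flip: power_mult_distrib)
  also have "(\<Sum>l<N. order_sign i l * (- 1) ^ l) = 0"
    unfolding sum_order_sign[OF ij(1)] alt_eq by (simp add: N_eq)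
  finally show "(Am * Em) $$ (i, j) = 0\<^sub>m N N $$ (i, j)" using ij by simp
qed (use Em_carrier Am_carrier in auto)

lemma Em_Am: "Em * Am = 0\<^sub>m N N"
proof -
  have "transpose_mat (Em * Am) = - Am * Em"
    using transpose_mult[OF Em_carrier Am_carrier] Em_sym Am_skew by simp
  also have "\<dots> = - (Am * Em)" using Am_carrier Em_carrier by (simp add: uminus_mult_left_mat)
  also have "\<dots> = 0\<^sub>m N N" unfolding Am_Em by (rule eq_matI) auto
  finally show ?thesis by (metis transpose_transpose zero_transpose_mat)
qed

text \<open>Cutting the range at both indices makes the product of the two signs constant on each
  piece.\<close>

lemma order_sign_order_sign_sum:
  assumes "i < N" "j < N"
  shows "(\<Sum>l<N. order_sign i l * order_sign l j * (- 1) ^ l) = (if i = j then - (1 - (- 1) ^ i) else - 1)"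
proof -
  have main: "(\<Sum>l<N. order_sign i l * order_sign l j * (- 1) ^ l) = - 1" if ij: "i < j" "j < N" for i j
  proof -
    have i: "i < N" using ij by simp
    have 1: "(\<Sum>l<i. order_sign i l * order_sign l j * (- 1) ^ l) = - alt i"
      unfolding alt_def sum_negf[symmetric] by (rule sum.cong) (use ij in \<open>auto simp: order_sign_def\<close>)
    have 2: "(\<Sum>l\<in>{i<..<j}. order_sign i l * order_sign l j * (- 1) ^ l) = (\<Sum>l\<in>{i<..<j}. (- 1) ^ l)"
      by (rule sum.cong) (auto simp: order_sign_def)
    have 3: "(\<Sum>l\<in>{j<..<N}. order_sign i l * order_sign l j * (- 1) ^ l) = - (\<Sum>l\<in>{j<..<N}. (- 1) ^ l)"
      unfolding sum_negf[symmetric] by (rule sum.cong) (use ij in \<open>auto simp: order_sign_def\<close>)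
    have "(\<Sum>l<N. order_sign i l * order_sign l j * (- 1) ^ l) = - alt i + (alt j - alt (Suc i)) - (alt N - alt (Suc j))"
      unfolding sum_lessThan_split3[OF ij(2)] sum_lessThan_split3[OF ij(1)] 1 2 3 alt_range[OF ij(1)] alt_range[OF ij(2)]
      by (simp add: order_sign_def)
    thus ?thesis by (simp add: alt_eq N_eq)
  qed
  have diag: "(\<Sum>l<N. order_sign i l * order_sign l i * (- 1) ^ l) = - (1 - (- 1) ^ i)" if i: "i < N" for i
  proof -
    have 1: "(\<Sum>l<i. order_sign i l * order_sign l i * (- 1) ^ l) = - alt i"
      unfolding alt_def sum_negf[symmetric] by (rule sum.cong) (auto simp: order_sign_def)
    have 3: "(\<Sum>l\<in>{i<..<N}. order_sign i l * order_sign l i * (- 1) ^ l) = - (\<Sum>l\<in>{i<..<N}. (- 1) ^ l)"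
      unfolding sum_negf[symmetric] by (rule sum.cong) (auto simp: order_sign_def)
    show ?thesis unfolding sum_lessThan_split3[OF i] 1 3 alt_range[OF i]
      by (auto simp: order_sign_def alt_eq N_eq)
  qed
  have sy: "order_sign i l * order_sign l j = order_sign j l * order_sign l i" for l by (auto simp: order_sign_def)
  consider "i = j" | "i < j" | "j < i" by linarith
  thus ?thesis
  proof cases
    case 1 thus ?thesis using diag[OF assms(1)] by simp
  next
    case 2 thus ?thesis using main[OF 2 assms(2)] by simp
  next
    case 3 thus ?thesis unfolding sy using main[OF 3 assms(1)] by simp
  qed
qed

text \<open>On V' the matrix A is an involution. This yields an explicit inverse for every element
  of the group and, later, for the change of basis.\<close>

lemma Am_Am: "Am * Am = 1\<^sub>m N - Em"
proof (rule eq_matI)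
  fix i j assume "i < dim_row (1\<^sub>m N - Em)" "j < dim_col (1\<^sub>m N - Em)"
  hence ij: "i < N" "j < N" using Em_carrier by auto
  have "(Am * Am) $$ (i, j) = (\<Sum>l<N. (- order_sign i l * xo i * xo l) * (- order_sign l j * xo l * xo j))"
    using ij Am_carrier by (simp add: mat_mult_index Am_index del: index_mult_mat(1) sum.lessThan_Suc)
  also have "\<dots> = (\<Sum>l<N. (xo i * xo j) * (order_sign i l * order_sign l j * (xo l * xo l)))"
    by (rule sum.cong) (auto simp: mult_ac)
  also have "\<dots> = (- 1) ^ k * xo i * xo j * (\<Sum>l<N. order_sign i l * order_sign l j * (- 1) ^ l)"
    unfolding sum_distrib_left xo_sq by (rule sum.cong) (auto simp: mult_ac)
  also have "\<dots> = (1\<^sub>m N - Em) $$ (i, j)"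
  proof (cases "i = j")
    case True
    have "(- 1) ^ k * xo i * xo i = (- 1) ^ i"
      unfolding mult.assoc xo_sq by (simp flip: power_mult_distrib mult.assoc)
    moreover have "(- 1) ^ i * (- 1) ^ i = (1 :: complex)" by (simp flip: power_mult_distrib)
    ultimately show ?thesis unfolding order_sign_order_sign_sum[OF ij] using ij Em_carrier True
      by (simp add: Em_index algebra_simps)
  next
    case False
    thus ?thesis unfolding order_sign_order_sign_sum[OF ij] using ij Em_carrier by (simp add: Em_index)
  qed
  finally show "(Am * Am) $$ (i, j) = (1\<^sub>m N - Em) $$ (i, j)" .
qed (use Em_carrier Am_carrier in auto)

lemma v_o_eq: "v_o k s = vec N xo"
  by (auto simp: v_o_def xo_def N_eq)

text \<open>Turns the conditions on vectors into matrix identities. The last two say that g and its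
  transpose both preserve A; the second of them comes from the explicit inverse $A g^T A + E$ of
  g.\<close>

lemma SpD:
  assumes g: "g \<in> Sp k s s"
  shows "g \<in> carrier_mat N N" "g * Em = Em" "Em * g = Em"
    "transpose_mat g * Am * g = Am" "g * Am * transpose_mat g = Am"
proof -
  note E = Em_carrier and A = Am_carrier
  show gc: "g \<in> carrier_mat N N" using g by (simp add: Sp_def N_eq)
  have gv: "g *\<^sub>v v_o k s = v_o k s" using g by (simp add: Sp_def)
  have gk: "\<And>w. w \<in> mat_kernel Em \<Longrightarrow> g *\<^sub>v w \<in> mat_kernel Em" using g by (auto simp: Sp_def Em_def)
  have gx: "(\<Sum>l<N. g $$ (i, l) * xo l) = xo i" if "i < N" for i
  proof -
    have "(g *\<^sub>v v_o k s) $ i = (\<Sum>l<N. g $$ (i, l) * xo l)"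
      using gc that by (simp add: v_o_eq scalar_prod_def atLeast0LessThan)
    thus ?thesis using gv that by (simp add: v_o_eq)
  qed
  show gE: "g * Em = Em"
  proof (rule eq_matI)
    fix i j assume "i < dim_row Em" "j < dim_col Em"
    hence ij: "i < N" "j < N" using E by auto
    have "(g * Em) $$ (i, j) = (\<Sum>l<N. g $$ (i, l) * ((- 1) ^ k * xo l * xo j))"
      using ij gc E by (simp add: mat_mult_index Em_index del: index_mult_mat(1) sum.lessThan_Suc)
    also have "\<dots> = (- 1) ^ k * xo j * (\<Sum>l<N. g $$ (i, l) * xo l)"
      by (simp add: sum_distrib_left mult_ac del: sum.lessThan_Suc)
    also have "\<dots> = Em $$ (i, j)" unfolding gx[OF ij(1)] using ij by (simp add: Em_index)
    finally show "(g * Em) $$ (i, j) = Em $$ (i, j)" .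
  qed (use gc E in auto)
  \<comment> \<open>The projection onto V' along $v_o$: its columns lie in the kernel of E, which g
    preserves.\<close>
  let ?Q = "1\<^sub>m N - Em"
  have Q: "?Q \<in> carrier_mat N N" using E by auto
  have EQ: "Em * ?Q = 0\<^sub>m N N"
    using E Em_idem by (subst mult_minus_distrib_mat[OF E one_carrier_mat E]) auto
  have "Em * (g * ?Q) = 0\<^sub>m N N"
  proof (rule mat_col_eqI)
    fix j assume "j < dim_col (0\<^sub>m N N :: complex mat)"
    hence j: "j < N" by simp
    have "Em *\<^sub>v col ?Q j = col (Em * ?Q) j" using col_mult2[OF E Q j] by simp
    hence "col ?Q j \<in> mat_kernel Em" using j Q E EQ by (auto simp: mat_kernel_def)
    hence "g *\<^sub>v col ?Q j \<in> mat_kernel Em" by (rule gk)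
    hence "Em *\<^sub>v (g *\<^sub>v col ?Q j) = 0\<^sub>v N" using E by (auto simp: mat_kernel_def)
    moreover have "col (Em * (g * ?Q)) j = Em *\<^sub>v (g *\<^sub>v col ?Q j)"
      using col_mult2[OF E mult_carrier_mat[OF gc Q] j] col_mult2[OF gc Q j] by simp
    ultimately show "col (Em * (g * ?Q)) j = col (0\<^sub>m N N) j" using j by simp
  qed (use E gc in auto)
  moreover have "Em * (g * ?Q) = Em * g - Em"
    using E gc gE Em_idem by (subst mult_minus_distrib_mat[OF gc one_carrier_mat E]) (simp add: mult_minus_distrib_mat[OF E gc E])
  ultimately have "Em * g - Em = 0\<^sub>m N N" by simp
  show Eg: "Em * g = Em"
  proof (rule eq_matI)
    fix i j assume "i < dim_row Em" "j < dim_col Em"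
    thus "(Em * g) $$ (i, j) = Em $$ (i, j)"
      using arg_cong[OF \<open>Em * g - Em = 0\<^sub>m N N\<close>, of "\<lambda>M. M $$ (i, j)"] E gc by simp
  qed (use gc E in auto)
  show gAg: "transpose_mat g * Am * g = Am"
  proof (rule eq_matI)
    fix i j assume "i < dim_row Am" "j < dim_col Am"
    hence ij: "i < N" "j < N" using A by auto
    have form: "(g *\<^sub>v unit_vec N i) \<bullet> (Am *\<^sub>v (g *\<^sub>v unit_vec N j)) = unit_vec N i \<bullet> (Am *\<^sub>v unit_vec N j)"
      using g unfolding Sp_def Am_def[symmetric] N_eq[symmetric] by auto
    have "transpose_mat g * Am * g = transpose_mat g * (Am * g)" using gc A by (simp add: assoc_mult_mat[of _ N N])
    moreover have "(transpose_mat g * (Am * g)) $$ (i, j) = (g *\<^sub>v unit_vec N i) \<bullet> (Am *\<^sub>v (g *\<^sub>v unit_vec N j))"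
      using ij gc A by (subst index_mult_mat(1), simp, simp, subst col_mult2[OF A gc ij(2)]) (simp add: mult_unit_vec[OF gc])
    moreover have "unit_vec N i \<bullet> (Am *\<^sub>v unit_vec N j) = Am $$ (i, j)"
      using ij A by (simp add: mult_unit_vec[OF A])
    ultimately show "(transpose_mat g * Am * g) $$ (i, j) = Am $$ (i, j)" using form by simp
  qed (use gc A in auto)
  let ?T = "transpose_mat g"
  have T: "?T \<in> carrier_mat N N" using gc by auto
  \<comment> \<open>The adjoint of g with respect to the form on V', completed by E along
    $v_o$.\<close>
  let ?h = "Am * ?T * Am + Em"
  have h: "?h \<in> carrier_mat N N" using A T E by auto
  note [simp] = assoc_mult_mat[of _ N N _ N _ N] mult_carrier_mat[of _ N N _ N] A T E gc
  have c: "Am * ?T * Am \<in> carrier_mat N N" "g * Am * ?T \<in> carrier_mat N N" "(g * Am * ?T) * Am \<in> carrier_mat N N"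
    by (intro mult_carrier_mat[of _ N N] A T gc)+
  have "?h * g = (Am * ?T * Am) * g + Em * g"
    by (rule add_mult_distrib_mat[OF c(1) E gc])
  also have "(Am * ?T * Am) * g = Am * (?T * Am * g)" by simp
  also have "Am * (?T * Am * g) + Em * g = 1\<^sub>m N" unfolding gAg Am_Am Eg using carrier_matD[OF Em_carrier] by (intro eq_matI) simp_all
  finally have "?h * g = 1\<^sub>m N" .
  hence "g * ?h = 1\<^sub>m N" by (rule mat_mult_left_right_inverse[OF h gc])
  moreover have "g * ?h = (g * Am * ?T) * Am + Em"
    using gE by (subst mult_add_distrib_mat[OF gc c(1) E]) simp
  ultimately have "(g * Am * ?T) * Am + Em = 1\<^sub>m N" by simp
  \<comment> \<open>Multiplying by A on the right removes the summand E. Then A A = 1 - E acts as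
    the identity on the product, because $g^T E = E$ and A E = 0.\<close>
  hence "((g * Am * ?T) * Am + Em) * Am = Am" using left_mult_one_mat[OF Am_carrier] by simp
  moreover have "((g * Am * ?T) * Am + Em) * Am = (g * Am * ?T) * (Am * Am)"
    using Em_Am c by (subst add_mult_distrib_mat[OF c(3) E A]) simp
  moreover have "(g * Am * ?T) * (Am * Am) = g * Am * ?T"
  proof -
    have "?T * Em = Em" using transpose_mult[OF E gc] Eg Em_sym by simp
    hence z: "(g * Am * ?T) * Em = 0\<^sub>m N N" using Am_Em right_mult_zero_mat[OF gc] by simp
    have "(g * Am * ?T) * (1\<^sub>m N - Em) = (g * Am * ?T) * 1\<^sub>m N - (g * Am * ?T) * Em"
      by (rule mult_minus_distrib_mat[OF c(2) one_carrier_mat E])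
    also have "\<dots> = g * Am * ?T" unfolding z right_mult_one_mat[OF c(2)]
      using carrier_matD[OF c(2)] by (intro eq_matI) simp_all
    finally show ?thesis unfolding Am_Am .
  qed
  ultimately show "g * Am * ?T = Am" by simp
qed

lemma SE_index:
  assumes "x < N * N" "y < N * N"
  shows "(sgnmat N * (Em \<otimes>\<^sub>k Em)) $$ (x, y) = - Am $$ (x div N, x mod N) * (xo (y div N) * xo (y mod N))"
proof -
  have c: "Em \<otimes>\<^sub>k Em \<in> carrier_mat (N * N) (N * N)" using Em_carrier by auto
  have k1: "(- 1) ^ k * (- 1) ^ k = (1 :: complex)" by (simp flip: power_mult_distrib)
  show ?thesis
    unfolding sgnmat_mult_index[OF c assms]
    using assms Em_carrier div_mod_less[OF assms(1)] div_mod_less[OF assms(2)] k1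
    by (simp add: kron_index Em_index Am_index)
qed

text \<open>The matrix has rank one. Its columns are multiples of A as a tensor, which g \<otimes> g
  fixes since $g A g^T = A$; its rows are multiples of $v_o$ \<otimes> $v_o$, fixed since E g =
  E.\<close>

lemma SE_commute:
  assumes g: "g \<in> carrier_mat N N" "Em * g = Em" "g * Am * transpose_mat g = Am"
  shows "(sgnmat N * (Em \<otimes>\<^sub>k Em)) * (g \<otimes>\<^sub>k g) = (g \<otimes>\<^sub>k g) * (sgnmat N * (Em \<otimes>\<^sub>k Em))"
proof -
  define S where "S = sgnmat N * (Em \<otimes>\<^sub>k Em)"
  have "S \<in> carrier_mat (N * N) (N * N)" using sgnmat_carrier[of N] Em_carrier by (auto simp: S_def)
  hence S: "dim_row S = N * N" "dim_col S = N * N" by auto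
  note S_index = SE_index[folded S_def]
  have gg: "g \<otimes>\<^sub>k g \<in> carrier_mat (N * N) (N * N)" using g by auto
  have xg: "(\<Sum>l<N. xo l * g $$ (l, j)) = xo j" if j: "j < N" for j
  proof -
    have "0 < N" by simp
    have x0: "xo 0 \<noteq> 0" using s_nz by (simp add: xo_def)
    have "(Em * g) $$ (0, j) = (\<Sum>l<N. ((- 1) ^ k * xo 0 * xo l) * g $$ (l, j))"
      using j g(1) Em_carrier by (simp add: mat_mult_index Em_index del: index_mult_mat(1) sum.lessThan_Suc)
    also have "\<dots> = (- 1) ^ k * xo 0 * (\<Sum>l<N. xo l * g $$ (l, j))"
      by (simp add: sum_distrib_left mult_ac del: sum.lessThan_Suc)
    finally show ?thesis using j x0 unfolding g(2) by (simp add: Em_index)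
  qed
  have gA: "(\<Sum>a<N. \<Sum>b<N. g $$ (i, a) * g $$ (j, b) * Am $$ (a, b)) = Am $$ (i, j)" if ij: "i < N" "j < N" for i j
  proof -
    have "(g * Am * transpose_mat g) $$ (i, j) = (\<Sum>b<N. (\<Sum>a<N. g $$ (i, a) * Am $$ (a, b)) * g $$ (j, b))"
      using ij g(1) Am_carrier by (simp add: mat_mult_index del: index_mult_mat(1) sum.lessThan_Suc assoc_mult_mat)
    also have "\<dots> = (\<Sum>a<N. \<Sum>b<N. g $$ (i, a) * g $$ (j, b) * Am $$ (a, b))"
      unfolding sum_distrib_right by (subst sum.swap) (simp add: mult_ac del: sum.lessThan_Suc)
    finally show ?thesis unfolding g(3) by simp
  qed
  show ?thesis
    unfolding S_def[symmetric]
  proof (rule eq_matI)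
    fix x y assume "x < dim_row ((g \<otimes>\<^sub>k g) * S)" "y < dim_col ((g \<otimes>\<^sub>k g) * S)"
    hence xy: "x < N * N" "y < N * N" using g(1) S by auto
    note xd = div_mod_less[OF xy(1)] and yd = div_mod_less[OF xy(2)]
    let ?a = "- Am $$ (x div N, x mod N)" and ?c = "xo (y div N) * xo (y mod N)"
    have "(S * (g \<otimes>\<^sub>k g)) $$ (x, y) = (\<Sum>z<N * N. ?a * (xo (z div N) * xo (z mod N)) * (g $$ (z div N, y div N) * g $$ (z mod N, y mod N)))"
      using xy S gg g(1) Em_carrier by (simp add: mat_mult_index S_index kron_index del: index_mult_mat(1) assoc_mult_mat)
    also have "\<dots> = (\<Sum>z<N. \<Sum>w<N. ?a * (xo z * xo w) * (g $$ (z, y div N) * g $$ (w, y mod N)))"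
      by (rule sum_div_mod)
    also have "\<dots> = ?a * ((\<Sum>z<N. xo z * g $$ (z, y div N)) * (\<Sum>w<N. xo w * g $$ (w, y mod N)))"
      unfolding sum_product unfolding sum_distrib_left by (intro sum.cong refl) (simp add: mult_ac)
    also have "\<dots> = ?a * ?c" using yd by (simp only: xg)
    finally have 1: "(S * (g \<otimes>\<^sub>k g)) $$ (x, y) = ?a * ?c" .
    have "((g \<otimes>\<^sub>k g) * S) $$ (x, y) = (\<Sum>z<N * N. (g $$ (x div N, z div N) * g $$ (x mod N, z mod N)) * (- Am $$ (z div N, z mod N) * ?c))"
      using xy S gg g(1) Em_carrier by (simp add: mat_mult_index S_index kron_index del: index_mult_mat(1) assoc_mult_mat)
    also have "\<dots> = (\<Sum>z<N. \<Sum>w<N. (g $$ (x div N, z) * g $$ (x mod N, w)) * (- Am $$ (z, w) * ?c))"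
      by (rule sum_div_mod)
    also have "\<dots> = - ?c * (\<Sum>z<N. \<Sum>w<N. g $$ (x div N, z) * g $$ (x mod N, w) * Am $$ (z, w))"
      by (simp add: sum_distrib_left mult_ac sum_negf del: sum.lessThan_Suc)
    also have "\<dots> = ?a * ?c" using xd by (simp add: gA)
    finally show "(S * (g \<otimes>\<^sub>k g)) $$ (x, y) = ((g \<otimes>\<^sub>k g) * S) $$ (x, y)" using 1 by simp
  qed (use g(1) S in auto)
qed

end

lemma loc2_sgnmat_mult_index:
  assumes N: "0 < N" and i: "1 \<le> i" "i < n" and M: "M \<in> carrier_mat (N ^ n) (N ^ n)"
    and xy: "x < N ^ n" "y < N ^ n"
  shows "(loc2 N n i (sgnmat N) * M) $$ (x, y) = order_sign (dgt N x (n - i)) (dgt N x (n - i - 1)) * M $$ (x, y)"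
proof -
  define p where "p = n - i - 1"
  have Sp: "Suc p = n - i" using i by (simp add: p_def)
  have e: "loc2 N n i (sgnmat N) $$ (x, z) = (if z = x then order_sign (dgt N x (n - i)) (dgt N x (n - i - 1)) else 0)"
    if z: "z < N ^ n" for z
  proof -
    have "z = x \<longleftrightarrow> (\<forall>l. l \<noteq> p \<longrightarrow> l \<noteq> Suc p \<longrightarrow> dgt N x l = dgt N z l) \<and>
       dgt N x (Suc p) * N + dgt N x p = dgt N z (Suc p) * N + dgt N z p"
    proof
      assume a: "(\<forall>l. l \<noteq> p \<longrightarrow> l \<noteq> Suc p \<longrightarrow> dgt N x l = dgt N z l) \<and>
         dgt N x (Suc p) * N + dgt N x p = dgt N z (Suc p) * N + dgt N z p"
      have "dgt N x (Suc p) = (dgt N x (Suc p) * N + dgt N x p) div N" using N by simp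
      also have "\<dots> = dgt N z (Suc p)" using a N by simp
      finally have 1: "dgt N x (Suc p) = dgt N z (Suc p)" .
      with a have "dgt N x p = dgt N z p" by simp
      hence "dgt N z l = dgt N x l" for l using a 1 by (cases "l = p \<or> l = Suc p") auto
      thus "z = x" by (intro dgt_inject[OF z xy(1)]) auto
    qed auto
    thus ?thesis
      unfolding loc2_index[OF N i p_def sgnmat_carrier xy(1) z] p_def[symmetric] Sp[symmetric]
      using N by (auto simp: sgnmat_def pair_less)
  qed
  have "(loc2 N n i (sgnmat N) * M) $$ (x, y) =
     (\<Sum>z<N ^ n. if z = x then order_sign (dgt N x (n - i)) (dgt N x (n - i - 1)) * M $$ (x, y) else 0)"
  proof -
    have "(loc2 N n i (sgnmat N) * M) $$ (x, y) = (\<Sum>z<N ^ n. loc2 N n i (sgnmat N) $$ (x, z) * M $$ (z, y))"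
      using loc2_carrier[OF i sgnmat_carrier[of N]] M xy by (simp add: mat_mult_index del: index_mult_mat(1))
    also have "\<dots> = (\<Sum>z<N ^ n. if z = x then order_sign (dgt N x (n - i)) (dgt N x (n - i - 1)) * M $$ (x, y) else 0)"
      by (rule sum.cong) (auto simp: e)
    finally show ?thesis .
  qed
  thus ?thesis using xy by simp
qed

section \<open>Limits of the scaled generators as q tends to 1\<close>

lemma isCont_rmq_nz:
  assumes "\<forall>\<^sub>F q in nhds 1. rmq q ^ 2 = - q"
  shows "rmq 1 ^ 2 = (- 1 :: complex)"
  using eventually_nhds_x_imp_x[OF assms] .

lemma tendsto_Eker:
  assumes rmq: "\<forall>\<^sub>F q in nhds 1. rmq q ^ 2 = - q" "isCont rmq 1"
    and f: "f \<in> idx (2 * k + 1) n" "g \<in> idx (2 * k + 1) n"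
  shows "((\<lambda>q. Eker k n q (rmq q) r f g) \<longlongrightarrow> Eker k n 1 (rmq 1) r f g) (at 1)"
proof -
  interpret at_one k "rmq 1" by unfold_locales (rule isCont_rmq_nz[OF rmq(1)])
  have S: "(Snum k \<longlongrightarrow> Snum k 1) (at 1)"
    unfolding Snum_def by (intro tendsto_intros) auto
  have S0: "Snum k 1 \<noteq> 0" by (simp add: Snum_1)
  have r: "(rmq \<longlongrightarrow> rmq 1) (at 1)" using rmq(2) by (simp add: isCont_def)
  have E: "((\<lambda>q. E_mat k q (rmq q) $$ (a, b)) \<longlongrightarrow> E_mat k 1 (rmq 1) $$ (a, b)) (at 1)"
    if "a < 2 * k + 1" "b < 2 * k + 1" for a b
    using that S0 s_nz unfolding E_mat_def Snum_def[symmetric]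
    by (simp only: index_mat split) (intro tendsto_divide tendsto_power_int S r)
  show ?thesis
    unfolding Eker_def using idx_less[OF f(1)] idx_less[OF f(2)]
    by (cases "\<forall>j<n-r. f j = g j") (simp_all only: if_P if_not_P if_False tendsto_const, (intro tendsto_prod E; simp)+)
qed

text \<open>With $w = q^{1/2}$ one has $w - 1/w = (q - 1)/w$, and the nonzero values of
  \<open>Ucoef\<close> also contain the factor q - 1. What remains is w times -1/q or 1, so the
  limit depends on the branch of the root through \<open>rq 1\<close>.\<close>

lemma tendsto_Ucoef:
  assumes rq: "\<forall>\<^sub>F q in nhds 1. rq q ^ 2 = q" "isCont rq 1"
  shows "((\<lambda>q. 1 / (rq q - inverse (rq q)) * Ucoef q a b) \<longlongrightarrow> rq 1 * order_sign a b) (at 1)"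
proof -
  have ev: "\<forall>\<^sub>F q in at 1. rq q ^ 2 = q \<and> q \<noteq> 1 \<and> q \<noteq> 0"
  proof (intro eventually_conj)
    show "\<forall>\<^sub>F q in at 1. rq q ^ 2 = q" using rq(1) by (simp add: eventually_at_filter eventually_mono)
    show "\<forall>\<^sub>F q in at 1. q \<noteq> (1 :: complex)" by (simp add: eventually_at_filter)
    show "\<forall>\<^sub>F q in at 1. q \<noteq> (0 :: complex)" by (rule tendsto_imp_eventually_ne[OF tendsto_ident_at]) simp
  qed
  have r: "(rq \<longlongrightarrow> rq 1) (at 1)" using rq(2) by (simp add: isCont_def)
  have "((\<lambda>q. rq q * (if a < b then - inverse q else if b < a then 1 else 0)) \<longlongrightarrow> rq 1 * order_sign a b) (at 1)"
    unfolding order_sign_def by (intro tendsto_mult r) (auto intro!: tendsto_eq_intros)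
  thus ?thesis
  proof (rule Lim_transform_eventually)
    show "\<forall>\<^sub>F q in at 1. rq q * (if a < b then - inverse q else if b < a then 1 else 0) =
        1 / (rq q - inverse (rq q)) * Ucoef q a b"
      using ev
    proof (eventually_elim)
      case (elim q)
      have main: "w * (if a < b then - inverse (w * w) else if b < a then 1 else 0) =
        1 / (w - inverse w) * Ucoef (w * w) a b" if w: "w \<noteq> 0" "w * w \<noteq> 1" for w :: complex
      proof -
        have "w - inverse w = (w * w - 1) / w" using w by (simp add: field_simps)
        hence e: "1 / (w - inverse w) = w / (w * w - 1)" by simp
        have nz: "w * w - 1 \<noteq> 0" using w by simp
        have "inverse (w * w) - 1 = - (inverse (w * w) * (w * w - 1))" using w by (simp add: field_simps)
        thus ?thesis unfolding Ucoef_def e using w nz by simp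
      qed
      have q: "rq q * rq q = q" using elim by (simp add: power2_eq_square)
      show ?case using main[of "rq q"] elim unfolding q by (metis mult_zero_left q)
    qed
  qed
qed

text \<open>An entry of $U_i E_{(r)}$ is a scalar vanishing at q = 1 times an entry of $E_{(r)}$
  that converges; only the scalar is affected by the division.\<close>

lemma value_at_1_U_E:
  assumes rq: "\<forall>\<^sub>F q in nhds 1. rq q ^ 2 = q" "isCont rq 1"
    and rmq: "\<forall>\<^sub>F q in nhds 1. rmq q ^ 2 = - q" "isCont rmq 1"
    and i: "1 \<le> i" "i < r" "r \<le> n" and N: "N = 2 * k + 1"
  defines "F \<equiv> \<lambda>q. (1 / (rq q - inverse (rq q))) \<cdot>\<^sub>m (rep k n q (rmq q) (GenU i) * rep k n q (rmq q) (GenE r))"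
  defines "V \<equiv> rq 1 \<cdot>\<^sub>m (loc2 N n i (sgnmat N) * rep k n 1 (rmq 1) (GenE r))"
  shows "x < N ^ n \<Longrightarrow> y < N ^ n \<Longrightarrow> ((\<lambda>q. F q $$ (x, y)) \<longlongrightarrow> V $$ (x, y)) (at 1)"
    and "value_at_1 F = V"
proof -
  have i': "i < n" using i by simp
  have N0: "0 < N" using N by simp
  have Ec: "rep k n q s (GenE r) \<in> carrier_mat (N ^ n) (N ^ n)" for q s using rep_E_carrier[OF i(3)] N by simp
  have Uc: "rep k n q s (GenU i) \<in> carrier_mat (N ^ n) (N ^ n)" for q s using rep_U_carrier[OF i(1) i'] N by simp
  have RE: "rep k n q s (GenE r) $$ (x, y) = Eker k n q s r (dgt N x) (dgt N y)" if "x < N ^ n" "y < N ^ n" for x y q s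
    using rep_E_index[OF i(3)] that unfolding N .
  have UE: "(rep k n q s (GenU i) * rep k n q s (GenE r)) $$ (x, y) = Ucoef q (dgt N x (n - i)) (dgt N x (n - i - 1)) *
      Eker k n q s r (dgt N x) (dgt N y)" if "s \<noteq> 0" "x < N ^ n" "y < N ^ n" for x y q s
    using U_E_index[OF i] that unfolding N .
  have lc: "loc2 N n i (sgnmat N) \<in> carrier_mat (N ^ n) (N ^ n)" by (rule loc2_carrier[OF i(1) i' sgnmat_carrier])
  have ev: "\<forall>\<^sub>F q in at 1. rmq q \<noteq> 0"
  proof -
    have "rmq 1 \<noteq> 0" using isCont_rmq_nz[OF rmq(1)] by auto
    thus ?thesis using rmq(2) by (intro tendsto_imp_eventually_ne[of rmq "rmq 1"]) (auto simp: isCont_def)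
  qed
  show lim: "((\<lambda>q. F q $$ (x, y)) \<longlongrightarrow> V $$ (x, y)) (at 1)" if xy: "x < N ^ n" "y < N ^ n" for x y
  proof -
    let ?f = "dgt N x" and ?g = "dgt N y"
    have fg: "?f \<in> idx (2 * k + 1) n" "?g \<in> idx (2 * k + 1) n"
      using dgt_idx[OF N0 xy(1)] dgt_idx[OF N0 xy(2)] N by simp_all
    have "((\<lambda>q. (1 / (rq q - inverse (rq q)) * Ucoef q (?f (n - i)) (?f (n - i - 1))) * Eker k n q (rmq q) r ?f ?g) \<longlongrightarrow>
      rq 1 * order_sign (?f (n - i)) (?f (n - i - 1)) * Eker k n 1 (rmq 1) r ?f ?g) (at 1)"
      by (intro tendsto_mult tendsto_Ucoef[OF rq] tendsto_Eker[OF rmq fg])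
    moreover have "V $$ (x, y) = rq 1 * order_sign (?f (n - i)) (?f (n - i - 1)) * Eker k n 1 (rmq 1) r ?f ?g"
      using xy carrier_matD[OF lc] carrier_matD[OF Ec]
      by (simp add: V_def loc2_sgnmat_mult_index[OF N0 i(1) i' Ec xy] RE[OF xy] del: index_mult_mat(1) rep.simps)
    moreover have "\<forall>\<^sub>F q in at 1. (1 / (rq q - inverse (rq q)) * Ucoef q (?f (n - i)) (?f (n - i - 1))) * Eker k n q (rmq q) r ?f ?g
        = F q $$ (x, y)"
      using ev
    proof eventually_elim
      case (elim q)
      thus ?case using xy carrier_matD[OF Uc] carrier_matD[OF Ec]
        by (simp add: F_def UE[OF elim xy] del: index_mult_mat(1) rep.simps)
    qed
    ultimately show ?thesis by (simp only: Lim_transform_eventually)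
  qed
  show "value_at_1 F = V"
  proof (rule eq_matI)
    fix x y assume "x < dim_row V" "y < dim_col V"
    hence xy: "x < N ^ n" "y < N ^ n" using carrier_matD[OF lc] carrier_matD[OF Ec] by (auto simp: V_def simp del: rep.simps)
    thus "value_at_1 F $$ (x, y) = V $$ (x, y)"
      using tendsto_Lim[OF _ lim[OF xy]] carrier_matD[OF Uc] carrier_matD[OF Ec] by (simp add: value_at_1_def F_def del: index_mult_mat(1) rep.simps)
  qed (use carrier_matD[OF lc] carrier_matD[OF Ec] carrier_matD[OF Uc] in \<open>auto simp: value_at_1_def V_def F_def simp del: rep.simps\<close>)
qed

lemma value_at_1_E_U:
  assumes rq: "\<forall>\<^sub>F q in nhds 1. rq q ^ 2 = q" "isCont rq 1"
    and rmq: "\<forall>\<^sub>F q in nhds 1. rmq q ^ 2 = - q" "isCont rmq 1"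
    and i: "1 \<le> i" "i < r" "r \<le> n" and N: "N = 2 * k + 1"
  defines "F \<equiv> \<lambda>q. (1 / (rq q - inverse (rq q))) \<cdot>\<^sub>m (rep k n q (rmq q) (GenE r) * rep k n q (rmq q) (GenU i))"
  defines "V \<equiv> transpose_mat (rq 1 \<cdot>\<^sub>m (loc2 N n i (sgnmat N) * rep k n 1 (rmq 1) (GenE r)))"
  shows "x < N ^ n \<Longrightarrow> y < N ^ n \<Longrightarrow> ((\<lambda>q. F q $$ (x, y)) \<longlongrightarrow> V $$ (x, y)) (at 1)"
    and "value_at_1 F = V"
proof -
  have i': "i < n" using i by simp
  have Ec: "rep k n q s (GenE r) \<in> carrier_mat (N ^ n) (N ^ n)" for q s using rep_E_carrier[OF i(3)] N by simp
  have Uc: "rep k n q s (GenU i) \<in> carrier_mat (N ^ n) (N ^ n)" for q s using rep_U_carrier[OF i(1) i'] N by simp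
  have lc: "loc2 N n i (sgnmat N) \<in> carrier_mat (N ^ n) (N ^ n)" by (rule loc2_carrier[OF i(1) i' sgnmat_carrier])
  note d = carrier_matD[OF Uc] carrier_matD[OF Ec] carrier_matD[OF lc]
  have ev: "\<forall>\<^sub>F q in at 1. rmq q \<noteq> 0"
  proof -
    have "rmq 1 \<noteq> 0" using isCont_rmq_nz[OF rmq(1)] by auto
    thus ?thesis using rmq(2) by (intro tendsto_imp_eventually_ne[of rmq "rmq 1"]) (auto simp: isCont_def)
  qed
  show lim: "((\<lambda>q. F q $$ (x, y)) \<longlongrightarrow> V $$ (x, y)) (at 1)" if xy: "x < N ^ n" "y < N ^ n" for x y
  proof -
    let ?G = "\<lambda>q. (1 / (rq q - inverse (rq q))) \<cdot>\<^sub>m (rep k n q (rmq q) (GenU i) * rep k n q (rmq q) (GenE r))"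
    have "((\<lambda>q. ?G q $$ (y, x)) \<longlongrightarrow> (rq 1 \<cdot>\<^sub>m (loc2 N n i (sgnmat N) * rep k n 1 (rmq 1) (GenE r))) $$ (y, x)) (at 1)"
      by (rule value_at_1_U_E(1)[OF rq rmq i N xy(2,1)])
    moreover have "(rq 1 \<cdot>\<^sub>m (loc2 N n i (sgnmat N) * rep k n 1 (rmq 1) (GenE r))) $$ (y, x) = V $$ (x, y)"
      using xy d unfolding V_def by simp
    moreover have "\<forall>\<^sub>F q in at 1. ?G q $$ (y, x) = F q $$ (x, y)"
      using ev
    proof eventually_elim
      case (elim q)
      show ?case using xy d unfolding F_def E_U_transpose[OF i elim] by (simp del: rep.simps index_mult_mat(1))
    qed
    ultimately show ?thesis by (simp only: Lim_transform_eventually)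
  qed
  show "value_at_1 F = V"
  proof (rule eq_matI)
    fix x y assume "x < dim_row V" "y < dim_col V"
    hence xy: "x < N ^ n" "y < N ^ n" using d by (auto simp: V_def simp del: rep.simps)
    thus "value_at_1 F $$ (x, y) = V $$ (x, y)"
      using tendsto_Lim[OF _ lim[OF xy]] d by (simp add: value_at_1_def F_def del: index_mult_mat(1) rep.simps)
  qed (use d in \<open>auto simp: value_at_1_def V_def F_def simp del: rep.simps\<close>)
qed

section \<open>Commutation of the generators at q = 1 with the symplectic group\<close>

context at_one
begin

text \<open>
  The limit of $(q^{1/2} - q^{-1/2})^{-1} U_i E_{(r)}$ is this matrix times the value of $q^{1/2}$ at 1.
\<close>

definition SEr :: "nat \<Rightarrow> nat \<Rightarrow> nat \<Rightarrow> complex mat" where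
  "SEr n i r = loc2 N n i (sgnmat N) * rep k n 1 s (GenE r)"

lemma SEr_carrier: "1 \<le> i \<Longrightarrow> i < r \<Longrightarrow> r \<le> n \<Longrightarrow> SEr n i r \<in> carrier_mat (N ^ n) (N ^ n)"
  unfolding SEr_def N_eq
  by (intro mult_carrier_mat[OF loc2_carrier[OF _ _ sgnmat_carrier] rep_E_carrier]) auto

text \<open>\<open>c\<close> stands for the value of $q^{1/2}$ at 1, which is 1 or -1 according to
  the branch.\<close>

definition gens1 :: "nat \<Rightarrow> complex \<Rightarrow> complex mat set" where
  "gens1 n c = {rep k n 1 s (GenE 1)} \<union> {rep k n 1 s (GenU i) | i. 1 \<le> i \<and> i < n}
    \<union> {c \<cdot>\<^sub>m SEr n i r | i r. 1 \<le> i \<and> i < r \<and> r \<le> n}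
    \<union> {transpose_mat (c \<cdot>\<^sub>m SEr n i r) | i r. 1 \<le> i \<and> i < r \<and> r \<le> n}"

lemma gens_at_1_eq:
  assumes rq: "\<forall>\<^sub>F q in nhds 1. rq q ^ 2 = q" "isCont rq 1"
    and rmq: "\<forall>\<^sub>F q in nhds 1. rmq q ^ 2 = - q" "isCont rmq 1" "rmq 1 = s"
  shows "gens_at_1 k n rq rmq = gens1 n (rq 1)"
proof -
  have c: "{f i r | i r. 1 \<le> i \<and> i < r \<and> r \<le> n} = {g i r | i r. 1 \<le> i \<and> i < r \<and> r \<le> n}"
    if "\<And>i r. 1 \<le> i \<Longrightarrow> i < r \<Longrightarrow> r \<le> n \<Longrightarrow> f i r = g i r" for f g :: "nat \<Rightarrow> nat \<Rightarrow> complex mat"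
    by (intro Collect_cong ex_cong1) (use that in auto)
  show ?thesis
    unfolding gens_at_1_def gens1_def SEr_def rmq(3)
    by (intro arg_cong2[of _ _ _ _ "(\<union>)"] refl c value_at_1_U_E(2)[OF rq rmq(1,2) _ _ _ N_eq, unfolded rmq(3)]
        value_at_1_E_U(2)[OF rq rmq(1,2) _ _ _ N_eq, unfolded rmq(3)])
qed

lemma rep_E_tensor: "rep k n 1 s (GenE r) = tensor_pow Em r \<otimes>\<^sub>k 1\<^sub>m (N ^ (n - r))"
  by (simp add: Em_def N_eq)

text \<open>At q = 1 the matrix is the identity minus the flip, which commutes with every g
  \<otimes> g.\<close>

lemma U_commute:
  assumes g: "g \<in> carrier_mat N N"
  shows "U_mat N 1 * (g \<otimes>\<^sub>k g) = (g \<otimes>\<^sub>k g) * U_mat N 1"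
proof (rule eq_matI)
  have d: "dim_row g = N" "dim_col g = N" using g by auto
  have Ud: "dim_row (U_mat N 1) = N * N" "dim_col (U_mat N 1) = N * N" by (simp_all add: U_mat_def)
  fix x y assume "x < dim_row ((g \<otimes>\<^sub>k g) * U_mat N 1)" "y < dim_col ((g \<otimes>\<^sub>k g) * U_mat N 1)"
  hence xy: "x < N * N" "y < N * N" using d by (auto simp: U_mat_def)
  note xd = div_mod_less[OF xy(1)] and yd = div_mod_less[OF xy(2)]
  \<comment> \<open>For c = d the identity and the flip cancel, in agreement with the value 0 in
    \<open>U_coeff\<close>.\<close>
  have Ue: "U_coeff 1 (a, b) (c, d) = (if a = c \<and> b = d then 1 else 0) - (if a = d \<and> b = c then 1 else 0)" for a b c d
    unfolding U_coeff_def by (cases "c = d"; cases "a = c"; cases "b = d"; simp)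
  have U2: "h * U_coeff 1 (z, w) (a, b) = (if z = a \<and> w = b then h else 0) - (if z = b \<and> w = a then h else 0)" for a b z w h
    unfolding Ue by (simp only: right_diff_distrib if_distrib[of "(*) h"] mult_1_right mult_zero_right)
  have sym: "U_coeff 1 (a, b) (z, w) = U_coeff 1 (z, w) (a, b)" for a b z w
    unfolding Ue by (intro arg_cong2[of _ _ _ _ "(-)"] if_cong refl) blast+
  have U1: "U_coeff 1 (a, b) (z, w) * h = (if z = a \<and> w = b then h else 0) - (if z = b \<and> w = a then h else 0)" for a b z w h
    by (subst sym, subst mult.commute, rule U2)
  have dl: "(\<Sum>z<N. \<Sum>w<N. if z = a \<and> w = b then h z w else 0) = h a b" if "a < N" "b < N" for a b and h :: "nat \<Rightarrow> nat \<Rightarrow> complex"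
  proof -
    have "(\<Sum>z<N. \<Sum>w<N. if z = a \<and> w = b then h z w else 0) = (\<Sum>z<N. if z = a then \<Sum>w<N. if w = b then h z w else 0 else 0)"
      by (rule sum.cong[OF refl]) auto
    thus ?thesis using that by simp
  qed
  let ?a = "x div N" and ?b = "x mod N" and ?c = "y div N" and ?d = "y mod N"
  have "(U_mat N 1 * (g \<otimes>\<^sub>k g)) $$ (x, y) = (\<Sum>z<N * N. U_coeff 1 (?a, ?b) (z div N, z mod N) * (g $$ (z div N, ?c) * g $$ (z mod N, ?d)))"
    using xy d Ud by (simp add: mat_mult_index kron_index del: index_mult_mat(1)) (simp add: U_mat_def)
  also have "\<dots> = (\<Sum>z<N. \<Sum>w<N. U_coeff 1 (?a, ?b) (z, w) * (g $$ (z, ?c) * g $$ (w, ?d)))"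
    by (rule sum_div_mod)
  also have "\<dots> = (\<Sum>z<N. \<Sum>w<N. (if z = ?a \<and> w = ?b then g $$ (z, ?c) * g $$ (w, ?d) else 0)
      - (if z = ?b \<and> w = ?a then g $$ (z, ?c) * g $$ (w, ?d) else 0))"
    by (simp only: U1 U2)
  also have "\<dots> = g $$ (?a, ?c) * g $$ (?b, ?d) - g $$ (?b, ?c) * g $$ (?a, ?d)"
    using xd by (simp only: sum_subtractf dl)
  finally have 1: "(U_mat N 1 * (g \<otimes>\<^sub>k g)) $$ (x, y) = g $$ (?a, ?c) * g $$ (?b, ?d) - g $$ (?b, ?c) * g $$ (?a, ?d)" .
  have "((g \<otimes>\<^sub>k g) * U_mat N 1) $$ (x, y) = (\<Sum>z<N * N. (g $$ (?a, z div N) * g $$ (?b, z mod N)) * U_coeff 1 (z div N, z mod N) (?c, ?d))"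
    using xy d Ud by (simp add: mat_mult_index kron_index del: index_mult_mat(1)) (simp add: U_mat_def)
  also have "\<dots> = (\<Sum>z<N. \<Sum>w<N. (g $$ (?a, z) * g $$ (?b, w)) * U_coeff 1 (z, w) (?c, ?d))"
    by (rule sum_div_mod)
  also have "\<dots> = (\<Sum>z<N. \<Sum>w<N. (if z = ?c \<and> w = ?d then g $$ (?a, z) * g $$ (?b, w) else 0)
      - (if z = ?d \<and> w = ?c then g $$ (?a, z) * g $$ (?b, w) else 0))"
    by (simp only: U1 U2)
  also have "\<dots> = g $$ (?a, ?c) * g $$ (?b, ?d) - g $$ (?a, ?d) * g $$ (?b, ?c)"
    using yd by (simp only: sum_subtractf dl)
  finally show "(U_mat N 1 * (g \<otimes>\<^sub>k g)) $$ (x, y) = ((g \<otimes>\<^sub>k g) * U_mat N 1) $$ (x, y)"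
    using 1 by (simp add: mult.commute)
qed (use g in \<open>auto simp: U_mat_def\<close>)

text \<open>A pair E \<otimes> E is split off from $E_{(r)}$ and joined to the order signs; the two
  resulting factors commute with the tensor power of g separately.\<close>

lemma SEr_commute:
  assumes g: "g \<in> carrier_mat N N" "g * Em = Em" "Em * g = Em" "g * Am * transpose_mat g = Am"
    and i: "1 \<le> i" "i < r" "r \<le> n"
  shows "SEr n i r * tensor_pow g n = tensor_pow g n * SEr n i r"
proof -
  let ?S = "sgnmat N" and ?EE = "Em \<otimes>\<^sub>k Em" and ?E = "rep k n 1 s (GenE r)" and ?G = "tensor_pow g n"
  have i': "i < n" using i by simp
  have EE: "?EE \<in> carrier_mat (N * N) (N * N)" using Em_carrier by auto
  have SE: "?S * ?EE \<in> carrier_mat (N * N) (N * N)" by (rule mult_carrier_mat[OF sgnmat_carrier EE])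
  have Ec: "?E \<in> carrier_mat (N ^ n) (N ^ n)" using rep_E_carrier[OF i(3)] N_eq by simp
  have Gc: "?G \<in> carrier_mat (N ^ n) (N ^ n)" using g(1) by auto
  have lc: "loc2 N n i M \<in> carrier_mat (N ^ n) (N ^ n)" if "M \<in> carrier_mat (N * N) (N * N)" for M :: "complex mat"
    by (rule loc2_carrier[OF i(1) i' that])
  have "SEr n i r = loc2 N n i ?S * (loc2 N n i ?EE * ?E)"
    unfolding SEr_def rep_E_tensor loc2_idem_absorb[OF Em_carrier Em_idem i] ..
  also have "\<dots> = loc2 N n i (?S * ?EE) * ?E"
    unfolding loc2_mult[OF sgnmat_carrier EE, symmetric] by (rule assoc_mult_mat[OF lc[OF sgnmat_carrier] lc[OF EE] Ec, symmetric])
  finally have e: "SEr n i r = loc2 N n i (?S * ?EE) * ?E" .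
  have c1: "loc2 N n i (?S * ?EE) * ?G = ?G * loc2 N n i (?S * ?EE)"
    by (rule loc2_commute_tensor_pow[OF g(1) SE i(1) i' SE_commute[OF g(1,3,4)]])
  have c2: "?E * ?G = ?G * ?E"
    unfolding rep_E_tensor by (rule tensor_pow_one_commute[OF g(1) Em_carrier i(3)]) (simp add: g)
  have "SEr n i r * ?G = loc2 N n i (?S * ?EE) * (?E * ?G)"
    unfolding e by (rule assoc_mult_mat[OF lc[OF SE] Ec Gc])
  also have "\<dots> = (loc2 N n i (?S * ?EE) * ?G) * ?E"
    unfolding c2 by (rule assoc_mult_mat[OF lc[OF SE] Gc Ec, symmetric])
  also have "\<dots> = ?G * SEr n i r"
    unfolding c1 e by (rule assoc_mult_mat[OF Gc lc[OF SE] Ec])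
  finally show ?thesis .
qed

lemma gens1_commute:
  assumes g: "g \<in> Sp k s s" and n: "n \<ge> 1" and X: "X \<in> gens1 n c"
  shows "X \<in> carrier_mat (N ^ n) (N ^ n)" "X * tensor_pow g n = tensor_pow g n * X"
proof -
  note g' = SpD[OF g]
  let ?G = "tensor_pow g n"
  have Gc: "?G \<in> carrier_mat (N ^ n) (N ^ n)" using g'(1) by auto
  have sm: "c \<cdot>\<^sub>m Y \<in> carrier_mat (N ^ n) (N ^ n)" "c \<cdot>\<^sub>m Y * ?G = ?G * (c \<cdot>\<^sub>m Y)"
    if "Y \<in> carrier_mat (N ^ n) (N ^ n)" "Y * ?G = ?G * Y" for Y
    using that Gc by (auto simp: mult_smult_distrib[of _ "N ^ n" "N ^ n"] mult_smult_assoc_mat[of _ "N ^ n" "N ^ n"])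
  have "X \<in> carrier_mat (N ^ n) (N ^ n) \<and> X * ?G = ?G * X"
    using X unfolding gens1_def
  proof (elim UnE CollectE exE conjE singletonE, goal_cases)
    case 1
    have "rep k n 1 s (GenE 1) * ?G = ?G * rep k n 1 s (GenE 1)"
      unfolding rep_E_tensor by (rule tensor_pow_one_commute[OF g'(1) Em_carrier n]) (simp add: g')
    thus ?case using 1 rep_E_carrier[OF n, of k 1 s] unfolding N_eq[symmetric] by (simp only: simp_thms)
  next
    case (2 i)
    have "rep k n 1 s (GenU i) = loc2 N n i (U_mat N 1)" unfolding rep_U N_eq ..
    thus ?case using 2 loc2_carrier[OF 2(2,3) U_mat_carrier] loc2_commute_tensor_pow[OF g'(1) U_mat_carrier 2(2,3) U_commute[OF g'(1)]]
      by metis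
  next
    case (3 i r)
    thus ?case using sm[OF SEr_carrier[OF 3(2-4)] SEr_commute[OF g'(1-3,5) 3(2-4)]] by blast
  next
    case (4 i r)
    \<comment> \<open>The transpose of g satisfies the same identities as g, so the transposed
      generators are treated by transposing the previous case.\<close>
    let ?T = "transpose_mat g"
    have T: "?T \<in> carrier_mat N N" using g'(1) by auto
    have "?T * Em = Em" using transpose_mult[OF Em_carrier g'(1)] g'(3) Em_sym by simp
    moreover have "Em * ?T = Em" using transpose_mult[OF g'(1) Em_carrier] g'(2) Em_sym by simp
    moreover have "?T * Am * transpose_mat ?T = Am" using g'(4) by simp
    ultimately have "SEr n i r * tensor_pow ?T n = tensor_pow ?T n * SEr n i r"
      by (intro SEr_commute[OF T _ _ _ 4(2-4)])
    hence "transpose_mat (SEr n i r * tensor_pow ?T n) = transpose_mat (tensor_pow ?T n * SEr n i r)" by simp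
    hence "?G * transpose_mat (SEr n i r) = transpose_mat (SEr n i r) * ?G"
      using transpose_mult[OF SEr_carrier[OF 4(2-4)], of "tensor_pow ?T n" "N ^ n"] tensor_pow_carrier[OF T, of n]
        transpose_mult[OF tensor_pow_carrier[OF T, of n] SEr_carrier[OF 4(2-4)]]
      by (simp add: transpose_tensor_pow)
    moreover have "X = c \<cdot>\<^sub>m transpose_mat (SEr n i r)" using 4(1) SEr_carrier[OF 4(2-4)] by auto
    moreover have "transpose_mat (SEr n i r) \<in> carrier_mat (N ^ n) (N ^ n)" using SEr_carrier[OF 4(2-4)] by auto
    ultimately show ?case using sm by metis
  qed
  thus "X \<in> carrier_mat (N ^ n) (N ^ n)" "X * tensor_pow g n = tensor_pow g n * X" by auto
qed

lemma End_Sp_iff: "X \<in> End_Sp k n s s \<longleftrightarrow> X \<in> carrier_mat (N ^ n) (N ^ n) \<and> (\<forall>g\<in>Sp k s s. X * tensor_pow g n = tensor_pow g n * X)"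
  by (auto simp: End_Sp_def ring_mat_def N_eq)

text \<open>Provides one element of the group, so that \<open>gens1_commute\<close> also tells that
  the generators are matrices of the right size.\<close>

lemma id_Sp: "1\<^sub>m N \<in> Sp k s s"
proof -
  have "invertible_mat (1\<^sub>m N :: complex mat)"
    unfolding invertible_mat_def inverts_mat_def by (intro conjI exI[of _ "1\<^sub>m N"]) auto
  moreover have "1\<^sub>m N *\<^sub>v v_o k s = v_o k s" by (rule one_mult_mat_vec) (simp add: v_o_eq)
  moreover have "1\<^sub>m N *\<^sub>v w = w" if "w \<in> mat_kernel (E_mat k 1 s)" for w
    using that by (intro one_mult_mat_vec) (auto simp: mat_kernel_def E_mat_def N_eq)
  moreover have "1\<^sub>m N *\<^sub>v w = w" if "w \<in> carrier_vec N" for w :: "complex vec"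
    using that by (rule one_mult_mat_vec)
  ultimately show ?thesis unfolding Sp_def N_eq[symmetric] by simp
qed

lemma alg_subset_End:
  assumes n: "n \<ge> 1"
  shows "alg_generated N n (gens1 n c) \<subseteq> End_Sp k n s s"
proof
  fix X assume "X \<in> alg_generated N n (gens1 n c)"
  thus "X \<in> End_Sp k n s s"
    unfolding alg_generated_def
  proof (induction rule: generate_ring.induct)
    case one
    have "1\<^sub>m (N ^ n) * tensor_pow g n = tensor_pow g n * 1\<^sub>m (N ^ n)" if "g \<in> Sp k s s" for g
      unfolding left_mult_one_mat[OF tensor_pow_carrier[OF SpD(1)[OF that]]] right_mult_one_mat[OF tensor_pow_carrier[OF SpD(1)[OF that]]] ..
    thus ?case by (simp add: End_Sp_iff ring_mat_simps)
  next
    case (incl X)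
    thus ?case
    proof
      assume "X \<in> End_scalars N n"
      then obtain a where X: "X = a \<cdot>\<^sub>m 1\<^sub>m (N ^ n)" by (auto simp: End_scalars_def)
      have "X * tensor_pow g n = tensor_pow g n * X" if "g \<in> Sp k s s" for g
      proof -
        have c: "tensor_pow g n \<in> carrier_mat (N ^ n) (N ^ n)" by (rule tensor_pow_carrier[OF SpD(1)[OF that]])
        show ?thesis unfolding X mult_smult_distrib[OF c one_carrier_mat] mult_smult_assoc_mat[OF one_carrier_mat c]
          left_mult_one_mat[OF c] right_mult_one_mat[OF c] ..
      qed
      thus ?case by (simp add: End_Sp_iff X)
    next
      assume "X \<in> gens1 n c"
      thus ?case using gens1_commute[OF _ n] id_Sp unfolding End_Sp_iff by blast
    qed
  next
    case (a_inv X)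
    interpret R: ring "End_tensor N n" by (rule ring_mat)
    have Xc: "X \<in> carrier_mat (N ^ n) (N ^ n)" using a_inv by (simp add: End_Sp_iff)
    have inv: "\<ominus>\<^bsub>End_tensor N n\<^esub> X = - X"
    proof (rule R.minus_equality)
      show "- X \<oplus>\<^bsub>End_tensor N n\<^esub> X = \<zero>\<^bsub>End_tensor N n\<^esub>" using Xc by (simp add: ring_mat_simps uminus_l_inv_mat)
    qed (use Xc in \<open>auto simp: ring_mat_simps\<close>)
    have "- X * tensor_pow g n = tensor_pow g n * - X" if g: "g \<in> Sp k s s" for g
    proof -
      have c: "tensor_pow g n \<in> carrier_mat (N ^ n) (N ^ n)" by (rule tensor_pow_carrier[OF SpD(1)[OF g]])
      have "X * tensor_pow g n = tensor_pow g n * X" using a_inv g by (simp add: End_Sp_iff)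
      thus ?thesis using carrier_matD[OF c] carrier_matD[OF Xc] by simp
    qed
    thus ?case using Xc unfolding inv by (simp add: End_Sp_iff)
  next
    case (eng_add X Y)
    have "(X + Y) * tensor_pow g n = tensor_pow g n * (X + Y)" if g: "g \<in> Sp k s s" for g
      using eng_add.IH g tensor_pow_carrier[OF SpD(1)[OF g], of n]
      by (auto simp: End_Sp_iff add_mult_distrib_mat[of _ "N ^ n" "N ^ n"] mult_add_distrib_mat[of _ "N ^ n" "N ^ n"])
    thus ?case using eng_add.IH by (auto simp: End_Sp_iff ring_mat_simps)
  next
    case (eng_mult X Y)
    have "(X * Y) * tensor_pow g n = tensor_pow g n * (X * Y)" if g: "g \<in> Sp k s s" for g
    proof -
      let ?G = "tensor_pow g n"
      have c: "X \<in> carrier_mat (N ^ n) (N ^ n)" "Y \<in> carrier_mat (N ^ n) (N ^ n)" "?G \<in> carrier_mat (N ^ n) (N ^ n)"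
        "X * ?G = ?G * X" "Y * ?G = ?G * Y"
        using eng_mult.IH g tensor_pow_carrier[OF SpD(1)[OF g], of n] by (auto simp: End_Sp_iff)
      show ?thesis by (metis assoc_mult_mat c)
    qed
    thus ?case using eng_mult.IH by (auto simp: End_Sp_iff ring_mat_simps)
  qed
qed

end

section \<open>A symplectic basis\<close>

lemma sum_delta_pair:
  fixes h :: "nat \<Rightarrow> complex"
  assumes "b < n"
  shows "(\<Sum>z<n. h z * (if z = b then c else 0)) = h b * c" "(\<Sum>z<n. (if z = b then c else 0) * h z) = c * h b"
  using assms by (simp_all add: if_distrib[of "\<lambda>t. _ * t"] if_distrib[of "\<lambda>t. t * _"] cong: if_cong)

context at_one
begin

text \<open>
  Up to the factors \<open>xo j\<close>, the columns of \<open>Pm\<close> are $v_o$ and the hyperbolic pairs produced by symplectic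
  elimination on \<open>Am\<close>.
\<close>

definition pe :: "nat \<Rightarrow> nat \<Rightarrow> complex" where
  "pe j c = (if c = 0 then 1
     else if odd c then (if Suc j = c then 1 else 0) - (if c < j then 1 else 0)
     else (if c \<le> Suc j then 1 else 0))"

definition Pm :: "complex mat" where "Pm = mat N N (\<lambda>(j, c). xo j * pe j c)"
text \<open>The coordinates of A, regarded as a tensor, in the basis \<open>Pm\<close>. Regarded as
  a bilinear form, A has the matrix \<open>- Jm\<close> there, see \<open>PAP\<close>.\<close>

definition Jf :: "nat \<Rightarrow> nat \<Rightarrow> complex" where "Jf a b = (if a \<noteq> 0 \<and> b = partner a then eta a else 0)"
definition Jm :: "complex mat" where "Jm = mat N N (\<lambda>(a, b). Jf a b)"
definition E0 :: "complex mat" where "E0 = mat N N (\<lambda>(a, b). if a = 0 \<and> b = 0 then 1 else 0)"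

lemma Pm_carrier: "Pm \<in> carrier_mat N N" and Jm_carrier: "Jm \<in> carrier_mat N N" and E0_carrier: "E0 \<in> carrier_mat N N"
  by (simp_all add: Pm_def Jm_def E0_def)

lemma partner_lt: "a < N \<Longrightarrow> partner a < N" unfolding N_eq by (rule partner_less)

text \<open>One step of the elimination: the hyperbolic pair number \<open>l\<close> accounts for
  exactly the entries whose smaller index is 2l or 2l + 1.\<close>

lemma pe_step:
  "pe i (2 * l + 1) * pe j (2 * l + 2) - pe i (2 * l + 2) * pe j (2 * l + 1) =
     (if min i j < 2 * l then 0 else if min i j < 2 * l + 2 then - order_sign i j else 0)"
  by (auto simp: pe_def order_sign_def min_def)

lemma pe_sum: "(\<Sum>l<m. pe i (2 * l + 1) * pe j (2 * l + 2) - pe i (2 * l + 2) * pe j (2 * l + 1)) =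
    (if min i j < 2 * m then - order_sign i j else 0)"
  by (induction m) (simp_all add: pe_step[simplified] del: min_less_iff_disj)

lemma sum_pairs: "(\<Sum>a\<in>{1..2 * m}. h a) = (\<Sum>l<m. h (2 * l + 1) + h (2 * l + 2 :: nat))" for h :: "nat \<Rightarrow> complex"
  by (induction m) (simp_all add: add.assoc)

lemma sum_lessThan_N: "(\<Sum>a<N. h a) = h 0 + (\<Sum>a\<in>{1..2 * k}. h a)" for h :: "nat \<Rightarrow> complex"
proof -
  have "{..<N} = insert 0 {1..2 * k}" by (auto simp: N_eq)
  thus ?thesis by simp
qed

lemma pe_order_sign:
  assumes "i < N" "j < N"
  shows "(\<Sum>a<N. pe i a * (\<Sum>b<N. Jf a b * pe j b)) = - order_sign i j"
proof -
  have "(\<Sum>b<N. Jf a b * pe j b) = (if a = 0 then 0 else eta a * pe j (partner a))" if a: "a < N" for a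
  proof -
    have "(\<Sum>b<N. Jf a b * pe j b) = (\<Sum>b<N. if b = partner a then (if a = 0 then 0 else eta a * pe j (partner a)) else 0)"
      by (intro sum.cong refl) (auto simp: Jf_def)
    thus ?thesis using partner_lt[OF a] by simp
  qed
  hence "(\<Sum>a<N. pe i a * (\<Sum>b<N. Jf a b * pe j b)) = (\<Sum>a<N. pe i a * (if a = 0 then 0 else eta a * pe j (partner a)))"
    by (intro sum.cong refl) simp
  also have "\<dots> = (\<Sum>a\<in>{1..2*k}. pe i a * (eta a * pe j (partner a)))"
    unfolding sum_lessThan_N by simp
  also have "\<dots> = (\<Sum>l<k. pe i (2 * l + 1) * pe j (2 * l + 2) - pe i (2 * l + 2) * pe j (2 * l + 1))"
    unfolding sum_pairs by (intro sum.cong refl) (simp add: eta_def partner_def)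
  \<comment> \<open>The only entry not reached by the k pairs is i = j = 2k, where the sign is
    0.\<close>
  also have "\<dots> = - order_sign i j"
    unfolding pe_sum using assms by (auto simp: order_sign_def N_eq)
  finally show ?thesis .
qed

text \<open>Since the squares of the \<open>xo\<close> alternate in sign, this says that all columns
  of \<open>Pm\<close> but the first lie in V', the kernel of E.\<close>

lemma pe_alt: "c < N \<Longrightarrow> (\<Sum>j<N. (- 1) ^ j * pe j c) = (if c = 0 then 1 else 0)"
proof -
  assume c: "c < N"
  have oddN: "odd N" by (simp add: N_eq)
  show ?thesis
  proof (cases "c = 0")
    case True thus ?thesis using oddN alt_eq[of N] by (simp add: pe_def alt_def)
  next
    case False
    then obtain d where d: "c = Suc d" by (cases c) auto
    have dN: "d < N" using c d by simp
    have 1: "(\<Sum>j<d. (- 1) ^ j * pe j c) = 0" by (rule sum.neutral) (auto simp: pe_def d)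
    show ?thesis
    proof (cases "odd c")
      case True
      have "c < N" by fact
      have 2: "(\<Sum>j\<in>{d<..<N}. (- 1) ^ j * pe j c) = - (\<Sum>j\<in>{c<..<N}. (- 1) ^ j)"
      proof -
        have "{d<..<N} = insert c {c<..<N}" using c d by auto
        hence "(\<Sum>j\<in>{d<..<N}. (- 1) ^ j * pe j c) = (\<Sum>j\<in>insert c {c<..<N}. (- 1) ^ j * pe j c)" by simp
        also have "\<dots> = (- 1) ^ c * pe c c + (\<Sum>j\<in>{c<..<N}. (- 1) ^ j * pe j c)" by simp
        also have "pe c c = 0" using True False by (simp add: pe_def)
        also have "(\<Sum>j\<in>{c<..<N}. (- 1) ^ j * pe j c) = - (\<Sum>j\<in>{c<..<N}. (- 1) ^ j)"
          unfolding sum_negf[symmetric] by (intro sum.cong refl) (use True False in \<open>auto simp: pe_def\<close>)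
        finally show ?thesis by simp
      qed
      show ?thesis
        unfolding sum_lessThan_split3[OF dN] 1 2 alt_range[OF c] alt_eq using oddN True False d by (auto simp: pe_def)
    next
      case ev: False
      have 2: "(\<Sum>j\<in>{d<..<N}. (- 1) ^ j * pe j c) = (\<Sum>j\<in>{d<..<N}. (- 1) ^ j)"
        by (intro sum.cong refl) (use ev False d in \<open>auto simp: pe_def\<close>)
      show ?thesis
        unfolding sum_lessThan_split3[OF dN] 1 2 alt_range[OF dN] alt_eq using oddN ev False d by (auto simp: pe_def)
    qed
  qed
qed

lemma PJP: "Pm * Jm * transpose_mat Pm = Am"
proof (rule eq_matI)
  fix i j assume "i < dim_row Am" "j < dim_col Am"
  hence ij: "i < N" "j < N" using Am_carrier by auto
  have T: "transpose_mat Pm \<in> carrier_mat N N" using Pm_carrier by auto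
  have "(Pm * (Jm * transpose_mat Pm)) $$ (i, j) = (\<Sum>a<N. (xo i * pe i a) * (\<Sum>b<N. Jf a b * (xo j * pe j b)))"
    using ij carrier_matD[OF Pm_carrier] carrier_matD[OF Jm_carrier]
    by (simp add: mat_mult_index del: index_mult_mat(1) assoc_mult_mat) (simp add: Pm_def Jm_def)
  also have "\<dots> = xo i * xo j * (\<Sum>a<N. pe i a * (\<Sum>b<N. Jf a b * pe j b))"
    by (simp add: sum_distrib_left mult_ac)
  also have "\<dots> = Am $$ (i, j)" unfolding pe_order_sign[OF ij] using ij by (simp add: Am_index)
  finally show "(Pm * Jm * transpose_mat Pm) $$ (i, j) = Am $$ (i, j)"
    unfolding assoc_mult_mat[OF Pm_carrier Jm_carrier T] .
qed (use Pm_carrier Am_carrier in auto)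

lemma Em_Pm: "Em * Pm = Pm * E0"
proof (rule eq_matI)
  note d = carrier_matD[OF Pm_carrier] carrier_matD[OF Em_carrier] carrier_matD[OF E0_carrier]
  fix i c assume "i < dim_row (Pm * E0)" "c < dim_col (Pm * E0)"
  hence ic: "i < N" "c < N" using d by auto
  have "(Em * Pm) $$ (i, c) = (\<Sum>l<N. ((- 1) ^ k * xo i * xo l) * (xo l * pe l c))"
    using ic d by (simp add: mat_mult_index Em_index del: index_mult_mat(1)) (simp add: Pm_def)
  also have "\<dots> = (- 1) ^ k * xo i * (\<Sum>l<N. (xo l * xo l) * pe l c)"
    by (simp add: sum_distrib_left mult_ac)
  also have "\<dots> = ((- 1) ^ k * (- 1) ^ k) * xo i * (\<Sum>l<N. (- 1) ^ l * pe l c)"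
    unfolding xo_sq by (simp add: sum_distrib_left mult_ac)
  also have "\<dots> = xo i * (if c = 0 then 1 else 0)"
    unfolding pe_alt[OF ic(2)] by (simp flip: power_mult_distrib)
  finally have 1: "(Em * Pm) $$ (i, c) = xo i * (if c = 0 then 1 else 0)" .
  have "(Pm * E0) $$ (i, c) = (\<Sum>l<N. (xo i * pe i l) * (if l = 0 then (if c = 0 then 1 else 0) else 0))"
    using ic d by (simp add: mat_mult_index del: index_mult_mat(1)) (simp add: Pm_def E0_def)
  also have "\<dots> = xo i * (if c = 0 then 1 else 0)"
    by (subst sum_delta_pair(1)) (simp_all add: pe_def)
  finally show "(Em * Pm) $$ (i, c) = (Pm * E0) $$ (i, c)" using 1 by simp
qed (use Pm_carrier Em_carrier E0_carrier in auto)

text \<open>The first column of \<open>Pm\<close> is $v_o$, and E is $v_o v_o^T$ divided by the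
  normalising sum $(-1)^k$.\<close>

lemma PEP: "Pm * E0 * transpose_mat Pm = (- 1) ^ k \<cdot>\<^sub>m Em"
proof (rule eq_matI)
  note d = carrier_matD[OF Pm_carrier] carrier_matD[OF Em_carrier] carrier_matD[OF E0_carrier]
  fix i j assume "i < dim_row ((- 1) ^ k \<cdot>\<^sub>m Em)" "j < dim_col ((- 1) ^ k \<cdot>\<^sub>m Em)"
  hence ij: "i < N" "j < N" using d by auto
  have T: "transpose_mat Pm \<in> carrier_mat N N" using Pm_carrier by auto
  have i0: "(Pm * E0) $$ (i, l) = (if l = 0 then xo i else 0)" if "l < N" for l
  proof -
    have "(Pm * E0) $$ (i, l) = (\<Sum>z<N. (xo i * pe i z) * (if z = 0 then (if l = 0 then 1 else 0) else 0))"
      using ij that d by (simp add: mat_mult_index del: index_mult_mat(1)) (simp add: Pm_def E0_def)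
    thus ?thesis by (subst (asm) sum_delta_pair(1)) (simp_all add: pe_def)
  qed
  have "(Pm * E0 * transpose_mat Pm) $$ (i, j) = (\<Sum>l<N. (Pm * E0) $$ (i, l) * transpose_mat Pm $$ (l, j))"
    using ij d by (simp add: mat_mult_index[of _ "Pm * E0"] del: index_mult_mat(1) assoc_mult_mat)
  also have "\<dots> = (\<Sum>l<N. (if l = 0 then xo i else 0) * (xo j * pe j l))"
    by (intro sum.cong refl) (use ij d i0 in \<open>simp add: Pm_def\<close>)
  also have "\<dots> = xo i * (xo j * pe j 0)" by (rule sum_delta_pair(2)) simp
  also have "\<dots> = ((- 1) ^ k \<cdot>\<^sub>m Em) $$ (i, j)" using ij d
    by (simp add: Em_index pe_def mult.assoc flip: power_mult_distrib)
  finally show "(Pm * E0 * transpose_mat Pm) $$ (i, j) = ((- 1) ^ k \<cdot>\<^sub>m Em) $$ (i, j)" .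
qed (use Pm_carrier Em_carrier E0_carrier in auto)

text \<open>The inverse of \<open>Pm\<close>, read off from $P (J + E_0) P^T = A + (-1)^k E$, whose
  right side is an involution.\<close>

definition Qm :: "complex mat" where
  "Qm = (Jm + E0) * (transpose_mat Pm * (Am + (- 1) ^ k \<cdot>\<^sub>m Em))"

lemma Qm_carrier: "Qm \<in> carrier_mat N N"
  unfolding Qm_def using Pm_carrier Jm_carrier E0_carrier Am_carrier Em_carrier
  by (intro mult_carrier_mat[of _ N N _ N] add_carrier_mat smult_carrier_mat transpose_eq_carrier)

lemma PQ: "Pm * Qm = 1\<^sub>m N" and QP: "Qm * Pm = 1\<^sub>m N"
proof -
  let ?T = "transpose_mat Pm" and ?c = "(- 1) ^ k :: complex"
  let ?H = "Am + ?c \<cdot>\<^sub>m Em"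
  note c = Pm_carrier Jm_carrier E0_carrier Am_carrier Em_carrier
  have T: "?T \<in> carrier_mat N N" using Pm_carrier by auto
  have cE: "?c \<cdot>\<^sub>m Em \<in> carrier_mat N N" using Em_carrier by auto
  have H: "?H \<in> carrier_mat N N" using cE by auto
  have JE: "Jm + E0 \<in> carrier_mat N N" using E0_carrier by auto
  have cc: "?c * ?c = 1" by (simp flip: power_mult_distrib)
  have "Pm * (Jm + E0) * ?T = (Pm * Jm + Pm * E0) * ?T"
    unfolding mult_add_distrib_mat[OF Pm_carrier Jm_carrier E0_carrier] ..
  also have "\<dots> = Pm * Jm * ?T + Pm * E0 * ?T"
    by (rule add_mult_distrib_mat[OF mult_carrier_mat[OF Pm_carrier Jm_carrier] mult_carrier_mat[OF Pm_carrier E0_carrier] T])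
  also have "\<dots> = ?H" unfolding PJP PEP ..
  finally have 1: "Pm * (Jm + E0) * ?T = ?H" .
  have "?H * ?H = ?H * Am + ?H * (?c \<cdot>\<^sub>m Em)" by (rule mult_add_distrib_mat[OF H Am_carrier cE])
  also have "?H * Am = Am * Am + ?c \<cdot>\<^sub>m Em * Am" by (rule add_mult_distrib_mat[OF Am_carrier cE Am_carrier])
  also have "?H * (?c \<cdot>\<^sub>m Em) = Am * (?c \<cdot>\<^sub>m Em) + (?c \<cdot>\<^sub>m Em) * (?c \<cdot>\<^sub>m Em)" by (rule add_mult_distrib_mat[OF Am_carrier cE cE])
  also have "?c \<cdot>\<^sub>m Em * Am = ?c \<cdot>\<^sub>m 0\<^sub>m N N"
    unfolding mult_smult_assoc_mat[OF Em_carrier Am_carrier] Em_Am ..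
  also have "Am * (?c \<cdot>\<^sub>m Em) = ?c \<cdot>\<^sub>m 0\<^sub>m N N"
    unfolding mult_smult_distrib[OF Am_carrier Em_carrier] Am_Em ..
  also have "(?c \<cdot>\<^sub>m Em) * (?c \<cdot>\<^sub>m Em) = Em"
    unfolding mult_smult_distrib[OF cE Em_carrier] mult_smult_assoc_mat[OF Em_carrier Em_carrier] Em_idem
    using cc by (intro eq_matI) (simp_all add: mult.assoc[symmetric])
  also have "(Am * Am + ?c \<cdot>\<^sub>m 0\<^sub>m N N) + (?c \<cdot>\<^sub>m 0\<^sub>m N N + Em) = 1\<^sub>m N"
    unfolding Am_Am using carrier_matD[OF Em_carrier] by (intro eq_matI) simp_all
  finally have 2: "?H * ?H = 1\<^sub>m N" .
  have "Pm * Qm = Pm * (Jm + E0) * ?T * ?H"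
    unfolding Qm_def
    by (simp add: assoc_mult_mat[of _ N N _ N _ N] mult_carrier_mat[of _ N N _ N] Pm_carrier JE T H)
  thus PQ: "Pm * Qm = 1\<^sub>m N" unfolding 1 2 .
  show "Qm * Pm = 1\<^sub>m N" by (rule mat_mult_left_right_inverse[OF Pm_carrier Qm_carrier PQ])
qed

lemma Jm_Jm: "Jm * Jm = E0 - 1\<^sub>m N"
proof (rule eq_matI)
  note d = carrier_matD[OF Jm_carrier] carrier_matD[OF E0_carrier]
  fix a c assume "a < dim_row (E0 - 1\<^sub>m N)" "c < dim_col (E0 - 1\<^sub>m N)"
  hence ac: "a < N" "c < N" using d by auto
  have "(Jm * Jm) $$ (a, c) = (\<Sum>b<N. Jf a b * Jf b c)"
    using ac d by (simp add: mat_mult_index del: index_mult_mat(1)) (simp add: Jm_def)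
  also have "\<dots> = (\<Sum>b<N. if b = partner a then Jf a (partner a) * Jf (partner a) c else 0)"
    by (intro sum.cong refl) (auto simp: Jf_def)
  also have "\<dots> = Jf a (partner a) * Jf (partner a) c" using partner_lt[OF ac(1)] by simp
  also have "\<dots> = (E0 - 1\<^sub>m N) $$ (a, c)" using ac d eta_partner[of a] by (auto simp: Jf_def E0_def)
  finally show "(Jm * Jm) $$ (a, c) = (E0 - 1\<^sub>m N) $$ (a, c)" .
qed (use Jm_carrier E0_carrier in auto)

text \<open>Tensors and forms transform inversely to each other. On V' the matrix A is its own
  inverse while the inverse of J is -J, which explains the sign; the components along $v_o$ vanish
  because E A = 0.\<close>

lemma PAP: "transpose_mat Pm * Am * Pm = - Jm"
proof -
  let ?T = "transpose_mat Pm" and ?S = "transpose_mat Qm"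
  have T: "?T \<in> carrier_mat N N" "?S \<in> carrier_mat N N" using Pm_carrier Qm_carrier by auto
  note c = Qm_carrier Pm_carrier Jm_carrier E0_carrier Em_carrier Am_carrier T
  let ?X = "?T * Am * Pm"
  have X: "?X \<in> carrier_mat N N" by (intro mult_carrier_mat[of _ N N _ N] c)
  note as = assoc_mult_mat[of _ N N _ N _ N] mult_carrier_mat[of _ N N _ N]
  have "Pm * (Jm * ?X) = (Pm * Jm * ?T) * Am * Pm" by (simp add: as c)
  also have "\<dots> = (1\<^sub>m N - Em) * Pm" unfolding PJP Am_Am ..
  also have "\<dots> = Pm - Em * Pm"
    using minus_mult_distrib_mat[OF one_carrier_mat Em_carrier Pm_carrier] left_mult_one_mat[OF Pm_carrier] by simp
  also have "\<dots> = Pm * (1\<^sub>m N - E0)"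
    unfolding Em_Pm mult_minus_distrib_mat[OF Pm_carrier one_carrier_mat E0_carrier] right_mult_one_mat[OF Pm_carrier] ..
  finally have "Qm * (Pm * (Jm * ?X)) = Qm * (Pm * (1\<^sub>m N - E0))" by simp
  moreover have "Qm * (Pm * Y) = Y" if Y: "Y \<in> carrier_mat N N" for Y
    unfolding assoc_mult_mat[OF Qm_carrier Pm_carrier Y, symmetric] QP by (rule left_mult_one_mat[OF Y])
  ultimately have JX: "Jm * ?X = 1\<^sub>m N - E0"
    using mult_carrier_mat[OF Jm_carrier X] minus_carrier_mat[OF E0_carrier, of "1\<^sub>m N"] by simp
  have E0T: "E0 * ?T = ?T * Em"
  proof -
    have "transpose_mat (Em * Pm) = transpose_mat (Pm * E0)" unfolding Em_Pm ..
    moreover have "transpose_mat E0 = E0" by (rule eq_matI) (auto simp: E0_def)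
    ultimately show ?thesis
      unfolding transpose_mult[OF Em_carrier Pm_carrier] transpose_mult[OF Pm_carrier E0_carrier] Em_sym by simp
  qed
  have "E0 * ?X = (E0 * ?T) * Am * Pm" by (simp add: as c)
  also have "\<dots> = ?T * (Em * Am) * Pm" unfolding E0T by (simp add: as c)
  also have "\<dots> = 0\<^sub>m N N" unfolding Em_Am using c right_mult_zero_mat[OF T(1)] left_mult_zero_mat[OF Pm_carrier] by simp
  finally have E0X: "E0 * ?X = 0\<^sub>m N N" .
  have "Jm * (1\<^sub>m N - E0) = Jm * (Jm * ?X)" unfolding JX ..
  also have "\<dots> = (E0 - 1\<^sub>m N) * ?X" unfolding Jm_Jm[symmetric] by (rule assoc_mult_mat[OF Jm_carrier Jm_carrier X, symmetric])
  also have "\<dots> = 0\<^sub>m N N - ?X"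
    unfolding minus_mult_distrib_mat[OF E0_carrier one_carrier_mat X] left_mult_one_mat[OF X] E0X ..
  finally have a: "Jm * (1\<^sub>m N - E0) = 0\<^sub>m N N - ?X" .
  have "Jm * E0 = 0\<^sub>m N N"
  proof (rule eq_matI)
    fix a b assume "a < dim_row (0\<^sub>m N N :: complex mat)" "b < dim_col (0\<^sub>m N N :: complex mat)"
    hence ab: "a < N" "b < N" by auto
    have "(Jm * E0) $$ (a, b) = (\<Sum>z<N. Jf a z * (if z = 0 then (if b = 0 then 1 else 0) else 0))"
      using ab carrier_matD[OF Jm_carrier] carrier_matD[OF E0_carrier]
      by (simp add: mat_mult_index del: index_mult_mat(1)) (simp add: Jm_def E0_def)
    also have "\<dots> = 0" by (subst sum_delta_pair(1)) (auto simp: Jf_def)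
    finally show "(Jm * E0) $$ (a, b) = 0\<^sub>m N N $$ (a, b)" using ab by simp
  qed (use c in auto)
  hence "Jm * (1\<^sub>m N - E0) = Jm - 0\<^sub>m N N"
    unfolding mult_minus_distrib_mat[OF Jm_carrier one_carrier_mat E0_carrier] right_mult_one_mat[OF Jm_carrier] by simp
  with a have b: "Jm - 0\<^sub>m N N = 0\<^sub>m N N - ?X" by simp
  show ?thesis
  proof (rule eq_matI)
    fix i j assume "i < dim_row (- Jm)" "j < dim_col (- Jm)"
    hence ij: "i < N" "j < N" using c by auto
    hence "Jm $$ (i, j) = - ?X $$ (i, j)"
      using arg_cong[OF b, of "\<lambda>M. M $$ (i, j)"] carrier_matD[OF X] carrier_matD[OF Jm_carrier] by simp
    thus "?X $$ (i, j) = (- Jm) $$ (i, j)" using ij carrier_matD[OF Jm_carrier] by simp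
  qed (use c in auto)
qed

end

section \<open>Operators of the generated algebra in the symplectic basis\<close>

text \<open>The operator on V \<otimes> V that pairs with the tensor \<open>b\<close> and returns
  the tensor \<open>a\<close>. The scaled generators have this shape on two factors.\<close>

definition rank_one :: "nat \<Rightarrow> complex mat \<Rightarrow> complex mat \<Rightarrow> complex mat" where
  "rank_one N a b = mat (N * N) (N * N) (\<lambda>(x, y). a $$ (x div N, x mod N) * b $$ (y div N, y mod N))"

lemma rank_one_carrier: "rank_one N a b \<in> carrier_mat (N * N) (N * N)"
  by (simp add: rank_one_def)

lemma dim_rank_one [simp]: "dim_row (rank_one N a b) = N * N" "dim_col (rank_one N a b) = N * N"
  by (simp_all add: rank_one_def)

lemma transpose_rank_one: "transpose_mat (rank_one N a b) = rank_one N b a"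
  by (rule eq_matI) (auto simp: rank_one_def)

lemma conj_index:
  fixes L a :: "complex mat"
  assumes "L \<in> carrier_mat N N" "a \<in> carrier_mat N N" "i < N" "j < N"
  shows "(L * a * transpose_mat L) $$ (i, j) = (\<Sum>z<N. \<Sum>w<N. L $$ (i, z) * L $$ (j, w) * a $$ (z, w))"
proof -
  have "(L * a * transpose_mat L) $$ (i, j) = (\<Sum>w<N. (\<Sum>z<N. L $$ (i, z) * a $$ (z, w)) * L $$ (j, w))"
    using assms by (simp add: mat_mult_index del: index_mult_mat(1) assoc_mult_mat)
  also have "\<dots> = (\<Sum>z<N. \<Sum>w<N. L $$ (i, z) * L $$ (j, w) * a $$ (z, w))"
    unfolding sum_distrib_right by (subst sum.swap) (simp add: mult_ac)
  finally show ?thesis .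
qed

text \<open>If tensors in V \<otimes> V are written as square matrices, then L \<otimes> L acts by
  $a |-> L a L^T$.\<close>

lemma kron_rank_one:
  assumes L: "L \<in> carrier_mat N N" and a: "a \<in> carrier_mat N N"
  shows "(L \<otimes>\<^sub>k L) * rank_one N a b = rank_one N (L * a * transpose_mat L) b"
proof (rule eq_matI)
  fix x y assume "x < dim_row (rank_one N (L * a * transpose_mat L) b)" "y < dim_col (rank_one N (L * a * transpose_mat L) b)"
  hence xy: "x < N * N" "y < N * N" by auto
  let ?b = "b $$ (y div N, y mod N)"
  have "((L \<otimes>\<^sub>k L) * rank_one N a b) $$ (x, y) =
     (\<Sum>z<N * N. (L $$ (x div N, z div N) * L $$ (x mod N, z mod N)) * (a $$ (z div N, z mod N) * ?b))"
    using xy L by (simp add: mat_mult_index kron_index del: index_mult_mat(1)) (simp add: rank_one_def)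
  also have "\<dots> = (\<Sum>z<N. \<Sum>w<N. (L $$ (x div N, z) * L $$ (x mod N, w)) * (a $$ (z, w) * ?b))"
    by (rule sum_div_mod)
  also have "\<dots> = (\<Sum>z<N. \<Sum>w<N. L $$ (x div N, z) * L $$ (x mod N, w) * a $$ (z, w)) * ?b"
    unfolding sum_distrib_right by (intro sum.cong refl) (simp add: mult_ac)
  also have "\<dots> = rank_one N (L * a * transpose_mat L) b $$ (x, y)"
    unfolding conj_index[OF L a div_mod_less[OF xy(1), THEN conjunct1] div_mod_less[OF xy(1), THEN conjunct2], symmetric]
    using xy by (simp add: rank_one_def)
  finally show "((L \<otimes>\<^sub>k L) * rank_one N a b) $$ (x, y) = rank_one N (L * a * transpose_mat L) b $$ (x, y)" .
qed (use L in auto)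

lemma rank_one_kron:
  assumes R: "R \<in> carrier_mat N N" and b: "b \<in> carrier_mat N N"
  shows "rank_one N a b * (R \<otimes>\<^sub>k R) = rank_one N a (transpose_mat R * b * R)"
proof -
  have RR: "R \<otimes>\<^sub>k R \<in> carrier_mat (N * N) (N * N)" using R by auto
  have "transpose_mat (rank_one N a b * (R \<otimes>\<^sub>k R)) = (transpose_mat R \<otimes>\<^sub>k transpose_mat R) * rank_one N b a"
    unfolding transpose_mult[OF rank_one_carrier RR] transpose_kron transpose_rank_one ..
  also have "\<dots> = rank_one N (transpose_mat R * b * transpose_mat (transpose_mat R)) a"
    using R b by (intro kron_rank_one) auto
  finally show ?thesis by (metis transpose_transpose transpose_rank_one)
qed

lemma transpose_smult_mat: "transpose_mat (a \<cdot>\<^sub>m X) = a \<cdot>\<^sub>m transpose_mat X"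
  by (rule eq_matI) auto

context at_one
begin

definition value_alg :: "nat \<Rightarrow> complex \<Rightarrow> complex mat set" where
  "value_alg n c = alg_generated N n (gens1 n c)"

lemma value_alg_carrier: "n \<ge> 1 \<Longrightarrow> X \<in> value_alg n c \<Longrightarrow> X \<in> carrier_mat (N ^ n) (N ^ n)"
  using alg_subset_End[of n c] by (auto simp: value_alg_def End_Sp_iff)

lemma value_alg_scalar: "a \<cdot>\<^sub>m 1\<^sub>m (N ^ n) \<in> value_alg n c"
  unfolding value_alg_def alg_generated_def by (intro generate_ring.incl) (auto simp: End_scalars_def)

lemma value_alg_gen: "X \<in> gens1 n c \<Longrightarrow> X \<in> value_alg n c"
  unfolding value_alg_def alg_generated_def by (intro generate_ring.incl) auto

lemma value_alg_add: "X \<in> value_alg n c \<Longrightarrow> Y \<in> value_alg n c \<Longrightarrow> X + Y \<in> value_alg n c"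
  unfolding value_alg_def alg_generated_def
  using generate_ring.eng_add[of X "End_tensor N n" _ Y] by (simp add: ring_mat_simps)

lemma value_alg_mult: "X \<in> value_alg n c \<Longrightarrow> Y \<in> value_alg n c \<Longrightarrow> X * Y \<in> value_alg n c"
  unfolding value_alg_def alg_generated_def
  using generate_ring.eng_mult[of X "End_tensor N n" _ Y] by (simp add: ring_mat_simps)

lemma value_alg_smult: "n \<ge> 1 \<Longrightarrow> X \<in> value_alg n c \<Longrightarrow> a \<cdot>\<^sub>m X \<in> value_alg n c"
proof -
  assume n: "n \<ge> 1" and X: "X \<in> value_alg n c"
  note Xc = value_alg_carrier[OF n X]
  have "(a \<cdot>\<^sub>m 1\<^sub>m (N ^ n)) * X \<in> value_alg n c" by (rule value_alg_mult[OF value_alg_scalar X])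
  thus ?thesis unfolding mult_smult_assoc_mat[OF one_carrier_mat Xc] left_mult_one_mat[OF Xc] .
qed

definition TP :: "nat \<Rightarrow> complex mat" where "TP n = tensor_pow Pm n"
definition TQ :: "nat \<Rightarrow> complex mat" where "TQ n = tensor_pow Qm n"

lemma TP_carrier: "TP n \<in> carrier_mat (N ^ n) (N ^ n)" and TQ_carrier: "TQ n \<in> carrier_mat (N ^ n) (N ^ n)"
  unfolding TP_def TQ_def using Pm_carrier Qm_carrier by auto

lemma TP_TQ: "TP n * TQ n = 1\<^sub>m (N ^ n)" and TQ_TP: "TQ n * TP n = 1\<^sub>m (N ^ n)"
  unfolding TP_def TQ_def using Pm_carrier Qm_carrier
  by (simp_all add: tensor_pow_mult PQ QP tensor_pow_one)

definition from_adapted :: "nat \<Rightarrow> complex mat \<Rightarrow> complex mat" where "from_adapted n X = TP n * X * TQ n"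

lemma from_adapted_mult:
  assumes "X \<in> carrier_mat (N ^ n) (N ^ n)" "Y \<in> carrier_mat (N ^ n) (N ^ n)"
  shows "from_adapted n (X * Y) = from_adapted n X * from_adapted n Y"
proof -
  let ?M = "N ^ n"
  note as = assoc_mult_mat[of _ ?M ?M _ ?M _ ?M] mult_carrier_mat[of _ ?M ?M _ ?M] TP_carrier[of n] TQ_carrier[of n] assms
  have "from_adapted n X * from_adapted n Y = TP n * X * (TQ n * TP n) * Y * TQ n" unfolding from_adapted_def by (simp add: as)
  also have "\<dots> = from_adapted n (X * Y)" unfolding TQ_TP from_adapted_def using right_mult_one_mat[OF mult_carrier_mat[OF TP_carrier assms(1)]] by (simp add: as)
  finally show ?thesis ..
qed

lemma from_adapted_add:
  assumes "X \<in> carrier_mat (N ^ n) (N ^ n)" "Y \<in> carrier_mat (N ^ n) (N ^ n)"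
  shows "from_adapted n (X + Y) = from_adapted n X + from_adapted n Y"
  unfolding from_adapted_def mult_add_distrib_mat[OF TP_carrier assms]
  by (rule add_mult_distrib_mat[OF mult_carrier_mat[OF TP_carrier assms(1)] mult_carrier_mat[OF TP_carrier assms(2)] TQ_carrier])

lemma from_adapted_smult: "X \<in> carrier_mat (N ^ n) (N ^ n) \<Longrightarrow> from_adapted n (a \<cdot>\<^sub>m X) = a \<cdot>\<^sub>m from_adapted n X"
  unfolding from_adapted_def mult_smult_distrib[OF TP_carrier]
  by (rule mult_smult_assoc_mat[OF mult_carrier_mat[OF TP_carrier] TQ_carrier])

lemma from_adapted_one: "from_adapted n (1\<^sub>m (N ^ n)) = 1\<^sub>m (N ^ n)"
  unfolding from_adapted_def right_mult_one_mat[OF TP_carrier] by (rule TP_TQ)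

lemma from_adapted_loc2:
  assumes M: "M \<in> carrier_mat (N * N) (N * N)" and i: "1 \<le> i" "i < n"
  shows "from_adapted n (loc2 N n i M) = loc2 N n i ((Pm \<otimes>\<^sub>k Pm) * M * (Qm \<otimes>\<^sub>k Qm))"
proof -
  note [simp] = carrier_matD[OF Pm_carrier] carrier_matD[OF Qm_carrier] carrier_matD[OF M]
  have 1: "tensor_pow Pm m * tensor_pow Qm m = 1\<^sub>m (N ^ m)" for m
    by (simp add: tensor_pow_mult PQ tensor_pow_one)
  show ?thesis
    unfolding from_adapted_def TP_def TQ_def tensor_pow_split2[OF i] loc2_def
    by (simp add: kron_mult 1 del: assoc_mult_mat)
qed

lemma from_adapted_tensor_pow_one:
  assumes M: "M \<in> carrier_mat N N" and r: "r \<le> n"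
  shows "from_adapted n (tensor_pow M r \<otimes>\<^sub>k 1\<^sub>m (N ^ (n - r))) = tensor_pow (Pm * M * Qm) r \<otimes>\<^sub>k 1\<^sub>m (N ^ (n - r))"
proof -
  note [simp] = carrier_matD[OF Pm_carrier] carrier_matD[OF Qm_carrier] carrier_matD[OF M]
  have 1: "tensor_pow Pm m * tensor_pow Qm m = 1\<^sub>m (N ^ m)" for m
    by (simp add: tensor_pow_mult PQ tensor_pow_one)
  have s: "tensor_pow g n = tensor_pow g r \<otimes>\<^sub>k tensor_pow g (n - r)" for g :: "complex mat"
    using r by (simp flip: tensor_pow_add)
  show ?thesis
    unfolding from_adapted_def TP_def TQ_def s
    by (simp add: kron_mult tensor_pow_mult PQ tensor_pow_one del: assoc_mult_mat)
qed

text \<open>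
  The change of basis is not orthogonal, so closure under transposition, which exchanges insertions and
  contractions, has to be imposed.
\<close>

definition adapted_alg :: "nat \<Rightarrow> complex \<Rightarrow> complex mat set" where
  "adapted_alg n c = {X \<in> carrier_mat (N ^ n) (N ^ n). from_adapted n X \<in> value_alg n c \<and> from_adapted n (transpose_mat X) \<in> value_alg n c}"

lemma adapted_alg_transpose: "X \<in> adapted_alg n c \<Longrightarrow> transpose_mat X \<in> adapted_alg n c" by (auto simp: adapted_alg_def)

lemma adapted_alg_carrier: "X \<in> adapted_alg n c \<Longrightarrow> X \<in> carrier_mat (N ^ n) (N ^ n)" by (auto simp: adapted_alg_def)

lemma adapted_alg_add: "X \<in> adapted_alg n c \<Longrightarrow> Y \<in> adapted_alg n c \<Longrightarrow> X + Y \<in> adapted_alg n c"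
  unfolding adapted_alg_def
  by (auto simp: from_adapted_add value_alg_add transpose_add[of _ "N ^ n" "N ^ n"] transpose_eq_carrier)

lemma adapted_alg_smult: "n \<ge> 1 \<Longrightarrow> X \<in> adapted_alg n c \<Longrightarrow> a \<cdot>\<^sub>m X \<in> adapted_alg n c"
  unfolding adapted_alg_def
  by (auto simp: from_adapted_smult value_alg_smult transpose_smult_mat transpose_eq_carrier)

lemma adapted_alg_mult: "X \<in> adapted_alg n c \<Longrightarrow> Y \<in> adapted_alg n c \<Longrightarrow> X * Y \<in> adapted_alg n c"
  unfolding adapted_alg_def
  by (auto simp: from_adapted_mult value_alg_mult transpose_mult[of _ "N ^ n" "N ^ n" _ "N ^ n"] transpose_eq_carrier)

lemma adapted_alg_one: "1\<^sub>m (N ^ n) \<in> adapted_alg n c"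
proof -
  have "1 \<cdot>\<^sub>m 1\<^sub>m (N ^ n) = (1\<^sub>m (N ^ n) :: complex mat)" by (rule eq_matI) auto
  thus ?thesis using value_alg_scalar[of 1 n c] by (auto simp: adapted_alg_def from_adapted_one)
qed

lemma PEQ: "Pm * E0 * Qm = Em"
proof -
  have "Pm * E0 * Qm = Em * (Pm * Qm)"
    unfolding Em_Pm[symmetric] by (rule assoc_mult_mat[OF Em_carrier Pm_carrier Qm_carrier])
  thus ?thesis unfolding PQ right_mult_one_mat[OF Em_carrier] .
qed

lemma E0_adapted_alg:
  assumes n: "n \<ge> 1"
  shows "tensor_pow E0 1 \<otimes>\<^sub>k 1\<^sub>m (N ^ (n - 1)) \<in> adapted_alg n c"
proof -
  have g: "tensor_pow Em 1 \<otimes>\<^sub>k 1\<^sub>m (N ^ (n - 1)) \<in> value_alg n c"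
    unfolding rep_E_tensor[symmetric] by (rule value_alg_gen) (simp add: gens1_def del: rep.simps)
  have T: "transpose_mat (tensor_pow E0 1 \<otimes>\<^sub>k 1\<^sub>m (N ^ (n - 1))) = tensor_pow E0 1 \<otimes>\<^sub>k 1\<^sub>m (N ^ (n - 1))"
  proof -
    have "transpose_mat E0 = E0" by (rule eq_matI) (auto simp: E0_def)
    thus ?thesis by (simp add: transpose_kron)
  qed
  show ?thesis
    unfolding adapted_alg_def mem_Collect_eq T from_adapted_tensor_pow_one[OF E0_carrier n] PEQ
    using g tensor_pow_one_carrier[OF E0_carrier n] by blast
qed

text \<open>This is the flip of two neighbouring factors. It commutes with P \<otimes> P, so it is
  unchanged by the change of basis, and it is symmetric.\<close>

lemma flip_adapted_alg:
  assumes i: "1 \<le> i" "i < n"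
  shows "1\<^sub>m (N ^ n) - rep k n 1 s (GenU i) \<in> adapted_alg n c"
proof -
  have n: "n \<ge> 1" using i by simp
  let ?U = "rep k n 1 s (GenU i)"
  have U: "?U = loc2 N n i (U_mat N 1)" unfolding rep_U N_eq ..
  have Uc: "?U \<in> carrier_mat (N ^ n) (N ^ n)" using rep_U_carrier[OF i, of k 1 s] by (simp add: N_eq)
  have PP: "Pm \<otimes>\<^sub>k Pm \<in> carrier_mat (N * N) (N * N)" "Qm \<otimes>\<^sub>k Qm \<in> carrier_mat (N * N) (N * N)"
    using Pm_carrier Qm_carrier by auto
  have "(Pm \<otimes>\<^sub>k Pm) * U_mat N 1 * (Qm \<otimes>\<^sub>k Qm) = U_mat N 1 * ((Pm \<otimes>\<^sub>k Pm) * (Qm \<otimes>\<^sub>k Qm))"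
    unfolding U_commute[OF Pm_carrier, symmetric] by (rule assoc_mult_mat[OF U_mat_carrier PP])
  also have "(Pm \<otimes>\<^sub>k Pm) * (Qm \<otimes>\<^sub>k Qm) = 1\<^sub>m (N * N)"
    using Pm_carrier Qm_carrier by (simp add: kron_mult PQ one_kron_one)
  finally have "from_adapted n ?U = ?U"
    unfolding U from_adapted_loc2[OF U_mat_carrier i] right_mult_one_mat[OF U_mat_carrier] by simp
  moreover have "?U \<in> value_alg n c" by (rule value_alg_gen) (use i in \<open>auto simp: gens1_def simp del: rep.simps\<close>)
  ultimately have "?U \<in> adapted_alg n c" using Uc unfolding adapted_alg_def by (simp only: mem_Collect_eq rep_U_sym simp_thms)
  hence "1\<^sub>m (N ^ n) + (- 1) \<cdot>\<^sub>m ?U \<in> adapted_alg n c" by (intro adapted_alg_add adapted_alg_one adapted_alg_smult n)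
  moreover have "1\<^sub>m (N ^ n) + (- 1) \<cdot>\<^sub>m ?U = 1\<^sub>m (N ^ n) - ?U"
    using carrier_matD[OF Uc] by (intro eq_matI) (simp_all del: rep.simps)
  ultimately show ?thesis by simp
qed

lemma SE_rank_one: "sgnmat N * (Em \<otimes>\<^sub>k Em) = rank_one N (- Am) ((- 1) ^ k \<cdot>\<^sub>m Em)"
proof (rule eq_matI)
  fix x y assume "x < dim_row (rank_one N (- Am) ((- 1) ^ k \<cdot>\<^sub>m Em))" "y < dim_col (rank_one N (- Am) ((- 1) ^ k \<cdot>\<^sub>m Em))"
  hence xy: "x < N * N" "y < N * N" by auto
  thus "(sgnmat N * (Em \<otimes>\<^sub>k Em)) $$ (x, y) = rank_one N (- Am) ((- 1) ^ k \<cdot>\<^sub>m Em) $$ (x, y)"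
    unfolding SE_index[OF xy] using carrier_matD[OF Am_carrier] carrier_matD[OF Em_carrier]
      div_mod_less[OF xy(1)] div_mod_less[OF xy(2)]
    by (simp add: rank_one_def Em_index flip: power_mult_distrib mult.assoc)
qed (use Em_carrier in auto)

lemma PEP': "transpose_mat Pm * ((- 1) ^ k \<cdot>\<^sub>m Em) * Pm = E0"
proof -
  let ?T = "transpose_mat Pm" and ?c = "(- 1) ^ k :: complex"
  note d = carrier_matD[OF Pm_carrier] carrier_matD[OF E0_carrier]
  have T: "?T \<in> carrier_mat N N" using Pm_carrier by auto
  have cE: "?c \<cdot>\<^sub>m Em \<in> carrier_mat N N" using Em_carrier by auto
  have PEi: "(Pm * E0) $$ (i, l) = (if l = 0 then xo i else 0)" if "i < N" "l < N" for i l
  proof -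
    have "(Pm * E0) $$ (i, l) = (\<Sum>z<N. (xo i * pe i z) * (if z = 0 then (if l = 0 then 1 else 0) else 0))"
      using that d by (simp add: mat_mult_index del: index_mult_mat(1)) (simp add: Pm_def E0_def)
    thus ?thesis by (subst (asm) sum_delta_pair(1)) (simp_all add: pe_def)
  qed
  have "?T * (?c \<cdot>\<^sub>m Em) * Pm = ?T * (?c \<cdot>\<^sub>m (Pm * E0))"
    unfolding assoc_mult_mat[OF T cE Pm_carrier] mult_smult_assoc_mat[OF Em_carrier Pm_carrier] Em_Pm ..
  also have "\<dots> = E0"
  proof (rule eq_matI)
    fix a b assume "a < dim_row E0" "b < dim_col E0"
    hence ab: "a < N" "b < N" using d by auto
    have "(?T * (?c \<cdot>\<^sub>m (Pm * E0))) $$ (a, b) = (\<Sum>i<N. (xo i * pe i a) * (?c * (if b = 0 then xo i else 0)))"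
      using ab d by (simp add: mat_mult_index[of _ ?T] PEi del: index_mult_mat(1) assoc_mult_mat) (simp add: Pm_def)
    also have "\<dots> = (if b = 0 then ?c else 0) * (\<Sum>i<N. (xo i * xo i) * pe i a)"
      by (simp add: sum_distrib_left mult_ac)
    also have "\<dots> = (if b = 0 then ?c * ?c else 0) * (\<Sum>i<N. (- 1) ^ i * pe i a)"
      unfolding xo_sq by (simp add: sum_distrib_left mult_ac)
    also have "\<dots> = E0 $$ (a, b)"
      unfolding pe_alt[OF ab(1)] using ab by (simp add: E0_def flip: power_mult_distrib)
    finally show "(?T * (?c \<cdot>\<^sub>m (Pm * E0))) $$ (a, b) = E0 $$ (a, b)" .
  qed (use d in auto)
  finally show ?thesis .
qed

lemma QJQ: "transpose_mat Qm * Jm * Qm = - Am"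
proof -
  let ?T = "transpose_mat Pm" and ?S = "transpose_mat Qm"
  have T: "?T \<in> carrier_mat N N" "?S \<in> carrier_mat N N" using Pm_carrier Qm_carrier by auto
  note c = Qm_carrier Pm_carrier Am_carrier Jm_carrier T
  note as = assoc_mult_mat[of _ N N _ N _ N] mult_carrier_mat[of _ N N _ N]
  have ST: "?S * ?T = 1\<^sub>m N" using transpose_mult[OF Pm_carrier Qm_carrier] PQ by simp
  have SJ: "?S * Jm \<in> carrier_mat N N" using c by auto
  have "- (?S * Jm * Qm) = ?S * (- Jm) * Qm" using carrier_matD[OF Jm_carrier] carrier_matD[OF Qm_carrier] by simp
  also have "\<dots> = (?S * ?T) * Am * (Pm * Qm)" unfolding PAP[symmetric] by (simp add: as c)
  also have "\<dots> = Am" unfolding ST PQ left_mult_one_mat[OF Am_carrier] right_mult_one_mat[OF Am_carrier] ..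
  finally have "- (- (?S * Jm * Qm)) = - Am" by simp
  thus ?thesis by simp
qed

lemma QEQ: "transpose_mat Qm * E0 * Qm = (- 1) ^ k \<cdot>\<^sub>m Em"
proof -
  let ?T = "transpose_mat Pm" and ?S = "transpose_mat Qm" and ?E = "(- 1) ^ k \<cdot>\<^sub>m Em"
  have T: "?T \<in> carrier_mat N N" "?S \<in> carrier_mat N N" using Pm_carrier Qm_carrier by auto
  have E: "?E \<in> carrier_mat N N" using Em_carrier by auto
  note as = assoc_mult_mat[of _ N N _ N _ N] mult_carrier_mat[of _ N N _ N]
  have ST: "?S * ?T = 1\<^sub>m N" using transpose_mult[OF Pm_carrier Qm_carrier] PQ by simp
  have "?S * E0 * Qm = (?S * ?T) * ?E * (Pm * Qm)" unfolding PEP'[symmetric]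
    by (simp add: as Qm_carrier Pm_carrier E T Em_carrier del: smult_carrier_mat)
  thus ?thesis unfolding ST PQ left_mult_one_mat[OF E] right_mult_one_mat[OF E] .
qed

text \<open>For i = 1 and r = 2 the scaled generator sends $v_o$ \<otimes> $v_o$ to a multiple of
  the tensor of the form, and the change of basis makes this -J against $E_0$. The transpose
  corresponds, up to sign, to the transposed generator; here the second family of scaled generators
  enters.\<close>

lemma arc_mat_adapted_alg:
  assumes n: "n \<ge> 2" and c: "c \<noteq> 0"
  shows "loc2 N n 1 (rank_one N (- Jm) E0) \<in> adapted_alg n c"
proof -
  have i: "1 \<le> (1::nat)" "1 < n" and n1: "n \<ge> 1" using n by auto
  let ?SE = "sgnmat N * (Em \<otimes>\<^sub>k Em)" and ?PP = "Pm \<otimes>\<^sub>k Pm" and ?QQ = "Qm \<otimes>\<^sub>k Qm" and ?c = "(- 1) ^ k :: complex"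
  have EE: "Em \<otimes>\<^sub>k Em \<in> carrier_mat (N * N) (N * N)" using Em_carrier by auto
  have cE: "?c \<cdot>\<^sub>m Em \<in> carrier_mat N N" using Em_carrier by auto
  have T: "transpose_mat Pm \<in> carrier_mat N N" "transpose_mat Qm \<in> carrier_mat N N" using Pm_carrier Qm_carrier by auto
  have "SEr n 1 2 = loc2 N n 1 ?SE"
  proof -
    have "rep k n 1 s (GenE 2) = loc2 N n 1 (Em \<otimes>\<^sub>k Em)"
      unfolding rep_E_tensor loc2_def by (simp add: one_kron_left[simplified] one_kron_right[simplified] kron_assoc numeral_2_eq_2)
    thus ?thesis unfolding SEr_def by (simp add: loc2_mult[OF sgnmat_carrier EE] del: rep.simps)
  qed
  have Sc: "SEr n 1 2 \<in> carrier_mat (N ^ n) (N ^ n)" using n by (intro SEr_carrier) auto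
  have Bm: "c \<cdot>\<^sub>m SEr n 1 2 \<in> value_alg n c" "transpose_mat (c \<cdot>\<^sub>m SEr n 1 2) \<in> value_alg n c"
  proof -
    have "\<exists>i r. c \<cdot>\<^sub>m SEr n 1 2 = c \<cdot>\<^sub>m SEr n i r \<and> 1 \<le> i \<and> i < r \<and> r \<le> n"
      "\<exists>i r. transpose_mat (c \<cdot>\<^sub>m SEr n 1 2) = transpose_mat (c \<cdot>\<^sub>m SEr n i r) \<and> 1 \<le> i \<and> i < r \<and> r \<le> n"
      using n by (intro exI[of _ 1] exI[of _ 2], simp)+
    thus "c \<cdot>\<^sub>m SEr n 1 2 \<in> value_alg n c" "transpose_mat (c \<cdot>\<^sub>m SEr n 1 2) \<in> value_alg n c"
      by (intro value_alg_gen; unfold gens1_def; blast)+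
  qed
  have B1: "SEr n 1 2 \<in> value_alg n c"
  proof -
    have "inverse c \<cdot>\<^sub>m (c \<cdot>\<^sub>m SEr n 1 2) = SEr n 1 2" using c by (intro eq_matI) auto
    thus ?thesis using value_alg_smult[OF n1 Bm(1), of "inverse c"] by simp
  qed
  have "inverse c \<cdot>\<^sub>m transpose_mat (c \<cdot>\<^sub>m SEr n 1 2) = transpose_mat (SEr n 1 2)"
    using c by (intro eq_matI) auto
  with value_alg_smult[OF n1 Bm(2), of "inverse c"] have B2: "transpose_mat (SEr n 1 2) \<in> value_alg n c" by simp
  let ?M = "rank_one N (- Jm) E0"
  have mJ: "- Jm \<in> carrier_mat N N" "- Am \<in> carrier_mat N N" using Jm_carrier Am_carrier by auto
  have "?PP * ?M = rank_one N (Pm * (- Jm) * transpose_mat Pm) E0" by (rule kron_rank_one[OF Pm_carrier mJ(1)])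
  also have "Pm * (- Jm) * transpose_mat Pm = - Am"
    using PJP carrier_matD[OF Jm_carrier] carrier_matD[OF Pm_carrier] by simp
  finally have "?PP * ?M * ?QQ = rank_one N (- Am) E0 * ?QQ" by simp
  also have "\<dots> = ?SE" unfolding rank_one_kron[OF Qm_carrier E0_carrier] QEQ SE_rank_one ..
  finally have 1: "from_adapted n (loc2 N n 1 ?M) = SEr n 1 2"
    unfolding from_adapted_loc2[OF rank_one_carrier i] \<open>SEr n 1 2 = loc2 N n 1 ?SE\<close> by simp
  have "?PP * rank_one N E0 (- Jm) * ?QQ = rank_one N (?c \<cdot>\<^sub>m Em) (- Jm) * ?QQ"
    unfolding kron_rank_one[OF Pm_carrier E0_carrier] PEP ..
  also have "\<dots> = rank_one N (?c \<cdot>\<^sub>m Em) (transpose_mat Qm * (- Jm) * Qm)" by (rule rank_one_kron[OF Qm_carrier mJ(1)])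
  also have "transpose_mat Qm * (- Jm) * Qm = Am"
  proof -
    have "transpose_mat Qm * (- Jm) * Qm = - (transpose_mat Qm * Jm * Qm)"
      using carrier_matD[OF Jm_carrier] carrier_matD[OF Qm_carrier] by simp
    thus ?thesis unfolding QJQ by simp
  qed
  also have "rank_one N (?c \<cdot>\<^sub>m Em) Am = (- 1) \<cdot>\<^sub>m transpose_mat ?SE"
    unfolding SE_rank_one transpose_rank_one using carrier_matD[OF Am_carrier]
    by (intro eq_matI) (auto simp: rank_one_def dest!: div_mod_less)
  finally have "from_adapted n (transpose_mat (loc2 N n 1 ?M)) = loc2 N n 1 ((- 1) \<cdot>\<^sub>m transpose_mat ?SE)"
    unfolding transpose_loc2 transpose_rank_one from_adapted_loc2[OF rank_one_carrier i] by simp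
  also have "\<dots> = (- 1) \<cdot>\<^sub>m transpose_mat (SEr n 1 2)"
    unfolding \<open>SEr n 1 2 = loc2 N n 1 ?SE\<close> transpose_loc2
    by (simp only: loc2_def kron_smult_left kron_smult_right)
  finally have 2: "from_adapted n (transpose_mat (loc2 N n 1 ?M)) = (- 1) \<cdot>\<^sub>m transpose_mat (SEr n 1 2)" .
  show ?thesis
    unfolding adapted_alg_def mem_Collect_eq 1 2
    by (intro conjI loc2_carrier[OF i rank_one_carrier] B1 value_alg_smult[OF n1 B2])
qed

section \<open>Operators on digit functions that the algebra contains\<close>

definition adapted_op :: "nat \<Rightarrow> complex \<Rightarrow> (((nat \<Rightarrow> nat) \<Rightarrow> complex) \<Rightarrow> (nat \<Rightarrow> nat) \<Rightarrow> complex) \<Rightarrow> bool" where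
  "adapted_op n c F \<longleftrightarrow> (\<exists>X\<in>adapted_alg n c. opr N n X F)"

lemma adapted_op_comp: "adapted_op n c F \<Longrightarrow> adapted_op n c G \<Longrightarrow> adapted_op n c (\<lambda>v. F (G v))"
  unfolding adapted_op_def using adapted_alg_mult opr_mult by blast

lemma adapted_op_id: "adapted_op n c (\<lambda>v. v)"
  unfolding adapted_op_def using adapted_alg_one opr_one by blast

lemma adapted_op_minus: "n \<ge> 1 \<Longrightarrow> adapted_op n c F \<Longrightarrow> adapted_op n c G \<Longrightarrow> adapted_op n c (\<lambda>v f. F v f - G v f)"
proof -
  assume n: "n \<ge> 1" and "adapted_op n c F" "adapted_op n c G"
  then obtain X Y where X: "X \<in> adapted_alg n c" "opr N n X F" and Y: "Y \<in> adapted_alg n c" "opr N n Y G"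
    by (auto simp: adapted_op_def)
  have "X + (- 1) \<cdot>\<^sub>m Y \<in> adapted_alg n c" by (intro adapted_alg_add adapted_alg_smult X Y n)
  moreover have "opr N n (X + (- 1) \<cdot>\<^sub>m Y) (\<lambda>v f. F v f + (- 1) * G v f)"
    by (intro opr_add opr_smult X Y)
  ultimately show ?thesis unfolding adapted_op_def by auto
qed

lemma adapted_op_cong: "adapted_op n c F \<Longrightarrow> (\<And>v f. f \<in> idx N n \<Longrightarrow> F v f = G v f) \<Longrightarrow> adapted_op n c G"
  unfolding adapted_op_def using opr_cong[OF _ N_pos] by blast

lemma adapted_op_smult: "n \<ge> 1 \<Longrightarrow> adapted_op n c F \<Longrightarrow> adapted_op n c (\<lambda>v f. a * F v f)"
  unfolding adapted_op_def using adapted_alg_smult opr_smult by blast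

lemma adapted_op_E: "n \<ge> 1 \<Longrightarrow> adapted_op n c (\<lambda>v f. if f (n - 1) = 0 then v f else 0)"
proof -
  assume n: "n \<ge> 1"
  let ?X = "tensor_pow E0 1 \<otimes>\<^sub>k 1\<^sub>m (N ^ (n - 1))"
  have "{n-1..<n} = {n - 1}" using n by auto
  hence s: "(\<Prod>j\<in>{n-1..<n}. h j) = h (n - 1)" for h :: "nat \<Rightarrow> complex" by simp
  have e: "?X $$ (x, y) = (if \<forall>j<n-1. dgt N x j = dgt N y j then E0 $$ (dgt N x (n - 1), dgt N y (n - 1)) else 0)"
    if "x < N ^ n" "y < N ^ n" for x y
    unfolding tensor_pow_one_index[OF N_pos E0_carrier n that] s ..
  have "opr N n ?X (\<lambda>v f. if f (n - 1) = 0 then v f else 0)"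
  proof (rule opr_kernel[OF N_pos tensor_pow_one_carrier[OF E0_carrier n] e])
    fix v f assume f: "f \<in> idx N n"
    have "(\<Sum>g\<in>idx N n. (if \<forall>j<n-1. f j = g j then E0 $$ (f (n - 1), g (n - 1)) else 0) * v g)
      = (\<Sum>g\<in>idx N n. if g = f then (if f (n - 1) = 0 then v f else 0) else 0)"
    proof (rule sum.cong[OF refl])
      fix g assume g: "g \<in> idx N n"
      have E: "E0 $$ (f (n - 1), g (n - 1)) = (if f (n - 1) = 0 \<and> g (n - 1) = 0 then 1 else 0)"
        using idx_less[OF f N_pos] idx_less[OF g N_pos] by (simp add: E0_def)
      have "g = f" if "\<forall>j<n-1. f j = g j" "f (n - 1) = g (n - 1)"
      proof
        fix j consider "j < n - 1" | "j = n - 1" | "j \<ge> n" using n by linarith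
        thus "g j = f j" by cases (use that f g in \<open>auto simp: idx_def\<close>)
      qed
      thus "(if \<forall>j<n-1. f j = g j then E0 $$ (f (n - 1), g (n - 1)) else 0) * v g =
        (if g = f then (if f (n - 1) = 0 then v f else 0) else 0)"
        unfolding E by auto
    qed
    also have "\<dots> = (if f (n - 1) = 0 then v f else 0)" using f by (simp add: finite_idx)
    finally show "(\<Sum>g\<in>idx N n. (if \<forall>j<n-1. f j = g j then E0 $$ (f (n - 1), g (n - 1)) else 0) * v g)
       = (if f (n - 1) = 0 then v f else 0)" .
  qed
  thus ?thesis unfolding adapted_op_def using E0_adapted_alg[OF n] by blast
qed

lemma adapted_op_swp:
  assumes p: "Suc p < n"
  shows "adapted_op n c (\<lambda>v f. v (swp p f))"
proof -
  define i where "i = n - Suc p"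
  have i: "1 \<le> i" "i < n" "n - i - 1 = p" using p by (auto simp: i_def)
  have "opr N n (1\<^sub>m (N ^ n) - rep k n 1 s (GenU i)) (\<lambda>v f. v f - Uop 1 p v f)"
    using opr_minus[OF opr_one opr_U[OF i(1,2), of k 1 s, unfolded i(3), folded N_eq]] .
  hence "adapted_op n c (\<lambda>v f. v f - Uop 1 p v f)" unfolding adapted_op_def using flip_adapted_alg[OF i(1,2)] by blast
  thus ?thesis
  proof (rule adapted_op_cong)
    fix v f
    have "swp p f = f" if "f (Suc p) = f p" using that by (auto simp: swp_def fun_eq_iff)
    thus "v f - Uop 1 p v f = v (swp p f)" by (auto simp: Uop_def)
  qed
qed

text \<open>The first two tensor factors are the two highest positions; permutations will carry the
  insertion to any other pair.\<close>

lemma adapted_op_arc0: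
  assumes n: "n \<ge> 2" and c: "c \<noteq> 0"
  shows "adapted_op n c (arc (n - 1) (n - 2))"
proof -
  define p where "p = n - 1 - 1"
  have p: "Suc p = n - 1" "p = n - 2" "p < n" "Suc p < n" using n by (auto simp: p_def)
  have i: "1 \<le> (1::nat)" "1 < n" and n1: "n \<ge> 1" using n by auto
  define K where "K f g = (if \<forall>l. l \<noteq> p \<longrightarrow> l \<noteq> Suc p \<longrightarrow> f l = g l
     then (if g (Suc p) = 0 \<and> g p = 0 then - Jf (f (Suc p)) (f p) else 0) else 0)" for f g :: "nat \<Rightarrow> nat"
  have "opr N n (loc2 N n 1 (rank_one N (- Jm) E0)) (\<lambda>v f. - arc (Suc p) p v f)"
  proof (rule opr_kernel[OF N_pos loc2_carrier[OF i rank_one_carrier], where K = K])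
    fix x y assume xy: "x < N ^ n" "y < N ^ n"
    have "rank_one N (- Jm) E0 $$ (a * N + b, c * N + d) = (if c = 0 \<and> d = 0 then - Jf a b else 0)"
      if "a < N" "b < N" "c < N" "d < N" for a b c d
      using that by (simp add: rank_one_def pair_less Jm_def E0_def)
    thus "loc2 N n 1 (rank_one N (- Jm) E0) $$ (x, y) = K (dgt N x) (dgt N y)"
      unfolding loc2_index[OF N_pos i p_def rank_one_carrier xy] K_def by (simp only: dgt_less[OF N_pos])
  next
    fix v f assume f: "f \<in> idx N n"
    have "(\<Sum>g\<in>idx N n. K f g * v g) = (\<Sum>g\<in>idx N n. if g = f(Suc p := 0, p := 0) then - Jf (f (Suc p)) (f p) * v (f(Suc p := 0, p := 0)) else 0)"
    proof (rule sum.cong[OF refl])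
      fix g
      have "(\<forall>l. l \<noteq> p \<longrightarrow> l \<noteq> Suc p \<longrightarrow> f l = g l) \<and> g (Suc p) = 0 \<and> g p = 0 \<longleftrightarrow> g = f(Suc p := 0, p := 0)"
      proof
        assume a: "(\<forall>l. l \<noteq> p \<longrightarrow> l \<noteq> Suc p \<longrightarrow> f l = g l) \<and> g (Suc p) = 0 \<and> g p = 0"
        show "g = f(Suc p := 0, p := 0)"
        proof
          fix l show "g l = (f(Suc p := 0, p := 0)) l" using a by (cases "l = p"; cases "l = Suc p") simp_all
        qed
      qed simp
      thus "K f g * v g = (if g = f(Suc p := 0, p := 0) then - Jf (f (Suc p)) (f p) * v (f(Suc p := 0, p := 0)) else 0)"
        unfolding K_def by (smt (verit) mult_zero_left)
    qed
    also have "\<dots> = - Jf (f (Suc p)) (f p) * v (f(Suc p := 0, p := 0))"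
      using idx_upd[OF idx_upd[OF f p(4) N_pos] p(3) N_pos] by (simp add: finite_idx)
    also have "\<dots> = - arc (Suc p) p v f" by (auto simp: arc_def Jf_def)
    finally show "(\<Sum>g\<in>idx N n. K f g * v g) = - arc (Suc p) p v f" .
  qed
  hence "adapted_op n c (\<lambda>v f. - arc (Suc p) p v f)" unfolding adapted_op_def using arc_mat_adapted_alg[OF n c] by blast
  from adapted_op_smult[OF n1 this, of "- 1"] show ?thesis unfolding p(1) p(2)[symmetric] by simp
qed

text \<open>The flips give the adjacent transpositions, conjugation gives all transpositions, and
  these generate the symmetric group.\<close>

lemma adapted_op_perm:
  assumes "\<sigma> permutes {..<n}"
  shows "adapted_op n c (\<lambda>v f. v (f \<circ> \<sigma>))"
proof -
  have adj: "adapted_op n c (\<lambda>v f. v (f \<circ> Transposition.transpose p (Suc p)))" if "Suc p < n" for p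
  proof -
    have "swp p f = f \<circ> Transposition.transpose p (Suc p)" for f
      by (auto simp: swp_def fun_eq_iff Transposition.transpose_def)
    thus ?thesis using adapted_op_swp[OF that, of c] by simp
  qed
  have tr: "adapted_op n c (\<lambda>v f. v (f \<circ> Transposition.transpose a (a + Suc d)))" if "a + Suc d < n" for a d
    using that
  proof (induction d)
    case 0 thus ?case using adj[of a] by (simp only: add_Suc_right add_0_right)
  next
    case (Suc d)
    let ?b = "a + Suc d"
    \<comment> \<open>Conjugating by the next adjacent transposition lengthens the distance of the
      two points by one.\<close>
    have t: "Transposition.transpose a (Suc ?b) = Transposition.transpose ?b (Suc ?b) \<circ> Transposition.transpose a ?b \<circ> Transposition.transpose ?b (Suc ?b)"
      by (auto simp: fun_eq_iff Transposition.transpose_def)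
    have "adapted_op n c (\<lambda>v f. v (f \<circ> Transposition.transpose a ?b))" by (rule Suc.IH) (use Suc.prems in simp)
    moreover have "adapted_op n c (\<lambda>v f. v (f \<circ> Transposition.transpose ?b (Suc ?b)))" by (rule adj) (use Suc.prems in simp)
    ultimately have "adapted_op n c (\<lambda>v f. v (f \<circ> Transposition.transpose ?b (Suc ?b) \<circ> Transposition.transpose a ?b \<circ> Transposition.transpose ?b (Suc ?b)))"
      using adapted_op_comp[of n c "\<lambda>v f. v (f \<circ> Transposition.transpose ?b (Suc ?b))"]
        adapted_op_comp[of n c "\<lambda>v f. v (f \<circ> Transposition.transpose ?b (Suc ?b) \<circ> Transposition.transpose a ?b)" "\<lambda>v f. v (f \<circ> Transposition.transpose ?b (Suc ?b))"]
      by blast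
    thus ?case unfolding comp_assoc[symmetric] add_Suc_right[of a "Suc d"] t .
  qed
  have tr': "adapted_op n c (\<lambda>v f. v (f \<circ> Transposition.transpose a b))" if "a < n" "b < n" "a \<noteq> b" for a b
  proof (cases "a < b")
    case True
    then obtain d where "b = a + Suc d" using less_imp_Suc_add by auto
    thus ?thesis using tr that by blast
  next
    case False
    with that have "b < a" by simp
    then obtain d where "a = b + Suc d" using less_imp_Suc_add by auto
    thus ?thesis using tr that by (simp add: transpose_commute)
  qed
  from assms finite_lessThan show ?thesis
  proof (induction rule: permutes_induct)
    case id thus ?case using adapted_op_id by simp
  next
    case (swap a b p)
    have "adapted_op n c (\<lambda>v f. v (f \<circ> Transposition.transpose a b))" by (rule tr') (use swap.hyps in auto)
    from adapted_op_comp[OF this swap.IH] show ?case by (simp only: comp_assoc)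
  qed
qed

lemma adapted_op_E_site:
  assumes j: "j < n"
  shows "adapted_op n c (\<lambda>v f. if f j = 0 then v f else 0)"
proof -
  have n: "n \<ge> 1" using j by simp
  let ?t = "Transposition.transpose j (n - 1)"
  have t: "?t permutes {..<n}" using j by (intro permutes_swap_id) auto
  have tt: "f \<circ> ?t \<circ> ?t = f" "(f \<circ> ?t) (n - 1) = f j" for f :: "nat \<Rightarrow> nat"
    by (auto simp: fun_eq_iff)
  have "adapted_op n c (\<lambda>v f. if (f \<circ> ?t) (n - 1) = 0 then v (f \<circ> ?t \<circ> ?t) else 0)"
    using adapted_op_comp[OF adapted_op_perm[OF t] adapted_op_comp[OF adapted_op_E[OF n] adapted_op_perm[OF t]]] .
  thus ?thesis by (rule adapted_op_cong) (simp only: tt)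
qed

text \<open>The projection onto the basis tensors whose positions different from $v_o$ are exactly
  those in \<open>Z\<close>, as a product of one projection or its complement for each
  position.\<close>

lemma adapted_op_diag:
  assumes n: "n \<ge> 1"
  shows "adapted_op n c (\<lambda>v f. if \<forall>j<n. j \<in> Z \<longleftrightarrow> f j \<noteq> 0 then v f else 0)"
proof -
  have "adapted_op n c (\<lambda>v f. if \<forall>j<m. j \<in> Z \<longleftrightarrow> f j \<noteq> 0 then v f else 0)" if "m \<le> n" for m
    using that
  proof (induction m)
    case 0 thus ?case using adapted_op_id by simp
  next
    case (Suc m)
    have E: "adapted_op n c (\<lambda>v f. if f m = 0 then v f else 0)" using Suc.prems by (intro adapted_op_E_site) auto
    have "adapted_op n c (\<lambda>v f. if m \<in> Z \<longleftrightarrow> f m \<noteq> 0 then v f else 0)"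
    proof (cases "m \<in> Z")
      case True
      show ?thesis by (rule adapted_op_cong[OF adapted_op_minus[OF n adapted_op_id E]]) (use True in auto)
    next
      case False
      thus ?thesis using E by simp
    qed
    moreover have "adapted_op n c (\<lambda>v f. if \<forall>j<m. j \<in> Z \<longleftrightarrow> f j \<noteq> 0 then v f else 0)" using Suc by simp
    ultimately have "adapted_op n c (\<lambda>v f. if m \<in> Z \<longleftrightarrow> f m \<noteq> 0 then (if \<forall>j<m. j \<in> Z \<longleftrightarrow> f j \<noteq> 0 then v f else 0) else 0)"
      by (rule adapted_op_comp)
    thus ?case by (rule adapted_op_cong) (auto simp: less_Suc_eq)
  qed
  thus ?thesis by simp
qed

lemma adapted_op_arc:
  assumes ij: "i < n" "j < n" "i \<noteq> j" and c: "c \<noteq> 0"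
  shows "adapted_op n c (arc i j)"
proof -
  have n: "n \<ge> 2" using ij by linarith
  \<comment> \<open>The permutation has to send n - 1 to \<open>i\<close> and n - 2 to
    \<open>j\<close>. The first transposition settles \<open>i\<close> but may move
    \<open>j\<close>, and \<open>m\<close> records where to.\<close>
  define \<tau> where "\<tau> = Transposition.transpose i (n - 1)"
  define m where "m = \<tau> j"
  have m: "m < n" "m \<noteq> n - 1" using ij by (auto simp: m_def \<tau>_def Transposition.transpose_def)
  define \<sigma> where "\<sigma> = \<tau> \<circ> Transposition.transpose m (n - 2)"
  have sp: "\<sigma> permutes {..<n}" unfolding \<sigma>_def \<tau>_def
    using ij m n by (intro permutes_compose permutes_swap_id) auto
  have s1: "\<sigma> (n - 1) = i" using m n by (auto simp: \<sigma>_def \<tau>_def Transposition.transpose_def)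
  have s2: "\<sigma> (n - 2) = j" by (simp add: \<sigma>_def m_def \<tau>_def)
  have "adapted_op n c (\<lambda>v f. arc (n - 1) (n - 2) (\<lambda>f. v (f \<circ> inv_into UNIV \<sigma>)) (f \<circ> \<sigma>))"
    using adapted_op_comp[OF adapted_op_perm[OF sp] adapted_op_comp[OF adapted_op_arc0[OF n c] adapted_op_perm[OF permutes_inv[OF sp]]]] .
  moreover have e: "(f \<circ> \<sigma>)(n - 1 := 0, n - 2 := 0) \<circ> inv_into UNIV \<sigma> = f(i := 0, j := 0)" for f :: "nat \<Rightarrow> nat"
  proof
    fix l
    have "l = i \<longleftrightarrow> inv_into UNIV \<sigma> l = n - 1" "l = j \<longleftrightarrow> inv_into UNIV \<sigma> l = n - 2" "\<sigma> (inv_into UNIV \<sigma> l) = l"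
      using permutes_inverses[OF sp] s1 s2 by metis+
    thus "((f \<circ> \<sigma>)(n - 1 := 0, n - 2 := 0) \<circ> inv_into UNIV \<sigma>) l = (f(i := 0, j := 0)) l" by auto
  qed
  ultimately show ?thesis by - (rule adapted_op_cong, assumption, simp only: arc_def e o_apply s1 s2)
qed

end

section \<open>Symplectic transvections\<close>

context at_one
begin

text \<open>The converse of \<open>SpD\<close>: matrix identities with E and A suffice for the
  conditions on vectors, with \<open>g'\<close> witnessing invertibility.\<close>

lemma SpI:
  assumes g: "g \<in> carrier_mat N N" "g' \<in> carrier_mat N N" "g * g' = 1\<^sub>m N"
    and E: "g * Em = Em" "Em * g = Em" and A: "transpose_mat g * Am * g = Am"
  shows "g \<in> Sp k s s"
proof -
  note d = carrier_matD[OF g(1)] carrier_matD[OF g(2)] carrier_matD[OF Em_carrier] carrier_matD[OF Am_carrier]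
  have "g' * g = 1\<^sub>m N" by (rule mat_mult_left_right_inverse[OF g])
  hence inv: "invertible_mat g"
    unfolding invertible_mat_def inverts_mat_def using g(3) d by (intro conjI exI[of _ g']) auto
  have vc: "v_o k s \<in> carrier_vec N" by (simp add: v_o_eq)
  have Ev: "Em *\<^sub>v v_o k s = v_o k s"
  proof (rule eq_vecI)
    fix i assume "i < dim_vec (v_o k s)"
    hence i: "i < N" using vc by simp
    have "(Em *\<^sub>v v_o k s) $ i = (\<Sum>l<N. ((- 1) ^ k * xo i * xo l) * xo l)"
      using i d by (simp add: v_o_eq scalar_prod_def Em_index atLeast0LessThan)
    also have "\<dots> = (- 1) ^ k * xo i * (\<Sum>l<N. xo l * xo l)"
      by (simp add: sum_distrib_left mult_ac)
    also have "\<dots> = v_o k s $ i" unfolding xo_sum using i by (simp add: v_o_eq flip: power_mult_distrib)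
    finally show "(Em *\<^sub>v v_o k s) $ i = v_o k s $ i" .
  qed (use d in \<open>auto simp: v_o_eq\<close>)
  have gv: "g *\<^sub>v v_o k s = v_o k s"
    using assoc_mult_mat_vec[OF g(1) Em_carrier vc] unfolding E(1) Ev by simp
  have ker: "g *\<^sub>v w \<in> mat_kernel (E_mat k 1 s)" if "w \<in> mat_kernel (E_mat k 1 s)" for w
  proof -
    have w: "w \<in> carrier_vec N" "Em *\<^sub>v w = 0\<^sub>v N" using that d unfolding Em_def[symmetric] mat_kernel_def by auto
    have "Em *\<^sub>v (g *\<^sub>v w) = 0\<^sub>v N"
      using assoc_mult_mat_vec[OF Em_carrier g(1) w(1)] unfolding E(2) w(2) by simp
    thus ?thesis using w g(1) d unfolding Em_def[symmetric] mat_kernel_def by auto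
  qed
  have form: "(g *\<^sub>v v) \<bullet> (Am *\<^sub>v (g *\<^sub>v w)) = v \<bullet> (Am *\<^sub>v w)" if v: "v \<in> carrier_vec N" and w: "w \<in> carrier_vec N" for v w
  proof -
    have T: "transpose_mat g \<in> carrier_mat N N" using g(1) by auto
    have gw: "g *\<^sub>v w \<in> carrier_vec N" using g(1) w by auto
    have Agw: "Am *\<^sub>v (g *\<^sub>v w) \<in> carrier_vec N" using Am_carrier gw by auto
    have "(g *\<^sub>v v) \<bullet> (Am *\<^sub>v (g *\<^sub>v w)) = v \<bullet> (transpose_mat g *\<^sub>v (Am *\<^sub>v (g *\<^sub>v w)))"
      using transpose_vec_mult_scalar[OF T Agw v] by simp
    also have "transpose_mat g *\<^sub>v (Am *\<^sub>v (g *\<^sub>v w)) = (transpose_mat g * Am * g) *\<^sub>v w"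
      unfolding assoc_mult_mat_vec[OF T Am_carrier gw, symmetric]
      by (rule assoc_mult_mat_vec[OF mult_carrier_mat[OF T Am_carrier] g(1) w, symmetric])
    finally show ?thesis unfolding A .
  qed
  show ?thesis
    unfolding Sp_def mem_Collect_eq N_eq[symmetric] using g(1) inv gv ker form unfolding Am_def by blast
qed

section \<open>Transvections and their derivatives\<close>

definition Wm :: "(nat \<Rightarrow> complex) \<Rightarrow> complex mat" where "Wm w = mat N N (\<lambda>(i, j). w i * w j)"
text \<open>The map sending v to $(w^T J v) w$, an infinitesimal transvection. For w with
  \<open>w 0 = 0\<close> these maps span the symplectic Lie algebra.\<close>

definition Lm :: "(nat \<Rightarrow> complex) \<Rightarrow> complex mat" where "Lm w = Wm w * Jm"

lemma Wm_carrier: "Wm w \<in> carrier_mat N N" by (simp add: Wm_def)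
lemma Lm_carrier: "Lm w \<in> carrier_mat N N" unfolding Lm_def by (rule mult_carrier_mat[OF Wm_carrier Jm_carrier])

lemma Jf_0: "Jf b 0 = 0" by (auto simp: Jf_def)

lemma Jf_skew: "Jf b a = - Jf a b"
  by (auto simp: Jf_def eta_partner)

lemma Jm_skew: "transpose_mat Jm = - Jm"
  by (rule eq_matI) (simp_all add: Jm_def Jf_skew[symmetric])

lemma Lm_index: "i < N \<Longrightarrow> j < N \<Longrightarrow> Lm w $$ (i, j) = w i * (\<Sum>b<N. w b * Jf b j)"
  using carrier_matD[OF Wm_carrier[of w]] carrier_matD[OF Jm_carrier]
  by (simp add: Lm_def mat_mult_index del: index_mult_mat(1)) (simp add: Wm_def Jm_def sum_distrib_left mult.assoc)

text \<open>The product contains the factor $w^T J w$, which equals its own negative because J is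
  skew.\<close>

lemma WJW: "Wm w * Jm * Wm w = 0\<^sub>m N N"
proof (rule eq_matI)
  note d = carrier_matD[OF Wm_carrier[of w]] carrier_matD[OF Jm_carrier]
  fix i j assume "i < dim_row (0\<^sub>m N N :: complex mat)" "j < dim_col (0\<^sub>m N N :: complex mat)"
  hence ij: "i < N" "j < N" by auto
  define t where "t = (\<Sum>b<N. (\<Sum>a<N. w a * Jf a b) * w b)"
  have "t = (\<Sum>b<N. \<Sum>a<N. w a * Jf a b * w b)" unfolding t_def by (simp add: sum_distrib_right)
  also have "\<dots> = (\<Sum>a<N. \<Sum>b<N. w a * Jf a b * w b)" by (rule sum.swap)
  also have "\<dots> = - (\<Sum>a<N. \<Sum>b<N. w b * Jf b a * w a)"
    unfolding sum_negf[symmetric] by (intro sum.cong refl) (subst Jf_skew, simp add: mult_ac)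
  also have "\<dots> = - t" unfolding t_def by (simp add: sum_distrib_right)
  finally have t: "t = 0" by simp
  have "(Wm w * Jm * Wm w) $$ (i, j) = (\<Sum>b<N. Lm w $$ (i, b) * Wm w $$ (b, j))"
    unfolding Lm_def[symmetric] using ij d carrier_matD[OF Lm_carrier[of w]]
    by (simp add: mat_mult_index del: index_mult_mat(1))
  also have "\<dots> = (\<Sum>b<N. w i * (\<Sum>a<N. w a * Jf a b) * (w b * w j))"
    by (intro sum.cong refl) (use ij in \<open>simp add: Lm_index Wm_def\<close>)
  also have "\<dots> = w i * w j * t" unfolding t_def by (subst sum_distrib_left) (intro sum.cong refl, simp add: mult_ac)
  finally show "(Wm w * Jm * Wm w) $$ (i, j) = 0\<^sub>m N N $$ (i, j)" using ij t by simp
qed (simp_all add: Wm_def)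

definition transvection :: "(nat \<Rightarrow> complex) \<Rightarrow> complex \<Rightarrow> complex mat" where
  "transvection w c = 1\<^sub>m N + c \<cdot>\<^sub>m Lm w"

lemma transvection_carrier: "transvection w c \<in> carrier_mat N N"
  unfolding transvection_def using Lm_carrier by auto

text \<open>With L = \<open>Lm w\<close>, the inverse of 1 + c L is 1 - c L since L L = 0. In $h^T J
  h$ the terms linear in c cancel and the quadratic one contains \<open>WJW\<close>. The condition
  on \<open>w\<close> makes $E_0 L$ vanish, so that $v_o$ splits off.\<close>

lemma transvection_Sp:
  assumes w0: "w 0 = 0"
  shows "Pm * transvection w c * Qm \<in> Sp k s s"
proof -
  let ?W = "Wm w" and ?L = "Lm w" and ?h = "transvection w c" and ?h' = "transvection w (- c)"
  note cc = Wm_carrier[of w] Lm_carrier[of w] Jm_carrier E0_carrier Pm_carrier Qm_carrier Em_carrier Am_carrier transvection_carrier[of w c] transvection_carrier[of w "- c"]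
  note as = assoc_mult_mat[of _ N N _ N _ N] mult_carrier_mat[of _ N N _ N]
  have cL: "a \<cdot>\<^sub>m ?L \<in> carrier_mat N N" for a using cc by auto
  have LL: "?L * ?L = 0\<^sub>m N N"
  proof -
    have "?L * ?L = (?W * Jm * ?W) * Jm" unfolding Lm_def by (simp add: as cc)
    thus ?thesis unfolding WJW using left_mult_zero_mat[OF Jm_carrier] by simp
  qed
  have "?h * ?h' = 1\<^sub>m N * ?h' + (c \<cdot>\<^sub>m ?L) * ?h'"
    unfolding transvection_def[of w c] by (rule add_mult_distrib_mat[OF one_carrier_mat cL cc(10)])
  also have "(c \<cdot>\<^sub>m ?L) * ?h' = (c \<cdot>\<^sub>m ?L) * 1\<^sub>m N + (c \<cdot>\<^sub>m ?L) * ((- c) \<cdot>\<^sub>m ?L)"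
    unfolding transvection_def by (rule mult_add_distrib_mat[OF cL one_carrier_mat cL])
  also have "(c \<cdot>\<^sub>m ?L) * ((- c) \<cdot>\<^sub>m ?L) = c \<cdot>\<^sub>m ((- c) \<cdot>\<^sub>m (?L * ?L))"
    unfolding mult_smult_assoc_mat[OF cc(2) cL] mult_smult_distrib[OF cc(2,2)] ..
  also have "1\<^sub>m N * ?h' + ((c \<cdot>\<^sub>m ?L) * 1\<^sub>m N + c \<cdot>\<^sub>m ((- c) \<cdot>\<^sub>m (?L * ?L))) = 1\<^sub>m N"
    unfolding LL right_mult_one_mat[OF cL] left_mult_one_mat[OF cc(10)] unfolding transvection_def
    using carrier_matD[OF cc(2)] by (intro eq_matI) simp_all
  finally have hh: "?h * ?h' = 1\<^sub>m N" .
  have EL: "E0 * ?L = 0\<^sub>m N N"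
  proof (rule eq_matI)
    fix a b assume "a < dim_row (0\<^sub>m N N :: complex mat)" "b < dim_col (0\<^sub>m N N :: complex mat)"
    hence ab: "a < N" "b < N" by auto
    have "(E0 * ?L) $$ (a, b) = (\<Sum>z<N. E0 $$ (a, z) * ?L $$ (z, b))"
      using ab carrier_matD[OF E0_carrier] carrier_matD[OF cc(2)] by (simp add: mat_mult_index del: index_mult_mat(1))
    also have "\<dots> = 0" by (rule sum.neutral) (use ab w0 in \<open>auto simp: E0_def Lm_index\<close>)
    finally show "(E0 * ?L) $$ (a, b) = 0\<^sub>m N N $$ (a, b)" using ab by simp
  qed (use cc in auto)
  have LE: "?L * E0 = 0\<^sub>m N N"
  proof (rule eq_matI)
    fix a b assume "a < dim_row (0\<^sub>m N N :: complex mat)" "b < dim_col (0\<^sub>m N N :: complex mat)"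
    hence ab: "a < N" "b < N" by auto
    have "(?L * E0) $$ (a, b) = (\<Sum>z<N. ?L $$ (a, z) * E0 $$ (z, b))"
      using ab carrier_matD[OF E0_carrier] carrier_matD[OF cc(2)] by (simp add: mat_mult_index del: index_mult_mat(1))
    also have "\<dots> = 0" by (rule sum.neutral) (use ab in \<open>auto simp: E0_def Lm_index Jf_0\<close>)
    finally show "(?L * E0) $$ (a, b) = 0\<^sub>m N N $$ (a, b)" using ab by simp
  qed (use cc in auto)
  have Eh: "E0 * ?h = E0"
    unfolding transvection_def mult_add_distrib_mat[OF E0_carrier one_carrier_mat cL] mult_smult_distrib[OF E0_carrier cc(2)] EL
      right_mult_one_mat[OF E0_carrier] using carrier_matD[OF E0_carrier] by (intro eq_matI) simp_all
  have hE: "?h * E0 = E0"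
    unfolding transvection_def add_mult_distrib_mat[OF one_carrier_mat cL E0_carrier] mult_smult_assoc_mat[OF cc(2) E0_carrier] LE
      left_mult_one_mat[OF E0_carrier] using carrier_matD[OF E0_carrier] by (intro eq_matI) simp_all
  let ?M = "Jm * ?W * Jm"
  have M: "?M \<in> carrier_mat N N" by (simp add: as cc)
  have cM: "a \<cdot>\<^sub>m ?M \<in> carrier_mat N N" for a using M by (rule smult_carrier_mat)
  have WT: "transpose_mat ?W = ?W" by (rule eq_matI) (auto simp: Wm_def)
  have "transpose_mat ?h = 1\<^sub>m N + c \<cdot>\<^sub>m transpose_mat ?L"
    unfolding transvection_def transpose_add[OF one_carrier_mat cL] transpose_smult_mat by simp
  also have "transpose_mat ?L = (- Jm) * ?W"
    unfolding Lm_def transpose_mult[OF cc(1,3)] Jm_skew WT ..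
  also have "\<dots> = (- 1) \<cdot>\<^sub>m (Jm * ?W)" using carrier_matD[OF cc(1)] carrier_matD[OF cc(3)]
    by (intro eq_matI) simp_all
  finally have hT: "transpose_mat ?h = 1\<^sub>m N + c \<cdot>\<^sub>m ((- 1) \<cdot>\<^sub>m (Jm * ?W))" .
  have JW: "Jm * ?W \<in> carrier_mat N N" "(- 1) \<cdot>\<^sub>m (Jm * ?W) \<in> carrier_mat N N" "c \<cdot>\<^sub>m ((- 1) \<cdot>\<^sub>m (Jm * ?W)) \<in> carrier_mat N N"
    using cc by auto
  have "transpose_mat ?h * Jm = Jm + c \<cdot>\<^sub>m ((- 1) \<cdot>\<^sub>m ?M)"
    unfolding hT add_mult_distrib_mat[OF one_carrier_mat JW(3) cc(3)] mult_smult_assoc_mat[OF JW(2) cc(3)]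
      mult_smult_assoc_mat[OF JW(1) cc(3)] left_mult_one_mat[OF cc(3)] ..
  hence "transpose_mat ?h * Jm * ?h = (Jm + c \<cdot>\<^sub>m ((- 1) \<cdot>\<^sub>m ?M)) * ?h" by simp
  also have "\<dots> = Jm * ?h + (c \<cdot>\<^sub>m ((- 1) \<cdot>\<^sub>m ?M)) * ?h"
    by (rule add_mult_distrib_mat[OF cc(3) _ cc(9)]) (intro smult_carrier_mat M)
  also have "Jm * ?h = Jm + c \<cdot>\<^sub>m ?M"
    unfolding transvection_def mult_add_distrib_mat[OF cc(3) one_carrier_mat cL] mult_smult_distrib[OF cc(3) cc(2)] right_mult_one_mat[OF cc(3)]
    unfolding Lm_def by (simp add: as cc)
  also have "(c \<cdot>\<^sub>m ((- 1) \<cdot>\<^sub>m ?M)) * ?h = c \<cdot>\<^sub>m ((- 1) \<cdot>\<^sub>m (?M * ?h))"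
    unfolding mult_smult_assoc_mat[OF smult_carrier_mat[OF M] cc(9)] mult_smult_assoc_mat[OF M cc(9)] ..
  also have "?M * ?h = ?M"
  proof -
    have "?M * ?L = Jm * (?W * Jm * ?W) * Jm" unfolding Lm_def by (simp add: as cc)
    hence "?M * ?L = 0\<^sub>m N N" unfolding WJW using right_mult_zero_mat[OF cc(3)] left_mult_zero_mat[OF cc(3)] by simp
    thus ?thesis unfolding transvection_def mult_add_distrib_mat[OF M one_carrier_mat cL] mult_smult_distrib[OF M cc(2)] right_mult_one_mat[OF M]
      using carrier_matD[OF M] by (intro eq_matI) simp_all
  qed
  also have "Jm + c \<cdot>\<^sub>m ?M + c \<cdot>\<^sub>m ((- 1) \<cdot>\<^sub>m ?M) = Jm"
    using carrier_matD[OF M] carrier_matD[OF cc(3)] by (intro eq_matI) simp_all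
  finally have hJh: "transpose_mat ?h * Jm * ?h = Jm" .
  have hTc: "transpose_mat ?h \<in> carrier_mat N N" "transpose_mat Pm \<in> carrier_mat N N" "transpose_mat Qm \<in> carrier_mat N N" using cc by auto
  let ?g = "Pm * ?h * Qm"
  have QPY: "Qm * (Pm * Y) = Y" if "Y \<in> carrier_mat N N" for Y
    unfolding assoc_mult_mat[OF Qm_carrier Pm_carrier that, symmetric] QP by (rule left_mult_one_mat[OF that])
  show ?thesis
  proof (rule SpI)
    show "?g \<in> carrier_mat N N" "Pm * ?h' * Qm \<in> carrier_mat N N" by (simp_all add: as cc)
    have "?g * (Pm * ?h' * Qm) = Pm * (?h * ?h') * Qm" by (simp add: as cc QPY)
    thus "?g * (Pm * ?h' * Qm) = 1\<^sub>m N" unfolding hh right_mult_one_mat[OF Pm_carrier] PQ .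
    have "?g * Em = Pm * (?h * E0) * Qm" unfolding PEQ[symmetric] by (simp add: as cc QPY)
    thus "?g * Em = Em" unfolding hE PEQ .
    have "Em * ?g = Pm * (E0 * ?h) * Qm" unfolding PEQ[symmetric] by (simp add: as cc QPY)
    thus "Em * ?g = Em" unfolding Eh PEQ .
    have gT: "transpose_mat ?g = transpose_mat Qm * transpose_mat ?h * transpose_mat Pm"
      unfolding transpose_mult[OF mult_carrier_mat[OF Pm_carrier cc(9)] Qm_carrier] transpose_mult[OF Pm_carrier cc(9)]
      by (simp add: as cc hTc)
    have "transpose_mat ?g * Am * ?g = transpose_mat Qm * transpose_mat ?h * (transpose_mat Pm * Am * Pm) * ?h * Qm"
      unfolding gT by (simp add: as cc hTc)
    also have "\<dots> = transpose_mat Qm * transpose_mat ?h * (- Jm) * ?h * Qm" unfolding PAP ..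
    also have "\<dots> = - (transpose_mat Qm * (transpose_mat ?h * Jm * ?h) * Qm)"
    proof -
      define A1 where "A1 = transpose_mat Qm * transpose_mat ?h"
      have A1: "A1 \<in> carrier_mat N N" unfolding A1_def by (rule mult_carrier_mat[OF hTc(3,1)])
      have d: "dim_row Jm = N" "dim_col Jm = N" "dim_row ?h = N" "dim_col ?h = N" "dim_row Qm = N" "dim_col A1 = N"
        using carrier_matD[OF cc(3)] carrier_matD[OF cc(9)] carrier_matD[OF Qm_carrier] carrier_matD[OF A1] by auto
      have "A1 * (- Jm) = - (A1 * Jm)" using d by simp
      moreover have "- (A1 * Jm) * ?h = - (A1 * Jm * ?h)" using d by (intro uminus_mult_left_mat) simp
      moreover have "- (A1 * Jm * ?h) * Qm = - (A1 * Jm * ?h * Qm)" using d by (intro uminus_mult_left_mat) simp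
      ultimately have "A1 * (- Jm) * ?h * Qm = - (A1 * Jm * ?h * Qm)" by simp
      moreover have "A1 * Jm * ?h * Qm = transpose_mat Qm * (transpose_mat ?h * Jm * ?h) * Qm"
        unfolding A1_def by (simp add: as cc hTc)
      ultimately show ?thesis unfolding A1_def by simp
    qed
    also have "\<dots> = Am" unfolding hJh QJQ by simp
    finally show "transpose_mat ?g * Am * ?g = Am" .
  qed
qed

lemma DERIV_tensor_entry:
  fixes L :: "complex mat"
  shows "((\<lambda>c. \<Prod>j\<in>A. (if f j = g j then 1 else 0) + c * L $$ (f j, g j)) has_field_derivative
     (\<Sum>l\<in>A. L $$ (f l, g l) * (\<Prod>j\<in>A - {l}. if f j = g j then 1 else 0))) (at 0)"
proof -
  have "((\<lambda>c. (if f j = g j then 1 else 0) + c * L $$ (f j, g j)) has_field_derivative L $$ (f j, g j)) (at 0)" for j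
    by (auto intro!: derivative_eq_intros)
  from has_field_derivative_prod[OF this, where A = A] show ?thesis by simp
qed

text \<open>The product of Kronecker deltas forces \<open>h\<close> to agree with \<open>g\<close>
  off \<open>l\<close>, so only the value at \<open>l\<close> is summed.\<close>

lemma site_sum:
  assumes g: "g \<in> idx N n" and l: "l < n"
  shows "(\<Sum>h\<in>idx N n. F h * (L (h l) * (\<Prod>j\<in>{..<n} - {l}. if h j = g j then 1 else 0))) = (\<Sum>b<N. F (g(l := b)) * (L b :: complex))"
proof -
  have "(\<Sum>h\<in>idx N n. F h * (L (h l) * (\<Prod>j\<in>{..<n} - {l}. if h j = g j then 1 else 0)))
    = (\<Sum>h\<in>(\<lambda>b. g(l := b)) ` {..<N}. F h * (L (h l) * (\<Prod>j\<in>{..<n} - {l}. if h j = g j then 1 else 0)))"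
  proof (rule sum.mono_neutral_right[OF finite_idx])
    show "(\<lambda>b. g(l := b)) ` {..<N} \<subseteq> idx N n" using g l by (auto intro: idx_upd)
    show "\<forall>h\<in>idx N n - (\<lambda>b. g(l := b)) ` {..<N}. F h * (L (h l) * (\<Prod>j\<in>{..<n} - {l}. if h j = g j then 1 else 0)) = 0"
    proof
      fix h assume h: "h \<in> idx N n - (\<lambda>b. g(l := b)) ` {..<N}"
      have "\<exists>j\<in>{..<n} - {l}. h j \<noteq> g j"
      proof (rule ccontr)
        assume "\<not> ?thesis"
        hence "h j = (g(l := h l)) j" for j
          using h g by (cases "j < n") (auto simp: idx_def)
        hence "h = g(l := h l)" by (rule ext)
        moreover have "h l < N" using h idx_less[OF _ N_pos] by blast
        ultimately show False using h by blast
      qed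
      hence "(\<Prod>j\<in>{..<n} - {l}. if h j = g j then 1 else 0) = (0 :: complex)"
        by (intro prod_zero) auto
      thus "F h * (L (h l) * (\<Prod>j\<in>{..<n} - {l}. if h j = g j then 1 else 0)) = 0" by simp
    qed
  qed
  also have "\<dots> = (\<Sum>b<N. F (g(l := b)) * L b)"
  proof (subst sum.reindex)
    show "inj_on (\<lambda>b. g(l := b)) {..<N}" by (rule inj_onI) (metis fun_upd_same)
    have "(\<Prod>j\<in>{..<n} - {l}. if (g(l := b)) j = g j then 1 else 0) = (1 :: complex)" for b
      by (rule prod.neutral) auto
    thus "sum ((\<lambda>h. F h * (L (h l) * (\<Prod>j\<in>{..<n} - {l}. if h j = g j then 1 else 0))) \<circ> (\<lambda>b. g(l := b))) {..<N}
      = (\<Sum>b<N. F (g(l := b)) * L b)" by simp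
  qed
  finally show ?thesis .
qed

text \<open>
  The derivative at \<open>c = 0\<close> of the commutation relation.
\<close>

lemma End_Lie:
  assumes X: "X \<in> carrier_mat (N ^ n) (N ^ n)"
    and K: "\<And>x y. x < N ^ n \<Longrightarrow> y < N ^ n \<Longrightarrow> X $$ (x, y) = K (dgt N x) (dgt N y)"
    and c: "\<And>c. X * tensor_pow (transvection w c) n = tensor_pow (transvection w c) n * X"
    and fg: "f \<in> idx N n" "g \<in> idx N n"
  shows "(\<Sum>l<n. \<Sum>b<N. K f (g(l := b)) * Lm w $$ (b, g l)) = (\<Sum>l<n. \<Sum>b<N. K (f(l := b)) g * Lm w $$ (f l, b))"
proof -
  let ?H = "\<lambda>c. tensor_pow (transvection w c) n" and ?L = "Lm w"
  obtain x where x: "x < N ^ n" "dgt N x = f" using dgt_bij[OF N_pos, of n] fg(1) unfolding bij_betw_def by (metis imageE lessThan_iff)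
  obtain y where y: "y < N ^ n" "dgt N y = g" using dgt_bij[OF N_pos, of n] fg(2) unfolding bij_betw_def by (metis imageE lessThan_iff)
  have hi: "transvection w c $$ (i, j) = (if i = j then 1 else 0) + c * ?L $$ (i, j)" if "i < N" "j < N" for i j c
    using that carrier_matD[OF Lm_carrier[of w]] by (simp add: transvection_def)
  have He: "?H c $$ (u, v) = (\<Prod>j<n. (if dgt N u j = dgt N v j then 1 else 0) + c * ?L $$ (dgt N u j, dgt N v j))"
    if "u < N ^ n" "v < N ^ n" for u v c
    unfolding tensor_pow_index[OF N_pos transvection_carrier that] by (intro prod.cong refl hi) simp_all
  have Hc: "?H c \<in> carrier_mat (N ^ n) (N ^ n)" for c by (rule tensor_pow_carrier[OF transvection_carrier])
  let ?P = "\<lambda>h h' c. \<Prod>j<n. (if h j = h' j then 1 else 0) + c * ?L $$ (h j, h' j)"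
  have l: "(X * ?H c) $$ (x, y) = (\<Sum>h\<in>idx N n. K f h * ?P h g c)" for c
  proof -
    have "(X * ?H c) $$ (x, y) = (\<Sum>z<N ^ n. K f (dgt N z) * ?P (dgt N z) g c)"
    proof -
      have "(X * ?H c) $$ (x, y) = (\<Sum>z<N ^ n. X $$ (x, z) * ?H c $$ (z, y))"
        using carrier_matD[OF X] carrier_matD[OF Hc] x y by (subst mat_mult_index) auto
      also have "\<dots> = (\<Sum>z<N ^ n. K f (dgt N z) * ?P (dgt N z) g c)"
        by (intro sum.cong refl arg_cong2[of _ _ _ _ "(*)"]) (simp_all only: lessThan_iff K He x y)
      finally show ?thesis .
    qed
    also have "\<dots> = (\<Sum>h\<in>idx N n. K f h * ?P h g c)" by (rule sum_dgt[OF N_pos])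
    finally show ?thesis .
  qed
  have r: "(?H c * X) $$ (x, y) = (\<Sum>h\<in>idx N n. K h g * ?P f h c)" for c
  proof -
    have "(?H c * X) $$ (x, y) = (\<Sum>z<N ^ n. K (dgt N z) g * ?P f (dgt N z) c)"
    proof -
      have "(?H c * X) $$ (x, y) = (\<Sum>z<N ^ n. ?H c $$ (x, z) * X $$ (z, y))"
        using carrier_matD[OF X] carrier_matD[OF Hc] x y by (subst mat_mult_index) auto
      also have "\<dots> = (\<Sum>z<N ^ n. X $$ (z, y) * ?H c $$ (x, z))" by (simp only: mult.commute)
      also have "\<dots> = (\<Sum>z<N ^ n. K (dgt N z) g * ?P f (dgt N z) c)"
        by (intro sum.cong refl arg_cong2[of _ _ _ _ "(*)"]) (simp_all only: lessThan_iff K He x y)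
      finally show ?thesis .
    qed
    also have "\<dots> = (\<Sum>h\<in>idx N n. K h g * ?P f h c)" by (rule sum_dgt[OF N_pos])
    finally show ?thesis .
  qed
  \<comment> \<open>Both sides are polynomials in the parameter of the transvection and agree
    everywhere, so their derivatives at 0 agree.\<close>
  have eq: "(\<lambda>c. \<Sum>h\<in>idx N n. K f h * ?P h g c) = (\<lambda>c. \<Sum>h\<in>idx N n. K h g * ?P f h c)"
    using l r c by metis
  have D1: "((\<lambda>c. \<Sum>h\<in>idx N n. K f h * ?P h g c) has_field_derivative
    (\<Sum>h\<in>idx N n. K f h * (\<Sum>l<n. ?L $$ (h l, g l) * (\<Prod>j\<in>{..<n} - {l}. if h j = g j then 1 else 0)))) (at 0)"
    by (intro DERIV_sum DERIV_cmult DERIV_tensor_entry)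
  have D2: "((\<lambda>c. \<Sum>h\<in>idx N n. K h g * ?P f h c) has_field_derivative
    (\<Sum>h\<in>idx N n. K h g * (\<Sum>l<n. ?L $$ (f l, h l) * (\<Prod>j\<in>{..<n} - {l}. if f j = h j then 1 else 0)))) (at 0)"
    by (intro DERIV_sum DERIV_cmult DERIV_tensor_entry)
  have "(\<Sum>h\<in>idx N n. K f h * (\<Sum>l<n. ?L $$ (h l, g l) * (\<Prod>j\<in>{..<n} - {l}. if h j = g j then 1 else 0)))
    = (\<Sum>h\<in>idx N n. K h g * (\<Sum>l<n. ?L $$ (f l, h l) * (\<Prod>j\<in>{..<n} - {l}. if f j = h j then 1 else 0)))"
    using DERIV_unique[OF D1[unfolded eq] D2] .
  also have "(\<Sum>h\<in>idx N n. K f h * (\<Sum>l<n. ?L $$ (h l, g l) * (\<Prod>j\<in>{..<n} - {l}. if h j = g j then 1 else 0)))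
    = (\<Sum>l<n. \<Sum>b<N. K f (g(l := b)) * ?L $$ (b, g l))"
    unfolding sum_distrib_left by (subst sum.swap) (intro sum.cong refl site_sum[OF fg(2)], simp)
  also have "(\<Sum>h\<in>idx N n. K h g * (\<Sum>l<n. ?L $$ (f l, h l) * (\<Prod>j\<in>{..<n} - {l}. if f j = h j then 1 else 0)))
    = (\<Sum>l<n. \<Sum>b<N. K (f(l := b)) g * ?L $$ (f l, b))"
  proof -
    have s: "(\<Prod>j\<in>A. if f j = h j then 1 else 0) = (\<Prod>j\<in>A. if h j = f j then 1 else (0::complex))" for h A
      by (intro prod.cong if_cong refl) (rule eq_commute)
    show ?thesis unfolding s
      unfolding sum_distrib_left by (subst sum.swap) (intro sum.cong refl site_sum[OF fg(1), where F = "\<lambda>h. K h g"], simp)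
  qed
  finally show ?thesis .
qed

end

section \<open>Spaces of matrices\<close>

text \<open>Serves the scalar matrices as well as the cosets of constants in $C_{n,-}$; in the
  latter case nontriviality is deduced from the representation.\<close>

lemma (in ring) subfield_range:
  fixes \<phi> :: "'c :: field \<Rightarrow> 'a"
  assumes carr: "\<And>a. \<phi> a \<in> carrier R" and one: "\<phi> 1 = \<one>"
    and add: "\<And>a b. \<phi> (a + b) = \<phi> a \<oplus> \<phi> b" and mult: "\<And>a b. \<phi> (a * b) = \<phi> a \<otimes> \<phi> b"
    and nontriv: "\<one> \<noteq> \<zero>"
  shows "subfield (range \<phi>) R"
proof -
  have "\<phi> 0 \<oplus> \<phi> 0 = \<phi> 0" using add[of 0 0] by simp
  hence zero: "\<phi> 0 = \<zero>" using add.l_cancel_one[of "\<phi> 0" "\<phi> 0"] carr by simp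
  have uminus: "\<ominus> \<phi> a = \<phi> (- a)" for a
    using minus_equality[of "\<phi> (- a)" "\<phi> a"] add[of "- a" a] carr zero by simp
  have sub: "subring (range \<phi>) R"
  proof (rule subringI)
    show "range \<phi> \<subseteq> carrier R" using carr by auto
    show "\<one> \<in> range \<phi>" using one by (metis rangeI)
  qed (auto simp: uminus simp flip: add mult)
  have scr: "subcring (range \<phi>) R"
    by (rule subcringI[OF sub]) (auto simp: mult.commute simp flip: mult)
  show ?thesis
  proof (rule subfieldI[OF scr])
    show "Units (R\<lparr>carrier := range \<phi>\<rparr>) = range \<phi> - {\<zero>}"
    proof (rule subset_antisym; rule subsetI)
      fix x assume x: "x \<in> Units (R\<lparr>carrier := range \<phi>\<rparr>)"
      then obtain y where y: "x \<in> range \<phi>" "y \<in> range \<phi>" "x \<otimes> y = \<one>" by (auto simp: Units_def)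
      have "x \<noteq> \<zero>" using y nontriv carr by auto
      thus "x \<in> range \<phi> - {\<zero>}" using y by simp
    next
      fix x assume "x \<in> range \<phi> - {\<zero>}"
      then obtain a where a: "x = \<phi> a" "a \<noteq> 0" using zero by auto
      have "\<phi> a \<otimes> \<phi> (inverse a) = \<one>" "\<phi> (inverse a) \<otimes> \<phi> a = \<one>"
        using a(2) one by (simp_all flip: mult)
      thus "x \<in> Units (R\<lparr>carrier := range \<phi>\<rparr>)" unfolding a(1) by (auto simp: Units_def)
    qed
  qed
qed

locale mat_space =
  fixes M :: nat
  assumes M_pos: "0 < M"
begin

abbreviation RM :: "complex mat ring" where "RM \<equiv> ring_mat TYPE(complex) M ()"
definition KM :: "complex mat set" where "KM = range (\<lambda>c. c \<cdot>\<^sub>m 1\<^sub>m M)"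

sublocale RM: ring RM by (rule ring_mat)

lemma KM_subfield: "subfield KM RM"
  unfolding KM_def
proof (rule RM.subfield_range)
  have "(1\<^sub>m M :: complex mat) $$ (0, 0) \<noteq> (0\<^sub>m M M) $$ (0, 0)" using M_pos by simp
  hence "1\<^sub>m M \<noteq> (0\<^sub>m M M :: complex mat)" by metis
  thus "\<one>\<^bsub>RM\<^esub> \<noteq> \<zero>\<^bsub>RM\<^esub>" by (simp add: ring_mat_simps)
  show "(1 :: complex) \<cdot>\<^sub>m 1\<^sub>m M = \<one>\<^bsub>RM\<^esub>" by (simp add: ring_mat_simps) (rule eq_matI, auto)
  fix a b :: complex
  show "(a + b) \<cdot>\<^sub>m 1\<^sub>m M = (a \<cdot>\<^sub>m 1\<^sub>m M) \<oplus>\<^bsub>RM\<^esub> (b \<cdot>\<^sub>m 1\<^sub>m M)"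
    by (simp add: ring_mat_simps) (rule eq_matI, auto)
  have "(a \<cdot>\<^sub>m 1\<^sub>m M) * (b \<cdot>\<^sub>m 1\<^sub>m M) = a \<cdot>\<^sub>m (1\<^sub>m M * (b \<cdot>\<^sub>m 1\<^sub>m M))"
    by (rule mult_smult_assoc_mat[of _ M M _ M]) auto
  also have "\<dots> = a \<cdot>\<^sub>m (b \<cdot>\<^sub>m 1\<^sub>m M)" by (subst left_mult_one_mat[of _ M M]) auto
  also have "\<dots> = (a * b) \<cdot>\<^sub>m 1\<^sub>m M" by (rule eq_matI) auto
  finally show "(a * b) \<cdot>\<^sub>m 1\<^sub>m M = (a \<cdot>\<^sub>m 1\<^sub>m M) \<otimes>\<^bsub>RM\<^esub> (b \<cdot>\<^sub>m 1\<^sub>m M)" by (simp add: ring_mat_simps)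
qed (simp add: ring_mat_simps)

lemma KM_mult:
  fixes A :: "complex mat"
  assumes "A \<in> carrier_mat M M"
  shows "(c \<cdot>\<^sub>m 1\<^sub>m M) * A = c \<cdot>\<^sub>m A"
  unfolding mult_smult_assoc_mat[OF one_carrier_mat assms] left_mult_one_mat[OF assms] ..

lemma Span_carrier: "set Us \<subseteq> carrier_mat M M \<Longrightarrow> RM.Span KM Us \<subseteq> carrier_mat M M"
  using RM.Span_in_carrier[OF subfieldE(3)[OF KM_subfield], of Us] by (simp only: ring_mat_simps)

lemma finite_dimension_carrier: "RM.finite_dimension KM (carrier RM)"
proof -
  define el :: "nat \<times> nat \<Rightarrow> complex mat" where "el p = mat M M (\<lambda>q. if q = p then 1 else 0)" for p
  have elc: "el p \<in> carrier_mat M M" for p by (simp add: el_def)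
  \<comment> \<open>Stated for matrices supported on a list of positions, so that the induction can
    remove one position at a time.\<close>
  have sp: "A \<in> RM.Span KM (map el ps)"
    if "A \<in> carrier_mat M M" "\<And>x y. x < M \<Longrightarrow> y < M \<Longrightarrow> A $$ (x, y) \<noteq> 0 \<Longrightarrow> (x, y) \<in> set ps" "set ps \<subseteq> {..<M} \<times> {..<M}" for A ps
    using that
  proof (induction ps arbitrary: A)
    case Nil
    hence "A = 0\<^sub>m M M" by (intro eq_matI) auto
    thus ?case by (simp add: ring_mat_simps)
  next
    case (Cons p ps)
    define B where "B = mat M M (\<lambda>q. if q = p then 0 else A $$ q)"
    have "B \<in> RM.Span KM (map el ps)"
    proof (rule Cons.IH)
      show "(x, y) \<in> set ps" if "x < M" "y < M" "B $$ (x, y) \<noteq> 0" for x y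
        using that Cons.prems(2)[of x y] by (auto simp: B_def split: if_splits)
    qed (use Cons.prems in \<open>auto simp: B_def\<close>)
    moreover have "A = (A $$ p \<cdot>\<^sub>m 1\<^sub>m M) * el p + B"
      unfolding KM_mult[OF elc] using carrier_matD[OF Cons.prems(1)]
      by (intro eq_matI) (simp_all add: el_def B_def)
    hence "A = (A $$ p \<cdot>\<^sub>m 1\<^sub>m M) \<otimes>\<^bsub>RM\<^esub> el p \<oplus>\<^bsub>RM\<^esub> B" by (simp add: ring_mat_simps)
    moreover have "A $$ p \<cdot>\<^sub>m 1\<^sub>m M \<in> KM" by (simp add: KM_def)
    ultimately show ?case unfolding list.map RM.Span.simps foldr.simps o_apply RM.line_extension_mem_iff by blast
  qed
  let ?Us = "map el (List.product [0..<M] [0..<M])"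
  have Us: "set ?Us \<subseteq> carrier RM" using elc by (auto simp: ring_mat_simps)
  have "carrier RM \<subseteq> RM.Span KM ?Us" by (rule subsetI, rule sp) (auto simp: ring_mat_simps)
  moreover have "RM.Span KM ?Us \<subseteq> carrier RM"
    by (rule RM.Span_in_carrier[OF subfieldE(3)[OF KM_subfield] Us])
  ultimately have "RM.Span KM ?Us = carrier RM" by auto
  thus ?thesis using RM.Span_finite_dimension[OF KM_subfield Us] by simp
qed

text \<open>\<open>subalgebra\<close> means a linear subspace over \<open>KM\<close>, so this is the
  subspace criterion.\<close>

lemma subspace_subalgebra:
  assumes V: "V \<subseteq> carrier_mat M M" "V \<noteq> {}" and add: "\<And>X Y. X \<in> V \<Longrightarrow> Y \<in> V \<Longrightarrow> X + Y \<in> V"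
    and smult: "\<And>c X. X \<in> V \<Longrightarrow> c \<cdot>\<^sub>m X \<in> V"
  shows "subalgebra KM V RM"
proof (rule subalgebra.intro)
  have inv: "\<ominus>\<^bsub>RM\<^esub> X = (- 1) \<cdot>\<^sub>m X" if "X \<in> V" for X
  proof (rule RM.minus_equality)
    have "X \<in> carrier_mat M M" using V that by auto
    thus "(- 1) \<cdot>\<^sub>m X \<oplus>\<^bsub>RM\<^esub> X = \<zero>\<^bsub>RM\<^esub>" "X \<in> carrier RM" "(- 1) \<cdot>\<^sub>m X \<in> carrier RM"
      by (auto simp: ring_mat_simps intro!: eq_matI)
  qed
  show "subgroup V (add_monoid RM)"
  proof (rule RM.add.subgroupI)
    show "V \<subseteq> carrier RM" "V \<noteq> {}" using V by (auto simp: ring_mat_simps)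
    show "\<ominus>\<^bsub>RM\<^esub> a \<in> V" if "a \<in> V" for a using inv[OF that] smult[OF that] by simp
    show "a \<oplus>\<^bsub>RM\<^esub> b \<in> V" if "a \<in> V" "b \<in> V" for a b using add that by (simp add: ring_mat_simps)
  qed
  have "(c \<cdot>\<^sub>m 1\<^sub>m M) * v \<in> V" if "v \<in> V" for c v
    using KM_mult[of v c] smult[OF that, of c] V(1) that by auto
  thus "subalgebra_axioms KM V RM"
    by unfold_locales (auto simp: KM_def ring_mat_simps)
qed

lemma subspace_finite_dimension:
  assumes "subalgebra KM V RM"
  shows "RM.finite_dimension KM V"
  using RM.subalbegra_incl_imp_finite_dimension[OF KM_subfield finite_dimension_carrier assms RM.subalgebra_in_carrier[OF assms]] .

definition ipm :: "complex mat \<Rightarrow> complex mat \<Rightarrow> complex" where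
  "ipm A B = (\<Sum>x<M. \<Sum>y<M. A $$ (x, y) * cnj (B $$ (x, y)))"

lemma ipm_add_right: "B \<in> carrier_mat M M \<Longrightarrow> C \<in> carrier_mat M M \<Longrightarrow> ipm A (B + C) = ipm A B + ipm A C"
  by (simp add: ipm_def distrib_left sum.distrib)
lemma ipm_smult_right: "B \<in> carrier_mat M M \<Longrightarrow> ipm A (c \<cdot>\<^sub>m B) = cnj c * ipm A B"
  by (simp add: ipm_def sum_distrib_left mult_ac)
lemma ipm_minus_left: "A \<in> carrier_mat M M \<Longrightarrow> C \<in> carrier_mat M M \<Longrightarrow> ipm (A - C) B = ipm A B - ipm C B"
  by (simp add: ipm_def left_diff_distrib sum_subtractf)
lemma ipm_smult_left: "A \<in> carrier_mat M M \<Longrightarrow> ipm (c \<cdot>\<^sub>m A) B = c * ipm A B"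
  by (simp add: ipm_def sum_distrib_left mult_ac)

lemma ipm_self_zero:
  assumes A: "A \<in> carrier_mat M M" and z: "ipm A A = 0"
  shows "A = 0\<^sub>m M M"
proof (rule eq_matI)
  fix i j assume "i < dim_row (0\<^sub>m M M :: complex mat)" "j < dim_col (0\<^sub>m M M :: complex mat)"
  hence ij: "i < M" "j < M" by auto
  have p: "Re (z * cnj z) = (cmod z)\<^sup>2" for z by (simp add: complex_mult_cnj cmod_power2)
  have "(\<Sum>x<M. \<Sum>y<M. (cmod (A $$ (x, y)))\<^sup>2) = Re (ipm A A)"
    unfolding ipm_def Re_sum p ..
  hence "(\<Sum>x<M. \<Sum>y<M. (cmod (A $$ (x, y)))\<^sup>2) = 0" using z by simp
  hence "(\<Sum>y<M. (cmod (A $$ (i, y)))\<^sup>2) = 0"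
    using ij sum_nonneg_eq_0_iff[of "{..<M}" "\<lambda>x. \<Sum>y<M. (cmod (A $$ (x, y)))\<^sup>2"] by (simp add: sum_nonneg)
  hence "(cmod (A $$ (i, j)))\<^sup>2 = 0"
    using ij sum_nonneg_eq_0_iff[of "{..<M}" "\<lambda>y. (cmod (A $$ (i, y)))\<^sup>2"] by simp
  thus "A $$ (i, j) = 0\<^sub>m M M $$ (i, j)" using ij by simp
qed (use A in auto)

lemma ipm_Span:
  assumes "set Us \<subseteq> carrier_mat M M" "\<And>u. u \<in> set Us \<Longrightarrow> ipm Z u = 0" "Y \<in> RM.Span KM Us"
  shows "ipm Z Y = 0"
  using assms
proof (induction Us arbitrary: Y)
  case Nil
  hence "Y = 0\<^sub>m M M" by (simp add: ring_mat_simps)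
  thus ?case by (simp add: ipm_def)
next
  case (Cons u Us)
  from Cons.prems(3) obtain c v where v: "v \<in> RM.Span KM Us" "Y = (c \<cdot>\<^sub>m 1\<^sub>m M) \<otimes>\<^bsub>RM\<^esub> u \<oplus>\<^bsub>RM\<^esub> v"
    unfolding RM.Span.simps foldr.simps o_apply RM.line_extension_mem_iff KM_def by blast
  have uc: "u \<in> carrier_mat M M" using Cons.prems by simp
  have vc: "v \<in> carrier_mat M M"
    using Span_carrier[of Us] v(1) Cons.prems(1) by auto
  have "Y = c \<cdot>\<^sub>m u + v" using v(2) KM_mult[OF uc] by (simp add: ring_mat_simps)
  moreover have "ipm Z v = 0" using Cons.IH[OF _ _ v(1)] Cons.prems by simp
  ultimately show ?case using uc vc Cons.prems(2)[of u] by (simp add: ipm_add_right ipm_smult_right)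
qed

lemma gram_schmidt_Span:
  assumes "set Us \<subseteq> carrier_mat M M" "X \<in> carrier_mat M M"
  shows "\<exists>Y\<in>RM.Span KM Us. \<forall>u\<in>set Us. ipm (X - Y) u = 0"
  using assms
proof (induction Us arbitrary: X)
  case Nil thus ?case by simp
next
  case (Cons u Us)
  have Usc: "set Us \<subseteq> carrier_mat M M" and uc: "u \<in> carrier_mat M M" using Cons.prems by auto
  have Sc: "RM.Span KM Us \<subseteq> carrier_mat M M"
    by (rule Span_carrier[OF Usc])
  from Cons.IH[OF Usc uc] obtain Yu where Yu: "Yu \<in> RM.Span KM Us" "\<And>v. v \<in> set Us \<Longrightarrow> ipm (u - Yu) v = 0" by blast
  from Cons.IH[OF Usc Cons.prems(2)] obtain Y1 where Y1: "Y1 \<in> RM.Span KM Us" "\<And>v. v \<in> set Us \<Longrightarrow> ipm (X - Y1) v = 0" by blast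
  define u0 Z where "u0 = u - Yu" and "Z = X - Y1"
  have c: "Yu \<in> carrier_mat M M" "Y1 \<in> carrier_mat M M" using Yu(1) Y1(1) Sc by auto
  have cu0: "u0 \<in> carrier_mat M M" and cZ: "Z \<in> carrier_mat M M" using c uc Cons.prems by (auto simp: u0_def Z_def)
  have u0Y: "ipm u0 v = 0" if "v \<in> RM.Span KM Us" for v
    by (rule ipm_Span[OF Usc _ that]) (use Yu(2) in \<open>simp add: u0_def\<close>)
  have ZY: "ipm Z v = 0" if "v \<in> RM.Span KM Us" for v
    by (rule ipm_Span[OF Usc _ that]) (use Y1(2) in \<open>simp add: Z_def\<close>)
  have uu: "u = u0 + Yu" unfolding u0_def using uc c by (intro eq_matI) auto
  have Zu: "ipm Z u = ipm Z u0" by (subst uu) (simp add: ipm_add_right cu0 c ZY[OF Yu(1)])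
  \<comment> \<open>\<open>u0\<close> and \<open>Z\<close> are the residuals of \<open>u\<close> and
    \<open>X\<close> after projection to the span of \<open>Us\<close>. The list may be linearly
    dependent; then \<open>u0\<close> can be zero, and the coefficient 0 serves.\<close>
  define a where "a = (if ipm u0 u0 = 0 then 0 else ipm Z u0 / ipm u0 u0)"
  have key: "ipm Z u0 = a * ipm u0 u0"
  proof (cases "ipm u0 u0 = 0")
    case True
    hence "u0 = 0\<^sub>m M M" by (rule ipm_self_zero[OF cu0])
    thus ?thesis by (simp add: ipm_def)
  qed (simp add: a_def)
  define Y where "Y = a \<cdot>\<^sub>m u + (Y1 + (- a) \<cdot>\<^sub>m Yu)"
  have sub: "subalgebra KM (RM.Span KM Us) RM"
    by (rule RM.Span_is_subalgebra[OF KM_subfield]) (use Usc in \<open>simp add: ring_mat_simps\<close>)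
  have w: "Y1 + (- a) \<cdot>\<^sub>m Yu \<in> RM.Span KM Us"
  proof -
    have "((- a) \<cdot>\<^sub>m 1\<^sub>m M) \<otimes>\<^bsub>RM\<^esub> Yu \<in> RM.Span KM Us"
      by (rule subalgebra.smult_closed[OF sub _ Yu(1)]) (simp add: KM_def)
    hence "(- a) \<cdot>\<^sub>m Yu \<in> RM.Span KM Us" using KM_mult[OF c(1)] by (simp add: ring_mat_simps)
    from subgroup.m_closed[OF subalgebra.axioms(1)[OF sub] Y1(1) this] show ?thesis by (simp add: ring_mat_simps)
  qed
  have "Y = (a \<cdot>\<^sub>m 1\<^sub>m M) \<otimes>\<^bsub>RM\<^esub> u \<oplus>\<^bsub>RM\<^esub> (Y1 + (- a) \<cdot>\<^sub>m Yu)"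
    using KM_mult[OF uc] by (simp add: Y_def ring_mat_simps)
  moreover have "a \<cdot>\<^sub>m 1\<^sub>m M \<in> KM" by (simp add: KM_def)
  ultimately have "Y \<in> RM.Span KM (u # Us)"
    using w unfolding RM.Span.simps foldr.simps o_apply RM.line_extension_mem_iff by blast
  moreover have XY: "X - Y = Z - a \<cdot>\<^sub>m u0"
    unfolding Y_def Z_def u0_def using c uc Cons.prems by (intro eq_matI) (auto simp: algebra_simps)
  have "ipm (X - Y) v = 0" if "v \<in> set (u # Us)" for v
  proof (cases "v = u")
    case True
    have "ipm u0 u = ipm u0 u0" by (subst uu) (simp add: ipm_add_right cu0 c u0Y[OF Yu(1)])
    thus ?thesis unfolding XY True using cu0 cZ Zu key by (simp add: ipm_minus_left ipm_smult_left)
  next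
    case False
    hence "v \<in> set Us" using that by simp
    thus ?thesis unfolding XY using cu0 cZ Yu(2) Y1(2) by (simp add: ipm_minus_left ipm_smult_left u0_def Z_def)
  qed
  ultimately show ?case by blast
qed

lemma orthogonal_projection:
  assumes sub: "subalgebra KM V RM" and X: "X \<in> carrier_mat M M"
  shows "\<exists>Y\<in>V. \<forall>Z\<in>V. ipm (X - Y) Z = 0"
proof -
  obtain d where "RM.dimension d KM V" using subspace_finite_dimension[OF sub] by auto
  then obtain Us where Us: "set Us \<subseteq> carrier RM" "RM.Span KM Us = V"
    using RM.exists_base[OF KM_subfield] by metis
  have Usc: "set Us \<subseteq> carrier_mat M M" using Us(1) by (simp add: ring_mat_simps)
  from gram_schmidt_Span[OF this X] obtain Y where Y: "Y \<in> V" "\<forall>u\<in>set Us. ipm (X - Y) u = 0"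
    unfolding Us(2) by blast
  thus ?thesis using ipm_Span[OF Usc, of "X - Y"] unfolding Us(2) by blast
qed

end

section \<open>Brauer diagrams and the commutant\<close>

text \<open>The positions below \<open>n\<close> carry the row of an operator, the next
  \<open>n\<close> positions carry its column with each digit replaced by its partner, as the dual
  basis with respect to the form requires.\<close>

definition lo :: "nat \<Rightarrow> (nat \<Rightarrow> nat) \<Rightarrow> nat \<Rightarrow> nat" where
  "lo n F = (\<lambda>j. if j < n then F j else 0)"
definition hi :: "nat \<Rightarrow> (nat \<Rightarrow> nat) \<Rightarrow> nat \<Rightarrow> nat" where
  "hi n F = (\<lambda>j. if j < n then partner (F (n + j)) else 0)"
definition merge :: "nat \<Rightarrow> (nat \<Rightarrow> nat) \<Rightarrow> (nat \<Rightarrow> nat) \<Rightarrow> nat \<Rightarrow> nat" where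
  "merge n f g = (\<lambda>j. if j < n then f j else if j < n + n then partner (g (j - n)) else 0)"
definition eta_prod :: "nat \<Rightarrow> (nat \<Rightarrow> nat) \<Rightarrow> complex" where
  "eta_prod n g = (\<Prod>j<n. eta (g j))"

type_synonym kern = "(nat \<Rightarrow> nat) \<Rightarrow> (nat \<Rightarrow> nat) \<Rightarrow> complex"

text \<open>
  The symplectic form identifies $V'$ with its dual and turns the kernel of an operator on
  $V^{\otimes n}$ into a tensor in $V^{\otimes 2n}$; \<open>untwist\<close> is the inverse.
\<close>

definition twist :: "nat \<Rightarrow> kern \<Rightarrow> (nat \<Rightarrow> nat) \<Rightarrow> complex" where
  "twist n K F = eta_prod n (hi n F) * K (lo n F) (hi n F)"
definition untwist :: "nat \<Rightarrow> ((nat \<Rightarrow> nat) \<Rightarrow> complex) \<Rightarrow> kern" where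
  "untwist n d f g = eta_prod n g * d (merge n f g)"

lemma eta_prod_upd: "l < n \<Longrightarrow> eta_prod n (g(l := b)) = eta_prod n g * eta (g l) * eta b"
proof -
  assume l: "l < n"
  have "eta_prod n h = eta (h l) * (\<Prod>j\<in>{..<n} - {l}. eta (h j))" for h
    unfolding eta_prod_def using l by (intro prod.remove) auto
  from this[of g] this[of "g(l := b)"] show ?thesis by (simp add: mult_ac)
qed

lemma eta_prod_eta_prod [simp]: "eta_prod n g * eta_prod n g = 1"
  by (simp add: eta_prod_def flip: prod.distrib)
lemma cnj_eta_prod [simp]: "cnj (eta_prod n g) = eta_prod n g" by (simp add: eta_prod_def)
lemma eta_prod_nz [simp]: "eta_prod n g \<noteq> 0" using eta_prod_eta_prod[of n g] by (metis mult_zero_left zero_neq_one)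

lemma sum_lessThan_double: "(\<Sum>l<n + m. h l) = (\<Sum>l<n. h l) + (\<Sum>l<m. h (n + l :: nat) :: complex)"
  by (induction m) (simp_all add: add.assoc)

lemma lo_idx: "0 < N \<Longrightarrow> F \<in> idx N (n + n) \<Longrightarrow> lo n F \<in> idx N n"
  by (auto simp: lo_def idx_def)
lemma hi_idx: "F \<in> idx (2 * k + 1) (n + n) \<Longrightarrow> hi n F \<in> idx (2 * k + 1) n"
  unfolding idx_def mem_Collect_eq hi_def using partner_less[of _ k] by simp
lemma merge_idx: "f \<in> idx (2 * k + 1) n \<Longrightarrow> g \<in> idx (2 * k + 1) n \<Longrightarrow> merge n f g \<in> idx (2 * k + 1) (n + n)"
  unfolding idx_def mem_Collect_eq merge_def using partner_less[of _ k] by simp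
lemma lo_merge: "f \<in> idx N n \<Longrightarrow> lo n (merge n f g) = f"
  by (auto simp: lo_def merge_def idx_def fun_eq_iff)
lemma hi_merge: "g \<in> idx N n \<Longrightarrow> hi n (merge n f g) = g"
  by (auto simp: hi_def merge_def idx_def fun_eq_iff)
lemma merge_lo_hi: "F \<in> idx N (n + n) \<Longrightarrow> merge n (lo n F) (hi n F) = F"
  by (auto simp: hi_def lo_def merge_def idx_def fun_eq_iff)

lemma merge_upd_left: "i < n \<Longrightarrow> (merge n f g)(i := b) = merge n (f(i := b)) g"
  by (auto simp: merge_def fun_eq_iff)
lemma merge_upd_right: "j < n \<Longrightarrow> (merge n f g)(n + j := b) = merge n f (g(j := partner b))"
  by (auto simp: merge_def fun_eq_iff)
lemma merge_left: "i < n \<Longrightarrow> merge n f g i = f i" by (simp add: merge_def)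
lemma merge_right: "j < n \<Longrightarrow> merge n f g (n + j) = partner (g j)" by (simp add: merge_def)

lemma twist_pairing:
  "(\<Sum>F\<in>idx (2*k+1) (n + n). twist n K F * d F) = (\<Sum>f\<in>idx (2*k+1) n. \<Sum>g\<in>idx (2*k+1) n. K f g * untwist n d f g)"
proof -
  let ?I = "idx (2*k+1) n"
  have "(\<Sum>F\<in>idx (2*k+1) (n + n). twist n K F * d F) = (\<Sum>(f, g)\<in>?I \<times> ?I. K f g * untwist n d f g)"
  proof (rule sum.reindex_bij_witness[of _ "\<lambda>(f, g). merge n f g" "\<lambda>F. (lo n F, hi n F)"], goal_cases)
    case (1 F) thus ?case by (simp add: merge_lo_hi)
  next
    case (2 F) thus ?case by (simp add: lo_idx hi_idx[simplified])
  next
    case (3 p) thus ?case by (auto simp: lo_merge hi_merge)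
  next
    case (4 p) thus ?case using merge_idx by auto
  next
    case (5 F) thus ?case by (simp add: merge_lo_hi twist_def untwist_def mult_ac)
  qed
  thus ?thesis by (simp add: sum.cartesian_product)
qed

text \<open>At an upper position the index is the partner of a column digit, so $E_{ac}$ turns into
  the matrix unit of the partners there; the signs come from the one factor of
  \<open>eta_prod\<close> that changes.\<close>

lemma twist_site_sum:
  assumes a: "a \<noteq> 0" and c: "c \<noteq> 0"
  shows "(\<Sum>l<n + n. site a c l (twist n K) F) = eta_prod n (hi n F) *
     ((\<Sum>l<n. site a c l (\<lambda>f. K f (hi n F)) (lo n F)) + eta a * eta c * (\<Sum>l<n. site (partner a) (partner c) l (K (lo n F)) (hi n F)))"
proof -
  have 1: "site a c l (twist n K) F = eta_prod n (hi n F) * site a c l (\<lambda>f. K f (hi n F)) (lo n F)" if l: "l < n" for l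
  proof -
    have "lo n (F(l := c)) = (lo n F)(l := c)" "hi n (F(l := c)) = hi n F" "lo n F l = F l"
      using l by (auto simp: lo_def hi_def fun_eq_iff)
    thus ?thesis by (simp add: site_def twist_def)
  qed
  have 2: "site a c (n + l) (twist n K) F = eta_prod n (hi n F) * (eta a * eta c * site (partner a) (partner c) l (K (lo n F)) (hi n F))" if l: "l < n" for l
  proof -
    have e: "lo n (F(n + l := c)) = lo n F" "hi n (F(n + l := c)) = (hi n F)(l := partner c)" "hi n F l = partner (F (n + l))"
      using l by (auto simp: lo_def hi_def fun_eq_iff)
    show ?thesis
    proof (cases "F (n + l) = a")
      case True
      have "eta_prod n ((hi n F)(l := partner c)) = eta_prod n (hi n F) * (eta a * eta c)"
        using l True e(3) eta_partner[OF a] eta_partner[OF c] by (simp add: eta_prod_upd)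
      thus ?thesis using True e by (simp add: site_def twist_def)
    next
      case False
      thus ?thesis using e by (simp add: site_def)
    qed
  qed
  have "(\<Sum>l<n + n. site a c l (twist n K) F) = (\<Sum>l<n. eta_prod n (hi n F) * site a c l (\<lambda>f. K f (hi n F)) (lo n F))
     + (\<Sum>l<n. eta_prod n (hi n F) * (eta a * eta c * site (partner a) (partner c) l (K (lo n F)) (hi n F)))"
    unfolding sum_lessThan_double by (intro arg_cong2[of _ _ _ _ "(+)"] sum.cong refl) (simp_all add: 1 2)
  thus ?thesis by (simp add: sum_distrib_left distrib_left)
qed

text \<open>Disjoint arcs act at different positions. If they share a position both sides vanish,
  because the inner arc needs a nonzero digit where the outer one has put 0.\<close>

lemma arc_commute:
  assumes "i \<noteq> j" "i' \<noteq> j'"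
  shows "arc i j (arc i' j' d) = arc i' j' (arc i j d)"
proof
  fix F
  show "arc i j (arc i' j' d) F = arc i' j' (arc i j d) F"
  proof (cases "{i, j} \<inter> {i', j'} = {}")
    case True
    hence "F(i := 0, j := 0, i' := 0, j' := 0) = F(i' := 0, j' := 0, i := 0, j := 0)"
      by (auto simp: fun_eq_iff)
    thus ?thesis using True by (auto simp: arc_def)
  next
    case False
    have "arc a b (arc a' b' d) F = 0" if "a \<noteq> b" "a' \<noteq> b'" "{a, b} \<inter> {a', b'} \<noteq> {}" for a b a' b'
      using that by (auto simp: arc_def)
    thus ?thesis using False assms by (metis inf_commute)
  qed
qed

text \<open>
  Lines are added first: a diagram is then a partial permutation followed or preceded by insertions
  and contractions.  Arcs on occupied positions give the zero function.
\<close>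

inductive_set lines :: "nat \<Rightarrow> ((nat \<Rightarrow> nat) \<Rightarrow> complex) set" for n where
  lines_0: "(\<lambda>F. if F = (\<lambda>_. 0) then 1 else 0) \<in> lines n"
| lines_arc: "d \<in> lines n \<Longrightarrow> i < n \<Longrightarrow> j < n \<Longrightarrow> arc i (n + j) d \<in> lines n"

inductive_set diagrams :: "nat \<Rightarrow> ((nat \<Rightarrow> nat) \<Rightarrow> complex) set" for n where
  diagrams_lines: "d \<in> lines n \<Longrightarrow> d \<in> diagrams n"
| diagrams_left: "d \<in> diagrams n \<Longrightarrow> i < j \<Longrightarrow> j < n \<Longrightarrow> arc i j d \<in> diagrams n"
| diagrams_right: "d \<in> diagrams n \<Longrightarrow> i < j \<Longrightarrow> j < n \<Longrightarrow> arc (n + i) (n + j) d \<in> diagrams n"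

text \<open>Lines have to be added first in \<open>diagrams\<close>, but since arcs commute a later
  line can be pulled inside.\<close>

lemma diagrams_line: "d \<in> diagrams n \<Longrightarrow> i < n \<Longrightarrow> j < n \<Longrightarrow> arc i (n + j) d \<in> diagrams n"
proof (induction rule: diagrams.induct)
  case (diagrams_lines d)
  thus ?case by (intro diagrams.diagrams_lines lines_arc)
next
  case (diagrams_left d i' j')
  have "arc i (n + j) (arc i' j' d) = arc i' j' (arc i (n + j) d)"
    using diagrams_left.hyps diagrams_left.prems by (intro arc_commute) auto
  thus ?case using diagrams_left diagrams.diagrams_left by simp
next
  case (diagrams_right d i' j')
  have "arc i (n + j) (arc (n + i') (n + j') d) = arc (n + i') (n + j') (arc i (n + j) d)"
    using diagrams_right.hyps diagrams_right.prems by (intro arc_commute) auto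
  thus ?case using diagrams_right diagrams.diagrams_right by simp
qed

lemma diagrams_arc:
  assumes d: "d \<in> diagrams n" and ij: "i < j" "j < n + n"
  shows "arc i j d \<in> diagrams n"
proof -
  consider "j < n" | "i < n" "n \<le> j" | "n \<le> i" by linarith
  thus ?thesis
  proof cases
    case 1 thus ?thesis using diagrams_left[OF d ij(1)] by simp
  next
    case 2
    thus ?thesis using diagrams_line[OF d, of i "j - n"] ij by simp
  next
    case 3
    thus ?thesis using diagrams_right[OF d, of "i - n" "j - n"] ij by simp
  qed
qed

lemma cnj_arc: "(\<And>F. cnj (d F) = d F) \<Longrightarrow> cnj (arc i j d F) = arc i j d F"
  by (simp add: arc_def)

lemma cnj_lines: "d \<in> lines n \<Longrightarrow> cnj (d F) = d F"
  by (induction arbitrary: F rule: lines.induct) (simp_all add: cnj_arc)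

text \<open>Diagrams are real, so Hermitian orthogonality to them is the bilinear orthogonality
  required in \<open>lie_inv_eq_zero\<close>.\<close>

lemma cnj_diagrams: "d \<in> diagrams n \<Longrightarrow> cnj (d F) = d F"
  by (induction arbitrary: F rule: diagrams.induct) (simp_all add: cnj_arc cnj_lines)

text \<open>A line joins the column position \<open>j\<close> to the row position
  \<open>\<sigma> j\<close> for each \<open>j\<close> in \<open>Z\<close>; at all other positions
  both rows and columns carry $v_o$.\<close>

definition partial_perm :: "nat \<Rightarrow> (nat \<Rightarrow> nat) \<Rightarrow> nat set \<Rightarrow> kern" where
  "partial_perm n \<sigma> Z f g = (if (\<forall>j<n. f (\<sigma> j) = g j) \<and> (\<forall>j<n. j \<in> Z \<longleftrightarrow> g j \<noteq> 0) then 1 else 0)"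

text \<open>The sign of the arc and the factor that \<open>eta_prod\<close> loses are
  \<open>eta\<close> of the same digit, so a line carries no sign.\<close>

lemma untwist_line:
  assumes ij: "i < n" "j < n"
  shows "untwist n (arc i (n + j) d) f g = (if f i \<noteq> 0 \<and> g j = f i then untwist n d (f(i := 0)) (g(j := 0)) else 0)"
proof -
  have u: "(merge n f g)(i := 0, n + j := 0) = merge n (f(i := 0)) (g(j := 0))"
    using ij by (simp add: merge_upd_left merge_upd_right)
  have w: "eta_prod n (g(j := 0)) = eta_prod n g * eta (g j)" using ij by (simp add: eta_prod_upd)
  show ?thesis using ij by (auto simp: untwist_def arc_def u w merge_left merge_right mult_ac)
qed

lemma untwist_left:
  assumes ij: "i < n" "j < n"
  shows "untwist n (arc i j d) f g = arc i j (\<lambda>f. untwist n d f g) f"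
  using ij by (auto simp: untwist_def arc_def merge_left merge_upd_left)

text \<open>Two signs compensate: passing to partners reverses the sign of the form, and the two
  factors removed from \<open>eta_prod\<close> have product -1.\<close>

lemma untwist_right:
  assumes ij: "i < n" "j < n" "i \<noteq> j"
  shows "untwist n (arc (n + i) (n + j) d) f g = arc i j (\<lambda>g. untwist n d f g) g"
proof (cases "g i \<noteq> 0 \<and> g j = partner (g i)")
  case True
  have u: "(merge n f g)(n + i := 0, n + j := 0) = merge n f (g(i := 0, j := 0))"
    using ij by (simp add: merge_upd_right)
  have "eta_prod n (g(i := 0, j := 0)) = eta_prod n g * eta (g i) * eta (g j)"
    using ij by (simp add: eta_prod_upd)
  hence "eta_prod n (g(i := 0, j := 0)) = - eta_prod n g" using True eta_partner[of "g i"] by (simp add: mult.assoc)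
  thus ?thesis using True ij eta_partner[of "g i"] by (simp add: untwist_def arc_def merge_right u)
next
  case False
  thus ?thesis using ij partner_swap[of "g j" "g i"] by (auto simp: untwist_def arc_def merge_right)
qed

text \<open>Induction over the lines. A new line between \<open>i\<close> and \<open>j\<close> adds
  \<open>j\<close> to \<open>Z\<close>, and a transposition corrects the permutation so that it
  sends \<open>j\<close> to \<open>i\<close>. If one end is already occupied, the result is
  zero.\<close>

lemma untwist_lines:
  assumes "d \<in> lines n"
  shows "(\<forall>f\<in>idx N n. \<forall>g\<in>idx N n. untwist n d f g = 0) \<or>
    (\<exists>\<sigma> Z. \<sigma> permutes {..<n} \<and> (\<forall>f\<in>idx N n. \<forall>g\<in>idx N n. untwist n d f g = partial_perm n \<sigma> Z f g))"
  using assms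
proof (induction rule: lines.induct)
  case lines_0
  have "untwist n (\<lambda>F. if F = (\<lambda>_. 0) then 1 else 0) f g = partial_perm n id {} f g"
    if fg: "f \<in> idx N n" "g \<in> idx N n" for f g
  proof -
    have "merge n f g = (\<lambda>_. 0) \<longleftrightarrow> f = (\<lambda>_. 0) \<and> g = (\<lambda>_. 0)"
    proof
      assume a: "merge n f g = (\<lambda>_. 0)"
      have "f = lo n (\<lambda>_. 0)" "g = hi n (\<lambda>_. 0)" using lo_merge[OF fg(1), of g] hi_merge[OF fg(2), of f] a by auto
      thus "f = (\<lambda>_. 0) \<and> g = (\<lambda>_. 0)" by (auto simp: lo_def hi_def)
    qed (auto simp: merge_def)
    moreover have "(\<forall>j<n. f (id j) = g j) \<and> (\<forall>j<n. j \<in> {} \<longleftrightarrow> g j \<noteq> 0) \<longleftrightarrow> f = (\<lambda>_. 0) \<and> g = (\<lambda>_. 0)"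
    proof
      assume a: "(\<forall>j<n. f (id j) = g j) \<and> (\<forall>j<n. j \<in> {} \<longleftrightarrow> g j \<noteq> 0)"
      have "f j = 0 \<and> g j = 0" for j using a fg by (cases "j < n") (auto simp: idx_def)
      thus "f = (\<lambda>_. 0) \<and> g = (\<lambda>_. 0)" by auto
    qed auto
    moreover have "eta_prod n (\<lambda>_. 0) = 1" by (simp add: eta_prod_def)
    ultimately show ?thesis unfolding untwist_def partial_perm_def by auto
  qed
  thus ?case using permutes_id by blast
next
  case (lines_arc d i j)
  from lines_arc.IH show ?case
  proof
    assume z: "\<forall>f\<in>idx N n. \<forall>g\<in>idx N n. untwist n d f g = 0"
    have "untwist n (arc i (n + j) d) f g = 0" if fg: "f \<in> idx N n" "g \<in> idx N n" for f g
    proof -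
      have "f(i := 0) \<in> idx N n" "g(j := 0) \<in> idx N n" using fg by (auto simp: idx_def)
      thus ?thesis using z lines_arc.hyps by (simp add: untwist_line)
    qed
    thus ?case by blast
  next
    assume "\<exists>\<sigma> Z. \<sigma> permutes {..<n} \<and> (\<forall>f\<in>idx N n. \<forall>g\<in>idx N n. untwist n d f g = partial_perm n \<sigma> Z f g)"
    then obtain \<sigma> Z where sp: "\<sigma> permutes {..<n}" and u: "\<forall>f\<in>idx N n. \<forall>g\<in>idx N n. untwist n d f g = partial_perm n \<sigma> Z f g"
      by blast
    have u': "untwist n (arc i (n + j) d) f g = (if f i \<noteq> 0 \<and> g j = f i then partial_perm n \<sigma> Z (f(i := 0)) (g(j := 0)) else 0)"
      if fg: "f \<in> idx N n" "g \<in> idx N n" for f g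
    proof -
      have "f(i := 0) \<in> idx N n" "g(j := 0) \<in> idx N n" using fg by (auto simp: idx_def)
      thus ?thesis using u lines_arc.hyps by (simp add: untwist_line)
    qed
    \<comment> \<open>The column position that the present permutation joins to \<open>i\<close>;
      \<open>i\<close> is occupied exactly if \<open>j'\<close> belongs to \<open>Z\<close>.\<close>
    define j' where "j' = inv_into UNIV \<sigma> i"
    have sj': "\<sigma> j' = i" unfolding j'_def using permutes_inverses(1)[OF sp] .
    have j'n: "j' < n" using permutes_in_image[OF sp, of j'] sj' lines_arc.hyps by simp
    have inj: "\<sigma> m = i \<longleftrightarrow> m = j'" for m using sj' permutes_inj[OF sp] by (auto dest: injD)
    show ?case
    proof (cases "j \<in> Z \<or> j' \<in> Z")
      case True
      have "partial_perm n \<sigma> Z (f(i := 0)) (g(j := 0)) = 0" for f g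
      proof -
        have "\<not> ((\<forall>m<n. (f(i := 0)) (\<sigma> m) = (g(j := 0)) m) \<and> (\<forall>m<n. m \<in> Z \<longleftrightarrow> (g(j := 0)) m \<noteq> 0))"
        proof
          assume a: "(\<forall>m<n. (f(i := 0)) (\<sigma> m) = (g(j := 0)) m) \<and> (\<forall>m<n. m \<in> Z \<longleftrightarrow> (g(j := 0)) m \<noteq> 0)"
          hence "j \<notin> Z" using lines_arc.hyps by auto
          moreover have "(g(j := 0)) j' = (f(i := 0)) (\<sigma> j')" using a j'n by auto
          hence "(g(j := 0)) j' = 0" by (simp add: sj')
          hence "j' \<notin> Z" using a j'n by metis
          ultimately show False using True by blast
        qed
        thus ?thesis unfolding partial_perm_def by (simp only: if_False)
      qed
      thus ?thesis using u' by simp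
    next
      case False
      define \<tau> where "\<tau> = Transposition.transpose j j'"
      define \<sigma>' where "\<sigma>' = \<sigma> \<circ> \<tau>"
      have sp': "\<sigma>' permutes {..<n}" unfolding \<sigma>'_def \<tau>_def
        using lines_arc.hyps j'n by (intro permutes_compose permutes_swap_id sp) auto
      have s1: "\<sigma>' j = i" by (simp add: \<sigma>'_def \<tau>_def sj')
      have s2: "\<sigma>' j' = \<sigma> j" by (simp add: \<sigma>'_def \<tau>_def)
      have s3: "\<sigma>' m = \<sigma> m" if "m \<noteq> j" "m \<noteq> j'" for m using that by (simp add: \<sigma>'_def \<tau>_def Transposition.transpose_def)
      \<comment> \<open>Both sides require agreement along the new permutation and nonzero digits
        exactly on \<open>insert j Z\<close>. The delicate position is \<open>j'\<close>: unless it
        equals \<open>j\<close>, its column digit and the row digit now assigned to it are both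
        0.\<close>
      have "(f i \<noteq> 0 \<and> g j = f i \<and> (\<forall>m<n. (f(i := 0)) (\<sigma> m) = (g(j := 0)) m) \<and> (\<forall>m<n. m \<in> Z \<longleftrightarrow> (g(j := 0)) m \<noteq> 0)) \<longleftrightarrow>
        ((\<forall>m<n. f (\<sigma>' m) = g m) \<and> (\<forall>m<n. m \<in> insert j Z \<longleftrightarrow> g m \<noteq> 0))" (is "?L \<longleftrightarrow> ?R") for f g
      proof
        assume L: ?L
        hence Lf: "(f(i := 0)) (\<sigma> m) = (g(j := 0)) m" if "m < n" for m using that by blast
        have LZ: "m \<in> Z \<longleftrightarrow> (g(j := 0)) m \<noteq> 0" if "m < n" for m using L that by blast
        have "f (\<sigma>' m) = g m" if m: "m < n" for m
        proof (cases "m = j")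
          case True thus ?thesis using L s1 by simp
        next
          case mj: False
          have gm: "g m = 0" if "m = j'" using LZ[OF m] False that mj by simp
          show ?thesis
          proof (cases "m = j'")
            case True
            hence "\<sigma> j \<noteq> i" using inj mj by auto
            hence "f (\<sigma> j) = 0" using Lf[of j] lines_arc.hyps by simp
            thus ?thesis using True s2 gm by simp
          next
            case F2: False
            have "\<sigma> m \<noteq> i" using inj F2 by simp
            thus ?thesis using Lf[OF m] mj s3[OF mj F2] by simp
          qed
        qed
        moreover have "m \<in> insert j Z \<longleftrightarrow> g m \<noteq> 0" if m: "m < n" for m
          using LZ[OF m] L by (cases "m = j") auto
        ultimately show ?R by blast
      next
        assume R: ?R
        hence Rf: "f (\<sigma>' m) = g m" if "m < n" for m using that by blast
        have RZ: "m \<in> insert j Z \<longleftrightarrow> g m \<noteq> 0" if "m < n" for m using R that by blast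
        have gj: "g j \<noteq> 0" using RZ[of j] lines_arc.hyps by simp
        have fi: "f i = g j" using Rf[of j] s1 lines_arc.hyps by simp
        have "(f(i := 0)) (\<sigma> m) = (g(j := 0)) m" if m: "m < n" for m
        proof (cases "m = j'")
          case True
          have "j' = j \<or> g j' = 0" using RZ[OF j'n] False by auto
          thus ?thesis using True sj' by auto
        next
          case F2: False
          hence si: "\<sigma> m \<noteq> i" using inj by simp
          show ?thesis
          proof (cases "m = j")
            case True
            hence "g j' = 0" using RZ[OF j'n] False F2 by auto
            hence "f (\<sigma> j) = 0" using Rf[OF j'n] s2 by simp
            thus ?thesis using True si by simp
          next
            case mj: False
            thus ?thesis using si Rf[OF m] s3[OF mj F2] by simp
          qed
        qed
        moreover have "m \<in> Z \<longleftrightarrow> (g(j := 0)) m \<noteq> 0" if m: "m < n" for m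
          using RZ[OF m] False by (cases "m = j") auto
        ultimately show ?L using gj fi by auto
      qed
      hence "(if f i \<noteq> 0 \<and> g j = f i then partial_perm n \<sigma> Z (f(i := 0)) (g(j := 0)) else 0) = partial_perm n \<sigma>' (insert j Z) f g" for f g
        unfolding partial_perm_def by (smt (verit, best))
      thus ?thesis using u' sp' by metis
    qed
  qed
qed

section \<open>The diagrams lie in the algebra and detect the commutant\<close>

context at_one
begin

definition diagram_mat :: "nat \<Rightarrow> ((nat \<Rightarrow> nat) \<Rightarrow> complex) \<Rightarrow> complex mat" where
  "diagram_mat n d = mat (N ^ n) (N ^ n) (\<lambda>(x, y). untwist n d (dgt N x) (dgt N y))"

lemma diagram_mat_carrier: "diagram_mat n d \<in> carrier_mat (N ^ n) (N ^ n)"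
  by (simp add: diagram_mat_def)

lemma diagram_mat_index: "x < N ^ n \<Longrightarrow> y < N ^ n \<Longrightarrow> diagram_mat n d $$ (x, y) = untwist n d (dgt N x) (dgt N y)"
  by (simp add: diagram_mat_def)

lemma partial_perm_adapted_alg:
  assumes n: "n \<ge> 1" and sp: "\<sigma> permutes {..<n}"
  shows "mat (N ^ n) (N ^ n) (\<lambda>(x, y). partial_perm n \<sigma> Z (dgt N x) (dgt N y)) \<in> adapted_alg n c"
proof -
  have "adapted_op n c (\<lambda>v f. if \<forall>j<n. j \<in> Z \<longleftrightarrow> (f \<circ> \<sigma>) j \<noteq> 0 then v (f \<circ> \<sigma>) else 0)"
    by (rule adapted_op_comp[OF adapted_op_perm[OF sp] adapted_op_diag[OF n]])
  then obtain X where X: "X \<in> adapted_alg n c" "opr N n X (\<lambda>v f. if \<forall>j<n. j \<in> Z \<longleftrightarrow> (f \<circ> \<sigma>) j \<noteq> 0 then v (f \<circ> \<sigma>) else 0)"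
    unfolding adapted_op_def by blast
  have "X = mat (N ^ n) (N ^ n) (\<lambda>(x, y). partial_perm n \<sigma> Z (dgt N x) (dgt N y))"
  proof (rule eq_matI)
    fix x y assume "x < dim_row (mat (N ^ n) (N ^ n) (\<lambda>(x, y). partial_perm n \<sigma> Z (dgt N x) (dgt N y)))"
      "y < dim_col (mat (N ^ n) (N ^ n) (\<lambda>(x, y). partial_perm n \<sigma> Z (dgt N x) (dgt N y)))"
    hence xy: "x < N ^ n" "y < N ^ n" by auto
    let ?f = "dgt N x" and ?g = "dgt N y"
    have fg: "?f \<in> idx N n" "?g \<in> idx N n" using dgt_idx[OF N_pos] xy by auto
    have "?f \<circ> \<sigma> = ?g \<longleftrightarrow> (\<forall>j<n. ?f (\<sigma> j) = ?g j)"
    proof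
      assume a: "\<forall>j<n. ?f (\<sigma> j) = ?g j"
      show "?f \<circ> \<sigma> = ?g"
      proof
        fix j show "(?f \<circ> \<sigma>) j = ?g j"
          using a fg permutes_not_in[OF sp, of j] by (cases "j < n") (auto simp: idx_def)
      qed
    qed (metis o_apply)
    moreover have "X $$ (x, y) = (if \<forall>j<n. j \<in> Z \<longleftrightarrow> (?f \<circ> \<sigma>) j \<noteq> 0 then (if ?f \<circ> \<sigma> = ?g then 1 else 0) else 0)"
      by (rule opr_index[OF X(2) xy])
    ultimately have "X $$ (x, y) = partial_perm n \<sigma> Z ?f ?g"
      unfolding partial_perm_def by (smt (verit, best) o_apply)
    thus "X $$ (x, y) = mat (N ^ n) (N ^ n) (\<lambda>(x, y). partial_perm n \<sigma> Z (dgt N x) (dgt N y)) $$ (x, y)" using xy by simp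
  qed (use opr_carrier[OF X(2)] in auto)
  thus ?thesis using X(1) by simp
qed

lemma diagram_mat_lines_adapted_alg:
  assumes n: "n \<ge> 1" and d: "d \<in> lines n"
  shows "diagram_mat n d \<in> adapted_alg n c"
  using untwist_lines[OF d, of N]
proof
  assume z: "\<forall>f\<in>idx N n. \<forall>g\<in>idx N n. untwist n d f g = 0"
  have "diagram_mat n d = 0 \<cdot>\<^sub>m 1\<^sub>m (N ^ n)"
    using z dgt_idx[OF N_pos] by (intro eq_matI) (auto simp: diagram_mat_def)
  thus ?thesis using adapted_alg_smult[OF n adapted_alg_one, where a = 0 and c = c] by simp
next
  assume "\<exists>\<sigma> Z. \<sigma> permutes {..<n} \<and> (\<forall>f\<in>idx N n. \<forall>g\<in>idx N n. untwist n d f g = partial_perm n \<sigma> Z f g)"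
  then obtain \<sigma> Z where s: "\<sigma> permutes {..<n}" "\<forall>f\<in>idx N n. \<forall>g\<in>idx N n. untwist n d f g = partial_perm n \<sigma> Z f g" by blast
  have "diagram_mat n d = mat (N ^ n) (N ^ n) (\<lambda>(x, y). partial_perm n \<sigma> Z (dgt N x) (dgt N y))"
    using s(2) dgt_idx[OF N_pos] by (intro eq_matI) (auto simp: diagram_mat_def)
  thus ?thesis using partial_perm_adapted_alg[OF n s(1)] by simp
qed

text \<open>An arc among the rows is left multiplication by an insertion, an arc among the columns
  is right multiplication by the transpose of an insertion. This is what the closure under
  transposition is for.\<close>

lemma diagram_mat_adapted_alg:
  assumes n: "n \<ge> 1" and c: "c \<noteq> 0" and d: "d \<in> diagrams n"
  shows "diagram_mat n d \<in> adapted_alg n c"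
  using d
proof (induction rule: diagrams.induct)
  case (diagrams_lines d)
  thus ?case by (rule diagram_mat_lines_adapted_alg[OF n])
next
  case (diagrams_left d i j)
  hence ij: "i < n" "j < n" "i \<noteq> j" by auto
  obtain Y where Y: "Y \<in> adapted_alg n c" "opr N n Y (arc i j)" using adapted_op_arc[OF ij c] unfolding adapted_op_def by blast
  have "diagram_mat n (arc i j d) = Y * diagram_mat n d"
  proof (rule eq_matI)
    fix x y assume "x < dim_row (Y * diagram_mat n d)" "y < dim_col (Y * diagram_mat n d)"
    hence xy: "x < N ^ n" "y < N ^ n" using opr_carrier[OF Y(2)] diagram_mat_carrier[of n d] by auto
    show "diagram_mat n (arc i j d) $$ (x, y) = (Y * diagram_mat n d) $$ (x, y)"
    proof -
      have "(Y * diagram_mat n d) $$ (x, y) = arc i j (\<lambda>f. untwist n d f (dgt N y)) (dgt N x)"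
        by (rule mult_index_opr[OF Y(2) diagram_mat_carrier diagram_mat_index xy])
      thus ?thesis unfolding diagram_mat_index[OF xy] untwist_left[OF ij(1,2)] by simp
    qed
  qed (use opr_carrier[OF Y(2)] in \<open>auto simp: diagram_mat_def\<close>)
  thus ?case using adapted_alg_mult[OF Y(1) diagrams_left.IH] by simp
next
  case (diagrams_right d i j)
  hence ij: "i < n" "j < n" "i \<noteq> j" by auto
  obtain Y where Y: "Y \<in> adapted_alg n c" "opr N n Y (arc i j)" using adapted_op_arc[OF ij c] unfolding adapted_op_def by blast
  have T: "transpose_mat (diagram_mat n d) \<in> carrier_mat (N ^ n) (N ^ n)" using diagram_mat_carrier by auto
  have Ti: "transpose_mat (diagram_mat n d) $$ (x, y) = untwist n d (dgt N y) (dgt N x)" if "x < N ^ n" "y < N ^ n" for x y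
    using that by (simp add: diagram_mat_def)
  have "diagram_mat n (arc (n + i) (n + j) d) = transpose_mat (Y * transpose_mat (diagram_mat n d))"
  proof (rule eq_matI)
    fix x y assume "x < dim_row (transpose_mat (Y * transpose_mat (diagram_mat n d)))" "y < dim_col (transpose_mat (Y * transpose_mat (diagram_mat n d)))"
    hence xy: "x < N ^ n" "y < N ^ n" using opr_carrier[OF Y(2)] diagram_mat_carrier[of n d] by auto
    have "transpose_mat (Y * transpose_mat (diagram_mat n d)) $$ (x, y) = (Y * transpose_mat (diagram_mat n d)) $$ (y, x)"
      using xy carrier_matD[OF opr_carrier[OF Y(2)]] carrier_matD[OF diagram_mat_carrier[of n d]] by simp
    also have "\<dots> = arc i j (\<lambda>f. untwist n d (dgt N x) f) (dgt N y)"
      by (rule mult_index_opr[OF Y(2) T Ti xy(2,1)])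
    finally show "diagram_mat n (arc (n + i) (n + j) d) $$ (x, y) = transpose_mat (Y * transpose_mat (diagram_mat n d)) $$ (x, y)"
      unfolding diagram_mat_index[OF xy] untwist_right[OF ij] by simp
  qed (use opr_carrier[OF Y(2)] in \<open>auto simp: diagram_mat_def\<close>)
  thus ?case using adapted_alg_transpose[OF adapted_alg_mult[OF Y(1) adapted_alg_transpose[OF diagrams_right.IH]]] by simp
qed

text \<open>Polarisation: the relation is quadratic in \<open>w\<close>, so inserting the sum of two
  basis vectors isolates the mixed terms. Up to a sign these are the Lie algebra elements of
  \<open>lie_inv\<close>.\<close>

lemma Lie_pair:
  assumes L: "\<And>w f g. w 0 = 0 \<Longrightarrow> f \<in> idx N n \<Longrightarrow> g \<in> idx N n \<Longrightarrow>
      (\<Sum>l<n. \<Sum>b<N. K f (g(l := b)) * Lm w $$ (b, g l)) = (\<Sum>l<n. \<Sum>b<N. K (f(l := b)) g * Lm w $$ (f l, b))"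
    and ac: "a \<in> {1..2*k}" "c \<in> {1..2*k}" and fg: "f \<in> idx N n" "g \<in> idx N n"
  shows "(\<Sum>l<n. site c a l (K f) g) - (\<Sum>l<n. site a c l (\<lambda>f. K f g) f) =
    eta a * eta c * ((\<Sum>l<n. site (partner a) (partner c) l (K f) g) - (\<Sum>l<n. site (partner c) (partner a) l (\<lambda>f. K f g) f))"
proof -
  \<comment> \<open>The entry at (f, g) of the commutator of the operator with kernel
    \<open>K\<close> and the derivation of the tensor power induced by \<open>T\<close>.\<close>
  define \<Lambda> where "\<Lambda> T = (\<Sum>l<n. \<Sum>b<N. K f (g(l := b)) * T b (g l)) - (\<Sum>l<n. \<Sum>b<N. K (f(l := b)) g * T (f l) b)" for T :: "nat \<Rightarrow> nat \<Rightarrow> complex"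
  define S where "S u v i j = u i * (\<Sum>b<N. v b * Jf b j)" for u v :: "nat \<Rightarrow> complex" and i j
  have add: "\<Lambda> (\<lambda>i j. T i j + T' i j) = \<Lambda> T + \<Lambda> T'" for T T'
    unfolding \<Lambda>_def by (simp add: distrib_left sum.distrib)
  have smult: "\<Lambda> (\<lambda>i j. z * T i j) = z * \<Lambda> T" for z T
    unfolding \<Lambda>_def by (simp add: sum_distrib_left right_diff_distrib mult_ac)
  have cong: "\<Lambda> T = \<Lambda> T'" if "\<And>i j. i < N \<Longrightarrow> j < N \<Longrightarrow> T i j = T' i j" for T T'
    unfolding \<Lambda>_def using that idx_less[OF fg(1) N_pos] idx_less[OF fg(2) N_pos]
    by (intro arg_cong2[of _ _ _ _ "(-)"] sum.cong refl) auto
  have SS: "\<Lambda> (S w w) = 0" if "w 0 = 0" for w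
  proof -
    have "\<Lambda> (S w w) = \<Lambda> (\<lambda>i j. Lm w $$ (i, j))" by (rule cong) (simp add: Lm_index S_def)
    also have "\<dots> = 0" unfolding \<Lambda>_def using L[of w f g, OF that fg] by simp
    finally show ?thesis .
  qed
  define \<delta> where "\<delta> a = (\<lambda>i. if i = a then 1 else 0 :: complex)" for a :: nat
  have d0: "\<delta> a 0 = 0" if "a \<in> {1..2*k}" for a using that by (auto simp: \<delta>_def)
  have pair: "\<Lambda> (S (\<delta> a) (\<delta> b)) + \<Lambda> (S (\<delta> b) (\<delta> a)) = 0" if ab: "a \<in> {1..2*k}" "b \<in> {1..2*k}" for a b
  proof -
    let ?w = "\<lambda>i. \<delta> a i + \<delta> b i"
    have "S ?w ?w = (\<lambda>i j. (S (\<delta> a) (\<delta> a) i j + S (\<delta> a) (\<delta> b) i j) + (S (\<delta> b) (\<delta> a) i j + S (\<delta> b) (\<delta> b) i j))"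
      by (auto simp: S_def fun_eq_iff distrib_right distrib_left sum.distrib)
    hence "\<Lambda> (S ?w ?w) = (\<Lambda> (S (\<delta> a) (\<delta> a)) + \<Lambda> (S (\<delta> a) (\<delta> b))) + (\<Lambda> (S (\<delta> b) (\<delta> a)) + \<Lambda> (S (\<delta> b) (\<delta> b)))"
      by (simp only: add)
    thus ?thesis using SS[of ?w] SS[of "\<delta> a", OF d0[OF ab(1)]] SS[of "\<delta> b", OF d0[OF ab(2)]] d0[OF ab(1)] d0[OF ab(2)] by simp
  qed
  have Sd: "S (\<delta> a) (\<delta> b) i j = eta b * (if i = a \<and> j = partner b then 1 else 0)" if "b \<in> {1..2*k}" for a b i j
  proof -
    have bN: "b < N" "b \<noteq> 0" using that by (auto simp: N_eq)
    have "(\<Sum>z<N. \<delta> b z * Jf z j) = Jf b j"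
      unfolding \<delta>_def using sum_delta_pair(2)[OF bN(1), of 1 "\<lambda>z. Jf z j"] by simp
    thus ?thesis using bN by (auto simp: S_def \<delta>_def Jf_def)
  qed
  have \<Lambda>E: "\<Lambda> (\<lambda>i j. if i = a \<and> j = c then 1 else 0) = (\<Sum>l<n. site c a l (K f) g) - (\<Sum>l<n. site a c l (\<lambda>f. K f g) f)"
    if "a < N" "c < N" for a c
  proof -
    have 1: "(\<Sum>b<N. K f (g(l := b)) * (if b = a \<and> g l = c then 1 else 0)) = site c a l (K f) g" for l
    proof -
      have "(\<Sum>b<N. K f (g(l := b)) * (if b = a \<and> g l = c then 1 else 0)) = (\<Sum>b<N. K f (g(l := b)) * (if b = a then (if g l = c then 1 else 0) else 0))"
        by (intro sum.cong refl) auto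
      also have "\<dots> = K f (g(l := a)) * (if g l = c then 1 else 0)" by (rule sum_delta_pair(1)[OF that(1)])
      finally show ?thesis by (simp add: site_def)
    qed
    have 2: "(\<Sum>b<N. K (f(l := b)) g * (if f l = a \<and> b = c then 1 else 0)) = site a c l (\<lambda>f. K f g) f" for l
    proof -
      have "(\<Sum>b<N. K (f(l := b)) g * (if f l = a \<and> b = c then 1 else 0)) = (\<Sum>b<N. K (f(l := b)) g * (if b = c then (if f l = a then 1 else 0) else 0))"
        by (intro sum.cong refl) auto
      also have "\<dots> = K (f(l := c)) g * (if f l = a then 1 else 0)" by (rule sum_delta_pair(1)[OF that(2)])
      finally show ?thesis by (simp add: site_def)
    qed
    show ?thesis unfolding \<Lambda>_def 1 2 ..
  qed
  have lt: "a < N" "c < N" "partner a < N" "partner c < N"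
    using ac partner_mem[OF ac(1)] partner_mem[OF ac(2)] by (auto simp: N_eq)
  \<comment> \<open>The pairing with J replaces the second vector by its partner, so
    \<open>partner c\<close> is taken in order to obtain $E_{ac}$.\<close>
  have "\<Lambda> (S (\<delta> a) (\<delta> (partner c))) = eta (partner c) * \<Lambda> (\<lambda>i j. if i = a \<and> j = c then 1 else 0)"
    unfolding smult[symmetric] using Sd[OF partner_mem[OF ac(2)]] by (intro cong) simp
  moreover have "\<Lambda> (S (\<delta> (partner c)) (\<delta> a)) = eta a * \<Lambda> (\<lambda>i j. if i = partner c \<and> j = partner a then 1 else 0)"
    unfolding smult[symmetric] using Sd[OF ac(1)] by (intro cong) simp
  ultimately have "eta (partner c) * \<Lambda> (\<lambda>i j. if i = a \<and> j = c then 1 else 0) + eta a * \<Lambda> (\<lambda>i j. if i = partner c \<and> j = partner a then 1 else 0) = 0"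
    using pair[OF ac(1) partner_mem[OF ac(2)]] by simp
  moreover have "eta (partner c) = - eta c" using ac by (intro eta_partner) auto
  ultimately have "eta c * \<Lambda> (\<lambda>i j. if i = a \<and> j = c then 1 else 0) = eta a * \<Lambda> (\<lambda>i j. if i = partner c \<and> j = partner a then 1 else 0)"
    by simp
  hence "eta c * (eta c * \<Lambda> (\<lambda>i j. if i = a \<and> j = c then 1 else 0)) = eta c * (eta a * \<Lambda> (\<lambda>i j. if i = partner c \<and> j = partner a then 1 else 0))" by simp
  hence "\<Lambda> (\<lambda>i j. if i = a \<and> j = c then 1 else 0) = eta a * eta c * \<Lambda> (\<lambda>i j. if i = partner c \<and> j = partner a then 1 else 0)"
    by (simp add: mult_ac)
  thus ?thesis unfolding \<Lambda>E[OF lt(1,2)] \<Lambda>E[OF lt(4,3)] .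
qed

lemma End_subset_alg:
  assumes n: "n \<ge> 1" and c: "c \<noteq> 0"
  shows "End_Sp k n s s \<subseteq> value_alg n c"
proof
  fix X assume X: "X \<in> End_Sp k n s s"
  let ?M = "N ^ n"
  interpret mat_space ?M by unfold_locales simp
  have Xc: "X \<in> carrier_mat ?M ?M" using X by (simp add: End_Sp_iff)
  note as = assoc_mult_mat[of _ ?M ?M _ ?M _ ?M] mult_carrier_mat[of _ ?M ?M _ ?M] TP_carrier[of n] TQ_carrier[of n]
  define X' where "X' = TQ n * X * TP n"
  have X'c: "X' \<in> carrier_mat ?M ?M" unfolding X'_def by (simp add: as Xc)
  have PQY: "TP n * (TQ n * Y) = Y" "TQ n * (TP n * Y) = Y" if "Y \<in> carrier_mat ?M ?M" for Y
    using left_mult_one_mat[OF that] assoc_mult_mat[OF TP_carrier TQ_carrier that] assoc_mult_mat[OF TQ_carrier TP_carrier that] TP_TQ TQ_TP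
    by metis+
  have cjX': "from_adapted n X' = X"
  proof -
    have "from_adapted n X' = X * (TP n * TQ n)" unfolding from_adapted_def X'_def by (simp add: as Xc PQY)
    thus ?thesis unfolding TP_TQ right_mult_one_mat[OF Xc] .
  qed
  have sub: "subalgebra KM (adapted_alg n c) RM"
  proof (rule subspace_subalgebra)
    show "adapted_alg n c \<subseteq> carrier_mat ?M ?M" using adapted_alg_carrier by blast
    show "adapted_alg n c \<noteq> {}" using adapted_alg_one by blast
  qed (auto intro: adapted_alg_add adapted_alg_smult[OF n])
  obtain Y where Y: "Y \<in> adapted_alg n c" "\<And>Z. Z \<in> adapted_alg n c \<Longrightarrow> ipm (X' - Y) Z = 0"
    using orthogonal_projection[OF sub X'c] by blast
  have Yc: "Y \<in> carrier_mat ?M ?M" using adapted_alg_carrier[OF Y(1)] .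
  define D where "D = X' - Y"
  have Dc: "D \<in> carrier_mat ?M ?M" using X'c Yc by (auto simp: D_def)
  have cjY: "from_adapted n Y \<in> value_alg n c" using Y(1) by (simp add: adapted_alg_def)
  have cjYE: "from_adapted n Y \<in> End_Sp k n s s" using cjY alg_subset_End[OF n] by (auto simp: value_alg_def)
  \<comment> \<open>Both \<open>X'\<close> and its projection \<open>Y\<close> commute with the
    transvections, the latter because the algebra is already known to lie in the commutant.\<close>
  have comm: "D * tensor_pow (transvection w a) n = tensor_pow (transvection w a) n * D" if w: "w 0 = 0" for w a
  proof -
    let ?h = "transvection w a"
    let ?G = "tensor_pow (Pm * ?h * Qm) n" and ?H = "tensor_pow ?h n"
    have Hc: "?H \<in> carrier_mat ?M ?M" by (rule tensor_pow_carrier[OF transvection_carrier])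
    have G: "?G = TP n * ?H * TQ n"
      unfolding TP_def TQ_def using carrier_matD[OF Pm_carrier] carrier_matD[OF Qm_carrier] carrier_matD[OF transvection_carrier[of w a]]
      by (simp add: tensor_pow_mult del: assoc_mult_mat)
    have gen: "(TQ n * Z * TP n) * ?H = ?H * (TQ n * Z * TP n)" if Z: "Z \<in> End_Sp k n s s" for Z
    proof -
      have Zc: "Z \<in> carrier_mat ?M ?M" and ZG: "Z * ?G = ?G * Z" using Z transvection_Sp[of w, OF w] by (auto simp: End_Sp_iff)
      have "(TQ n * Z * TP n) * ?H = TQ n * (Z * ?G) * TP n"
        unfolding G by (simp add: as Zc Hc TQ_TP right_mult_one_mat[OF Hc])
      also have "\<dots> = ?H * (TQ n * Z * TP n)" unfolding ZG unfolding G by (simp add: as Zc Hc PQY)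
      finally show ?thesis .
    qed
    have 1: "X' * ?H = ?H * X'" unfolding X'_def by (rule gen[OF X])
    have "TQ n * from_adapted n Y * TP n = Y * (TQ n * TP n)" unfolding from_adapted_def by (simp add: as Yc PQY)
    hence "TQ n * from_adapted n Y * TP n = Y" unfolding TQ_TP right_mult_one_mat[OF Yc] .
    with gen[OF cjYE] have 2: "Y * ?H = ?H * Y" by simp
    show ?thesis unfolding D_def minus_mult_distrib_mat[OF X'c Yc Hc] mult_minus_distrib_mat[OF Hc X'c Yc] 1 2 ..
  qed
  \<comment> \<open>For digit functions \<open>f\<close> and \<open>g\<close> at most one term of
    the double sum survives, so an inverse of \<open>dgt\<close> is avoided.\<close>
  define K where "K f g = (\<Sum>x<?M. \<Sum>y<?M. if dgt N x = f \<and> dgt N y = g then D $$ (x, y) else 0)" for f g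
  have K: "D $$ (x, y) = K (dgt N x) (dgt N y)" if xy: "x < ?M" "y < ?M" for x y
  proof -
    have i: "dgt N u = dgt N v \<longleftrightarrow> u = v" if "u < ?M" "v < ?M" for u v using dgt_inject[OF that] by auto
    have "K (dgt N x) (dgt N y) = (\<Sum>u<?M. if u = x then (\<Sum>v<?M. if v = y then D $$ (u, v) else 0) else 0)"
      unfolding K_def by (intro sum.cong refl) (use i xy in \<open>auto intro!: sum.cong\<close>)
    thus ?thesis using xy by simp
  qed
  have L: "(\<Sum>l<n. \<Sum>b<N. K f (g(l := b)) * Lm w $$ (b, g l)) = (\<Sum>l<n. \<Sum>b<N. K (f(l := b)) g * Lm w $$ (f l, b))"
    if "w 0 = 0" "f \<in> idx N n" "g \<in> idx N n" for w f g
    by (rule End_Lie[OF Dc K comm[of w, OF that(1)] that(2,3)])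
  have inv: "lie_inv k (n + n) (twist n K)"
    unfolding lie_inv_def
  proof (intro ballI)
    fix a e F assume ae: "a \<in> {1..2*k}" "e \<in> {1..2*k}" and F: "F \<in> idx (2*k+1) (n + n)"
    have nz: "a \<noteq> 0" "e \<noteq> 0" "partner a \<noteq> 0" "partner e \<noteq> 0" using ae by auto
    have fg: "lo n F \<in> idx N n" "hi n F \<in> idx N n" using F lo_idx[of "2*k+1" F n] hi_idx[OF F] unfolding N_eq by auto
    note p = Lie_pair[of n K, OF L ae fg]
    define u v u' v' where "u = (\<Sum>l<n. site a e l (\<lambda>f. K f (hi n F)) (lo n F))"
      and "v = (\<Sum>l<n. site (partner a) (partner e) l (K (lo n F)) (hi n F))"
      and "u' = (\<Sum>l<n. site (partner e) (partner a) l (\<lambda>f. K f (hi n F)) (lo n F))"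
      and "v' = (\<Sum>l<n. site e a l (K (lo n F)) (hi n F))"
    have p': "v' - u = eta a * eta e * (v - u')" using p unfolding u_def v_def u'_def v'_def by simp
    have e1: "eta (partner a) = - eta a" "eta (partner e) = - eta e" using nz by (auto intro: eta_partner)
    have "(\<Sum>l<n + n. site a e l (twist n K) F) = eta_prod n (hi n F) * (u + eta a * eta e * v)"
      unfolding twist_site_sum[OF nz(1,2)] u_def v_def ..
    moreover have "(\<Sum>l<n + n. site (partner e) (partner a) l (twist n K) F) = eta_prod n (hi n F) * (u' + eta a * eta e * v')"
      unfolding twist_site_sum[OF nz(4,3)] u'_def v'_def by (simp add: e1 mult.commute)
    \<comment> \<open>\<open>p'\<close> gives v' = u + t (v - u') with t = eta a * eta e, and t t =
      1. Thus the commutator relation for the kernel becomes the invariance relation for the twisted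
      tensor.\<close>
    moreover have "u + eta a * eta e * v = eta a * eta e * (u' + eta a * eta e * v')"
    proof -
      define t where "t = eta a * eta e"
      have tt: "t * (t * z) = z" for z by (simp add: t_def mult_ac)
      have "t * (u' + t * v') = t * u' + v'" by (simp add: distrib_left tt)
      also have "\<dots> = t * u' + (u + t * (v - u'))" using p' unfolding t_def[symmetric] by (simp add: algebra_simps)
      also have "\<dots> = u + t * v" by (simp add: right_diff_distrib)
      finally show ?thesis unfolding t_def[symmetric] by simp
    qed
    ultimately show "(\<Sum>l<n + n. site a e l (twist n K) F) = eta a * eta e * (\<Sum>l<n + n. site (partner e) (partner a) l (twist n K) F)"
      by (simp add: mult_ac)
  qed
  have orth: "(\<Sum>F\<in>idx (2*k+1) (n + n). twist n K F * d F) = 0" if d: "d \<in> diagrams n" for d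
  proof -
    have "(\<Sum>F\<in>idx (2*k+1) (n + n). twist n K F * d F) = (\<Sum>f\<in>idx N n. \<Sum>g\<in>idx N n. K f g * untwist n d f g)"
      unfolding twist_pairing N_eq ..
    also have "\<dots> = (\<Sum>x<?M. \<Sum>y<?M. K (dgt N x) (dgt N y) * untwist n d (dgt N x) (dgt N y))"
      unfolding sum_dgt[OF N_pos, symmetric] ..
    \<comment> \<open>The conjugation in \<open>ipm\<close> has no effect on a diagram, so the
      pairing with it is the inner product with its matrix.\<close>
    also have "\<dots> = ipm D (diagram_mat n d)"
      unfolding ipm_def by (intro sum.cong refl) (simp add: K diagram_mat_index untwist_def cnj_diagrams[OF d])
    also have "\<dots> = 0" unfolding D_def by (rule Y(2)[OF diagram_mat_adapted_alg[OF n c d]])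
    finally show ?thesis .
  qed
  have z: "twist n K F = 0" if "F \<in> idx (2*k+1) (n + n)" for F
    by (rule lie_inv_eq_zero[OF _ _ inv orth that])
      (auto intro: diagrams_lines lines_0 diagrams_arc)
  have "D = 0\<^sub>m ?M ?M"
  proof (rule eq_matI)
    fix x y assume "x < dim_row (0\<^sub>m ?M ?M :: complex mat)" "y < dim_col (0\<^sub>m ?M ?M :: complex mat)"
    hence xy: "x < ?M" "y < ?M" by auto
    have fg: "dgt N x \<in> idx N n" "dgt N y \<in> idx N n" using dgt_idx[OF N_pos] xy by auto
    have "merge n (dgt N x) (dgt N y) \<in> idx (2*k+1) (n + n)" using fg by (intro merge_idx) (simp_all add: N_eq)
    from z[OF this] have "K (dgt N x) (dgt N y) = 0"
      unfolding twist_def lo_merge[OF fg(1)] hi_merge[OF fg(2)] by simp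
    thus "D $$ (x, y) = 0\<^sub>m ?M ?M $$ (x, y)" using K xy by simp
  qed (use Dc in auto)
  have "X' = Y"
  proof (rule eq_matI)
    fix x y assume "x < dim_row Y" "y < dim_col Y"
    hence "x < ?M" "y < ?M" using Yc by auto
    thus "X' $$ (x, y) = Y $$ (x, y)"
      using arg_cong[OF \<open>D = 0\<^sub>m ?M ?M\<close>, of "\<lambda>A. A $$ (x, y)"] Yc by (simp add: D_def)
  qed (use X'c Yc in auto)
  thus "X \<in> value_alg n c" using cjX' cjY by simp
qed

end

section \<open>The defining relations for q near 1\<close>

declare rep.simps [simp del]

definition Gop :: "complex \<Rightarrow> nat \<Rightarrow> ((nat \<Rightarrow> nat) \<Rightarrow> complex) \<Rightarrow> (nat \<Rightarrow> nat) \<Rightarrow> complex" where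
  "Gop q p v f = q * v f - Uop q p v f"

lemma Gop_cases:
  "f (Suc p) = f p \<Longrightarrow> Gop q p v f = q * v f"
  "f (Suc p) < f p \<Longrightarrow> Gop q p v f = (q - inverse q) * v f + v (swp p f)"
  "f p < f (Suc p) \<Longrightarrow> Gop q p v f = v (swp p f)"
  by (auto simp: Gop_def Uop_def algebra_simps)

lemma swp_same: "f (Suc p) = f p \<Longrightarrow> swp p f = f"
  by (auto simp: swp_def fun_eq_iff)

lemma swp_braid: "swp p (swp (Suc p) (swp p f)) = swp (Suc p) (swp p (swp (Suc p) f))"
  by (auto simp: swp_def fun_eq_iff)

lemma Gop_quadratic:
  assumes "q \<noteq> 0"
  shows "Gop q p (Gop q p v) f = (q - inverse q) * Gop q p v f + v f"
proof -
  have qq: "q * inverse q = 1" "inverse q * q = 1" using assms by auto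
  consider "f (Suc p) = f p" | "f (Suc p) < f p" | "f p < f (Suc p)" by linarith
  thus ?thesis
  proof cases
    case 1 thus ?thesis using assms by (simp add: Gop_cases algebra_simps)
  next
    case 2
    hence "swp p f p < swp p f (Suc p)" by simp
    thus ?thesis using 2 by (simp add: Gop_cases)
  next
    case 3
    hence "swp p f (Suc p) < swp p f p" by simp
    thus ?thesis using 3 by (simp add: Gop_cases)
  qed
qed

text \<open>Only the relative order of three neighbouring digits matters, which leaves thirteen weak
  orderings. Swapping equal digits does nothing, and these cases close by $q^2 = (q - q^{-1}) q +
  1$.\<close>

lemma Gop_braid:
  assumes q: "q \<noteq> 0"
  shows "Gop q (Suc p) (Gop q p (Gop q (Suc p) v)) f = Gop q p (Gop q (Suc p) (Gop q p v)) f"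
proof -
  let ?a = "f (Suc (Suc p))" and ?b = "f (Suc p)" and ?c = "f p"
  define r where "r = q - inverse q"
  have qr: "q * q = r * q + 1" using q by (simp add: r_def algebra_simps)
  have q1: "q * (q * z) = r * (q * z) + z" for z using qr by (simp add: mult.assoc[symmetric] distrib_right)
  have n: "swp (Suc p) h p = h p" "swp p h (Suc (Suc p)) = h (Suc (Suc p))" for h by (simp_all add: swp_app)
  have G: "h (Suc p') = h p' \<Longrightarrow> Gop q p' v h = q * v h"
    "h (Suc p') < h p' \<Longrightarrow> Gop q p' v h = r * v h + v (swp p' h)"
    "h p' < h (Suc p') \<Longrightarrow> Gop q p' v h = v (swp p' h)" for p' h v
    unfolding r_def by (simp_all add: Gop_cases)
  consider "?a = ?b" "?b = ?c" | "?a = ?b" "?b < ?c" | "?a = ?b" "?c < ?b" | "?a < ?b" "?b = ?c" | "?b < ?a" "?b = ?c"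
    | "?a = ?c" "?a < ?b" | "?a = ?c" "?b < ?a"
    | "?a < ?b" "?b < ?c" | "?a < ?c" "?c < ?b" | "?b < ?a" "?a < ?c" | "?b < ?c" "?c < ?a" | "?c < ?a" "?a < ?b" | "?c < ?b" "?b < ?a"
    by (cases ?a ?b rule: linorder_cases; cases ?b ?c rule: linorder_cases;
        cases ?a ?c rule: linorder_cases; blast)
  thus ?thesis
  proof cases
    case 1 thus ?thesis by (simp add: G n)
  next
    case 2
    have s: "swp (Suc p) f = f" "swp p (swp (Suc p) (swp p f)) = swp (Suc p) (swp p f)"
      using 2 by (auto intro!: swp_same)
    thus ?thesis using 2 by (simp add: G n swp_braid algebra_simps q1)
  next
    case 3
    have s: "swp (Suc p) f = f" "swp p (swp (Suc p) (swp p f)) = swp (Suc p) (swp p f)"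
      using 3 by (auto intro!: swp_same)
    thus ?thesis using 3 by (simp add: G n swp_braid algebra_simps q1)
  next
    case 4
    have s: "swp p f = f" "swp (Suc p) (swp p (swp (Suc p) f)) = swp p (swp (Suc p) f)"
      using 4 by (auto intro!: swp_same)
    thus ?thesis using 4 by (simp add: G n swp_braid algebra_simps q1)
  next
    case 5
    have s: "swp p f = f" "swp (Suc p) (swp p (swp (Suc p) f)) = swp p (swp (Suc p) f)"
      using 5 by (auto intro!: swp_same)
    thus ?thesis using 5 by (simp add: G n swp_braid algebra_simps q1)
  next
    case 6
    have s: "swp p (swp (Suc p) f) = swp (Suc p) f" "swp (Suc p) (swp p f) = swp p f"
      using 6 by (auto intro!: swp_same)
    thus ?thesis using 6 by (simp add: G n algebra_simps q1)
  next
    case 7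
    have s: "swp p (swp (Suc p) f) = swp (Suc p) f" "swp (Suc p) (swp p f) = swp p f"
      using 7 by (auto intro!: swp_same)
    thus ?thesis using 7 by (simp add: G n algebra_simps q1)
  qed (simp_all add: G n swp_braid algebra_simps)
qed

lemma swp_far: "Suc p < p' \<or> Suc p' < p \<Longrightarrow> swp p (swp p' f) = swp p' (swp p f)"
  by (auto simp: swp_def fun_eq_iff)

lemma Gop_far:
  assumes "Suc p < p' \<or> Suc p' < p"
  shows "Gop q p (Gop q p' v) f = Gop q p' (Gop q p v) f"
proof -
  have a: "swp p f p' = f p'" "swp p f (Suc p') = f (Suc p')" "swp p' f p = f p" "swp p' f (Suc p) = f (Suc p)"
    using assms by (auto simp: swp_app)
  show ?thesis
    unfolding Gop_def Uop_def a swp_far[OF assms] by (simp add: algebra_simps)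
qed

text \<open>The conditions hold for all q close to 1: they make E and the coefficient of $e_{(r)}$
  meaningful, and q = -1 is excluded so that the factor 1 + q can be cancelled from geometric
  sums.\<close>

locale rep_at =
  fixes k :: nat and q s :: complex and n :: nat
  assumes s2: "s ^ 2 = - q" and q0: "q \<noteq> 0" and q1: "q \<noteq> - 1" and qN: "q ^ (2 * k + 1) + 1 \<noteq> 0"
    and S0: "Snum k q \<noteq> 0"
begin

definition N :: nat where N_eq: "N = 2 * k + 1"
lemma N_pos [simp]: "0 < N" by (simp add: N_eq)

abbreviation Um :: "nat \<Rightarrow> complex mat" where "Um i \<equiv> rep k n q s (GenU i)"
abbreviation Er :: "nat \<Rightarrow> complex mat" where "Er r \<equiv> rep k n q s (GenE r)"
definition Gm :: "nat \<Rightarrow> complex mat" where "Gm i = q \<cdot>\<^sub>m 1\<^sub>m (N ^ n) - Um i"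
definition Eq :: "complex mat" where "Eq = E_mat k q s"
definition xq :: "nat \<Rightarrow> complex" where "xq j = s powi (int k - int j)"

lemma s_nz: "s \<noteq> 0" using s2 q0 by auto

lemma Eq_carrier: "Eq \<in> carrier_mat N N" by (simp add: Eq_def E_mat_def N_eq)
lemma Eq_index: "i < N \<Longrightarrow> j < N \<Longrightarrow> Eq $$ (i, j) = xq i * xq j / Snum k q"
  by (simp add: Eq_def E_mat_index[OF s_nz] xq_def N_eq)

lemma Um_carrier: "1 \<le> i \<Longrightarrow> i < n \<Longrightarrow> Um i \<in> carrier_mat (N ^ n) (N ^ n)"
  unfolding N_eq by (rule rep_U_carrier)
lemma Er_carrier: "r \<le> n \<Longrightarrow> Er r \<in> carrier_mat (N ^ n) (N ^ n)"
  unfolding N_eq by (rule rep_E_carrier)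
lemma opr_Um: "1 \<le> i \<Longrightarrow> i < n \<Longrightarrow> opr N n (Um i) (Uop q (n - i - 1))"
  unfolding N_eq by (rule opr_U)

lemma opr_Gm: "1 \<le> i \<Longrightarrow> i < n \<Longrightarrow> opr N n (Gm i) (Gop q (n - i - 1))"
  using opr_minus[OF opr_smult[OF opr_one, of N n q] opr_Um] unfolding Gm_def Gop_def[abs_def] .

lemma rel_braid:
  assumes "1 \<le> i" "i + 1 < n"
  shows "Gm i * Gm (i + 1) * Gm i = Gm (i + 1) * Gm i * Gm (i + 1)"
proof -
  define p where "p = n - (i + 1) - 1"
  have p: "n - i - 1 = Suc p" using assms by (simp add: p_def)
  have 1: "opr N n (Gm i) (Gop q (Suc p))" using opr_Gm[of i] assms p by simp
  have 2: "opr N n (Gm (i + 1)) (Gop q p)" using opr_Gm[of "i + 1"] assms by (simp add: p_def)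
  show ?thesis
    by (rule opr_unique[OF opr_mult[OF opr_mult[OF 1 2] 1] opr_mult[OF opr_mult[OF 2 1] 2] N_pos])
      (rule Gop_braid[OF q0])
qed

lemma rel_far:
  assumes "1 \<le> i" "i < n" "1 \<le> j" "j < n" "\<bar>int i - int j\<bar> \<noteq> 1"
  shows "Gm i * Gm j = Gm j * Gm i"
proof (cases "i = j")
  case False
  have "Suc (n - i - 1) < n - j - 1 \<or> Suc (n - j - 1) < n - i - 1" using assms False by linarith
  from Gop_far[OF this] show ?thesis
    by (intro opr_unique[OF opr_mult[OF opr_Gm opr_Gm] opr_mult[OF opr_Gm opr_Gm] N_pos] assms(1-4))
qed simp

lemma rel_quadratic:
  assumes "1 \<le> i" "i < n"
  shows "Gm i * Gm i = (q - inverse q) \<cdot>\<^sub>m Gm i + 1\<^sub>m (N ^ n)"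
  by (rule opr_unique[OF opr_mult[OF opr_Gm opr_Gm] opr_add[OF opr_smult[OF opr_Gm] opr_one] N_pos])
    (use assms Gop_quadratic[OF q0] in auto)

lemma Er_eq: "Er r = tensor_pow Eq r \<otimes>\<^sub>k 1\<^sub>m (N ^ (n - r))"
  by (simp add: Eq_def N_eq rep.simps(2))

lemma Um_eq: "Um i = loc2 N n i (U_mat N q)"
  unfolding rep_U N_eq ..

lemma rel_E1_U:
  assumes i: "2 \<le> i" "i < n"
  shows "Er 1 * Um i = Um i * Er 1"
proof -
  let ?Y = "loc2 N (n - 1) (i - 1) (U_mat N q)"
  have "N ^ (i - 1) = N * N ^ (i - 2)"
  proof -
    have "i - 1 = Suc (i - 2)" using i by simp
    thus ?thesis by simp
  qed
  hence U: "Um i = 1\<^sub>m N \<otimes>\<^sub>k ?Y"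
    unfolding Um_eq loc2_def using i by (simp add: one_kron_one[symmetric] kron_assoc numeral_2_eq_2)
  have Y: "?Y \<in> carrier_mat (N ^ (n - 1)) (N ^ (n - 1))" by (rule loc2_carrier[OF _ _ U_mat_carrier]) (use i in auto)
  have E: "Er 1 = Eq \<otimes>\<^sub>k 1\<^sub>m (N ^ (n - 1))" unfolding Er_eq tensor_pow_1 ..
  note d = carrier_matD[OF Y] carrier_matD[OF Eq_carrier]
  show ?thesis
    unfolding U E using d left_mult_one_mat[OF Y] right_mult_one_mat[OF Y] left_mult_one_mat[OF Eq_carrier] right_mult_one_mat[OF Eq_carrier]
    by (simp add: kron_mult)
qed

definition yq :: "nat \<Rightarrow> complex" where "yq a = (- q) powi (int k - int a)"

lemma xq_sq: "xq a * xq a = yq a"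
proof -
  have "xq a * xq a = (s * s) powi (int k - int a)" by (simp add: xq_def power_int_mult_distrib)
  thus ?thesis using s2 by (simp add: yq_def power2_eq_square)
qed

lemma Snum_eq: "Snum k q = (\<Sum>a<N. yq a)"
  unfolding Snum_def yq_def N_eq
  by (rule sum.reindex_bij_witness[of _ Suc "\<lambda>m. m - 1"]) (auto simp: algebra_simps of_nat_diff)

lemma yq_Suc: "yq (Suc a) * (- q) = yq a"
proof -
  define m where "m = int k - int (Suc a)"
  have "int k - int a = m + 1" by (simp add: m_def)
  moreover have "(- q) powi (m + 1) = (- q) powi m * (- q)" using q0 by (simp add: power_int_add_1)
  ultimately show ?thesis unfolding yq_def m_def[symmetric] by simp
qed

text \<open>The geometric sum with ratio -1/q, with the denominator cleared.\<close>

lemma yq_sum: "(1 + q) * (\<Sum>a<m. yq a) = q * (yq 0 - yq m)"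
proof (induction m)
  case (Suc m)
  have "(1 + q) * (\<Sum>a<Suc m. yq a) = q * (yq 0 - yq m) + (1 + q) * yq m"
    using Suc by (simp add: distrib_left)
  also have "\<dots> = q * yq 0 + yq m" by (simp add: algebra_simps)
  also have "yq m = - (q * yq (Suc m))" using yq_Suc[of m] by (simp add: mult.commute)
  finally show ?case by (simp add: algebra_simps)
qed simp

lemma yq_0_N: "yq 0 = - (q ^ N) * yq N"
proof -
  have "yq a = (- q) ^ m * yq (a + m)" for a m
  proof (induction m)
    case (Suc m)
    have "yq (a + m) = - q * yq (Suc (a + m))" by (metis mult.commute yq_Suc)
    thus ?case using Suc by simp
  qed simp
  from this[of 0 N] show ?thesis by (simp add: N_eq)
qed

definition ec :: complex where "ec = (q ^ (N - 1) + q) / (q ^ N + 1)"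

text \<open>This is where the coefficient in the recursion for $e_{(r)}$ comes from: tracing the
  diagonal of U against $v_o$ in one factor gives 1/q for smaller and q for larger indices, and the
  two partial sums combine into a constant minus \<open>yq b\<close>.\<close>

lemma partial_trace:
  assumes b: "b < N"
  shows "(\<Sum>a<b. yq a) * inverse q + (\<Sum>a\<in>{b<..<N}. yq a) * q = ec * Snum k q - yq b"
proof -
  have q1': "1 + q \<noteq> 0" using q1 by (metis add.commute add_eq_0_iff2 add.inverse_inverse)
  have qN': "q ^ N + 1 \<noteq> 0" using qN by (simp add: N_eq)
  let ?A = "\<Sum>a<b. yq a" and ?B = "\<Sum>a\<in>{b<..<N}. yq a"
  have split: "(\<Sum>a<N. yq a) = ?A + yq b + ?B"
  proof -
    have "{..<N} = {..<b} \<union> ({b} \<union> {b<..<N})" using b by auto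
    hence "(\<Sum>a<N. yq a) = (\<Sum>a\<in>{..<b} \<union> ({b} \<union> {b<..<N}). yq a)" by simp
    also have "\<dots> = ?A + (\<Sum>a\<in>{b} \<union> {b<..<N}. yq a)" by (rule sum.union_disjoint) auto
    also have "(\<Sum>a\<in>{b} \<union> {b<..<N}. yq a) = yq b + ?B" by (subst sum.union_disjoint) auto
    finally show ?thesis by (simp add: add.assoc)
  qed
  have A: "(1 + q) * ?A = q * (yq 0 - yq b)" by (rule yq_sum)
  have S: "(1 + q) * Snum k q = q * (yq 0 - yq N)" unfolding Snum_eq by (rule yq_sum)
  have B: "(1 + q) * ?B = q * (yq 0 - yq N) - q * (yq 0 - yq b) - (1 + q) * yq b"
  proof -
    have "(1 + q) * ?B = (1 + q) * Snum k q - (1 + q) * ?A - (1 + q) * yq b"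
      unfolding Snum_eq split by (simp add: algebra_simps)
    thus ?thesis unfolding S A .
  qed
  have "(1 + q) * (?A * inverse q + ?B * q) = ((1 + q) * ?A) * inverse q + ((1 + q) * ?B) * q"
    by (simp add: algebra_simps)
  also have "\<dots> = (yq 0 - yq b) + (q * (yq 0 - yq N) - q * (yq 0 - yq b) - (1 + q) * yq b) * q"
    unfolding A B using q0 by simp
  also have "\<dots> = (yq 0 - q * q * yq N) - (1 + q) * yq b" by (simp add: algebra_simps)
  also have "yq 0 - q * q * yq N = (1 + q) * (ec * Snum k q)"
  proof -
    have qNq: "q ^ N = q * q ^ (N - 1)" by (metis N_pos Suc_diff_1 power_Suc)
    have "(1 + q) * (ec * Snum k q) = ec * (q * (yq 0 - yq N))" using S by (simp add: mult_ac)
    also have "\<dots> = - (ec * (q ^ N + 1)) * (q * yq N)" unfolding yq_0_N by (simp add: algebra_simps)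
    also have "ec * (q ^ N + 1) = q ^ (N - 1) + q" unfolding ec_def using qN' by simp
    also have "- (q ^ (N - 1) + q) * (q * yq N) = yq 0 - q * q * yq N"
      unfolding yq_0_N qNq by (simp add: algebra_simps)
    finally show ?thesis ..
  qed
  finally have "(1 + q) * (?A * inverse q + ?B * q) = (1 + q) * (ec * Snum k q - yq b)"
    by (simp add: right_diff_distrib)
  thus ?thesis using q1' by simp
qed

lemma Eq_idem: "Eq * Eq = Eq"
proof (rule eq_matI)
  note d = carrier_matD[OF Eq_carrier]
  fix i j assume "i < dim_row Eq" "j < dim_col Eq"
  hence ij: "i < N" "j < N" using d by auto
  have "(Eq * Eq) $$ (i, j) = (\<Sum>l<N. (xq i * xq l / Snum k q) * (xq l * xq j / Snum k q))"
    using ij d by (simp add: mat_mult_index Eq_index del: index_mult_mat(1))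
  also have "\<dots> = xq i * xq j / Snum k q / Snum k q * (\<Sum>l<N. xq l * xq l)"
    unfolding sum_distrib_left by (intro sum.cong refl) simp
  also have "\<dots> = Eq $$ (i, j)" unfolding xq_sq Snum_eq[symmetric] using S0 ij by (simp add: Eq_index)
  finally show "(Eq * Eq) $$ (i, j) = Eq $$ (i, j)" .
qed (use Eq_carrier in auto)

lemma rel_E_idem: "r \<le> n \<Longrightarrow> Er r * Er r = Er r"
  unfolding Er_eq using carrier_matD[OF Eq_carrier] by (simp add: kron_mult tensor_pow_mult Eq_idem)

text \<open>E has rank one, so the product is determined by contracting U with $v_o$ in the first
  factor on both sides. Off the diagonal only the flip term of U contributes; on the diagonal
  \<open>partial_trace\<close> applies.\<close>

lemma EUE: "(Eq \<otimes>\<^sub>k 1\<^sub>m N) * U_mat N q * (Eq \<otimes>\<^sub>k 1\<^sub>m N) = ec \<cdot>\<^sub>m (Eq \<otimes>\<^sub>k 1\<^sub>m N) - Eq \<otimes>\<^sub>k Eq"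
proof (rule eq_matI)
  note d = carrier_matD[OF Eq_carrier] carrier_matD[OF U_mat_carrier[of N q]]
  let ?E = "Eq \<otimes>\<^sub>k 1\<^sub>m N" and ?U = "U_mat N q" and ?S = "Snum k q"
  fix x y assume "x < dim_row (ec \<cdot>\<^sub>m ?E - Eq \<otimes>\<^sub>k Eq)" "y < dim_col (ec \<cdot>\<^sub>m ?E - Eq \<otimes>\<^sub>k Eq)"
  hence xy: "x < N * N" "y < N * N" using d by auto
  let ?a = "x div N" and ?b = "x mod N" and ?c = "y div N" and ?d = "y mod N"
  note xd = div_mod_less[OF xy(1)] and yd = div_mod_less[OF xy(2)]
  have Ei: "?E $$ (z, w) = Eq $$ (z div N, w div N) * (if z mod N = w mod N then 1 else 0)" if "z < N * N" "w < N * N" for z w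
    using that d div_mod_less[OF that(1)] div_mod_less[OF that(2)] by (simp add: kron_index)
  have Ui: "?U $$ (z, w) = U_coeff q (z div N, z mod N) (w div N, w mod N)" if "z < N * N" "w < N * N" for z w
    using that by (simp add: U_mat_def)
  have EU: "(?E * ?U) $$ (x, w) = (\<Sum>a'<N. Eq $$ (?a, a') * U_coeff q (a', ?b) (w div N, w mod N))" if w: "w < N * N" for w
  proof -
    have "(?E * ?U) $$ (x, w) = (\<Sum>z<N * N. ?E $$ (x, z) * ?U $$ (z, w))"
      using xy w d by (subst mat_mult_index) auto
    also have "\<dots> = (\<Sum>z<N * N. (Eq $$ (?a, z div N) * (if ?b = z mod N then 1 else 0)) * U_coeff q (z div N, z mod N) (w div N, w mod N))"
      by (intro sum.cong refl) (use Ei Ui xy w in simp)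
    also have "\<dots> = (\<Sum>a'<N. \<Sum>b'<N. (Eq $$ (?a, a') * (if ?b = b' then 1 else 0)) * U_coeff q (a', b') (w div N, w mod N))"
      by (rule sum_div_mod)
    also have "\<dots> = (\<Sum>a'<N. \<Sum>b'<N. if b' = ?b then Eq $$ (?a, a') * U_coeff q (a', ?b) (w div N, w mod N) else 0)"
      by (intro sum.cong refl) auto
    finally show ?thesis using xd by simp
  qed
  \<comment> \<open>The contraction of U with $v_o$ in the first factor, as a function of the second
    indices of row and column.\<close>
  define W where "W = (\<Sum>c'<N. \<Sum>a'<N. xq a' * xq c' * U_coeff q (a', ?b) (c', ?d))"
  have "(?E * ?U * ?E) $$ (x, y) = (\<Sum>w<N * N. (?E * ?U) $$ (x, w) * ?E $$ (w, y))"
    using xy d by (subst mat_mult_index) auto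
  also have "\<dots> = (\<Sum>w<N * N. (\<Sum>a'<N. Eq $$ (?a, a') * U_coeff q (a', ?b) (w div N, w mod N)) * (Eq $$ (w div N, ?c) * (if w mod N = ?d then 1 else 0)))"
    by (intro sum.cong refl) (use EU Ei xy in simp)
  also have "\<dots> = (\<Sum>c'<N. \<Sum>d'<N. (\<Sum>a'<N. Eq $$ (?a, a') * U_coeff q (a', ?b) (c', d')) * (Eq $$ (c', ?c) * (if d' = ?d then 1 else 0)))"
    by (rule sum_div_mod)
  also have "\<dots> = (\<Sum>c'<N. \<Sum>d'<N. if d' = ?d then (\<Sum>a'<N. Eq $$ (?a, a') * U_coeff q (a', ?b) (c', ?d)) * Eq $$ (c', ?c) else 0)"
    by (intro sum.cong refl) auto
  also have "\<dots> = (\<Sum>c'<N. (\<Sum>a'<N. Eq $$ (?a, a') * U_coeff q (a', ?b) (c', ?d)) * Eq $$ (c', ?c))"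
    using yd by simp
  also have "\<dots> = (\<Sum>c'<N. \<Sum>a'<N. (xq ?a * xq ?c / ?S / ?S) * (xq a' * xq c' * U_coeff q (a', ?b) (c', ?d)))"
    unfolding sum_distrib_right by (intro sum.cong refl) (use xd yd in \<open>simp add: Eq_index\<close>)
  also have "\<dots> = (xq ?a * xq ?c / ?S / ?S) * W"
    unfolding W_def sum_distrib_left ..
  also have "W = ec * ?S * (if ?b = ?d then 1 else 0) - xq ?b * xq ?d"
  proof (cases "?b = ?d")
    case False
    have "W = (\<Sum>c'<N. \<Sum>a'<N. if a' = ?d then (if c' = ?b then - (xq ?d * xq ?b) else 0) else 0)"
      unfolding W_def by (intro sum.cong refl) (use False in \<open>auto simp: U_coeff_def\<close>)
    also have "\<dots> = - (xq ?d * xq ?b)" using xd yd by simp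
    finally show ?thesis using False by (simp add: mult.commute)
  next
    case True
    let ?b = "y mod N"
    have "W = (\<Sum>c'<N. \<Sum>a'<N. if a' = c' then (if c' = ?b then 0 else if c' < ?b then yq c' * inverse q else yq c' * q) else 0)"
      unfolding W_def True by (intro sum.cong refl) (auto simp: U_coeff_def xq_sq mult_ac)
    also have "\<dots> = (\<Sum>c'<N. if c' = ?b then 0 else if c' < ?b then yq c' * inverse q else yq c' * q)"
      by (intro sum.cong refl) simp
    also have "\<dots> = (\<Sum>c'<?b. yq c') * inverse q + (\<Sum>c'\<in>{?b<..<N}. yq c') * q"
    proof -
      have b: "?b < N" using yd by simp
      let ?h = "\<lambda>c'. if c' = ?b then 0 else if c' < ?b then yq c' * inverse q else yq c' * q"
      have "{..<N} = {..<b'} \<union> ({b'} \<union> {b'<..<N})" if "b' < N" for b' using that by auto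
      note this[OF b]
      hence "(\<Sum>c'<N. ?h c') = (\<Sum>c'\<in>{..<?b} \<union> ({?b} \<union> {?b<..<N}). ?h c')" by simp
      also have "\<dots> = (\<Sum>c'<?b. ?h c') + (\<Sum>c'\<in>{?b} \<union> {?b<..<N}. ?h c')" by (rule sum.union_disjoint) auto
      also have "(\<Sum>c'\<in>{?b} \<union> {?b<..<N}. ?h c') = (\<Sum>c'\<in>{?b<..<N}. ?h c')" by (subst sum.union_disjoint) auto
      also have "\<dots> = (\<Sum>c'\<in>{?b<..<N}. yq c') * q" unfolding sum_distrib_right by (intro sum.cong refl) auto
      also have "(\<Sum>c'<?b. ?h c') = (\<Sum>c'<?b. yq c') * inverse q" unfolding sum_distrib_right by (intro sum.cong refl) auto
      finally show ?thesis .
    qed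
    also have "\<dots> = ec * ?S - yq ?b" by (rule partial_trace) (use yd in simp)
    finally show ?thesis using True by (simp add: xq_sq)
  qed
  also have "(xq ?a * xq ?c / ?S / ?S) * (ec * ?S * (if ?b = ?d then 1 else 0) - xq ?b * xq ?d)
     = (ec \<cdot>\<^sub>m ?E - Eq \<otimes>\<^sub>k Eq) $$ (x, y)"
    using xy xd yd d S0 by (simp add: kron_index Eq_index right_diff_distrib)
  finally show "(?E * ?U * ?E) $$ (x, y) = (ec \<cdot>\<^sub>m ?E - Eq \<otimes>\<^sub>k Eq) $$ (x, y)" .
qed (use carrier_matD[OF Eq_carrier] carrier_matD[OF U_mat_carrier[of N q]] in auto)

text \<open>$E_{(r)}$ is E \<otimes> 1 on the factors r and r + 1, with idempotents E before them
  and identities after them, so the relation reduces to \<open>EUE\<close>.\<close>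

lemma rel_E_Suc:
  assumes r: "1 \<le> r" "r < n"
  shows "Er (r + 1) = ec \<cdot>\<^sub>m Er r - Er r * Um r * Er r"
proof -
  let ?T = "tensor_pow Eq (r - 1)" and ?I = "1\<^sub>m (N ^ (n - r - 1)) :: complex mat"
  have T: "tensor_pow Eq m = tensor_pow Eq (m - 1) \<otimes>\<^sub>k Eq" if "1 \<le> m" for m
  proof -
    have "tensor_pow Eq ((m - 1) + 1) = tensor_pow Eq (m - 1) \<otimes>\<^sub>k tensor_pow Eq 1" by (rule tensor_pow_add)
    thus ?thesis using that unfolding tensor_pow_1 by simp
  qed
  have p: "N ^ (n - r) = N * N ^ (n - r - 1)" using r by (metis Suc_diff_Suc diff_diff_left plus_1_eq_Suc power_Suc add.commute)
  have E1: "Er r = ?T \<otimes>\<^sub>k (Eq \<otimes>\<^sub>k 1\<^sub>m N) \<otimes>\<^sub>k ?I"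
    unfolding Er_eq p one_kron_one[symmetric] by (subst T[OF r(1)]) (simp only: kron_assoc)
  have "tensor_pow Eq (r + 1) = ?T \<otimes>\<^sub>k Eq \<otimes>\<^sub>k Eq"
    using T[of "r + 1"] T[OF r(1)] r by (simp add: kron_assoc)
  hence E2: "Er (r + 1) = ?T \<otimes>\<^sub>k (Eq \<otimes>\<^sub>k Eq) \<otimes>\<^sub>k ?I"
    unfolding Er_eq by (simp add: kron_assoc)
  note d = carrier_matD[OF Eq_carrier] carrier_matD[OF U_mat_carrier[of N q]]
  have TT: "?T * 1\<^sub>m (N ^ (r - 1)) = ?T" "?T * ?T = ?T"
    using right_mult_one_mat[OF tensor_pow_carrier[OF Eq_carrier]] d by (auto simp: tensor_pow_mult Eq_idem)
  have "Er r * Um r * Er r = ?T \<otimes>\<^sub>k ((Eq \<otimes>\<^sub>k 1\<^sub>m N) * U_mat N q * (Eq \<otimes>\<^sub>k 1\<^sub>m N)) \<otimes>\<^sub>k ?I"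
    unfolding E1 Um_eq loc2_def using d TT by (simp add: kron_mult del: assoc_mult_mat)
  also have "\<dots> = ?T \<otimes>\<^sub>k (ec \<cdot>\<^sub>m (Eq \<otimes>\<^sub>k 1\<^sub>m N) - Eq \<otimes>\<^sub>k Eq) \<otimes>\<^sub>k ?I" unfolding EUE ..
  also have "(ec \<cdot>\<^sub>m (Eq \<otimes>\<^sub>k 1\<^sub>m N) - Eq \<otimes>\<^sub>k Eq) \<otimes>\<^sub>k ?I = (ec \<cdot>\<^sub>m (Eq \<otimes>\<^sub>k 1\<^sub>m N)) \<otimes>\<^sub>k ?I - (Eq \<otimes>\<^sub>k Eq) \<otimes>\<^sub>k ?I"
    by (rule kron_minus_left[of _ "N * N" "N * N"]) (use Eq_carrier in auto)
  also have "?T \<otimes>\<^sub>k ((ec \<cdot>\<^sub>m (Eq \<otimes>\<^sub>k 1\<^sub>m N)) \<otimes>\<^sub>k ?I - (Eq \<otimes>\<^sub>k Eq) \<otimes>\<^sub>k ?I)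
     = ?T \<otimes>\<^sub>k (ec \<cdot>\<^sub>m (Eq \<otimes>\<^sub>k 1\<^sub>m N)) \<otimes>\<^sub>k ?I - ?T \<otimes>\<^sub>k (Eq \<otimes>\<^sub>k Eq) \<otimes>\<^sub>k ?I"
    by (rule kron_minus_right[of _ "N * N * N ^ (n - r - 1)" "N * N * N ^ (n - r - 1)"]) (use Eq_carrier in auto)
  also have "\<dots> = ec \<cdot>\<^sub>m Er r - Er (r + 1)"
    unfolding E1 E2 kron_smult_left kron_smult_right ..
  finally have e: "Er r * Um r * Er r = ec \<cdot>\<^sub>m Er r - Er (r + 1)" .
  have c: "Er r \<in> carrier_mat (N ^ n) (N ^ n)" "Er (r + 1) \<in> carrier_mat (N ^ n) (N ^ n)" using Er_carrier r by auto
  show ?thesis unfolding e using carrier_matD[OF c(1)] carrier_matD[OF c(2)] by (intro eq_matI) (simp_all del: rep.simps)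
qed

text \<open>On a tensor symmetric in three positions the inner U acts by scalars
  \<open>Ucoef\<close>, and the outer one permutes equal values; an identity of scalars for each
  order of the digits remains.\<close>

lemma Uop_three:
  assumes v: "v (swp p f) = v f" "v (swp (Suc p) f) = v f" "v (swp p (swp (Suc p) f)) = v (swp (Suc p) f)" "v (swp (Suc p) (swp p f)) = v (swp p f)"
  shows "Uop q (Suc p) (Uop q p v) f + Uop q (Suc p) v f = Uop q p (Uop q (Suc p) v) f + Uop q p v f"
proof -
  let ?a = "f (Suc (Suc p))" and ?b = "f (Suc p)" and ?c = "f p"
  have 1: "Uop q p v f = Ucoef q ?b ?c * v f" "Uop q (Suc p) v f = Ucoef q ?a ?b * v f"
    using Uop_sym v by auto
  have 2: "Uop q p v (swp (Suc p) f) = Ucoef q ?a ?c * v f" "Uop q (Suc p) v (swp p f) = Ucoef q ?a ?c * v f"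
    using Uop_sym[OF v(3), of q] Uop_sym[OF v(4), of q] v by (simp_all add: swp_app)
  have "Uop q (Suc p) (Uop q p v) f = (if ?a = ?b then 0 else (if ?a < ?b then inverse q else q) * (Ucoef q ?b ?c * v f) - Ucoef q ?a ?c * v f)"
    unfolding Uop_def[of q "Suc p" "Uop q p v"] 1 2 ..
  moreover have "Uop q p (Uop q (Suc p) v) f = (if ?b = ?c then 0 else (if ?b < ?c then inverse q else q) * (Ucoef q ?a ?b * v f) - Ucoef q ?a ?c * v f)"
    unfolding Uop_def[of q p "Uop q (Suc p) v"] 1 2 ..
  moreover have "(if a = b then 0 else (if a < b then inverse q else q) * (Ucoef q b c * z) - Ucoef q a c * z) + Ucoef q a b * z
    = (if b = c then 0 else (if b < c then inverse q else q) * (Ucoef q a b * z) - Ucoef q a c * z) + Ucoef q b c * z" for a b c z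
    using q0 by (cases a b rule: linorder_cases; cases b c rule: linorder_cases; cases a c rule: linorder_cases)
      (simp_all add: Ucoef_def algebra_simps)
  ultimately show ?thesis unfolding 1 by simp
qed

lemma rel_three_left:
  assumes j: "2 \<le> j" "j < r" "r \<le> n"
  shows "(Um (j - 1) * Um j + Um (j - 1)) * Er r = (Um j * Um (j - 1) + Um j) * Er r"
proof (rule eq_matI)
  define p where "p = n - j - 1"
  have p: "n - (j - 1) - 1 = Suc p" "n - r \<le> p" "Suc (Suc p) < n" using j by (auto simp: p_def)
  have 1: "opr N n (Um (j - 1)) (Uop q (Suc p))" using opr_Um[of "j - 1"] j p by simp
  have 2: "opr N n (Um j) (Uop q p)" using opr_Um[of j] j by (simp add: p_def)
  have Ec: "Er r \<in> carrier_mat (N ^ n) (N ^ n)" by (rule Er_carrier[OF j(3)])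
  have Ei: "Er r $$ (x, y) = Eker k n q s r (dgt N x) (dgt N y)" if "x < N ^ n" "y < N ^ n" for x y
    using rep_E_index[OF j(3)] that unfolding N_eq .
  fix x y assume "x < dim_row ((Um j * Um (j - 1) + Um j) * Er r)" "y < dim_col ((Um j * Um (j - 1) + Um j) * Er r)"
  hence xy: "x < N ^ n" "y < N ^ n" using opr_carrier[OF 2] Ec by auto
  let ?v = "\<lambda>f. Eker k n q s r f (dgt N y)" and ?f = "dgt N x"
  have f: "?f \<in> idx N n" "dgt N y \<in> idx N n" using dgt_idx[OF N_pos] xy by auto
  have E: "?v (swp i h) = ?v h" if "n - r \<le> i" "Suc i < n" "h \<in> idx N n" for i h
    using Eker_swp[OF _ _ s_nz that(1,2), of h k "dgt N y"] that f unfolding N_eq by blast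
  have l: "((Um (j - 1) * Um j + Um (j - 1)) * Er r) $$ (x, y) = Uop q (Suc p) (Uop q p ?v) ?f + Uop q (Suc p) ?v ?f"
    by (rule mult_index_opr[OF opr_add[OF opr_mult[OF 1 2] 1] Ec Ei xy])
  have r: "((Um j * Um (j - 1) + Um j) * Er r) $$ (x, y) = Uop q p (Uop q (Suc p) ?v) ?f + Uop q p ?v ?f"
    by (rule mult_index_opr[OF opr_add[OF opr_mult[OF 2 1] 2] Ec Ei xy])
  show "((Um (j - 1) * Um j + Um (j - 1)) * Er r) $$ (x, y) = ((Um j * Um (j - 1) + Um j) * Er r) $$ (x, y)"
    unfolding l r by (rule Uop_three) (use p f in \<open>auto intro!: E swp_idx\<close>)
qed (use carrier_matD[OF Um_carrier[of j]] carrier_matD[OF Um_carrier[of "j - 1"]] j in auto)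

text \<open>The transpose of \<open>rel_three_left\<close>, all matrices involved being
  symmetric.\<close>

lemma rel_three_right:
  assumes j: "2 \<le> j" "j < r" "r \<le> n"
  shows "Er r * (Um j * Um (j - 1) + Um (j - 1)) = Er r * (Um (j - 1) * Um j + Um j)"
proof -
  let ?M = "N ^ n"
  have c: "Um (j - 1) \<in> carrier_mat ?M ?M" "Um j \<in> carrier_mat ?M ?M" "Er r \<in> carrier_mat ?M ?M"
    using Um_carrier[of j] Um_carrier[of "j - 1"] Er_carrier j by auto
  have t: "transpose_mat ((X * Y + Z) * Er r) = Er r * (Y * X + Z)"
    if "X \<in> carrier_mat ?M ?M" "Y \<in> carrier_mat ?M ?M" "Z \<in> carrier_mat ?M ?M" "transpose_mat X = X" "transpose_mat Y = Y" "transpose_mat Z = Z" for X Y Z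
  proof -
    have "X * Y + Z \<in> carrier_mat ?M ?M" using that by auto
    from transpose_mult[OF this c(3)] show ?thesis
      unfolding transpose_add[OF mult_carrier_mat[OF that(1,2)] that(3)] transpose_mult[OF that(1,2)] that(4-6) rep_E_sym[OF s_nz] .
  qed
  have "transpose_mat ((Um (j - 1) * Um j + Um (j - 1)) * Er r) = transpose_mat ((Um j * Um (j - 1) + Um j) * Er r)"
    unfolding rel_three_left[OF j] ..
  thus ?thesis
    unfolding t[OF c(1,2,1) rep_U_sym rep_U_sym rep_U_sym] t[OF c(2,1,2) rep_U_sym rep_U_sym rep_U_sym] .
qed

end

section \<open>Evaluation of rational functions and noncommutative polynomials\<close>

lemma eventually_poly_nonzero:
  fixes p :: "complex poly"
  assumes "p \<noteq> 0"
  shows "\<forall>\<^sub>F q in at a. poly p q \<noteq> 0"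
proof -
  have "\<forall>\<^sub>F q in at a. \<forall>z\<in>{z. poly p z = 0}. q \<noteq> z"
  proof (intro eventually_ball_finite poly_roots_finite[OF assms] ballI)
    fix z show "\<forall>\<^sub>F q in at a. q \<noteq> z" by (rule eventually_neq_at_within)
  qed
  thus ?thesis by eventually_elim auto
qed

text \<open>
  The numerator and denominator are chosen arbitrarily, so the value is meaningful only for \<open>q\<close> outside
  a finite set; all rules below hold eventually in a punctured neighbourhood.
\<close>

definition ev :: "ratfun \<Rightarrow> complex \<Rightarrow> complex" where
  "ev r q = (let pd = SOME pd. snd pd \<noteq> 0 \<and> r = Fraction_Field.Fract (fst pd) (snd pd)
     in poly (fst pd) q / poly (snd pd) q)"

lemma ev_obtain:
  obtains p d where "d \<noteq> 0" "r = Fraction_Field.Fract p d" "\<And>q. ev r q = poly p q / poly d q"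
proof -
  let ?P = "\<lambda>pd. snd pd \<noteq> 0 \<and> r = Fraction_Field.Fract (fst pd) (snd pd)"
  have "\<exists>pd. ?P pd" by (cases r) auto
  hence "?P (SOME pd. ?P pd)" by (rule someI_ex)
  thus ?thesis using that unfolding ev_def Let_def by blast
qed

lemma ev_Fract:
  assumes "d \<noteq> 0"
  shows "\<forall>\<^sub>F q in at a. ev (Fraction_Field.Fract p d) q = poly p q / poly d q"
proof -
  obtain p' d' where d': "d' \<noteq> 0" "Fraction_Field.Fract p d = Fraction_Field.Fract p' d'"
    and e: "\<And>q. ev (Fraction_Field.Fract p d) q = poly p' q / poly d' q" by (rule ev_obtain) blast
  have "p * d' = p' * d" using d' assms by (simp add: eq_fract)
  hence "poly p q * poly d' q = poly p' q * poly d q" for q by (metis poly_mult)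
  show ?thesis using eventually_poly_nonzero[OF assms, of a] eventually_poly_nonzero[OF d'(1), of a]
    by eventually_elim (simp add: e frac_eq_eq \<open>\<And>q. poly p q * poly d' q = poly p' q * poly d q\<close>)
qed

lemma ev_0 [simp]: "ev 0 q = 0"
proof -
  obtain p d where "d \<noteq> 0" "0 = Fraction_Field.Fract p d" "ev 0 q = poly p q / poly d q" by (rule ev_obtain) blast
  thus ?thesis by (simp add: Zero_fract_def eq_fract)
qed

lemma ev_const: "\<forall>\<^sub>F q in at a. ev (Fraction_Field.Fract [:c:] 1) q = c"
  using ev_Fract[of 1 "[:c:]" a] by simp

lemma ev_1: "\<forall>\<^sub>F q in at a. ev 1 q = 1"
  using ev_Fract[of 1 1 a] by (simp add: One_fract_def)

lemma ev_q_ind: "\<forall>\<^sub>F q in at a. ev q_ind q = q"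
  using ev_Fract[of 1 "[:0, 1:]" a] by (simp add: q_ind_def)

lemma ev_add: "\<forall>\<^sub>F q in at a. ev (r + s) q = ev r q + ev s q"
proof -
  obtain p d where 1: "d \<noteq> 0" "r = Fraction_Field.Fract p d" "\<And>q. ev r q = poly p q / poly d q" by (rule ev_obtain) blast
  obtain p' d' where 2: "d' \<noteq> 0" "s = Fraction_Field.Fract p' d'" "\<And>q. ev s q = poly p' q / poly d' q" by (rule ev_obtain) blast
  have "r + s = Fraction_Field.Fract (p * d' + p' * d) (d * d')" using 1 2 by simp
  moreover have "d * d' \<noteq> 0" using 1 2 by simp
  ultimately have "\<forall>\<^sub>F q in at a. ev (r + s) q = poly (p * d' + p' * d) q / poly (d * d') q" using ev_Fract by metis
  thus ?thesis using eventually_poly_nonzero[OF 1(1), of a] eventually_poly_nonzero[OF 2(1), of a]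
    by eventually_elim (simp add: 1(3) 2(3) add_frac_eq)
qed

lemma ev_mult: "\<forall>\<^sub>F q in at a. ev (r * s) q = ev r q * ev s q"
proof -
  obtain p d where 1: "d \<noteq> 0" "r = Fraction_Field.Fract p d" "\<And>q. ev r q = poly p q / poly d q" by (rule ev_obtain) blast
  obtain p' d' where 2: "d' \<noteq> 0" "s = Fraction_Field.Fract p' d'" "\<And>q. ev s q = poly p' q / poly d' q" by (rule ev_obtain) blast
  have "r * s = Fraction_Field.Fract (p * p') (d * d')" using 1 2 by simp
  moreover have "d * d' \<noteq> 0" using 1 2 by simp
  ultimately have "\<forall>\<^sub>F q in at a. ev (r * s) q = poly (p * p') q / poly (d * d') q" using ev_Fract by metis
  thus ?thesis by eventually_elim (simp add: 1(3) 2(3))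
qed

lemma ev_uminus: "\<forall>\<^sub>F q in at a. ev (- r) q = - ev r q"
  using ev_add[of r "- r" a] by eventually_elim (simp add: eq_neg_iff_add_eq_0 add.commute)

lemma ev_diff: "\<forall>\<^sub>F q in at a. ev (r - s) q = ev r q - ev s q"
  using ev_add[of r "- s" a] ev_uminus[of s a] by eventually_elim simp

lemma ev_inverse: "\<forall>\<^sub>F q in at a. ev (inverse r) q = inverse (ev r q)"
proof (cases "r = 0")
  case False
  show ?thesis using ev_mult[of r "inverse r" a] ev_1[of a]
    by eventually_elim (simp add: False inverse_unique[symmetric])
qed simp

lemma ev_power: "\<forall>\<^sub>F q in at a. ev (r ^ m) q = ev r q ^ m"
proof (induction m)
  case 0 show ?case using ev_1[of a] by simp
next
  case (Suc m)
  thus ?case using ev_mult[of r "r ^ m" a] by eventually_elim simp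
qed

lemma ev_e_coeff: "\<forall>\<^sub>F q in at a. ev (e_coeff N) q = (q ^ (N - 1) + q) / (q ^ N + 1)"
proof -
  let ?x = "q_ind ^ (N - 1) + q_ind" and ?y = "q_ind ^ N + 1"
  show ?thesis
    using ev_q_ind[of a] ev_1[of a] ev_power[of q_ind N a] ev_power[of q_ind "N - 1" a]
      ev_add[of "q_ind ^ (N - 1)" q_ind a] ev_add[of "q_ind ^ N" 1 a] ev_inverse[of ?y a] ev_mult[of ?x "inverse ?y" a]
    by eventually_elim (simp add: e_coeff_def divide_inverse)
qed

text \<open>Splitting off the powers of q - a from numerator and denominator leaves a quotient that
  is finite and nonzero at \<open>a\<close>; \<open>v\<close> is the order of \<open>r\<close>
  there.\<close>

lemma ev_leading_term:
  assumes "r \<noteq> 0"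
  shows "\<exists>v l. l \<noteq> 0 \<and> ((\<lambda>q. ev r q * (q - a) powi (- v)) \<longlongrightarrow> l) (at a)"
proof -
  obtain p d where pd: "d \<noteq> 0" "r = Fraction_Field.Fract p d" "\<And>q. ev r q = poly p q / poly d q" by (rule ev_obtain) blast
  have p0: "p \<noteq> 0" using assms pd by (auto simp: Zero_fract_def eq_fract)
  have dec: "\<exists>m p'. poly p' a \<noteq> 0 \<and> p = [:- a, 1:] ^ m * p'" if "p \<noteq> 0" for p :: "complex poly"
    using order_decomp[OF that, of a] poly_eq_0_iff_dvd by metis
  obtain m p' where p: "poly p' a \<noteq> 0" "p = [:- a, 1:] ^ m * p'" using dec[OF p0] by blast
  obtain m' d' where d: "poly d' a \<noteq> 0" "d = [:- a, 1:] ^ m' * d'" using dec[OF pd(1)] by blast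
  have "((\<lambda>q. poly p' q / poly d' q) \<longlongrightarrow> poly p' a / poly d' a) (at a)"
    by (intro tendsto_intros d(1))
  moreover have "\<forall>\<^sub>F q in at a. poly p' q / poly d' q = ev r q * (q - a) powi (- (int m - int m'))"
    using eventually_neq_at_within[of a a UNIV]
  proof eventually_elim
    case (elim q)
    have "(q - a) ^ m * (q - a) powi (int m' - int m) = (q - a) ^ m'"
      using elim by (simp add: power_int_diff)
    moreover have "ev r q = (q - a) ^ m * poly p' q / ((q - a) ^ m' * poly d' q)" by (simp add: pd(3) p d)
    ultimately show ?case using elim by (simp add: mult_ac)
  qed
  ultimately have "((\<lambda>q. ev r q * (q - a) powi (- (int m - int m'))) \<longlongrightarrow> poly p' a / poly d' a) (at a)"
    by (rule Lim_transform_eventually)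
  thus ?thesis using p(1) d(1) by (metis divide_eq_0_iff)
qed

text \<open>
  The exponent \<open>v\<close> is the smallest order at \<open>a\<close> among the nonzero coefficients.
\<close>

lemma common_leading_term:
  assumes "finite A" "i0 \<in> A" "c i0 \<noteq> 0"
  shows "\<exists>v l. (\<forall>i\<in>A. ((\<lambda>q. ev (c i) q * (q - a) powi (- v)) \<longlongrightarrow> l i) (at a)) \<and> (\<exists>i\<in>A. c i \<noteq> 0 \<and> l i \<noteq> 0)"
proof -
  have "\<forall>i. \<exists>v l. c i \<noteq> 0 \<longrightarrow> l \<noteq> 0 \<and> ((\<lambda>q. ev (c i) q * (q - a) powi (- v)) \<longlongrightarrow> l) (at a)"
    using ev_leading_term by blast
  then obtain v l where vl: "\<And>i. c i \<noteq> 0 \<Longrightarrow> l i \<noteq> 0 \<and> ((\<lambda>q. ev (c i) q * (q - a) powi (- v i)) \<longlongrightarrow> l i) (at a)"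
    by metis
  let ?B = "{i \<in> A. c i \<noteq> 0}"
  define w where "w = Min (v ` ?B)"
  have B: "finite (v ` ?B)" "v ` ?B \<noteq> {}" using assms by auto
  obtain j where j: "j \<in> A" "c j \<noteq> 0" "v j = w" using Min_in[OF B] by (auto simp: w_def)
  define l' where "l' i = (if c i \<noteq> 0 \<and> v i = w then l i else 0)" for i
  have "((\<lambda>q. ev (c i) q * (q - a) powi (- w)) \<longlongrightarrow> l' i) (at a)" if i: "i \<in> A" for i
  proof (cases "c i = 0")
    case False
    have le: "w \<le> v i" unfolding w_def using B(1) i False by (intro Min_le) auto
    define m where "m = nat (v i - w)"
    have "((\<lambda>q. (q - a) ^ m) \<longlongrightarrow> (a - a) ^ m) (at a)" by (intro tendsto_intros)
    hence "((\<lambda>q. ev (c i) q * (q - a) powi (- v i) * (q - a) ^ m) \<longlongrightarrow> l i * (a - a) ^ m) (at a)"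
      using vl[OF False] by (intro tendsto_mult) auto
    moreover have "l i * (a - a) ^ m = l' i" using False le by (auto simp: l'_def m_def)
    moreover have "\<forall>\<^sub>F q in at a. ev (c i) q * (q - a) powi (- v i) * (q - a) ^ m = ev (c i) q * (q - a) powi (- w)"
      using eventually_neq_at_within[of a a UNIV]
    proof eventually_elim
      case (elim q)
      have "(q - a) powi (- v i) * (q - a) powi (int m) = (q - a) powi (- v i + int m)"
        by (rule power_int_add[symmetric]) (use elim in simp)
      moreover have "- v i + int m = - w" using le by (simp add: m_def)
      ultimately show ?case by (simp add: mult.assoc)
    qed
    ultimately show ?thesis by (simp add: Lim_transform_eventually)
  qed (simp add: l'_def)
  moreover have "l' j \<noteq> 0" using j vl by (simp add: l'_def)
  ultimately show ?thesis using j by blast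
qed

lemma poly_mapping_add_induct [case_names zero add]:
  assumes "P 0" and "\<And>f w c. P f \<Longrightarrow> P (f + Poly_Mapping.single w c)"
  shows "P (f :: 'a \<Rightarrow>\<^sub>0 'b :: comm_monoid_add)"
proof (induction f rule: update_induct)
  case (update f w c)
  have "Poly_Mapping.update w c f = f + Poly_Mapping.single w c"
    using update by (intro poly_mapping_eqI) (auto simp: lookup_update lookup_add lookup_single in_keys_iff when_def)
  thus ?case using assms(2) update by simp
qed (rule assms(1))

section \<open>Evaluation of noncommutative polynomials in matrices\<close>

locale word_eval =
  fixes M :: nat and \<rho> :: "gen \<Rightarrow> complex \<Rightarrow> complex mat"
  assumes \<rho>_carrier [simp]: "\<rho> g q \<in> carrier_mat M M"
begin

definition wordmat :: "monomial \<Rightarrow> complex \<Rightarrow> complex mat" where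
  "wordmat w q = foldr (\<lambda>g X. \<rho> g q * X) (letters w) (1\<^sub>m M)"

definition evalm :: "ncpoly \<Rightarrow> complex \<Rightarrow> complex mat" where
  "evalm f q = mat M M (\<lambda>(x, y). \<Sum>w\<in>Poly_Mapping.keys f. ev (Poly_Mapping.lookup f w) q * wordmat w q $$ (x, y))"

lemma wordmat_carrier [simp]: "wordmat w q \<in> carrier_mat M M"
proof -
  have "foldr (\<lambda>g X. \<rho> g q * X) gs (1\<^sub>m M) \<in> carrier_mat M M" for gs
    by (induction gs) (auto intro!: mult_carrier_mat[OF \<rho>_carrier])
  thus ?thesis by (simp add: wordmat_def)
qed

lemma wordmat_0: "wordmat 0 q = 1\<^sub>m M"
  by (simp add: wordmat_def zero_monomial_def)

lemma wordmat_single: "wordmat (Monomial [g]) q = \<rho> g q"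
  by (simp add: wordmat_def right_mult_one_mat[OF \<rho>_carrier])

lemma wordmat_add: "wordmat (v + w) q = wordmat v q * wordmat w q"
proof -
  have c: "foldr (\<lambda>g X. \<rho> g q * X) gs (1\<^sub>m M) \<in> carrier_mat M M" for gs
    using wordmat_carrier[of "Monomial gs" q] by (simp add: wordmat_def)
  have "foldr (\<lambda>g X. \<rho> g q * X) (gs @ hs) (1\<^sub>m M)
     = foldr (\<lambda>g X. \<rho> g q * X) gs (1\<^sub>m M) * foldr (\<lambda>g X. \<rho> g q * X) hs (1\<^sub>m M)" for gs hs
  proof (induction gs)
    case Nil
    show ?case using left_mult_one_mat[OF c] by simp
  next
    case (Cons g gs)
    show ?case using Cons assoc_mult_mat[OF \<rho>_carrier c c] by simp
  qed
  thus ?thesis by (simp add: wordmat_def plus_monomial_def)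
qed

lemma evalm_carrier [simp]: "evalm f q \<in> carrier_mat M M"
  by (simp add: evalm_def)

lemma evalm_dim [simp]: "dim_row (evalm f q) = M" "dim_col (evalm f q) = M"
  by (simp_all add: evalm_def)

lemma evalm_index:
  assumes "finite A" "Poly_Mapping.keys f \<subseteq> A" "x < M" "y < M"
  shows "evalm f q $$ (x, y) = (\<Sum>w\<in>A. ev (Poly_Mapping.lookup f w) q * wordmat w q $$ (x, y))"
  using assms by (simp add: evalm_def) (rule sum.mono_neutral_left, auto simp: in_keys_iff)

lemma evalm_0 [simp]: "evalm 0 q = 0\<^sub>m M M"
  by (rule eq_matI) (auto simp: evalm_def)

lemma evalm_single: "evalm (Poly_Mapping.single w c) q = ev c q \<cdot>\<^sub>m wordmat w q"
proof (rule eq_matI)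
  fix x y assume "x < dim_row (ev c q \<cdot>\<^sub>m wordmat w q)" "y < dim_col (ev c q \<cdot>\<^sub>m wordmat w q)"
  hence xy: "x < M" "y < M" using carrier_matD[OF wordmat_carrier] by auto
  have "Poly_Mapping.keys (Poly_Mapping.single w c) \<subseteq> {w}" by simp
  from evalm_index[OF _ this xy] show "evalm (Poly_Mapping.single w c) q $$ (x, y) = (ev c q \<cdot>\<^sub>m wordmat w q) $$ (x, y)"
    using xy carrier_matD[OF wordmat_carrier] by simp
qed (use carrier_matD[OF wordmat_carrier] in auto)

lemma evalm_add: "\<forall>\<^sub>F q in at a. evalm (f + g) q = evalm f q + evalm g q"
proof -
  let ?A = "Poly_Mapping.keys f \<union> Poly_Mapping.keys g"
  have "\<forall>\<^sub>F q in at a. \<forall>w\<in>?A. ev (Poly_Mapping.lookup (f + g) w) q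
      = ev (Poly_Mapping.lookup f w) q + ev (Poly_Mapping.lookup g w) q"
    by (intro eventually_ball_finite ballI) (simp_all add: lookup_add ev_add)
  thus ?thesis
  proof eventually_elim
    case (elim q)
    show ?case
    proof (rule eq_matI)
      fix x y assume "x < dim_row (evalm f q + evalm g q)" "y < dim_col (evalm f q + evalm g q)"
      hence xy: "x < M" "y < M" by auto
      have "evalm (f + g) q $$ (x, y) = (\<Sum>w\<in>?A. ev (Poly_Mapping.lookup (f + g) w) q * wordmat w q $$ (x, y))"
        by (rule evalm_index[OF _ keys_add xy]) simp
      also have "\<dots> = (\<Sum>w\<in>?A. ev (Poly_Mapping.lookup f w) q * wordmat w q $$ (x, y) + ev (Poly_Mapping.lookup g w) q * wordmat w q $$ (x, y))"
        by (intro sum.cong refl) (use elim in \<open>simp add: distrib_right\<close>)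
      also have "\<dots> = (\<Sum>w\<in>?A. ev (Poly_Mapping.lookup f w) q * wordmat w q $$ (x, y)) + (\<Sum>w\<in>?A. ev (Poly_Mapping.lookup g w) q * wordmat w q $$ (x, y))"
        by (rule sum.distrib)
      also have "\<dots> = (evalm f q + evalm g q) $$ (x, y)"
        using xy evalm_index[of ?A f x y q] evalm_index[of ?A g x y q] by simp
      finally show "evalm (f + g) q $$ (x, y) = (evalm f q + evalm g q) $$ (x, y)" .
    qed auto
  qed
qed

lemma evalm_single_mult_single:
  "\<forall>\<^sub>F q in at a. evalm (Poly_Mapping.single v c * Poly_Mapping.single w d) q
     = evalm (Poly_Mapping.single v c) q * evalm (Poly_Mapping.single w d) q"
  using ev_mult[of c d a]
proof eventually_elim
  case (elim q)
  have "(ev c q \<cdot>\<^sub>m wordmat v q) * (ev d q \<cdot>\<^sub>m wordmat w q) = ev c q \<cdot>\<^sub>m (ev d q \<cdot>\<^sub>m (wordmat v q * wordmat w q))"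
    using mult_smult_assoc_mat[OF wordmat_carrier smult_carrier_mat[OF wordmat_carrier]]
      mult_smult_distrib[OF wordmat_carrier wordmat_carrier] by metis
  thus ?case unfolding mult_single evalm_single wordmat_add elim by (auto intro!: eq_matI)
qed

text \<open>For given polynomials only finitely many identities between coefficients are involved,
  so they hold simultaneously near \<open>a\<close>. The neighbourhood depends on \<open>f\<close>
  and \<open>g\<close>; no single \<open>q\<close> is claimed to give a homomorphism.\<close>

lemma evalm_mult: "\<forall>\<^sub>F q in at a. evalm (f * g) q = evalm f q * evalm g q"
proof (induction f rule: poly_mapping_add_induct)
  case zero
  show ?case using left_mult_zero_mat[OF evalm_carrier] by simp
next
  case (add f v c)
  let ?s = "Poly_Mapping.single v c"
  have "\<forall>\<^sub>F q in at a. evalm (?s * g) q = evalm ?s q * evalm g q"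
  proof (induction g rule: poly_mapping_add_induct)
    case zero
    show ?case using right_mult_zero_mat[OF evalm_carrier] by simp
  next
    case (add g w d)
    let ?t = "Poly_Mapping.single w d"
    show ?case using add evalm_add[of "?s * g" "?s * ?t" a] evalm_add[of g ?t a] evalm_single_mult_single[of v c w d a]
    proof eventually_elim
      case (elim q)
      show ?case unfolding distrib_left elim
        using mult_add_distrib_mat[OF evalm_carrier evalm_carrier evalm_carrier] by metis
    qed
  qed
  thus ?case using add evalm_add[of "f * g" "?s * g" a] evalm_add[of f ?s a]
  proof eventually_elim
    case (elim q)
    show ?case unfolding distrib_right elim
      using add_mult_distrib_mat[OF evalm_carrier evalm_carrier evalm_carrier] by metis
  qed
qed

lemma evalm_diff: "\<forall>\<^sub>F q in at a. evalm (f - g) q = evalm f q - evalm g q"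
  using evalm_add[of "f - g" g a]
proof eventually_elim
  case (elim q)
  have "evalm f q = evalm (f - g) q + evalm g q" using elim by simp
  thus ?case by (intro eq_matI) auto
qed

lemma evalm_uminus: "\<forall>\<^sub>F q in at a. evalm (- f) q = - evalm f q"
  using evalm_diff[of 0 f a] by eventually_elim (auto intro!: eq_matI)

lemma evalm_const: "evalm (const c) q = ev c q \<cdot>\<^sub>m 1\<^sub>m M"
  by (simp add: const_def evalm_single wordmat_0)

lemma evalm_1: "\<forall>\<^sub>F q in at a. evalm 1 q = 1\<^sub>m M"
proof -
  have "1 = const 1" by (simp add: const_def single_one)
  have "\<forall>\<^sub>F q in at a. evalm (const 1) q = 1\<^sub>m M"
    using ev_1[of a] by eventually_elim (auto simp: evalm_const intro!: eq_matI)
  thus ?thesis using \<open>1 = const 1\<close> by simp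
qed

lemma evalm_gen:
  "\<forall>\<^sub>F q in at a. evalm (u_gen i) q = \<rho> (GenU i) q"
  "\<forall>\<^sub>F q in at a. evalm (e_gen r) q = \<rho> (GenE r) q"
  using ev_1[of a] by (eventually_elim; auto simp: u_gen_def e_gen_def evalm_single wordmat_single intro!: eq_matI)+

lemma evalm_const_mult: "\<forall>\<^sub>F q in at a. evalm (const c * f) q = ev c q \<cdot>\<^sub>m evalm f q"
  using evalm_mult[of "const c" f a]
proof eventually_elim
  case (elim q)
  show ?case unfolding elim evalm_const
    using mult_smult_assoc_mat[OF one_carrier_mat evalm_carrier] left_mult_one_mat[OF evalm_carrier] by metis
qed

end

section \<open>The free algebra\<close>

lemma in_free_alg: "f \<in> carrier (free_alg n) \<longleftrightarrow> (\<forall>w\<in>Poly_Mapping.keys f. set (letters w) \<subseteq> gens n)"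
  by (simp add: free_alg_def)

lemma free_alg_simps:
  "\<zero>\<^bsub>free_alg n\<^esub> = 0" "\<one>\<^bsub>free_alg n\<^esub> = 1" "(f \<oplus>\<^bsub>free_alg n\<^esub> g) = f + g" "f \<otimes>\<^bsub>free_alg n\<^esub> g = f * g"
  by (simp_all add: free_alg_def)

lemma free_alg_closed [intro]:
  "0 \<in> carrier (free_alg n)" "1 \<in> carrier (free_alg n)" "const c \<in> carrier (free_alg n)"
  "f \<in> carrier (free_alg n) \<Longrightarrow> g \<in> carrier (free_alg n) \<Longrightarrow> f + g \<in> carrier (free_alg n)"
  "f \<in> carrier (free_alg n) \<Longrightarrow> g \<in> carrier (free_alg n) \<Longrightarrow> f - g \<in> carrier (free_alg n)"
  "f \<in> carrier (free_alg n) \<Longrightarrow> - f \<in> carrier (free_alg n)"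
  "f \<in> carrier (free_alg n) \<Longrightarrow> g \<in> carrier (free_alg n) \<Longrightarrow> f * g \<in> carrier (free_alg n)"
  "1 \<le> i \<Longrightarrow> i < n \<Longrightarrow> u_gen i \<in> carrier (free_alg n)"
  "1 \<le> i \<Longrightarrow> i < n \<Longrightarrow> g_gen i \<in> carrier (free_alg n)"
  "1 \<le> r \<Longrightarrow> r \<le> n \<Longrightarrow> e_gen r \<in> carrier (free_alg n)"
proof -
  have c: "const c \<in> carrier (free_alg n)" for c by (auto simp: in_free_alg const_def zero_monomial_def)
  have u: "u_gen i \<in> carrier (free_alg n)" if "1 \<le> i" "i < n" for i
    using that by (auto simp: in_free_alg u_gen_def gens_def)
  have d: "f - g \<in> carrier (free_alg n)" if "f \<in> carrier (free_alg n)" "g \<in> carrier (free_alg n)" for f g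
    using that keys_diff[of f g] unfolding in_free_alg by blast
  show "0 \<in> carrier (free_alg n)" "const c \<in> carrier (free_alg n)" using c by (auto simp: in_free_alg)
  show "1 \<in> carrier (free_alg n)" by (simp add: in_free_alg zero_monomial_def)
  show "f + g \<in> carrier (free_alg n)" if "f \<in> carrier (free_alg n)" "g \<in> carrier (free_alg n)"
    using that keys_add[of f g] unfolding in_free_alg by blast
  show "f - g \<in> carrier (free_alg n)" if "f \<in> carrier (free_alg n)" "g \<in> carrier (free_alg n)"
    by (rule d[OF that])
  show "- f \<in> carrier (free_alg n)" if "f \<in> carrier (free_alg n)"
    using that by (simp add: in_free_alg)
  show "f * g \<in> carrier (free_alg n)" if "f \<in> carrier (free_alg n)" "g \<in> carrier (free_alg n)"
    unfolding in_free_alg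
  proof
    fix w assume "w \<in> Poly_Mapping.keys (f * g)"
    then obtain a b where "w = a + b" "a \<in> Poly_Mapping.keys f" "b \<in> Poly_Mapping.keys g" using keys_mult[of f g] by auto
    thus "set (letters w) \<subseteq> gens n" using that by (auto simp: in_free_alg plus_monomial_def)
  qed
  show "u_gen i \<in> carrier (free_alg n)" if "1 \<le> i" "i < n" by (rule u[OF that])
  show "g_gen i \<in> carrier (free_alg n)" if "1 \<le> i" "i < n" unfolding g_gen_def by (rule d[OF c u[OF that]])
  show "e_gen r \<in> carrier (free_alg n)" if "1 \<le> r" "r \<le> n"
    using that by (auto simp: in_free_alg e_gen_def gens_def)
qed

lemma ring_free_alg: "ring (free_alg n)"
proof (rule ringI)
  show "abelian_group (free_alg n)"
  proof (rule abelian_groupI)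
    fix f assume "f \<in> carrier (free_alg n)"
    thus "\<exists>g\<in>carrier (free_alg n). (g \<oplus>\<^bsub>free_alg n\<^esub> f) = \<zero>\<^bsub>free_alg n\<^esub>"
      by (intro bexI[of _ "- f"]) (auto simp: free_alg_simps)
  qed (auto simp: free_alg_simps add_ac)
  show "Group.monoid (free_alg n)"
    by (rule monoidI) (auto simp: free_alg_simps mult.assoc)
qed (auto simp: free_alg_simps distrib_left distrib_right)

lemma relators_subset: "relators N n \<subseteq> carrier (free_alg n)"
  unfolding relators_def hecke_relators_def by (auto intro!: free_alg_closed)

section \<open>Specialisation at q = 1\<close>

context word_eval begin

lemma evalm_eq_mult:
  assumes "\<forall>\<^sub>F q in at a. evalm f q = F q" "\<forall>\<^sub>F q in at a. evalm g q = G q"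
  shows "\<forall>\<^sub>F q in at a. evalm (f * g) q = F q * G q"
  using assms evalm_mult[of f g a] by eventually_elim simp

lemma evalm_eq_add:
  assumes "\<forall>\<^sub>F q in at a. evalm f q = F q" "\<forall>\<^sub>F q in at a. evalm g q = G q"
  shows "\<forall>\<^sub>F q in at a. evalm (f + g) q = F q + G q"
  using assms evalm_add[of f g a] by eventually_elim simp

lemma evalm_eq_diff:
  assumes "\<forall>\<^sub>F q in at a. evalm f q = F q" "\<forall>\<^sub>F q in at a. evalm g q = G q"
  shows "\<forall>\<^sub>F q in at a. evalm (f - g) q = F q - G q"
  using assms evalm_diff[of f g a] by eventually_elim simp

lemma evalm_eq_const_mult:
  assumes "\<forall>\<^sub>F q in at a. ev c q = h q" "\<forall>\<^sub>F q in at a. evalm f q = F q"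
  shows "\<forall>\<^sub>F q in at a. evalm (const c * f) q = h q \<cdot>\<^sub>m F q"
  using assms evalm_const_mult[of c f a] by eventually_elim simp

text \<open>The substitute for the kernel of the representation: since evaluation is multiplicative
  only near \<open>a\<close>, elements count as zero if they vanish eventually.\<close>

definition vanishing :: "nat \<Rightarrow> complex \<Rightarrow> ncpoly set" where
  "vanishing n a = {f \<in> carrier (free_alg n). \<forall>\<^sub>F q in at a. evalm f q = 0\<^sub>m M M}"

lemma vanishing_diffI:
  assumes "f - g \<in> carrier (free_alg n)"
    and f: "\<forall>\<^sub>F q in at a. evalm f q = F q" and g: "\<forall>\<^sub>F q in at a. evalm g q = G q"
    and "\<forall>\<^sub>F q in at a. F q = G q"
  shows "f - g \<in> vanishing n a"
proof -
  have "\<forall>\<^sub>F q in at a. evalm (f - g) q = 0\<^sub>m M M"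
    using evalm_diff[of f g a] f g assms(4)
    by eventually_elim (metis minus_r_inv_mat[OF evalm_carrier])
  thus ?thesis using assms(1) by (simp add: vanishing_def)
qed

lemma ideal_vanishing: "ideal (vanishing n a) (free_alg n)"
proof (rule idealI[OF ring_free_alg])
  interpret F: ring "free_alg n" by (rule ring_free_alg)
  show "subgroup (vanishing n a) (add_monoid (free_alg n))"
  proof (rule F.add.subgroupI)
    show "vanishing n a \<subseteq> carrier (free_alg n)" by (auto simp: vanishing_def)
    have "0 \<in> vanishing n a" by (auto simp: vanishing_def)
    thus "vanishing n a \<noteq> {}" by blast
    fix f assume f: "f \<in> vanishing n a"
    have "\<ominus>\<^bsub>free_alg n\<^esub> f = - f"
      by (rule F.minus_equality) (use f in \<open>auto simp: vanishing_def free_alg_simps\<close>)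
    moreover have "- f \<in> carrier (free_alg n)" using f by (auto simp: vanishing_def)
    moreover have "\<forall>\<^sub>F q in at a. evalm f q = 0\<^sub>m M M" using f by (simp add: vanishing_def)
    hence "\<forall>\<^sub>F q in at a. evalm (- f) q = 0\<^sub>m M M"
      using evalm_uminus[of f a] by eventually_elim (auto intro!: eq_matI)
    ultimately show "\<ominus>\<^bsub>free_alg n\<^esub> f \<in> vanishing n a" by (simp add: vanishing_def)
    fix g assume g: "g \<in> vanishing n a"
    have "f + g \<in> carrier (free_alg n)" using f g by (auto simp: vanishing_def)
    moreover have "\<forall>\<^sub>F q in at a. evalm (f + g) q = 0\<^sub>m M M + 0\<^sub>m M M"
      by (rule evalm_eq_add) (use f g in \<open>simp_all add: vanishing_def\<close>)
    ultimately show "f \<oplus>\<^bsub>free_alg n\<^esub> g \<in> vanishing n a"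
      by (simp add: vanishing_def free_alg_simps)
  qed
  fix f g assume fg: "f \<in> vanishing n a" "g \<in> carrier (free_alg n)"
  have f: "\<forall>\<^sub>F q in at a. evalm f q = 0\<^sub>m M M" using fg by (simp add: vanishing_def)
  have "\<forall>\<^sub>F q in at a. evalm (g * f) q = 0\<^sub>m M M" "\<forall>\<^sub>F q in at a. evalm (f * g) q = 0\<^sub>m M M"
    using f evalm_mult[of g f a] evalm_mult[of f g a]
    by (eventually_elim; metis right_mult_zero_mat[OF evalm_carrier] left_mult_zero_mat[OF evalm_carrier])+
  thus "g \<otimes>\<^bsub>free_alg n\<^esub> f \<in> vanishing n a" "f \<otimes>\<^bsub>free_alg n\<^esub> g \<in> vanishing n a"
    using fg by (auto simp: vanishing_def free_alg_simps)
qed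

end

lemma Snum_tendsto: "(Snum k \<longlongrightarrow> Snum k 1) (at 1)"
  unfolding Snum_def by (intro tendsto_intros) auto

locale rep_family =
  fixes k n :: nat and rmq :: "complex \<Rightarrow> complex"
  assumes rmq: "\<forall>\<^sub>F q in nhds 1. rmq q ^ 2 = - q" "isCont rmq 1"
begin

definition N :: nat where N_eq: "N = 2 * k + 1"

text \<open>
  Words with letters outside \<open>gens n\<close> would give matrices of the wrong size.
\<close>

definition rho :: "gen \<Rightarrow> complex \<Rightarrow> complex mat" where
  "rho g q = (if g \<in> gens n then rep k n q (rmq q) g else 0\<^sub>m (N ^ n) (N ^ n))"

sublocale word_eval "N ^ n" rho
proof
  fix g q
  show "rho g q \<in> carrier_mat (N ^ n) (N ^ n)"
    using rep_U_carrier[of _ n k q "rmq q"] rep_E_carrier[of _ n k q "rmq q"]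
    by (auto simp: rho_def gens_def N_eq)
qed

abbreviation Um where "Um i q \<equiv> rep k n q (rmq q) (GenU i)"
abbreviation Er where "Er r q \<equiv> rep k n q (rmq q) (GenE r)"
abbreviation Gm where "Gm i q \<equiv> q \<cdot>\<^sub>m 1\<^sub>m (N ^ n) - Um i q"

lemma evalm_u: "1 \<le> i \<Longrightarrow> i < n \<Longrightarrow> \<forall>\<^sub>F q in at a. evalm (u_gen i) q = Um i q"
  using evalm_gen(1)[of i a] by (simp add: rho_def gens_def)
lemma evalm_e: "1 \<le> r \<Longrightarrow> r \<le> n \<Longrightarrow> \<forall>\<^sub>F q in at a. evalm (e_gen r) q = Er r q"
  using evalm_gen(2)[of r a] by (simp add: rho_def gens_def)
lemma evalm_g:
  assumes "1 \<le> i" "i < n"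
  shows "\<forall>\<^sub>F q in at a. evalm (g_gen i) q = Gm i q"
  unfolding g_gen_def
proof (rule evalm_eq_diff[OF _ evalm_u[OF assms]])
  show "\<forall>\<^sub>F q in at a. evalm (const q_ind) q = q \<cdot>\<^sub>m 1\<^sub>m (N ^ n)"
    using ev_q_ind[of a] by eventually_elim (simp add: evalm_const)
qed

lemma eventually_rep_at: "\<forall>\<^sub>F q in at 1. rep_at k q (rmq q)"
proof -
  have p: "((\<lambda>q :: complex. q ^ (2 * k + 1) + 1) \<longlongrightarrow> 1 ^ (2 * k + 1) + 1) (at 1)" by (intro tendsto_intros)
  have e: "\<forall>\<^sub>F q in at 1. f q \<noteq> c" if "(f \<longlongrightarrow> l) (at 1)" "l \<noteq> c" for f :: "complex \<Rightarrow> complex" and l c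
    using that by (rule tendsto_imp_eventually_ne)
  have "\<forall>\<^sub>F q in at 1. rmq q ^ 2 = - q" using rmq(1) by (simp add: eventually_at_filter eventually_mono)
  moreover have "\<forall>\<^sub>F q in at 1. q \<noteq> (0 :: complex)" "\<forall>\<^sub>F q in at 1. q \<noteq> (- 1 :: complex)"
    by (rule e[OF tendsto_ident_at], simp)+
  moreover have "\<forall>\<^sub>F q in at 1. q ^ (2 * k + 1) + 1 \<noteq> (0 :: complex)" by (rule e[OF p]) simp
  \<comment> \<open>The value of the sum at q = 1 does not involve the square root, so the imaginary
    unit serves as an instance for the locale parameter.\<close>
  moreover have "\<forall>\<^sub>F q in at 1. Snum k q \<noteq> 0" by (rule e[OF Snum_tendsto]) (simp add: at_one.Snum_1[OF at_one.intro, of "\<i>"])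
  ultimately show ?thesis by eventually_elim (simp add: rep_at_def)
qed

text \<open>Each relator is a difference whose two terms evaluate, near 1, to the two sides of a
  matrix identity of \<open>rep_at\<close>.\<close>

lemma relators_vanish: "relators N n \<subseteq> vanishing n 1"
proof
  fix f assume fr: "f \<in> relators N n"
  hence fc: "f \<in> carrier (free_alg n)" using relators_subset by blast
  have Neq: "rep_at.N k = N" if "rep_at k q s" for q s using rep_at.N_eq[OF that] N_eq by simp
  have Geq: "rep_at.Gm k q s n i = q \<cdot>\<^sub>m 1\<^sub>m (N ^ n) - rep k n q s (GenU i)" if "rep_at k q s" for q s i
    using rep_at.Gm_def[OF that] Neq[OF that] by simp
  from fr consider
     (braid) i where "1 \<le> i" "i + 1 < n" "f = g_gen i * g_gen (i + 1) * g_gen i - g_gen (i + 1) * g_gen i * g_gen (i + 1)"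
   | (far) i j where "1 \<le> i" "i < n" "1 \<le> j" "j < n" "\<bar>int i - int j\<bar> \<noteq> 1" "f = g_gen i * g_gen j - g_gen j * g_gen i"
   | (quad) i where "1 \<le> i" "i < n" "f = g_gen i * g_gen i - (const (q_ind - inverse q_ind) * g_gen i + 1)"
   | (comm) i where "2 \<le> i" "i < n" "f = e_gen 1 * u_gen i - u_gen i * e_gen 1"
   | (idem) r where "1 \<le> r" "r \<le> n" "f = e_gen r * e_gen r - e_gen r"
   | (Suc) r where "1 \<le> r" "r < n" "f = e_gen (r + 1) - (const (e_coeff N) * e_gen r - e_gen r * u_gen r * e_gen r)"
   | (left) j r where "2 \<le> j" "j < r" "r \<le> n" "f = (u_gen (j - 1) * u_gen j + u_gen (j - 1)) * e_gen r
       - (u_gen j * u_gen (j - 1) + u_gen j) * e_gen r"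
   | (right) j r where "2 \<le> j" "j < r" "r \<le> n" "f = e_gen r * (u_gen j * u_gen (j - 1) + u_gen (j - 1))
       - e_gen r * (u_gen (j - 1) * u_gen j + u_gen j)"
    unfolding relators_def hecke_relators_def Un_iff mem_Collect_eq
    by (elim disjE exE conjE) blast+
  thus "f \<in> vanishing n 1"
  proof cases
    case braid
    have g: "\<forall>\<^sub>F q in at 1. evalm (g_gen i) q = Gm i q" "\<forall>\<^sub>F q in at 1. evalm (g_gen (i + 1)) q = Gm (i + 1) q"
      using braid by (auto intro!: evalm_g)
    have "\<forall>\<^sub>F q in at 1. Gm i q * Gm (i + 1) q * Gm i q = Gm (i + 1) q * Gm i q * Gm (i + 1) q"
      using eventually_rep_at
    proof eventually_elim
      case (elim q)
      show ?case using rep_at.rel_braid[OF elim braid(1,2)] unfolding Geq[OF elim] .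
    qed
    with fc show ?thesis unfolding braid(3) by - (rule vanishing_diffI[OF _ evalm_eq_mult[OF evalm_eq_mult] evalm_eq_mult[OF evalm_eq_mult]]; (assumption | rule g))
  next
    case far
    have g: "\<forall>\<^sub>F q in at 1. evalm (g_gen i) q = Gm i q" "\<forall>\<^sub>F q in at 1. evalm (g_gen j) q = Gm j q"
      using far by (auto intro!: evalm_g)
    have "\<forall>\<^sub>F q in at 1. Gm i q * Gm j q = Gm j q * Gm i q"
      using eventually_rep_at
    proof eventually_elim
      case (elim q)
      show ?case using rep_at.rel_far[OF elim far(1-5)] unfolding Geq[OF elim] .
    qed
    with fc show ?thesis unfolding far(6) by - (rule vanishing_diffI[OF _ evalm_eq_mult evalm_eq_mult]; (assumption | rule g))
  next
    case quad
    have g: "\<forall>\<^sub>F q in at 1. evalm (g_gen i) q = Gm i q" using quad by (auto intro!: evalm_g)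
    have c: "\<forall>\<^sub>F q in at 1. ev (q_ind - inverse q_ind) q = q - inverse q"
      using ev_q_ind[of 1] ev_inverse[of q_ind 1] ev_diff[of q_ind "inverse q_ind" 1] by eventually_elim simp
    have "\<forall>\<^sub>F q in at 1. Gm i q * Gm i q = (q - inverse q) \<cdot>\<^sub>m Gm i q + 1\<^sub>m (N ^ n)"
      using eventually_rep_at
    proof eventually_elim
      case (elim q)
      show ?case using rep_at.rel_quadratic[OF elim quad(1,2)] unfolding Geq[OF elim] Neq[OF elim] .
    qed
    with fc show ?thesis unfolding quad(3)
      by - (rule vanishing_diffI[OF _ evalm_eq_mult evalm_eq_add[OF evalm_eq_const_mult[OF c] evalm_1]]; (assumption | rule g))
  next
    case comm
    have g: "\<forall>\<^sub>F q in at 1. evalm (e_gen 1) q = Er 1 q" "\<forall>\<^sub>F q in at 1. evalm (u_gen i) q = Um i q"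
      using comm by (auto intro!: evalm_e evalm_u)
    have "\<forall>\<^sub>F q in at 1. Er 1 q * Um i q = Um i q * Er 1 q"
      using eventually_rep_at by eventually_elim (rule rep_at.rel_E1_U[OF _ comm(1,2)])
    with fc show ?thesis unfolding comm(3) by - (rule vanishing_diffI[OF _ evalm_eq_mult evalm_eq_mult]; (assumption | rule g))
  next
    case idem
    note g = evalm_e[OF idem(1,2), of 1]
    have "\<forall>\<^sub>F q in at 1. Er r q * Er r q = Er r q"
      using eventually_rep_at by eventually_elim (rule rep_at.rel_E_idem[OF _ idem(2)])
    with fc show ?thesis unfolding idem(3) by - (rule vanishing_diffI[OF _ evalm_eq_mult]; (assumption | rule g))
  next
    case Suc
    have g: "\<forall>\<^sub>F q in at 1. evalm (e_gen r) q = Er r q" "\<forall>\<^sub>F q in at 1. evalm (u_gen r) q = Um r q"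
      "\<forall>\<^sub>F q in at 1. evalm (e_gen (r + 1)) q = Er (r + 1) q"
      using Suc by (auto intro!: evalm_e evalm_u)
    have "\<forall>\<^sub>F q in at 1. Er (r + 1) q = ((q ^ (N - 1) + q) / (q ^ N + 1)) \<cdot>\<^sub>m Er r q - Er r q * Um r q * Er r q"
      using eventually_rep_at
    proof eventually_elim
      case (elim q)
      show ?case using rep_at.rel_E_Suc[OF elim Suc(1,2)] unfolding rep_at.ec_def[OF elim] Neq[OF elim] .
    qed
    with fc show ?thesis unfolding Suc(3)
      by - (rule vanishing_diffI[OF _ _ evalm_eq_diff[OF evalm_eq_const_mult[OF ev_e_coeff] evalm_eq_mult[OF evalm_eq_mult]]]; (assumption | rule g))
  next
    case left
    have g: "\<forall>\<^sub>F q in at 1. evalm (e_gen r) q = Er r q" "\<forall>\<^sub>F q in at 1. evalm (u_gen j) q = Um j q"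
      "\<forall>\<^sub>F q in at 1. evalm (u_gen (j - 1)) q = Um (j - 1) q"
      using left by (auto intro!: evalm_e evalm_u)
    have "\<forall>\<^sub>F q in at 1. (Um (j - 1) q * Um j q + Um (j - 1) q) * Er r q = (Um j q * Um (j - 1) q + Um j q) * Er r q"
      using eventually_rep_at by eventually_elim (rule rep_at.rel_three_left[OF _ left(1-3)])
    with fc show ?thesis unfolding left(4)
      by - (rule vanishing_diffI[OF _ evalm_eq_mult[OF evalm_eq_add[OF evalm_eq_mult]] evalm_eq_mult[OF evalm_eq_add[OF evalm_eq_mult]]]; (assumption | rule g))
  next
    case right
    have g: "\<forall>\<^sub>F q in at 1. evalm (e_gen r) q = Er r q" "\<forall>\<^sub>F q in at 1. evalm (u_gen j) q = Um j q"
      "\<forall>\<^sub>F q in at 1. evalm (u_gen (j - 1)) q = Um (j - 1) q"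
      using right by (auto intro!: evalm_e evalm_u)
    have "\<forall>\<^sub>F q in at 1. Er r q * (Um j q * Um (j - 1) q + Um (j - 1) q) = Er r q * (Um (j - 1) q * Um j q + Um j q)"
      using eventually_rep_at by eventually_elim (rule rep_at.rel_three_right[OF _ right(1-3)])
    with fc show ?thesis unfolding right(4)
      by - (rule vanishing_diffI[OF _ evalm_eq_mult[OF _ evalm_eq_add[OF evalm_eq_mult]] evalm_eq_mult[OF _ evalm_eq_add[OF evalm_eq_mult]]]; (assumption | rule g))
  qed
qed

lemma rel_ideal_vanishes: "rel_ideal N n \<subseteq> vanishing n 1"
  unfolding rel_ideal_def by (rule ring.genideal_minimal[OF ring_free_alg ideal_vanishing relators_vanish])

end

lemma vdim_eq:
  assumes "ring R" "subfield K R" "ring.dimension R d K E"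
  shows "vdim R K E = enat d"
proof -
  have "(THE d. ring.dimension R d K E) = d"
    using assms(3) ring.dimension_is_inj[OF assms(1,2) _ assms(3)] by (rule the_equality)
  thus ?thesis using assms(3) unfolding vdim_def by auto
qed

section \<open>Lifting the algebra at q = 1 to the free algebra over the rational functions\<close>

context rep_family
begin

lemma rmq_nz: "rmq 1 \<noteq> 0"
  using isCont_rmq_nz[OF rmq(1)] by auto

lemma Um_tendsto:
  assumes i: "1 \<le> i" "i < n" and xy: "x < N ^ n" "y < N ^ n"
  shows "((\<lambda>q. Um i q $$ (x, y)) \<longlongrightarrow> Um i 1 $$ (x, y)) (at 1)"
proof -
  define p where "p = n - i - 1"
  have N0: "0 < N" by (simp add: N_eq)
  have idx: "Um i q $$ (x, y) = (if \<forall>l. l \<noteq> p \<longrightarrow> l \<noteq> Suc p \<longrightarrow> dgt N x l = dgt N y l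
     then U_coeff q (dgt N x (Suc p), dgt N x p) (dgt N y (Suc p), dgt N y p) else 0)" for q
  proof -
    have "dgt N z l < N" for z l by (simp add: dgt_def N0)
    moreover have "(a * N + b) div N = a" if "b < N" for a b using that by simp
    ultimately have "U_mat N q $$ (dgt N x (Suc p) * N + dgt N x p, dgt N y (Suc p) * N + dgt N y p)
       = U_coeff q (dgt N x (Suc p), dgt N x p) (dgt N y (Suc p), dgt N y p)"
      using pair_less N0 by (simp add: U_mat_def)
    thus ?thesis
      unfolding rep_U N_eq[symmetric] loc2_index[OF N0 i p_def U_mat_carrier xy] by (rule if_cong[OF refl _ refl])
  qed
  have inv: "((\<lambda>q :: complex. inverse q) \<longlongrightarrow> 1) (at 1)"
    using tendsto_inverse[OF tendsto_ident_at[of "1 :: complex" UNIV]] by simp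
  have U: "((\<lambda>q :: complex. if P then 0 else if Q then (if R then inverse q else q) else if S then - 1 else 0)
     \<longlongrightarrow> (if P then 0 else if Q then (if R then inverse 1 else 1) else if S then - 1 else 0)) (at 1)" for P Q R S
    by (cases P; cases Q; cases R; cases S) (simp_all add: inv)
  have U: "((\<lambda>q. U_coeff q (a, b) (c, d)) \<longlongrightarrow> U_coeff 1 (a, b) (c, d)) (at 1)" for a b c d
    unfolding U_coeff_def prod.case by (rule U)
  show ?thesis
  proof (cases "\<forall>l. l \<noteq> p \<longrightarrow> l \<noteq> Suc p \<longrightarrow> dgt N x l = dgt N y l")
    case True
    show ?thesis unfolding idx if_P[OF True] by (rule U)
  next
    case False
    show ?thesis unfolding idx if_not_P[OF False] by (rule tendsto_const)
  qed
qed

lemma Er_tendsto: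
  assumes r: "r \<le> n" and xy: "x < N ^ n" "y < N ^ n"
  shows "((\<lambda>q. Er r q $$ (x, y)) \<longlongrightarrow> Er r 1 $$ (x, y)) (at 1)"
proof -
  have "0 < 2 * k + 1" by simp
  thus ?thesis
    using xy unfolding N_eq rep_E_index[OF r xy[unfolded N_eq]]
    by (intro tendsto_Eker[OF rmq] dgt_idx)
qed

text \<open>Only the limit of the values has to exist; the coefficients of \<open>f\<close> may have
  poles at 1, which is how the scaled generators are reached.\<close>

definition liftable :: "complex mat \<Rightarrow> bool" where
  "liftable X \<longleftrightarrow> X \<in> carrier_mat (N ^ n) (N ^ n) \<and> (\<exists>f\<in>carrier (free_alg n).
     \<forall>x<N ^ n. \<forall>y<N ^ n. ((\<lambda>q. evalm f q $$ (x, y)) \<longlongrightarrow> X $$ (x, y)) (at 1))"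

lemma liftableI:
  assumes "X \<in> carrier_mat (N ^ n) (N ^ n)" "f \<in> carrier (free_alg n)" "\<forall>\<^sub>F q in at 1. evalm f q = F q"
    and "\<And>x y. x < N ^ n \<Longrightarrow> y < N ^ n \<Longrightarrow> ((\<lambda>q. F q $$ (x, y)) \<longlongrightarrow> X $$ (x, y)) (at 1)"
  shows "liftable X"
  unfolding liftable_def
proof (intro conjI bexI[OF _ assms(2)] allI impI assms(1))
  fix x y assume xy: "x < N ^ n" "y < N ^ n"
  have "\<forall>\<^sub>F q in at 1. F q $$ (x, y) = evalm f q $$ (x, y)"
    using assms(3) by eventually_elim simp
  thus "((\<lambda>q. evalm f q $$ (x, y)) \<longlongrightarrow> X $$ (x, y)) (at 1)"
    by (rule Lim_transform_eventually[OF assms(4)[OF xy]])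
qed

lemma liftable_scalar: "liftable (c \<cdot>\<^sub>m 1\<^sub>m (N ^ n))"
proof (rule liftableI)
  show "\<forall>\<^sub>F q in at 1. evalm (const (Fraction_Field.Fract [:c:] 1)) q = c \<cdot>\<^sub>m 1\<^sub>m (N ^ n)"
    using ev_const[of c 1] by eventually_elim (simp add: evalm_const)
qed auto

lemma liftable_add:
  assumes "liftable X" "liftable Y"
  shows "liftable (X + Y)"
proof -
  obtain f g where f: "f \<in> carrier (free_alg n)"
      "\<And>x y. x < N ^ n \<Longrightarrow> y < N ^ n \<Longrightarrow> ((\<lambda>q. evalm f q $$ (x, y)) \<longlongrightarrow> X $$ (x, y)) (at 1)"
    and g: "g \<in> carrier (free_alg n)"
      "\<And>x y. x < N ^ n \<Longrightarrow> y < N ^ n \<Longrightarrow> ((\<lambda>q. evalm g q $$ (x, y)) \<longlongrightarrow> Y $$ (x, y)) (at 1)"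
    using assms unfolding liftable_def by blast
  have XY: "X \<in> carrier_mat (N ^ n) (N ^ n)" "Y \<in> carrier_mat (N ^ n) (N ^ n)"
    using assms unfolding liftable_def by auto
  show ?thesis
  proof (rule liftableI[OF _ _ evalm_add])
    show "X + Y \<in> carrier_mat (N ^ n) (N ^ n)" using XY by auto
    show "f + g \<in> carrier (free_alg n)" using f g by auto
    fix x y assume "x < N ^ n" "y < N ^ n"
    thus "((\<lambda>q. (evalm f q + evalm g q) $$ (x, y)) \<longlongrightarrow> (X + Y) $$ (x, y)) (at 1)"
      using carrier_matD[OF XY(1)] carrier_matD[OF XY(2)] by (auto intro!: tendsto_add f g)
  qed
qed

lemma liftable_mult:
  assumes "liftable X" "liftable Y"
  shows "liftable (X * Y)"
proof -
  obtain f g where f: "f \<in> carrier (free_alg n)"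
      "\<And>x y. x < N ^ n \<Longrightarrow> y < N ^ n \<Longrightarrow> ((\<lambda>q. evalm f q $$ (x, y)) \<longlongrightarrow> X $$ (x, y)) (at 1)"
    and g: "g \<in> carrier (free_alg n)"
      "\<And>x y. x < N ^ n \<Longrightarrow> y < N ^ n \<Longrightarrow> ((\<lambda>q. evalm g q $$ (x, y)) \<longlongrightarrow> Y $$ (x, y)) (at 1)"
    using assms unfolding liftable_def by blast
  have XY: "X \<in> carrier_mat (N ^ n) (N ^ n)" "Y \<in> carrier_mat (N ^ n) (N ^ n)"
    using assms unfolding liftable_def by auto
  show ?thesis
  proof (rule liftableI[OF _ _ evalm_mult])
    show "X * Y \<in> carrier_mat (N ^ n) (N ^ n)" using XY by auto
    show "f * g \<in> carrier (free_alg n)" using f g by auto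
    fix x y assume xy: "x < N ^ n" "y < N ^ n"
    have "(evalm f q * evalm g q) $$ (x, y) = (\<Sum>z<N ^ n. evalm f q $$ (x, z) * evalm g q $$ (z, y))" for q
      using xy by (subst mat_mult_index) auto
    moreover have "(X * Y) $$ (x, y) = (\<Sum>z<N ^ n. X $$ (x, z) * Y $$ (z, y))"
      using xy carrier_matD[OF XY(1)] carrier_matD[OF XY(2)] by (subst mat_mult_index) auto
    ultimately show "((\<lambda>q. (evalm f q * evalm g q) $$ (x, y)) \<longlongrightarrow> (X * Y) $$ (x, y)) (at 1)"
      using xy by (simp only:) (auto intro!: tendsto_sum tendsto_mult f g)
  qed
qed

end

locale rep_at_one = rep_family +
  fixes rq :: "complex \<Rightarrow> complex"
  assumes rq: "\<forall>\<^sub>F q in nhds 1. rq q ^ 2 = q" "isCont rq 1" and n: "n \<ge> 1"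
begin

sublocale at: at_one k "rmq 1" by unfold_locales (rule isCont_rmq_nz[OF rmq(1)])

lemma rq_1: "rq 1 ^ 2 = 1" "rq 1 \<noteq> 0"
  using eventually_nhds_x_imp_x[OF rq(1)] by auto

text \<open>
  Since $q^{1/2} - q^{-1/2} = (q-1)/q^{1/2}$, the scalar $q^{1/2}(1)/(q-1)$ is rational in $q$ and has
  the same effect in the limit.
\<close>

lemma liftable_scaled:
  assumes f: "f \<in> carrier (free_alg n)" "\<forall>\<^sub>F q in at 1. evalm f q = F q" "\<And>q. F q \<in> carrier_mat (N ^ n) (N ^ n)"
    and V: "V \<in> carrier_mat (N ^ n) (N ^ n)"
      "\<And>x y. x < N ^ n \<Longrightarrow> y < N ^ n \<Longrightarrow> ((\<lambda>q. ((1 / (rq q - inverse (rq q))) \<cdot>\<^sub>m F q) $$ (x, y)) \<longlongrightarrow> V $$ (x, y)) (at 1)"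
  shows "liftable V"
proof -
  define c where "c = Fraction_Field.Fract [:rq 1:] 1 * inverse (q_ind - 1)"
  have c: "\<forall>\<^sub>F q in at 1. ev c q = rq 1 / (q - 1)"
    unfolding c_def
    using ev_mult[of "Fraction_Field.Fract [:rq 1:] 1" "inverse (q_ind - 1)" 1] ev_const[of "rq 1" 1] ev_inverse[of "q_ind - 1" 1]
      ev_diff[of q_ind 1 1] ev_1[of 1] ev_q_ind[of 1]
    by eventually_elim (simp add: divide_inverse)
  have rt: "(rq \<longlongrightarrow> rq 1) (at 1)" using rq(2) by (simp add: isCont_def)
  show ?thesis
  proof (rule liftableI[OF V(1) _ evalm_eq_const_mult[OF c f(2)]])
    show "const c * f \<in> carrier (free_alg n)" using f(1) by auto
    fix x y assume xy: "x < N ^ n" "y < N ^ n"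
    have "((\<lambda>q. rq 1 / rq q * ((1 / (rq q - inverse (rq q))) \<cdot>\<^sub>m F q) $$ (x, y)) \<longlongrightarrow> rq 1 / rq 1 * V $$ (x, y)) (at 1)"
      by (intro tendsto_intros rt rq_1 V(2) xy)
    moreover have "\<forall>\<^sub>F q in at 1. rq 1 / rq q * ((1 / (rq q - inverse (rq q))) \<cdot>\<^sub>m F q) $$ (x, y) = ((rq 1 / (q - 1)) \<cdot>\<^sub>m F q) $$ (x, y)"
    proof -
      have "\<forall>\<^sub>F q in at 1. rq q ^ 2 = q" using rq(1) by (simp add: eventually_at_filter eventually_mono)
      thus ?thesis using tendsto_imp_eventually_ne[OF rt rq_1(2)] eventually_neq_at_within[of 1 1 UNIV]
      proof eventually_elim
        case (elim q)
        have "rq q * (rq q - inverse (rq q)) = q - 1" using elim by (simp add: power2_eq_square right_diff_distrib)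
        hence "rq 1 / rq q * (1 / (rq q - inverse (rq q))) = rq 1 / (q - 1)" by (metis mult.right_neutral times_divide_times_eq)
        thus ?case using xy carrier_matD[OF f(3)] by (simp add: mult.assoc[symmetric] del: times_divide_eq_right times_divide_eq_left)
      qed
    qed
    ultimately show "((\<lambda>q. ((rq 1 / (q - 1)) \<cdot>\<^sub>m F q) $$ (x, y)) \<longlongrightarrow> V $$ (x, y)) (at 1)"
      using rq_1(2) by (simp add: Lim_transform_eventually)
  qed
qed

lemma liftable_gen:
  assumes "X \<in> gens_at_1 k n rq rmq"
  shows "liftable X"
proof -
  from assms consider (E) "X = Er 1 1" | (U) i where "1 \<le> i" "i < n" "X = Um i 1"
    | (UE) i r where "1 \<le> i" "i < r" "r \<le> n" "X = value_at_1 (\<lambda>q. (1 / (rq q - inverse (rq q))) \<cdot>\<^sub>m (Um i q * Er r q))"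
    | (EU) i r where "1 \<le> i" "i < r" "r \<le> n" "X = value_at_1 (\<lambda>q. (1 / (rq q - inverse (rq q))) \<cdot>\<^sub>m (Er r q * Um i q))"
    unfolding gens_at_1_def Un_iff mem_Collect_eq singleton_iff by blast
  thus ?thesis
  proof cases
    case E
    show ?thesis unfolding E
      by (rule liftableI[OF _ _ evalm_e Er_tendsto]) (use n rep_E_carrier[OF n] in \<open>auto simp: N_eq\<close>)
  next
    case U
    show ?thesis unfolding U(3)
      by (rule liftableI[OF _ _ evalm_u Um_tendsto]) (use U rep_U_carrier[OF U(1,2)] in \<open>auto simp: N_eq\<close>)
  next
    case UE
    hence i: "i < n" "1 \<le> r" by auto
    have c: "Um i q \<in> carrier_mat (N ^ n) (N ^ n)" "Er r q \<in> carrier_mat (N ^ n) (N ^ n)" for q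
      using rep_U_carrier[OF UE(1) i(1)] rep_E_carrier[OF UE(3)] unfolding N_eq by blast+
    note v = value_at_1_U_E[OF rq rmq UE(1-3) N_eq]
    show ?thesis
    proof (rule liftable_scaled[OF _ evalm_eq_mult[OF evalm_u evalm_e]])
      show "u_gen i * e_gen r \<in> carrier (free_alg n)" by (intro free_alg_closed UE i)
      show "X \<in> carrier_mat (N ^ n) (N ^ n)" using c[of 1] carrier_matD[OF mult_carrier_mat[OF c]]
        unfolding UE(4) value_at_1_def by auto
      fix x y assume "x < N ^ n" "y < N ^ n"
      from v(1)[OF this] show "((\<lambda>q. ((1 / (rq q - inverse (rq q))) \<cdot>\<^sub>m (Um i q * Er r q)) $$ (x, y)) \<longlongrightarrow> X $$ (x, y)) (at 1)"
        unfolding UE(4) v(2) .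
    qed (use UE i mult_carrier_mat[OF c] in auto)
  next
    case EU
    hence i: "i < n" "1 \<le> r" by auto
    have c: "Um i q \<in> carrier_mat (N ^ n) (N ^ n)" "Er r q \<in> carrier_mat (N ^ n) (N ^ n)" for q
      using rep_U_carrier[OF EU(1) i(1)] rep_E_carrier[OF EU(3)] unfolding N_eq by blast+
    note v = value_at_1_E_U[OF rq rmq EU(1-3) N_eq]
    show ?thesis
    proof (rule liftable_scaled[OF _ evalm_eq_mult[OF evalm_e evalm_u]])
      show "e_gen r * u_gen i \<in> carrier (free_alg n)" by (intro free_alg_closed EU i)
      show "X \<in> carrier_mat (N ^ n) (N ^ n)" using c[of 1] carrier_matD[OF mult_carrier_mat[OF c(2,1)]]
        unfolding EU(4) value_at_1_def by auto
      fix x y assume "x < N ^ n" "y < N ^ n"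
      from v(1)[OF this] show "((\<lambda>q. ((1 / (rq q - inverse (rq q))) \<cdot>\<^sub>m (Er r q * Um i q)) $$ (x, y)) \<longlongrightarrow> X $$ (x, y)) (at 1)"
        unfolding EU(4) v(2) .
    qed (use EU i mult_carrier_mat[OF c(2,1)] in auto)
  qed
qed

lemma alg_liftable:
  assumes "X \<in> alg_generated N n (gens_at_1 k n rq rmq)"
  shows "liftable X"
  using assms unfolding alg_generated_def
proof (induction rule: generate_ring.induct)
  case one
  have "(1 :: complex) \<cdot>\<^sub>m 1\<^sub>m (N ^ n) = 1\<^sub>m (N ^ n)" by (rule eq_matI) auto
  thus ?case using liftable_scalar[of 1] by (simp add: ring_mat_simps)
next
  case (incl X)
  thus ?case using liftable_gen liftable_scalar by (auto simp: End_scalars_def)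
next
  case (a_inv X)
  interpret R: ring "End_tensor N n" by (rule ring_mat)
  have X: "X \<in> carrier_mat (N ^ n) (N ^ n)" using a_inv by (simp add: liftable_def)
  have "liftable (((- 1) \<cdot>\<^sub>m 1\<^sub>m (N ^ n)) * X)" by (rule liftable_mult[OF liftable_scalar a_inv(2)])
  moreover have "\<ominus>\<^bsub>End_tensor N n\<^esub> X = (- 1) \<cdot>\<^sub>m X"
    by (rule R.minus_equality) (use X in \<open>auto simp: ring_mat_simps intro!: eq_matI\<close>)
  moreover have "((- 1) \<cdot>\<^sub>m 1\<^sub>m (N ^ n)) * X = (- 1) \<cdot>\<^sub>m X"
    unfolding mult_smult_assoc_mat[OF one_carrier_mat X] left_mult_one_mat[OF X] ..
  ultimately show ?case by simp
next
  case (eng_add X Y)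
  thus ?case using liftable_add by (simp add: ring_mat_simps)
next
  case (eng_mult X Y)
  thus ?case using liftable_mult by (simp add: ring_mat_simps)
qed

section \<open>The quotient algebra and the lower bound for its dimension\<close>

abbreviation I where "I \<equiv> rel_ideal N n"

lemma ideal_I: "ideal I (free_alg n)"
  unfolding rel_ideal_def by (rule ring.genideal_ideal[OF ring_free_alg relators_subset])

sublocale F: ring "free_alg n" by (rule ring_free_alg)

sublocale Q: ring_hom_ring "free_alg n" "C_alg N n" "(+>\<^bsub>free_alg n\<^esub>) I"
  unfolding C_alg_def by (rule ideal.rcos_ring_hom_ring[OF ideal_I])

sublocale W: mat_space "N ^ n"
  by unfold_locales (simp add: N_eq)

lemma coset_eq_zero:
  assumes "f \<in> carrier (free_alg n)"
  shows "(I +>\<^bsub>free_alg n\<^esub> f) = \<zero>\<^bsub>C_alg N n\<^esub> \<longleftrightarrow> f \<in> I"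
proof -
  have sg: "subgroup I (add_monoid (free_alg n))"
    using ideal_I unfolding ideal_def additive_subgroup_def by blast
  have z: "\<zero>\<^bsub>C_alg N n\<^esub> = I" unfolding C_alg_def FactRing_def by (simp only: ring_record_simps)
  show ?thesis unfolding z using F.a_coset_join1[OF _ assms sg] F.a_coset_join2[OF assms sg] by blast
qed

lemma const_hom: "const 1 = 1" "const (a + b) = const a + const b" "const (a * b) = const a * const b" "const 0 = 0"
  by (simp_all add: const_def single_one single_add mult_single)

lemma const_carrier: "const c \<in> carrier (free_alg n)" by auto

lemma C_scalars_subfield: "subfield (C_scalars N n) (C_alg N n)"
proof -
  have "subfield (range (\<lambda>c. I +>\<^bsub>free_alg n\<^esub> const c)) (C_alg N n)"
  proof (rule Q.S.subfield_range)
    show "(I +>\<^bsub>free_alg n\<^esub> const 1) = \<one>\<^bsub>C_alg N n\<^esub>"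
      using Q.hom_one by (simp add: const_hom free_alg_simps)
    show "(I +>\<^bsub>free_alg n\<^esub> const (a + b)) = (I +>\<^bsub>free_alg n\<^esub> const a) \<oplus>\<^bsub>C_alg N n\<^esub> (I +>\<^bsub>free_alg n\<^esub> const b)" for a b
      using Q.hom_add[OF const_carrier const_carrier] by (simp add: const_hom free_alg_simps)
    show "(I +>\<^bsub>free_alg n\<^esub> const (a * b)) = (I +>\<^bsub>free_alg n\<^esub> const a) \<otimes>\<^bsub>C_alg N n\<^esub> (I +>\<^bsub>free_alg n\<^esub> const b)" for a b
      using Q.hom_mult[OF const_carrier const_carrier] by (simp add: const_hom free_alg_simps)
    show "(I +>\<^bsub>free_alg n\<^esub> const c) \<in> carrier (C_alg N n)" for c by (rule Q.hom_closed[OF const_carrier])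
    \<comment> \<open>If the quotient were trivial, 1 would lie in the ideal and hence evaluate to
      the zero matrix near q = 1.\<close>
    show "\<one>\<^bsub>C_alg N n\<^esub> \<noteq> \<zero>\<^bsub>C_alg N n\<^esub>"
    proof
      assume "\<one>\<^bsub>C_alg N n\<^esub> = \<zero>\<^bsub>C_alg N n\<^esub>"
      hence "1 \<in> I" using Q.hom_one coset_eq_zero[of 1] by (auto simp: free_alg_simps)
      hence "\<forall>\<^sub>F q in at 1. evalm 1 q = 0\<^sub>m (N ^ n) (N ^ n)" using rel_ideal_vanishes by (auto simp: vanishing_def)
      hence "\<forall>\<^sub>F q :: complex in at 1. (1\<^sub>m (N ^ n) :: complex mat) = 0\<^sub>m (N ^ n) (N ^ n)"
        using evalm_1[of 1] by eventually_elim simp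
      hence "(1\<^sub>m (N ^ n) :: complex mat) = 0\<^sub>m (N ^ n) (N ^ n)" by (simp add: eventually_const)
      hence "(1\<^sub>m (N ^ n) :: complex mat) $$ (0, 0) = 0\<^sub>m (N ^ n) (N ^ n) $$ (0, 0)" by simp
      thus False using W.M_pos by simp
    qed
  qed
  moreover have "range (\<lambda>c. I +>\<^bsub>free_alg n\<^esub> const c) = C_scalars N n" by (auto simp: C_scalars_def)
  ultimately show ?thesis by simp
qed

lemma evalm_combine:
  assumes "x < N ^ n" "y < N ^ n"
  shows "\<forall>\<^sub>F q in at a. evalm (F.combine (map const cs) fs) q $$ (x, y)
     = (\<Sum>i<min (length cs) (length fs). ev (cs ! i) q * evalm (fs ! i) q $$ (x, y))"
proof (induction cs fs rule: list_induct2')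
  case (4 c cs f fs)
  let ?g = "F.combine (map const cs) fs"
  have "F.combine (map const (c # cs)) (f # fs) = const c * f + ?g" by (simp add: free_alg_simps)
  hence "\<forall>\<^sub>F q in at a. evalm (F.combine (map const (c # cs)) (f # fs)) q = evalm (const c * f) q + evalm ?g q"
    using evalm_add[of "const c * f" ?g a] by simp
  thus ?case using evalm_const_mult[of c f a] 4
  proof eventually_elim
    case (elim q)
    have "evalm (F.combine (map const (c # cs)) (f # fs)) q $$ (x, y) = ev c q * evalm f q $$ (x, y) + evalm ?g q $$ (x, y)"
      unfolding elim(1,2) using assms by simp
    thus ?case unfolding elim(3) by (simp add: sum.lessThan_Suc_shift del: F.combine.simps sum.lessThan_Suc)
  qed
qed (use assms in \<open>simp_all add: free_alg_simps\<close>)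

lemma combine_index:
  assumes "x < N ^ n" "y < N ^ n"
  shows "set Xs \<subseteq> carrier_mat (N ^ n) (N ^ n) \<Longrightarrow> W.RM.combine (map (\<lambda>c. c \<cdot>\<^sub>m 1\<^sub>m (N ^ n)) cs) Xs \<in> carrier_mat (N ^ n) (N ^ n) \<and>
     W.RM.combine (map (\<lambda>c. c \<cdot>\<^sub>m 1\<^sub>m (N ^ n)) cs) Xs $$ (x, y)
     = (\<Sum>i<min (length cs) (length Xs). cs ! i * (Xs ! i) $$ (x, y))"
proof (induction cs Xs rule: list_induct2')
  case (4 c cs X Xs)
  let ?Y = "W.RM.combine (map (\<lambda>c. c \<cdot>\<^sub>m 1\<^sub>m (N ^ n)) cs) Xs"
  have X: "X \<in> carrier_mat (N ^ n) (N ^ n)" using 4 by simp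
  have Y: "?Y \<in> carrier_mat (N ^ n) (N ^ n)" using 4 by simp
  have e: "W.RM.combine (map (\<lambda>c. c \<cdot>\<^sub>m 1\<^sub>m (N ^ n)) (c # cs)) (X # Xs) = c \<cdot>\<^sub>m X + ?Y"
    using W.KM_mult[OF X] by (simp add: ring_mat_simps)
  have "(c \<cdot>\<^sub>m X + ?Y) $$ (x, y) = c * X $$ (x, y) + ?Y $$ (x, y)"
    using assms carrier_matD[OF X] carrier_matD[OF Y] by simp
  thus ?case unfolding e using 4 X by (simp add: sum.lessThan_Suc_shift del: W.RM.combine.simps sum.lessThan_Suc)
qed (use assms in \<open>simp_all add: ring_mat_simps\<close>)

lemma lifts_independent:
  assumes fs: "length fs = length Xs" "set fs \<subseteq> carrier (free_alg n)" and Xs: "set Xs \<subseteq> carrier_mat (N ^ n) (N ^ n)"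
    and ind: "W.RM.independent W.KM Xs"
    and lim: "\<And>i x y. i < length Xs \<Longrightarrow> x < N ^ n \<Longrightarrow> y < N ^ n \<Longrightarrow> ((\<lambda>q. evalm (fs ! i) q $$ (x, y)) \<longlongrightarrow> (Xs ! i) $$ (x, y)) (at 1)"
  shows "Q.S.independent (C_scalars N n) (map ((+>\<^bsub>free_alg n\<^esub>) I) fs)"
proof (rule Q.S.trivial_combine_imp_independent[OF C_scalars_subfield])
  show "set (map ((+>\<^bsub>free_alg n\<^esub>) I) fs) \<subseteq> carrier (C_alg N n)" using fs(2) Q.hom_closed by auto
  fix Ks assume Ks: "set Ks \<subseteq> C_scalars N n" "Q.S.combine Ks (map ((+>\<^bsub>free_alg n\<^esub>) I) fs) = \<zero>\<^bsub>C_alg N n\<^esub>"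
  have "\<exists>cs. Ks = map (\<lambda>c. I +>\<^bsub>free_alg n\<^esub> const c) cs"
    using Ks(1) by (auto simp: ex_map_conv C_scalars_def)
  then obtain cs where cs: "Ks = map ((+>\<^bsub>free_alg n\<^esub>) I) (map const cs)" unfolding map_map comp_def by blast
  let ?g = "F.combine (map const cs) fs"
  have cc: "set (map const cs) \<subseteq> carrier (free_alg n)" by auto
  have "?g \<in> carrier (free_alg n)" by (rule F.combine_in_carrier[OF cc fs(2)])
  from coset_eq_zero[OF this] have "?g \<in> I" using Ks(2) unfolding cs Q.combine_hom[OF cc fs(2)] by simp
  hence van: "\<forall>\<^sub>F q in at 1. evalm ?g q = 0\<^sub>m (N ^ n) (N ^ n)" using rel_ideal_vanishes by (auto simp: vanishing_def)
  \<comment> \<open>\<open>combine\<close> stops at the end of the shorter list, so only the first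
    \<open>m\<close> coefficients matter.\<close>
  define m where "m = min (length cs) (length fs)"
  have c0: "cs ! i = 0" if i: "i < m" for i
  proof (rule ccontr)
    assume "cs ! i \<noteq> 0"
    then obtain v l where v: "\<And>i. i < m \<Longrightarrow> ((\<lambda>q. ev (cs ! i) q * (q - 1) powi (- v)) \<longlongrightarrow> l i) (at 1)"
      and l: "\<exists>i<m. l i \<noteq> 0"
      using common_leading_term[of "{..<m}" i "(!) cs" 1] i by auto
    \<comment> \<open>The rescaled relation is eventually zero by \<open>van\<close>, and its limit
      is the relation between the \<open>Xs\<close> with coefficients \<open>l\<close>.\<close>
    have z: "(\<Sum>i<m. l i * (Xs ! i) $$ (x, y)) = 0" if xy: "x < N ^ n" "y < N ^ n" for x y
    proof (rule tendsto_unique)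
      show "((\<lambda>q. \<Sum>i<m. (ev (cs ! i) q * (q - 1) powi (- v)) * evalm (fs ! i) q $$ (x, y)) \<longlongrightarrow> (\<Sum>i<m. l i * (Xs ! i) $$ (x, y))) (at 1)"
        by (intro tendsto_sum tendsto_mult v lim xy) (auto simp: m_def fs(1))
      have "\<forall>\<^sub>F q in at 1. 0 = (\<Sum>i<m. (ev (cs ! i) q * (q - 1) powi (- v)) * evalm (fs ! i) q $$ (x, y))"
        using van evalm_combine[OF xy, where cs = cs and fs = fs and a = 1]
      proof eventually_elim
        case (elim q)
        have "(\<Sum>i<m. (ev (cs ! i) q * (q - 1) powi (- v)) * evalm (fs ! i) q $$ (x, y))
           = (q - 1) powi (- v) * (\<Sum>i<m. ev (cs ! i) q * evalm (fs ! i) q $$ (x, y))"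
          unfolding sum_distrib_left by (intro sum.cong refl) (simp only: mult_ac)
        also have "(\<Sum>i<m. ev (cs ! i) q * evalm (fs ! i) q $$ (x, y)) = 0"
          using elim xy unfolding m_def by simp
        finally show ?case by simp
      qed
      thus "((\<lambda>q. \<Sum>i<m. (ev (cs ! i) q * (q - 1) powi (- v)) * evalm (fs ! i) q $$ (x, y)) \<longlongrightarrow> 0) (at 1)"
        by (rule Lim_transform_eventually[OF tendsto_const])
    qed simp
    let ?Ls = "map (\<lambda>c. c \<cdot>\<^sub>m 1\<^sub>m (N ^ n)) (map l [0..<m])"
    have mX: "m \<le> length Xs" by (simp add: m_def fs(1))
    have "W.RM.combine ?Ls Xs = 0\<^sub>m (N ^ n) (N ^ n)"
    proof (rule eq_matI)
      fix x y assume "x < dim_row (0\<^sub>m (N ^ n) (N ^ n) :: complex mat)" "y < dim_col (0\<^sub>m (N ^ n) (N ^ n) :: complex mat)"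
      hence xy: "x < N ^ n" "y < N ^ n" by auto
      have "W.RM.combine ?Ls Xs $$ (x, y) = (\<Sum>i<min (length (map l [0..<m])) (length Xs). map l [0..<m] ! i * (Xs ! i) $$ (x, y))"
        using combine_index[OF xy Xs] by blast
      also have "\<dots> = (\<Sum>i<m. l i * (Xs ! i) $$ (x, y))" using mX by (intro sum.cong) auto
      finally show "W.RM.combine ?Ls Xs $$ (x, y) = 0\<^sub>m (N ^ n) (N ^ n) $$ (x, y)" using z[OF xy] xy by simp
    qed (use combine_index[OF W.M_pos W.M_pos Xs, of "map l [0..<m]"] in auto)
    hence "W.RM.combine ?Ls Xs = \<zero>\<^bsub>W.RM\<^esub>" by (simp add: ring_mat_simps)
    moreover have "set ?Ls \<subseteq> W.KM" by (auto simp: W.KM_def)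
    ultimately have "set (take (length Xs) ?Ls) \<subseteq> {\<zero>\<^bsub>W.RM\<^esub>}"
      using W.RM.independent_imp_trivial_combine[OF W.KM_subfield ind] by blast
    moreover have "take (length Xs) ?Ls = ?Ls" using mX by simp
    ultimately have L: "set ?Ls \<subseteq> {0\<^sub>m (N ^ n) (N ^ n)}" by (simp add: ring_mat_simps)
    have "l j = 0" if "j < m" for j
    proof -
      have "l j \<cdot>\<^sub>m 1\<^sub>m (N ^ n) \<in> set ?Ls" using that by simp
      hence "l j \<cdot>\<^sub>m 1\<^sub>m (N ^ n) = 0\<^sub>m (N ^ n) (N ^ n)" using L by blast
      hence "(l j \<cdot>\<^sub>m 1\<^sub>m (N ^ n)) $$ (0, 0) = 0\<^sub>m (N ^ n) (N ^ n) $$ (0, 0)" by simp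
      thus ?thesis using W.M_pos by simp
    qed
    thus False using l by blast
  qed
  show "set (take (length (map ((+>\<^bsub>free_alg n\<^esub>) I) fs)) Ks) \<subseteq> {\<zero>\<^bsub>C_alg N n\<^esub>}"
  proof
    fix K assume "K \<in> set (take (length (map ((+>\<^bsub>free_alg n\<^esub>) I) fs)) Ks)"
    then obtain i where i: "i < m" "K = Ks ! i" by (auto simp: in_set_conv_nth cs m_def)
    hence "K = I +>\<^bsub>free_alg n\<^esub> const 0" using c0[OF i(1)] by (simp add: cs m_def)
    thus "K \<in> {\<zero>\<^bsub>C_alg N n\<^esub>}" using Q.hom_zero by (simp add: const_hom free_alg_simps)
  qed
qed

lemma vdim_le:
  assumes sub: "A \<subseteq> alg_generated N n (gens_at_1 k n rq rmq)" and A: "subalgebra W.KM A W.RM"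
  shows "vdim (End_tensor N n) (End_scalars N n) A \<le> vdim (C_alg N n) (C_scalars N n) (carrier (C_alg N n))"
proof -
  have KM: "W.KM = End_scalars N n" by (auto simp: W.KM_def End_scalars_def)
  obtain d where d: "W.RM.dimension d W.KM A"
    using W.subspace_finite_dimension[OF A] unfolding W.RM.finite_dimension_def by blast
  have l: "vdim (End_tensor N n) (End_scalars N n) A = enat d"
    using vdim_eq[OF W.RM.ring_axioms W.KM_subfield d] unfolding KM .
  show ?thesis
  proof (cases "\<exists>e. Q.S.dimension e (C_scalars N n) (carrier (C_alg N n))")
    \<comment> \<open>If $C_{n,-}$ has no finite dimension, its \<open>vdim\<close> is infinite and
      the bound is trivial.\<close>
    case False
    thus ?thesis by (simp add: vdim_def)
  next
    case True
    then obtain e where e: "Q.S.dimension e (C_scalars N n) (carrier (C_alg N n))" by blast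
    obtain Xs where Xs: "W.RM.independent W.KM Xs" "length Xs = d" "W.RM.Span W.KM Xs = A" "set Xs \<subseteq> carrier W.RM"
      using W.RM.exists_base[OF W.KM_subfield d] by blast
    have "set Xs \<subseteq> A" using W.RM.Span_base_incl[OF W.KM_subfield Xs(4)] Xs(3) by simp
    hence lift: "\<forall>X\<in>set Xs. liftable X" using sub alg_liftable by blast
    define lf where "lf X = (SOME f. f \<in> carrier (free_alg n) \<and>
       (\<forall>x<N ^ n. \<forall>y<N ^ n. ((\<lambda>q. evalm f q $$ (x, y)) \<longlongrightarrow> X $$ (x, y)) (at 1)))" for X
    have lf: "lf X \<in> carrier (free_alg n) \<and>
       (\<forall>x<N ^ n. \<forall>y<N ^ n. ((\<lambda>q. evalm (lf X) q $$ (x, y)) \<longlongrightarrow> X $$ (x, y)) (at 1))" if "X \<in> set Xs" for X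
      unfolding lf_def by (rule someI_ex) (use lift that in \<open>auto simp: liftable_def\<close>)
    have "Q.S.independent (C_scalars N n) (map ((+>\<^bsub>free_alg n\<^esub>) I) (map lf Xs))"
    proof (rule lifts_independent[OF _ _ _ Xs(1)])
      show "set (map lf Xs) \<subseteq> carrier (free_alg n)" using lf by auto
      show "set Xs \<subseteq> carrier_mat (N ^ n) (N ^ n)" using lift by (auto simp: liftable_def)
      fix i x y assume "i < length Xs" "x < N ^ n" "y < N ^ n"
      thus "((\<lambda>q. evalm (map lf Xs ! i) q $$ (x, y)) \<longlongrightarrow> (Xs ! i) $$ (x, y)) (at 1)"
        using lf[of "Xs ! i"] by simp
    qed simp
    moreover have "set (map ((+>\<^bsub>free_alg n\<^esub>) I) (map lf Xs)) \<subseteq> carrier (C_alg N n)"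
      using lf Q.hom_closed by auto
    ultimately have "length (map ((+>\<^bsub>free_alg n\<^esub>) I) (map lf Xs)) \<le> e"
      by (rule Q.S.independent_length_le_dimension[OF C_scalars_subfield e])
    hence "d \<le> e" using Xs(2) by simp
    thus ?thesis unfolding l vdim_eq[OF Q.S.ring_axioms C_scalars_subfield e] by simp
  qed
qed

end

theorem proposition3p6:
  fixes k N n :: nat
    and rq rmq :: "complex \<Rightarrow> complex"
    and t :: complex
  assumes N: "N = 2 * k + 1" "N \<ge> 3"
    and n: "n \<ge> 1"
    and rq: "\<forall>\<^sub>F q in nhds 1. rq q ^ 2 = q" "isCont rq 1"
    and rmq: "\<forall>\<^sub>F q in nhds 1. rmq q ^ 2 = - q" "isCont rmq 1"
    and t: "t ^ 2 = - 1" "rmq 1 * t = - 1"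
  shows "alg_generated N n (gens_at_1 k n rq rmq) = End_Sp k n (rmq 1) t
    \<and> vdim (C_alg N n) (C_scalars N n) (carrier (C_alg N n))
        \<ge> vdim (End_tensor N n) (End_scalars N n) (End_Sp k n (rmq 1) t)"
proof -
  interpret rep_at_one k n rmq rq by unfold_locales (fact rmq rq n)+
  have s: "rmq 1 * rmq 1 = - 1" using isCont_rmq_nz[OF rmq(1)] by (simp add: power2_eq_square)
  \<comment> \<open>The two chosen square roots coincide at q = 1, since their product is -1 and so
    is the square of \<open>rmq 1\<close>.\<close>
  have "rmq 1 * t = rmq 1 * rmq 1" using t s by simp
  hence t': "t = rmq 1" using rmq_nz by simp
  have NN: "rep_family.N k = N" "at.N = N" using N_eq at.N_eq N(1) by auto
  have A: "alg_generated N n (gens_at_1 k n rq rmq) = at.value_alg n (rq 1)"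
    unfolding at.value_alg_def NN at.gens_at_1_eq[OF rq rmq refl] ..
  have eq: "alg_generated N n (gens_at_1 k n rq rmq) = End_Sp k n (rmq 1) t"
    using at.End_subset_alg[OF n rq_1(2)] at.alg_subset_End[OF n, of "rq 1"]
    unfolding A t' at.value_alg_def by blast
  have "subalgebra W.KM (End_Sp k n (rmq 1) t) W.RM"
    unfolding eq[symmetric] A
  proof (rule W.subspace_subalgebra)
    show "at.value_alg n (rq 1) \<subseteq> carrier_mat (rep_family.N k ^ n) (rep_family.N k ^ n)"
      using at.value_alg_carrier[OF n] unfolding NN by blast
    show "at.value_alg n (rq 1) \<noteq> {}" using at.value_alg_scalar by blast
  qed (use at.value_alg_add at.value_alg_smult[OF n] in auto)
  hence "vdim (C_alg N n) (C_scalars N n) (carrier (C_alg N n))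
        \<ge> vdim (End_tensor N n) (End_scalars N n) (End_Sp k n (rmq 1) t)"
    using vdim_le[of "End_Sp k n (rmq 1) t"] eq unfolding NN by simp
  thus ?thesis using eq by blast
qed

end
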